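(* Let $q$ be a prime power, let $p$ be the characteristic of $\mathbb{F}_q$, and let $n \geq 3$ be an integer. Then $$\max_{\theta \in \mathbb{T}} \left| \sum_{\substack{f \in \mathbb{F}_q[t] \text{ monic} \\ \deg f = n}} \mu(f)\, \mathbf{e}_q(f \theta) \right| \leq 4\, q^{\frac{3n+1}{4}}\left(\tfrac{3\sqrt{3}}{2}\right)^n .$$
   Context: $\mathbb{F}_q((1/t)) = \{\sum_{i \leq j} x_i t^i : x_i \in \mathbb{F}_q,\ j \in \mathbb{Z}\}$ is the field of formal Laurent series in $1/t$, containing $\mathbb{F}_q[t]$. The set $\mathbb{T} = \{\sum_{i<0} x_i t^i : x_i \in \mathbb{F}_q\}$ is a subring of $\mathbb{F}_q((1/t))$. Define $\psi:\mathbb{F}_q \to \mathbb{C}^\times$ by $\psi(x) = e^{2\pi i\, \mathrm{tr}(x)/p}$, where $\mathrm{tr}:\mathbb{F}_q \to \mathbb{F}_p$ is the trace map, and define $\mathbf{e}_q : \mathbb{F}_q((1/t)) \to \mathbb{C}^\times$ by $\mathbf{e}_q(\sum_i x_i t^i) = \psi(x_{-1})$. For a monic polynomial $f$, $\mu(f)$ is the Möbius function of $\mathbb{F}_q[t]$: $\mu(f) = (-1)^k$ if $f$ is a product of $k$ distinct monic irreducibles, and $\mu(f)=0$ if $f$ is divisible by the square of a nonconstant polynomial. *)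

theory Defs
  imports "HOL-Computational_Algebra.Computational_Algebra" "HOL-Number_Theory.Cong"
    "HOL-Library.Cardinality"
begin

text \<open>
  The type variable \<open>'a :: finite_field\<close> plays the role of the field with \<open>q = CARD('a)\<close>
  elements, and \<open>CHAR('a)\<close> is its characteristic \<open>p\<close>.
\<close>

lemma finite_field_prime_CHAR: "prime CHAR('a :: finite_field)"
  by (simp add: prime_CHAR_semidom)

lemma finite_field_card_power_CHAR:
  "\<exists>r. CARD('a :: finite_field) = CHAR('a) ^ r"
proof -
  define p where "p = CHAR('a)"
  have p: "prime p" unfolding p_def by (rule finite_field_prime_CHAR)
  define P where "P = (\<lambda>k. \<exists>H :: 'a set. (\<forall>x\<in>H. \<forall>y\<in>H. x + y \<in> H) \<and> 0 \<in> H \<and> card H = p ^ k)"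
  have bound: "k \<le> CARD('a)" if "P k" for k
  proof -
    from that obtain H :: "'a set" where "card H = p ^ k" by (auto simp: P_def)
    hence "p ^ k \<le> CARD('a)" using card_mono[of UNIV H] by simp
    moreover have "k < p ^ k" using p by (simp add: power_gt_expt prime_gt_Suc_0_nat)
    ultimately show ?thesis by linarith
  qed
  have "P 0" unfolding P_def by (intro exI[of _ "{0}"]) auto
  define r where "r = Greatest P"
  have "P r" unfolding r_def using \<open>P 0\<close> bound by (rule GreatestI_nat)
  have maxr: "k \<le> r" if "P k" for k
    unfolding r_def using that bound by (rule Greatest_le_nat)
  from \<open>P r\<close> obtain H :: "'a set" where H: "\<And>x y. x \<in> H \<Longrightarrow> y \<in> H \<Longrightarrow> x + y \<in> H"
      "0 \<in> H" "card H = p ^ r"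
    by (auto simp: P_def)
  have mult: "of_nat k * x \<in> H" if "x \<in> H" for k x
    by (induction k) (use that H in \<open>auto simp: algebra_simps\<close>)
  have neg: "- x \<in> H" if "x \<in> H" for x
  proof -
    have "of_nat (p - 1) + 1 = (of_nat p :: 'a)"
      using prime_gt_0_nat[OF p] by (metis Suc_pred' add.commute of_nat_Suc One_nat_def)
    hence "of_nat (p - 1) = (- 1 :: 'a)" by (simp add: p_def eq_neg_iff_add_eq_0)
    hence "of_nat (p - 1) * x = - x" by simp
    thus ?thesis using mult[OF that, of "p - 1"] by simp
  qed
  have "H = UNIV"
  proof (rule ccontr)
    assume "H \<noteq> UNIV"
    then obtain z where z: "z \<notin> H" by auto
    define g where "g = (\<lambda>(h, k :: nat). h + of_nat k * z)"
    have inj_aux: "j = k" if "j \<le> k" "k < p" "h + of_nat j * z = h' + of_nat k * z" "h \<in> H" "h' \<in> H"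
      for j k h h'
    proof (rule ccontr)
      assume "j \<noteq> k"
      define d where "d = k - j"
      have d: "0 < d" "d < p" using that \<open>j \<noteq> k\<close> by (auto simp: d_def)
      have "of_nat d * z = h + (- h')"
        using that by (simp add: d_def of_nat_diff algebra_simps)
      hence dz: "of_nat d * z \<in> H" using H(1) neg that by metis
      have "coprime d p" using d p
        by (metis coprime_commute prime_imp_coprime nat_dvd_not_less)
      then obtain e where e: "[d * e = 1] (mod p)"
        using cong_solve_coprime_nat[of d p] by auto
      hence "of_nat (d * e) = (of_nat 1 :: 'a)" 
        unfolding p_def of_nat_eq_iff_cong_CHAR by simp
      hence "of_nat e * of_nat d = (1 :: 'a)" by (simp add: mult.commute)
      hence "of_nat e * (of_nat d * z) = z" by (simp flip: mult.assoc)
      thus False using mult[OF dz, of e] z by metis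
    qed
    have inj: "inj_on g (H \<times> {..<p})"
    proof (rule inj_onI; clarify)
      fix h j h' k
      assume *: "h \<in> H" "h' \<in> H" "j < p" "k < p" "g (h, j) = g (h', k)"
      have "j = k"
        using inj_aux[of j k h h'] inj_aux[of k j h' h] * unfolding g_def by (cases "j \<le> k") auto
      thus "h = h' \<and> j = k" using * by (simp add: g_def)
    qed
    have "P (Suc r)"
      unfolding P_def
    proof (intro exI[of _ "g ` (H \<times> {..<p})"] conjI ballI)
      show "card (g ` (H \<times> {..<p})) = p ^ Suc r"
        by (simp add: card_image[OF inj] card_cartesian_product H(3))
      show "0 \<in> g ` (H \<times> {..<p})"
        using H(2) prime_gt_0_nat[OF p] by (intro image_eqI[of _ _ "(0, 0)"]) (auto simp: g_def)
      fix x y assume "x \<in> g ` (H \<times> {..<p})" "y \<in> g ` (H \<times> {..<p})"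
      then obtain h j h' k where *: "h \<in> H" "h' \<in> H" "x = g (h, j)" "y = g (h', k)"
        by auto
      have "of_nat ((j + k) mod p) = (of_nat (j + k) :: 'a)"
        unfolding p_def of_nat_eq_iff_cong_CHAR by simp
      hence "x + y = g (h + h', (j + k) mod p)"
        using * by (simp add: g_def algebra_simps)
      thus "x + y \<in> g ` (H \<times> {..<p})"
        using H(1) * prime_gt_0_nat[OF p] by auto
    qed
    from maxr[OF this] show False by simp
  qed
  with H(3) show ?thesis by (auto simp: p_def)
qed

text \<open>The trace of the extension of the prime field, as the sum of the Galois conjugates.\<close>

definition ff_degree :: "'a :: finite_field itself \<Rightarrow> nat"
  where "ff_degree _ = (THE r. CARD('a) = CHAR('a) ^ r)"

definition ff_trace :: "'a :: finite_field \<Rightarrow> 'a"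
  where "ff_trace x = (\<Sum>i<ff_degree TYPE('a). x ^ (CHAR('a) ^ i))"

lemma ff_degree: "CARD('a :: finite_field) = CHAR('a) ^ ff_degree TYPE('a)"
proof -
  obtain r where "CARD('a) = CHAR('a) ^ r" using finite_field_card_power_CHAR by blast
  moreover from this have "s = r" if "CARD('a) = CHAR('a) ^ s" for s
    using that prime_gt_Suc_0_nat[OF finite_field_prime_CHAR[where 'a = 'a]] by simp
  ultimately have "\<exists>!r. CARD('a) = CHAR('a) ^ r" by blast
  thus ?thesis unfolding ff_degree_def by (rule theI')
qed

lemma ff_trace_in_prime_field:
  "\<exists>!k. k < CHAR('a) \<and> of_nat k = ff_trace (x :: 'a :: finite_field)"
proof -
  define p r where "p = CHAR('a)" and "r = ff_degree TYPE('a)"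
  have p: "prime p" unfolding p_def by (rule finite_field_prime_CHAR)
  have fix_p: "y ^ p = y" if "y = of_nat k" for y :: 'a and k
    using that
  proof (induction k arbitrary: y)
    case (Suc k)
    thus ?case using freshmans_dream[of p 1 "of_nat k :: 'a"] p by (simp add: p_def)
  qed (use p prime_gt_0_nat in \<open>auto simp: power_0_left\<close>)
  have "ff_trace x ^ p = (\<Sum>i<r. (x ^ (p ^ i)) ^ p)"
    unfolding ff_trace_def r_def[symmetric] p_def[symmetric]
    by (rule freshmans_dream_sum) (use p in \<open>auto simp: p_def\<close>)
  also have "\<dots> = (\<Sum>i<r. x ^ (p ^ Suc i))"
    by (simp add: power_mult [symmetric] mult.commute)
  also have "\<dots> + x = (\<Sum>i<Suc r. x ^ (p ^ i))"
    by (subst sum.lessThan_Suc_shift) simp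
  also have "\<dots> = ff_trace x + x ^ (p ^ r)"
    by (simp add: ff_trace_def p_def r_def)
  also have "x ^ (p ^ r) = x"
    using finite_field_power_card_eq_same[of x] ff_degree[where 'a = 'a] by (simp add: p_def r_def)
  finally have tr: "ff_trace x ^ p = ff_trace x" by simp
  have p1: "p > 1" using p prime_gt_1_nat by auto
  define Q where "Q = monom (1 :: 'a) p - monom 1 1"
  have "coeff Q p = 1" using p1 by (simp add: Q_def)
  hence "Q \<noteq> 0" by auto
  have "degree Q \<le> p"
    unfolding Q_def using p1 by (intro degree_diff_le) (auto simp: degree_monom_eq)
  with card_poly_roots_bound[OF \<open>Q \<noteq> 0\<close>] have card_le: "card {y. poly Q y = 0} \<le> p" by linarith
  have inj: "inj_on (of_nat :: nat \<Rightarrow> 'a) {..<p}"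
    unfolding p_def by (intro inj_onI) (auto simp: of_nat_eq_iff_cong_CHAR cong_def)
  have sub: "of_nat ` {..<p} \<subseteq> {y. poly Q y = 0}"
    using fix_p by (auto simp: Q_def poly_monom)
  have "of_nat ` {..<p} = {y. poly Q y = 0}"
    by (rule card_seteq[OF _ sub])
       (use card_le in \<open>auto simp: card_image[OF inj]\<close>)
  moreover have "poly Q (ff_trace x) = 0"
    using tr by (simp add: Q_def poly_monom)
  ultimately have "ff_trace x \<in> of_nat ` {..<p}" by blast
  then obtain k where "k < p" "of_nat k = ff_trace x" by (metis imageE lessThan_iff)
  thus ?thesis using inj unfolding p_def[symmetric] inj_on_def by (intro ex1I[of _ k]) auto
qed

text \<open>
  Here \<open>tr x\<close> is represented by the integer \<open>k\<close> with \<open>0 \<le> k < p\<close> lying over it.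
\<close>

definition ff_psi :: "'a :: finite_field \<Rightarrow> complex"
  where "ff_psi x =
    exp (2 * of_real pi * \<i> * of_nat (THE k. k < CHAR('a) \<and> of_nat k = ff_trace x) / of_nat CHAR('a))"

text \<open>
  A Laurent series in \<open>1/t\<close> is an element of the type \<open>'a fls\<close> whose formal variable
  stands for \<open>1/t\<close>. Thus the coefficient of \<open>t ^ i\<close> in \<open>\<theta>\<close> is \<open>fls_nth \<theta> (- i)\<close>,
  and \<open>t\<close> itself is \<open>fls_X_inv\<close>.
\<close>

definition fls_of_poly_inv :: "'a :: finite_field poly \<Rightarrow> 'a fls"
  where "fls_of_poly_inv f = poly (map_poly fls_const f) fls_X_inv"

lemma fls_of_poly_inv_nth:
  "fls_nth (fls_of_poly_inv f) (- i) = (if i < 0 then 0 else coeff f (nat i))"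
proof (induction f arbitrary: i)
  case (pCons a f)
  have "fls_of_poly_inv (pCons a f) = fls_const a + fls_X_inv * fls_of_poly_inv f"
    by (simp add: fls_of_poly_inv_def map_poly_pCons)
  moreover have "- i + 1 = - (i - 1)" by simp
  ultimately have "fls_nth (fls_of_poly_inv (pCons a f)) (- i) =
      (if i = 0 then a else 0) + (if i - 1 < 0 then 0 else coeff f (nat (i - 1)))"
    using pCons.IH[of "i - 1"] by (simp add: fls_X_inv_times_conv_shift)
  moreover have "nat i = Suc (nat (i - 1))" if "i > 0" using that by simp
  ultimately show ?case by (cases "i > 0") auto
qed (simp add: fls_of_poly_inv_def)

definition unit_interval_fls :: "'a :: finite_field fls set"
  where "unit_interval_fls = {\<theta>. \<forall>i\<ge>0. fls_nth \<theta> (- i) = 0}"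

definition e_q :: "'a :: finite_field fls \<Rightarrow> complex"
  where "e_q \<theta> = ff_psi (fls_nth \<theta> (- (-1)))"

definition monic_polys :: "nat \<Rightarrow> 'a :: finite_field poly set"
  where "monic_polys n = {f. lead_coeff f = 1 \<and> degree f = n}"

definition poly_moebius :: "'a :: finite_field poly \<Rightarrow> int"
  where "poly_moebius f =
    (if squarefree f then (-1) ^ card {g. irreducible g \<and> lead_coeff g = 1 \<and> g dvd f} else 0)"

lemma poly_moebius_not_squarefree:
  assumes "degree g > 0" "g ^ 2 dvd f"
  shows   "poly_moebius f = 0"
proof -
  have "\<not> g dvd 1" using assms(1) by (auto simp: is_unit_poly_iff)
  hence "\<not> squarefree f" using assms(2) not_squarefreeI by blast
  thus ?thesis by (simp add: poly_moebius_def)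
qed

lemma poly_moebius_prod:
  fixes S :: "'a :: finite_field poly set"
  assumes fin: "finite S" and S: "\<And>g. g \<in> S \<Longrightarrow> irreducible g \<and> lead_coeff g = 1"
  shows   "poly_moebius (\<Prod>S) = (-1) ^ card S"
proof -
  have assoc: "g = h" if "irreducible g" "irreducible h" "lead_coeff g = 1" "lead_coeff h = 1" "g dvd h"
    for g h :: "'a poly"
  proof -
    from \<open>g dvd h\<close> obtain c where c: "h = g * c" by blast
    with that have "c dvd 1" by (metis irreducibleD irreducible_def)
    then obtain a where a: "c = [:a:]" by (auto elim: is_unit_polyE)
    have "lead_coeff h = lead_coeff g * a" unfolding c a by (subst lead_coeff_mult) simp
    with that have "a = 1" by simp
    with a c show ?thesis by simp
  qed
  have dvd_prodD: "g \<in> T" if "irreducible g" "lead_coeff g = 1" and dvd: "g dvd \<Prod>T" and "T \<subseteq> S" for g T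
  proof -
    have prime: "prime_elem g" using that by (intro field_poly_irreducible_imp_prime)
    have "finite T" using that fin by (auto intro: finite_subset)
    from this prime dvd that(1) have "\<exists>h\<in>T. g dvd h"
    proof (induction T rule: finite_induct)
      case (insert h T)
      thus ?case by (auto simp: prime_elem_dvd_mult_iff)
    qed (simp add: irreducible_def)
    then obtain h where "h \<in> T" "g dvd h" by blast
    thus ?thesis using assoc[of g h] S[of h] that by auto
  qed
  have irr_dvd: "\<exists>g. irreducible g \<and> lead_coeff g = 1 \<and> g dvd y" if "degree y > 0" for y :: "'a poly"
    using that
  proof (induction "degree y" arbitrary: y rule: less_induct)
    case (less y)
    show ?case
    proof (cases "irreducible y")
      case True
      define z where "z = smult (inverse (lead_coeff y)) y"
      have z: "z = [:inverse (lead_coeff y):] * y" by (simp add: z_def)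
      have "[:inverse (lead_coeff y):] dvd 1"
        using less.prems by (auto simp: is_unit_const_poly_iff dvd_field_iff)
      hence "irreducible z" using True unfolding z by (subst irreducible_mult_unit_left)
      moreover have "lead_coeff z = 1" using less.prems by (auto simp: z_def)
      moreover have "z dvd y" using less.prems unfolding z_def by (intro smult_dvd) auto
      ultimately show ?thesis by blast
    next
      case False
      moreover have "y \<noteq> 0" "\<not> y dvd 1" using less.prems by (auto simp: is_unit_poly_iff)
      ultimately obtain a b where ab: "y = a * b" "\<not> a dvd 1" "\<not> b dvd 1"
        unfolding irreducible_def by blast
      have nz: "a \<noteq> 0" "b \<noteq> 0" using ab less.prems by auto
      hence "degree a > 0" "degree b > 0" using ab by (auto simp: is_unit_iff_degree)
      moreover have "degree y = degree a + degree b" using ab nz by (simp add: degree_mult_eq)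
      ultimately obtain g where "irreducible g \<and> lead_coeff g = 1 \<and> g dvd a"
        using less.hyps[of a] by auto
      thus ?thesis using ab by (auto intro: dvd_mult2)
    qed
  qed
  have nz: "\<Prod>S \<noteq> 0" using fin S by force
  have "squarefree (\<Prod>S)"
  proof (rule squarefreeI, rule ccontr)
    fix y assume y: "y ^ 2 dvd \<Prod>S" "\<not> y dvd 1"
    with nz have "y \<noteq> 0" by auto
    with y have "degree y > 0" by (simp add: is_unit_iff_degree)
    then obtain g where g: "irreducible g" "lead_coeff g = 1" "g dvd y" using irr_dvd by blast
    hence gg: "g * g dvd \<Prod>S" using y by (metis mult_dvd_mono dvd_trans power2_eq_square)
    hence "g dvd \<Prod>S" by (meson dvd_mult_left)
    hence "g \<in> S" using dvd_prodD g by blast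
    hence "\<Prod>S = g * \<Prod>(S - {g})" using fin by (simp add: prod.remove)
    with gg have "g dvd \<Prod>(S - {g})" using g by auto
    with dvd_prodD[of g "S - {g}"] g show False by auto
  qed
  moreover have "{g. irreducible g \<and> lead_coeff g = 1 \<and> g dvd \<Prod>S} = S"
    using dvd_prodD[of _ S] S dvd_prodI[OF fin] by auto
  ultimately show ?thesis by (simp add: poly_moebius_def)
qed

lemma finite_monic_polys: "finite (monic_polys n :: 'a :: finite_field poly set)"
proof (rule finite_imageD)
  show "finite (coeffs ` (monic_polys n :: 'a poly set))"
    by (rule finite_subset[OF _ finite_lists_length_le[of "UNIV :: 'a set" "Suc n"]])
       (auto simp: monic_polys_def coeffs_def)
  show "inj_on coeffs (monic_polys n :: 'a poly set)"
    by (intro inj_onI) (simp add: coeffs_eq_iff)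
qed

text \<open>
  The sum over \<open>f\<close> of degree \<open>n\<close> takes only finitely many values as \<open>\<theta>\<close> varies,
  so that its maximum over \<open>\<theta>\<close> is given by \<open>Max\<close>.
\<close>

lemma finite_moebius_exp_sum:
  "finite ((\<lambda>\<theta> :: 'a :: finite_field fls.
      cmod (\<Sum>f\<in>monic_polys n. of_int (poly_moebius f) * e_q (fls_of_poly_inv f * \<theta>)))
    ` unit_interval_fls)"
proof -
  let ?M = "monic_polys n :: 'a poly set"
  let ?S = "\<lambda>\<theta>. \<Sum>f\<in>?M. of_int (poly_moebius f) * e_q (fls_of_poly_inv f * \<theta>)"
  define F where "F = ?M \<rightarrow>\<^sub>E (range (ff_psi :: 'a \<Rightarrow> complex))"
  have "finite F" unfolding F_def by (intro finite_PiE finite_monic_polys) auto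
  moreover have "cmod (?S \<theta>) \<in> (\<lambda>c. cmod (\<Sum>f\<in>?M. of_int (poly_moebius f) * c f)) ` F" for \<theta>
  proof (rule image_eqI)
    let ?c = "restrict (\<lambda>f. e_q (fls_of_poly_inv f * \<theta>)) ?M"
    show "cmod (?S \<theta>) = cmod (\<Sum>f\<in>?M. of_int (poly_moebius f) * ?c f)"
      by (intro arg_cong[of _ _ cmod] sum.cong) auto
    show "?c \<in> F" by (auto simp: F_def e_q_def)
  qed
  ultimately show ?thesis
    by (meson finite_imageI finite_subset image_subsetI)
qed

lemma zero_in_unit_interval_fls: "0 \<in> unit_interval_fls"
  by (simp add: unit_interval_fls_def)

end

(*
  By Dirichlet approximation there is a monic g of degree at most n/2 such that e_q(f theta), for
  f monic of degree n, depends only on f mod g and on the leading coefficients of f. Splitting the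
  sum according to gcd(f, g) and expanding in characters of the finite group of such residue
  classes (the l1-norm of the Fourier coefficients is at most the square root of the group order)
  reduces the theorem to sums of mu(f) chi(f), which are coefficients of 1/L(chi). L(chi) is a
  polynomial, and the Riemann hypothesis, i.e. that its inverse zeros have absolute value at most
  sqrt q, bounds these coefficients by a binomial coefficient times q^(n/2).

  The Riemann hypothesis is proved by Stepanov's method, without curves. Let w(x) be the
  matrix of multiplication by the (normalised) linear polynomial with root x on the residue ring,
  and let U be the infinite product of w, w^(q), w^(q^2), ..., where the powers of matrices are
  taken entrywise, so that U = w U^(q). If x lies in the field with q^r elements, the value at x of
  the product W_r of the first r factors is the residue class of the norm of the linear polynomial.
  A polynomial combination of the reduced monomials in the entries of W_r, small in degree but
  vanishing to high order at all points in a given class, bounds the number of these points from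
  above by q^r/D + O(q^(r/2)), where D is at least the number of classes occurring often; since the
  upper bounds add up to about q^r, they are sharp.
*)

theory Submission
  imports Defs "HOL-Algebra.Algebraic_Closure_Type"
begin

hide_const (open) UnivPoly.coeff UnivPoly.monom Polynomials.degree Polynomials.lead_coeff
  Coset.order Divisibility.irreducible Divisibility.prime Module.smult

text \<open>The entries of \<open>U\<close> generate over K(X) an algebra of finite dimension
  \<open>D\<close>, which stands in for the function field of a covering curve; the constant
  matrices c for which u -> cu respects all relations of \<open>U\<close> stand in for its Galois
  group. The same number \<open>D\<close> has to appear on two sides. It counts the free
  coefficients of the auxiliary polynomial per degree, which gives q^r/D for one class; and it
  bounds the number of maps u -> cu, since distinct ones are linearly independent, so that at most
  \<open>D\<close> classes hold more than a bounded number of points. Only then are the upper bounds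
  forced to be sharp. The infinite product converges because w(0) is the identity; a translation of
  the point and the passage from q to one of its powers achieve this. Exponents r = 2\<mu> are taken
  because W_r is the product of W_\<mu> and its q^\<mu>-th twist, and the twist is constant to order
  q^\<mu> at each point. Restricting r to multiples of a fixed number does no harm: power sums along
  such a progression still bound the inverse zeros.\<close>

lemma homogeneous_solution:
  fixes m :: "'e \<Rightarrow> 'v \<Rightarrow> 'a :: idom"
  assumes "finite E" "finite V" "card E < card V"
  shows "\<exists>c. (\<exists>v\<in>V. c v \<noteq> 0) \<and> (\<forall>e\<in>E. (\<Sum>v\<in>V. c v * m e v) = 0)"
  using assms
proof (induction E arbitrary: V m rule: finite_induct)
  case empty
  then have "V \<noteq> {}" by auto
  then show ?case by (intro exI[of _ "\<lambda>_. 1"]) auto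
next
  case (insert e E)
  show ?case
  proof (cases "\<forall>v\<in>V. m e v = 0")
    case True
    have "card E < card V" using insert by auto
    from insert.IH[OF insert.prems(1) this, of m] obtain c where
      c: "\<exists>v\<in>V. c v \<noteq> 0" "\<forall>e\<in>E. (\<Sum>v\<in>V. c v * m e v) = 0" by blast
    then show ?thesis using True by (intro exI[of _ c]) auto
  next
    case False
    then obtain v0 where v0: "v0 \<in> V" "m e v0 \<noteq> 0" by blast
    define V' where "V' = V - {v0}"
    have fin: "finite V'" and card: "card E < card V'"
      using insert v0 by (auto simp: V'_def)
    \<comment> \<open>The unknown \<open>v0\<close> is eliminated by cross-multiplication, since the
      lemma is also applied over polynomials and over power series, where the pivot
      \<open>m e v0\<close> has no inverse in general.\<close>
    define m' where "m' = (\<lambda>e' v. m e v0 * m e' v - m e' v0 * m e v)"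
    from insert.IH[OF fin card, of m'] obtain c' where
      c': "\<exists>v\<in>V'. c' v \<noteq> 0" "\<And>e'. e' \<in> E \<Longrightarrow> (\<Sum>v\<in>V'. c' v * m' e' v) = 0" by blast
    define c where "c = (\<lambda>v. if v = v0 then - (\<Sum>u\<in>V'. c' u * m e u) else m e v0 * c' v)"
    have sum_c: "(\<Sum>v\<in>V. c v * f v) = - (\<Sum>u\<in>V'. c' u * m e u) * f v0 + m e v0 * (\<Sum>v\<in>V'. c' v * f v)" for f
    proof -
      have "(\<Sum>v\<in>V. c v * f v) = c v0 * f v0 + (\<Sum>v\<in>V'. c v * f v)"
        unfolding V'_def using v0 insert.prems by (intro sum.remove) auto
      also have "(\<Sum>v\<in>V'. c v * f v) = (\<Sum>v\<in>V'. m e v0 * (c' v * f v))"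
        by (intro sum.cong) (auto simp: c_def V'_def)
      finally show ?thesis by (simp add: c_def sum_distrib_left)
    qed
    have "(\<Sum>v\<in>V. c v * m e' v) = 0" if "e' \<in> insert e E" for e'
    proof (cases "e' = e")
      case True
      then show ?thesis by (subst sum_c) (simp add: algebra_simps)
    next
      case False
      with that have "(\<Sum>v\<in>V'. c' v * m' e' v) = 0" using c' by auto
      also have "(\<Sum>v\<in>V'. c' v * m' e' v) = 
          m e v0 * (\<Sum>v\<in>V'. c' v * m e' v) - m e' v0 * (\<Sum>v\<in>V'. c' v * m e v)"
        by (simp add: m'_def sum_distrib_left sum_subtractf [symmetric] algebra_simps)
      finally show ?thesis by (subst sum_c) (simp add: algebra_simps)
    qed
    moreover from c' obtain v where "v \<in> V'" "c' v \<noteq> 0" by blast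
    then have "v \<in> V" "c v \<noteq> 0" using v0 by (auto simp: c_def V'_def)
    ultimately show ?thesis by blast
  qed
qed

text \<open>
  A polynomial in the shift of the sequence of power sums that vanishes at all the other
  values isolates the powers of a single \<open>\<gamma> i\<close>.
\<close>

lemma norm_le_of_power_sums_bounded:
  fixes \<gamma> :: "'i \<Rightarrow> complex"
  assumes "finite I" "B > 0" and bd: "\<And>r. r > 0 \<Longrightarrow> cmod (\<Sum>i\<in>I. \<gamma> i ^ r) \<le> C * B ^ r"
    and "i0 \<in> I"
  shows "cmod (\<gamma> i0) \<le> B"
proof (rule ccontr)
  assume "\<not> ?thesis"
  then have gt: "cmod (\<gamma> i0) > B" by simp
  define p where "p = (\<Prod>z\<in>\<gamma> ` I - {\<gamma> i0}. [:-z, 1:])"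
  \<comment> \<open>Indices with equal values add up with a positive multiplicity, so the isolated
    value cannot cancel.\<close>
  define K where "K = of_nat (card {i\<in>I. \<gamma> i = \<gamma> i0}) * poly p (\<gamma> i0)"
  have K: "K \<noteq> 0"
    using assms by (auto simp: K_def p_def poly_prod)
  have pz: "poly p (\<gamma> i) = 0" if "i \<in> I" "\<gamma> i \<noteq> \<gamma> i0" for i
    using that assms by (auto simp: p_def poly_prod)
  have eq: "(\<Sum>k\<le>degree p. coeff p k * (\<Sum>i\<in>I. \<gamma> i ^ (r + k))) = K * \<gamma> i0 ^ r" for r
  proof -
    have "(\<Sum>k\<le>degree p. coeff p k * (\<Sum>i\<in>I. \<gamma> i ^ (r + k))) = (\<Sum>i\<in>I. \<gamma> i ^ r * poly p (\<gamma> i))"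
      unfolding poly_altdef sum_distrib_left
      by (subst sum.swap) (simp add: power_add algebra_simps)
    also have "\<dots> = (\<Sum>i | i \<in> I \<and> \<gamma> i = \<gamma> i0. \<gamma> i ^ r * poly p (\<gamma> i))"
      using assms by (intro sum.mono_neutral_right) (auto simp: pz)
    also have "\<dots> = (\<Sum>i | i \<in> I \<and> \<gamma> i = \<gamma> i0. \<gamma> i0 ^ r * poly p (\<gamma> i0))"
      by (intro sum.cong) auto
    finally show ?thesis by (simp add: K_def)
  qed
  define C' where "C' = (\<Sum>k\<le>degree p. cmod (coeff p k) * C * B ^ k)"
  have le: "cmod K * cmod (\<gamma> i0) ^ r \<le> C' * B ^ r" if "r > 0" for r
  proof -
    have "cmod K * cmod (\<gamma> i0) ^ r = cmod (\<Sum>k\<le>degree p. coeff p k * (\<Sum>i\<in>I. \<gamma> i ^ (r + k)))"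
      unfolding eq by (simp add: norm_mult norm_power)
    also have "\<dots> \<le> (\<Sum>k\<le>degree p. cmod (coeff p k) * (C * B ^ (r + k)))"
      using bd that by (intro sum_norm_le) (auto simp: norm_mult intro!: mult_left_mono)
    also have "\<dots> = C' * B ^ r"
      by (simp add: C'_def sum_distrib_left sum_distrib_right power_add algebra_simps)
    finally show ?thesis .
  qed
  define x where "x = cmod (\<gamma> i0) / B"
  have x: "x > 1" using gt assms by (simp add: x_def)
  have le': "x ^ r \<le> C' / cmod K" if "r > 0" for r
    using le[OF that] K assms by (simp add: x_def power_divide field_simps)
  obtain r where "x ^ r > C' / cmod K" using x real_arch_pow by blast
  moreover have "x ^ Suc r \<ge> x ^ r" using x by (intro power_increasing) auto
  ultimately show False using le'[of "Suc r"] by force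
qed

section \<open>Matrices indexed by natural numbers\<close>

text \<open>Matrices are functions on all pairs of naturals that vanish outside the \<open>d\<close>
  by \<open>d\<close> square. The size can then depend on variables, later on
  \<open>degree G + k\<close>, and equality of matrices is equality of functions.\<close>

definition mat_mult :: "nat \<Rightarrow> (nat \<Rightarrow> nat \<Rightarrow> 'r :: comm_ring_1) \<Rightarrow> (nat \<Rightarrow> nat \<Rightarrow> 'r) \<Rightarrow> nat \<Rightarrow> nat \<Rightarrow> 'r"
  where "mat_mult d A B = (\<lambda>i j. if i < d \<and> j < d then \<Sum>k<d. A i k * B k j else 0)"

definition id_mat :: "nat \<Rightarrow> nat \<Rightarrow> nat \<Rightarrow> 'r :: comm_ring_1"
  where "id_mat d = (\<lambda>i j. if i < d \<and> i = j then 1 else 0)"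

definition square_mats :: "nat \<Rightarrow> (nat \<Rightarrow> nat \<Rightarrow> 'r :: comm_ring_1) set"
  where "square_mats d = {A. \<forall>i j. \<not> (i < d \<and> j < d) \<longrightarrow> A i j = 0}"

definition scale_mat :: "'r :: comm_ring_1 \<Rightarrow> (nat \<Rightarrow> nat \<Rightarrow> 'r) \<Rightarrow> nat \<Rightarrow> nat \<Rightarrow> 'r"
  where "scale_mat c A = (\<lambda>i j. c * A i j)"

definition map_mat :: "('r \<Rightarrow> 's) \<Rightarrow> (nat \<Rightarrow> nat \<Rightarrow> 'r) \<Rightarrow> nat \<Rightarrow> nat \<Rightarrow> 's"
  where "map_mat \<phi> A = (\<lambda>i j. \<phi> (A i j))"

lemma mat_mult_in_square_mats [simp]: "mat_mult d A B \<in> square_mats d"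
  by (auto simp: mat_mult_def square_mats_def)

lemma id_mat_in_square_mats [simp]: "id_mat d \<in> square_mats d"
  by (auto simp: id_mat_def square_mats_def)

lemma cmD: "A \<in> square_mats d \<Longrightarrow> \<not> (i < d \<and> j < d) \<Longrightarrow> A i j = 0"
  by (auto simp: square_mats_def)

lemma square_mats_eqI: "A \<in> square_mats d \<Longrightarrow> B \<in> square_mats d \<Longrightarrow> (\<And>i j. i < d \<Longrightarrow> j < d \<Longrightarrow> A i j = B i j) \<Longrightarrow> A = B"
  by (rule ext, rule ext) (metis cmD)

lemma mat_mult_assoc: "mat_mult d (mat_mult d A B) C = mat_mult d A (mat_mult d B C)"
proof (intro ext)
  fix i j
  have "(\<Sum>k<d. (\<Sum>l<d. A i l * B l k) * C k j) = (\<Sum>l<d. \<Sum>k<d. A i l * B l k * C k j)"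
    by (subst sum.swap) (simp add: sum_distrib_right)
  also have "\<dots> = (\<Sum>l<d. A i l * (\<Sum>k<d. B l k * C k j))"
    by (simp add: sum_distrib_left mult.assoc)
  finally show "mat_mult d (mat_mult d A B) C i j = mat_mult d A (mat_mult d B C) i j"
    by (auto simp: mat_mult_def)
qed

lemma mat_mult_id_mat_right: "A \<in> square_mats d \<Longrightarrow> mat_mult d A (id_mat d) = A"
  by (rule square_mats_eqI) (auto simp: mat_mult_def square_mats_def id_mat_def if_distrib sum.delta cong: if_cong)

lemma mat_mult_id_mat_left: "A \<in> square_mats d \<Longrightarrow> mat_mult d (id_mat d) A = A"
  by (rule square_mats_eqI) (auto simp: mat_mult_def square_mats_def id_mat_def if_distrib if_distribR sum.delta cong: if_cong)

lemma mat_mult_scale_mat_left: "mat_mult d (scale_mat c A) B = scale_mat c (mat_mult d A B)"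
  by (auto simp: mat_mult_def scale_mat_def sum_distrib_left mult.assoc intro!: ext)

lemma mat_mult_scale_mat_right: "mat_mult d A (scale_mat c B) = scale_mat c (mat_mult d A B)"
  by (auto simp: mat_mult_def scale_mat_def sum_distrib_left mult_ac intro!: ext)

lemma scale_mat_in_square_mats [simp]: "A \<in> square_mats d \<Longrightarrow> scale_mat c A \<in> square_mats d"
  by (auto simp: square_mats_def scale_mat_def)

lemma mat_mult_diff_left: "mat_mult d (\<lambda>i j. A i j - B i j) C i j = mat_mult d A C i j - mat_mult d B C i j"
  by (auto simp: mat_mult_def algebra_simps sum_subtractf)

lemma mat_mult_diff_right: "mat_mult d A (\<lambda>i j. B i j - C i j) i j = mat_mult d A B i j - mat_mult d A C i j"
  by (auto simp: mat_mult_def algebra_simps sum_subtractf)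

definition ring_hom_fun :: "('r :: comm_ring_1 \<Rightarrow> 's :: comm_ring_1) \<Rightarrow> bool"
  where "ring_hom_fun \<phi> \<longleftrightarrow> \<phi> 0 = 0 \<and> \<phi> 1 = 1 \<and> (\<forall>x y. \<phi> (x + y) = \<phi> x + \<phi> y) \<and> (\<forall>x y. \<phi> (x * y) = \<phi> x * \<phi> y)"

lemma rhomI: "\<phi> 0 = 0 \<Longrightarrow> \<phi> 1 = 1 \<Longrightarrow> (\<And>x y. \<phi> (x + y) = \<phi> x + \<phi> y) \<Longrightarrow>
  (\<And>x y. \<phi> (x * y) = \<phi> x * \<phi> y) \<Longrightarrow> ring_hom_fun \<phi>"
  by (auto simp: ring_hom_fun_def)

context
  fixes \<phi> :: "'r :: comm_ring_1 \<Rightarrow> 's :: comm_ring_1"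
  assumes \<phi>: "ring_hom_fun \<phi>"
begin

lemma ring_hom_fun_0: "\<phi> 0 = 0" and ring_hom_fun_1: "\<phi> 1 = 1" and ring_hom_fun_add: "\<phi> (x + y) = \<phi> x + \<phi> y"
  and ring_hom_fun_mult: "\<phi> (x * y) = \<phi> x * \<phi> y"
  using \<phi> by (auto simp: ring_hom_fun_def)

lemma ring_hom_fun_minus: "\<phi> (- x) = - \<phi> x"
  by (metis add.right_inverse minus_unique ring_hom_fun_0 ring_hom_fun_add)

lemma ring_hom_fun_diff: "\<phi> (x - y) = \<phi> x - \<phi> y"
  by (metis add_uminus_conv_diff ring_hom_fun_add ring_hom_fun_minus)

lemma ring_hom_fun_sum: "\<phi> (\<Sum>x\<in>A. f x) = (\<Sum>x\<in>A. \<phi> (f x))"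
  by (induction A rule: infinite_finite_induct) (auto simp: ring_hom_fun_0 ring_hom_fun_add)

lemma ring_hom_fun_prod: "\<phi> (\<Prod>x\<in>A. f x) = (\<Prod>x\<in>A. \<phi> (f x))"
  by (induction A rule: infinite_finite_induct) (auto simp: ring_hom_fun_1 ring_hom_fun_mult)

lemma ring_hom_fun_power: "\<phi> (x ^ n) = \<phi> x ^ n"
  by (induction n) (auto simp: ring_hom_fun_1 ring_hom_fun_mult)

lemma map_mat_mat_mult: "map_mat \<phi> (mat_mult d A B) = mat_mult d (map_mat \<phi> A) (map_mat \<phi> B)"
  by (auto simp: map_mat_def mat_mult_def ring_hom_fun_0 ring_hom_fun_sum ring_hom_fun_mult intro!: ext)

lemma map_mat_id_mat: "map_mat \<phi> (id_mat d) = id_mat d"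
  by (auto simp: map_mat_def id_mat_def ring_hom_fun_0 ring_hom_fun_1 intro!: ext)

lemma map_mat_scale_mat: "map_mat \<phi> (scale_mat c A) = scale_mat (\<phi> c) (map_mat \<phi> A)"
  by (auto simp: map_mat_def scale_mat_def ring_hom_fun_mult intro!: ext)

lemma map_mat_in_square_mats: "A \<in> square_mats d \<Longrightarrow> map_mat \<phi> A \<in> square_mats d"
  by (auto simp: map_mat_def square_mats_def ring_hom_fun_0)

end

lemma ring_hom_fun_poly: "ring_hom_fun (\<lambda>p. poly p x)"
  by (auto simp: ring_hom_fun_def)

lemma ring_hom_fun_fps_of_poly: "ring_hom_fun fps_of_poly"
  by (auto simp: ring_hom_fun_def fps_of_poly_add fps_of_poly_mult)

lemma ring_hom_fun_const_poly: "ring_hom_fun (\<lambda>c. [:c:])"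
  by (auto simp: ring_hom_fun_def mult.commute one_pCons)

lemma ring_hom_fun_map_poly: 
  assumes "ring_hom_fun \<phi>" shows "ring_hom_fun (map_poly \<phi>)"
proof (rule rhomI)
  fix p q
  show "map_poly \<phi> (p + q) = map_poly \<phi> p + map_poly \<phi> q"
    by (intro poly_eqI) (simp add: coeff_map_poly ring_hom_fun_0[OF assms] ring_hom_fun_add[OF assms])
  show "map_poly \<phi> (p * q) = map_poly \<phi> p * map_poly \<phi> q"
    by (intro poly_eqI) (simp add: coeff_map_poly coeff_mult ring_hom_fun_0[OF assms] ring_hom_fun_sum[OF assms] ring_hom_fun_mult[OF assms])
qed (auto simp: map_poly_1 ring_hom_fun_1[OF assms])

section \<open>Frobenius powers\<close>

lemma frob_sum:
  fixes f :: "'i \<Rightarrow> 'r :: comm_ring_1"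
  assumes "prime CHAR('r)" "q = CHAR('r) ^ a"
  shows "(\<Sum>x\<in>A. f x) ^ (q ^ s) = (\<Sum>x\<in>A. f x ^ (q ^ s))"
  by (rule freshmans_dream_sum'[OF assms(1), of _ "a * s"]) (simp add: assms power_mult)

lemma frob_add:
  fixes x :: "'r :: comm_ring_1"
  assumes "prime CHAR('r)" "q = CHAR('r) ^ a"
  shows "(x + y) ^ (q ^ s) = x ^ (q ^ s) + y ^ (q ^ s)"
  by (rule freshmans_dream'[OF assms(1), of _ "a * s"]) (simp add: assms power_mult)

lemma frob_diff:
  fixes x :: "'r :: comm_ring_1"
  assumes "prime CHAR('r)" "q = CHAR('r) ^ a"
  shows "(x - y) ^ (q ^ s) = x ^ (q ^ s) - y ^ (q ^ s)"
  using frob_add[OF assms, of "x - y" y s] by simp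

lemma frob_minus:
  fixes x :: "'r :: comm_ring_1"
  assumes "prime CHAR('r)" "q = CHAR('r) ^ a"
  shows "(- x) ^ (q ^ s) = - (x ^ (q ^ s))"
proof -
  have "q ^ s > 0" using assms by (simp add: prime_gt_0_nat)
  then show ?thesis
  using frob_diff[OF assms, of 0 x s] by (simp add: power_0_left)
qed

text \<open>Let \<open>Q\<close> be a power of the characteristic. For a matrix of polynomials with
  coefficients fixed by the \<open>Q\<close>-th power map, this is the substitution of X^Q for X;
  for a matrix of constants it is the action of Frobenius.\<close>

definition twist :: "nat \<Rightarrow> (nat \<Rightarrow> nat \<Rightarrow> 'r :: comm_ring_1) \<Rightarrow> nat \<Rightarrow> nat \<Rightarrow> 'r"
  where "twist Q A = (\<lambda>i j. A i j ^ Q)"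

lemma twist_mat_mult:
  fixes A :: "nat \<Rightarrow> nat \<Rightarrow> 'r :: comm_ring_1"
  assumes "prime CHAR('r)" "q = CHAR('r) ^ a"
  shows "twist (q ^ s) (mat_mult d A B) = mat_mult d (twist (q ^ s) A) (twist (q ^ s) B)"
proof -
  have "q ^ s > 0" using assms by (simp add: prime_gt_0_nat)
  then show ?thesis
    by (auto simp: twist_def mat_mult_def frob_sum[OF assms] power_mult_distrib power_0_left intro!: ext)
qed

lemma twist_twist: "twist Q (twist R A) = twist (Q * R) A"
  by (auto simp: twist_def power_mult [symmetric] mult.commute intro!: ext)

lemma twist_id_mat: "Q > 0 \<Longrightarrow> twist Q (id_mat d) = id_mat d"
  by (auto simp: twist_def id_mat_def power_0_left intro!: ext)

lemma twist_scale_mat: "twist Q (scale_mat c A) = scale_mat (c ^ Q) (twist Q A)"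
  by (auto simp: twist_def scale_mat_def power_mult_distrib)

lemma twist_in_square_mats: "Q > 0 \<Longrightarrow> A \<in> square_mats d \<Longrightarrow> twist Q A \<in> square_mats d"
  by (auto simp: twist_def square_mats_def power_0_left)

lemma map_mat_twist: "ring_hom_fun \<phi> \<Longrightarrow> map_mat \<phi> (twist Q A) = twist Q (map_mat \<phi> A)"
  by (auto simp: map_mat_def twist_def ring_hom_fun_power)

section \<open>The twisted products and their X-adic limit\<close>

lemma X_power_dvd_poly_iff: "[:0, 1:] ^ n dvd p \<longleftrightarrow> (\<forall>k<n. coeff p k = 0)" for p :: "'a :: field poly"
  using monom_1_dvd_iff'[of n p] by (simp add: monom_altdef)

lemma X_power_dvd_fps_iff: "fps_X ^ n dvd z \<longleftrightarrow> (\<forall>k<n. fps_nth z k = 0)" for z :: "'a :: field fps"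
proof (cases "z = 0")
  case False
  then have "fps_X ^ n dvd z \<longleftrightarrow> n \<le> subdegree z"
    by (subst fps_dvd_iff) auto
  also have "\<dots> \<longleftrightarrow> (\<forall>k<n. fps_nth z k = 0)"
    using False by (metis less_le_trans nth_less_subdegree_zero nth_subdegree_nonzero not_le)
  finally show ?thesis .
qed auto

lemma fps_of_poly_dvd: "p dvd q \<Longrightarrow> fps_of_poly p dvd fps_of_poly q"
  by (auto simp: dvd_def fps_of_poly_mult)

text \<open>
  The matrix \<open>w\<close> depends polynomially on a point of the affine line. The product \<open>W r\<close> of its first
  \<open>r\<close> Frobenius twists, at a point \<open>x\<close> with \<open>x ^ (q ^ r) = x\<close>, is the Frobenius class of \<open>x\<close>.
\<close>

locale frob_matrix =
  fixes q qe d :: nat and w :: "nat \<Rightarrow> nat \<Rightarrow> 'k :: alg_closed_field poly"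
  assumes prime_char: "prime CHAR('k)" and q_eq: "q = CHAR('k) ^ qe" and a_pos: "qe > 0"
    and algebraic: "\<exists>n>0. (z :: 'k) ^ (q ^ n) = z"
    and w_square_mats: "w \<in> square_mats d"
    and w_coeff: "coeff (w i j) n ^ q = coeff (w i j) n"
    and w_0: "coeff (w i j) 0 = id_mat d i j"
begin

lemma q_ge_2: "q \<ge> 2"
proof -
  have "CHAR('k) ^ 1 \<le> CHAR('k) ^ qe" using a_pos prime_gt_0_nat[OF prime_char] 
    by (intro power_increasing) auto
  then show ?thesis using prime_ge_2_nat[OF prime_char] q_eq by simp
qed

lemma q_pos [simp]: "q > 0" using q_ge_2 by auto

lemma qpow_gt: "n < q ^ n"
  using q_ge_2 by (simp add: power_gt_expt)

lemma char_poly: "prime CHAR('k poly)" "q = CHAR('k poly) ^ qe"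
  and char_fps: "prime CHAR('k fps)" "q = CHAR('k fps) ^ qe"
  and char_k: "prime CHAR('k)" "q = CHAR('k) ^ qe"
  using prime_char q_eq by auto

fun W :: "nat \<Rightarrow> nat \<Rightarrow> nat \<Rightarrow> 'k poly" where
  "W 0 = id_mat d"
| "W (Suc r) = mat_mult d (W r) (twist (q ^ r) w)"

lemma W_square_mats [simp]: "W r \<in> square_mats d"
  by (cases r) auto

lemma W_1: "W (Suc 0) = w"
  by (simp add: mat_mult_id_mat_left w_square_mats twist_def)

lemma W_add: "W (r + s) = mat_mult d (W r) (twist (q ^ r) (W s))"
proof (induction s)
  case 0
  then show ?case by (simp add: twist_id_mat mat_mult_id_mat_right)
next
  case (Suc s)
  have "W (r + Suc s) = mat_mult d (mat_mult d (W r) (twist (q ^ r) (W s))) (twist (q ^ (r + s)) w)"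
    using Suc by simp
  also have "\<dots> = mat_mult d (W r) (mat_mult d (twist (q ^ r) (W s)) (twist (q ^ r) (twist (q ^ s) w)))"
    by (simp add: mat_mult_assoc twist_twist power_add)
  also have "\<dots> = mat_mult d (W r) (twist (q ^ r) (mat_mult d (W s) (twist (q ^ s) w)))"
    by (simp add: twist_mat_mult[OF char_poly])
  finally show ?case by simp
qed

text \<open>The new factor is the twist of w by q^r, and w(0) is the identity, so this factor is the
  identity modulo X^(q^r).\<close>

lemma W_step: "[:0, 1:] ^ (q ^ r) dvd W (Suc r) i j - W r i j"
proof -
  have "W r = mat_mult d (W r) (id_mat d)" by (simp add: mat_mult_id_mat_right)
  then have "W (Suc r) i j - W r i j = mat_mult d (W r) (\<lambda>k j. twist (q ^ r) w k j - id_mat d k j) i j"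
    by (simp add: mat_mult_diff_right)
  also have "[:0, 1:] ^ (q ^ r) dvd \<dots>"
  proof -
    have "[:0, 1:] ^ (q ^ r) dvd twist (q ^ r) w k j - id_mat d k j" for k j
    proof -
      have "coeff (w k j - id_mat d k j) 0 = 0"
        by (simp add: w_0) (simp add: id_mat_def)
      then have "[:0, 1:] ^ 1 dvd w k j - id_mat d k j"
        by (subst X_power_dvd_poly_iff) auto
      then have "[:0, 1:] ^ (q ^ r) dvd (w k j - id_mat d k j) ^ (q ^ r)"
        by (simp add: dvd_power_same)
      also have "(w k j - id_mat d k j) ^ (q ^ r) = twist (q ^ r) w k j - id_mat d k j"
        by (subst frob_diff[OF char_poly]) (auto simp: twist_def id_mat_def)
      finally show ?thesis .
    qed
    then show ?thesis by (auto simp: mat_mult_def intro!: dvd_sum dvd_mult)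
  qed
  finally show ?thesis .
qed

lemma W_stable: "r \<le> s \<Longrightarrow> [:0, 1:] ^ (q ^ r) dvd W s i j - W r i j"
proof (induction s rule: dec_induct)
  case (step s)
  have "q ^ r \<le> q ^ s" using step q_ge_2 by (intro power_increasing) auto
  then have "[:0, 1:] ^ (q ^ r) dvd ([:0, 1:] :: 'k poly) ^ (q ^ s)"
    by (rule le_imp_power_dvd)
  then have "[:0, 1:] ^ (q ^ r) dvd W (Suc s) i j - W s i j"
    using W_step dvd_trans by blast
  with step have "[:0, 1:] ^ (q ^ r) dvd (W (Suc s) i j - W s i j) + (W s i j - W r i j)"
    by (intro dvd_add) auto
  then show ?case by (simp del: W.simps)
qed auto

text \<open>The limit of the \<open>W r\<close> in the \<open>X\<close>-adic topology.\<close>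

definition U :: "nat \<Rightarrow> nat \<Rightarrow> 'k fps"
  where "U = (\<lambda>i j. Abs_fps (\<lambda>n. coeff (W n i j) n))"

lemma U_W: "fps_X ^ (q ^ r) dvd U i j - fps_of_poly (W r i j)"
proof (subst X_power_dvd_fps_iff, intro allI impI)
  fix n assume n: "n < q ^ r"
  \<comment> \<open>Because n < q^n, the n-th coefficient no longer changes from \<open>W n\<close>
    on; this is why the diagonal coefficients in \<open>U\<close> give the limit.\<close>
  have "coeff (W n i j) n = coeff (W r i j) n"
  proof (cases "r \<le> n")
    case True
    show ?thesis using W_stable[OF True, of i j] n by (subst (asm) X_power_dvd_poly_iff) auto
  next
    case False
    then have "n \<le> r" by simp
    from W_stable[OF this, of i j] show ?thesis using qpow_gt[of n] 
      by (subst (asm) X_power_dvd_poly_iff) auto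
  qed
  then show "fps_nth (U i j - fps_of_poly (W r i j)) n = 0"
    by (simp add: U_def)
qed

lemma U_square_mats [simp]: "U \<in> square_mats d"
  by (auto simp: square_mats_def U_def fps_eq_iff cmD[OF W_square_mats])

lemma U_0: "fps_nth (U i j) 0 = id_mat d i j"
  by (simp add: U_def) (simp add: id_mat_def)

text \<open>The factorisation of \<open>W (r + n)\<close> into \<open>W r\<close> and the twist of
  \<open>W n\<close> passes to the limit; both sides are compared modulo X^n for every n.\<close>

lemma U_eq: "U = mat_mult d (map_mat fps_of_poly (W r)) (twist (q ^ r) U)"
proof (rule square_mats_eqI)
  fix i j assume ij: "i < d" "j < d"
  have "fps_X ^ n dvd U i j - mat_mult d (map_mat fps_of_poly (W r)) (twist (q ^ r) U) i j" for n
  proof -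
    have "fps_X ^ (q ^ (r + n)) dvd U i j - fps_of_poly (W (r + n) i j)" by (rule U_W)
    moreover have "(fps_X :: 'k fps) ^ n dvd fps_X ^ (q ^ (r + n))"
      using qpow_gt[of "r + n"] by (intro le_imp_power_dvd) auto
    ultimately have 1: "fps_X ^ n dvd U i j - fps_of_poly (W (r + n) i j)" by (rule dvd_trans[rotated])
    have e1: "fps_of_poly (W (r + n) i j) = map_mat fps_of_poly (W (r + n)) i j" by (simp add: map_mat_def)
    have e2: "map_mat fps_of_poly (W (r + n)) = mat_mult d (map_mat fps_of_poly (W r)) (twist (q ^ r) (map_mat fps_of_poly (W n)))"
      by (simp add: W_add map_mat_mat_mult[OF ring_hom_fun_fps_of_poly] map_mat_twist[OF ring_hom_fun_fps_of_poly])
    have 2: "fps_X ^ n dvd fps_of_poly (W (r + n) i j) - mat_mult d (map_mat fps_of_poly (W r)) (twist (q ^ r) U) i j"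
      unfolding e1 e2 mat_mult_diff_right[symmetric]
    proof -
      have "fps_X ^ n dvd twist (q ^ r) (map_mat fps_of_poly (W n)) k j - twist (q ^ r) U k j" for k j
      proof -
        have "twist (q ^ r) (map_mat fps_of_poly (W n)) k j - twist (q ^ r) U k j =
          - ((U k j - fps_of_poly (W n k j)) ^ (q ^ r))"
          using frob_diff[OF char_fps, of "U k j" "fps_of_poly (W n k j)" r] 
          unfolding twist_def map_mat_def by (simp only: minus_diff_eq)
        moreover have "fps_X ^ n dvd U k j - fps_of_poly (W n k j)"
          using U_W[of n k j] qpow_gt[of n] by (meson dvd_trans le_imp_power_dvd less_imp_le)
        then have "fps_X ^ n dvd (U k j - fps_of_poly (W n k j)) ^ (q ^ r)"
          by (rule dvd_trans) (simp add: dvd_power)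
        ultimately show ?thesis by simp
      qed
      then show "fps_X ^ n dvd mat_mult d (map_mat fps_of_poly (W r))
        (\<lambda>i j. twist (q ^ r) (map_mat fps_of_poly (W n)) i j - twist (q ^ r) U i j) i j"
        by (auto simp: mat_mult_def intro!: dvd_sum dvd_mult)
    qed
    from dvd_add[OF 1 2] show ?thesis by simp
  qed
  then have "fps_nth (U i j - mat_mult d (map_mat fps_of_poly (W r)) (twist (q ^ r) U) i j) n = 0" for n
    using X_power_dvd_fps_iff lessI by blast
  then show "U i j = mat_mult d (map_mat fps_of_poly (W r)) (twist (q ^ r) U) i j"
    by (simp add: fps_eq_iff)
qed auto

text \<open>A denominator for the inverse of w. As w is the identity modulo X, no nonzero row is
  killed by it; hence in a nontrivial solution of the \<open>d\<close> equations saying that a row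
  times w is a multiple of a unit row, the multiplier is nonzero.\<close>

lemma adj_exists: "\<exists>adj \<Delta>. \<Delta> \<noteq> 0 \<and> adj \<in> square_mats d \<and> mat_mult d adj w = scale_mat \<Delta> (id_mat d)"
proof -
  have inj: "\<forall>i<d. a i = 0" if a: "\<And>j. j < d \<Longrightarrow> (\<Sum>i<d. a i * w i j) = 0" for a
  proof -
    \<comment> \<open>Infinite descent: after division by X^n the row is still killed by w, and at X
      = 0 this says that its constant terms vanish.\<close>
    have "\<forall>i<d. [:0, 1:] ^ n dvd a i" for n
    proof (induction n)
      case (Suc n)
      then have "\<forall>i. \<exists>b. i < d \<longrightarrow> a i = [:0, 1:] ^ n * b" by (auto simp: dvd_def)
      then obtain b where b: "\<And>i. i < d \<Longrightarrow> a i = [:0, 1:] ^ n * b i" by metis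
      have "[:0, 1:] dvd b j" if j: "j < d" for j
      proof -
        have "(\<Sum>i<d. a i * w i j) = [:0, 1:] ^ n * (\<Sum>i<d. b i * w i j)"
          by (simp add: sum_distrib_left b mult.assoc)
        with a[OF j] have "(\<Sum>i<d. b i * w i j) = 0" by simp
        then have "coeff (\<Sum>i<d. b i * w i j) 0 = 0" by simp
        then have "(\<Sum>i<d. coeff (b i) 0 * id_mat d i j) = 0"
          by (simp add: coeff_sum coeff_mult w_0)
        then have "coeff (b j) 0 = 0"
          using j by (simp add: id_mat_def if_distrib cong: if_cong)
        then have "[:0, 1:] ^ 1 dvd b j" by (subst X_power_dvd_poly_iff) auto
        then show ?thesis by simp
      qed
      then have "[:0, 1:] ^ n * [:0, 1:] dvd a i" if "i < d" for i
        unfolding b[OF that] using that by (intro mult_dvd_mono) auto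
      then show ?case by (metis power_Suc2)
    qed auto
    then have "coeff (a i) n = 0" if "i < d" for i n
      using that X_power_dvd_poly_iff lessI by blast
    then show ?thesis by (auto simp: poly_eq_iff)
  qed
  have "\<exists>a \<delta>. \<delta> \<noteq> 0 \<and> (\<forall>j<d. (\<Sum>i<d. a i * w i j) = (if i0 = j then \<delta> else 0))" if "i0 < d" for i0
  proof -
    \<comment> \<open>The extra unknown, with index \<open>d\<close> and coefficient -1 in equation
      \<open>i0\<close>, is the multiplier.\<close>
    define m where "m = (\<lambda>j i. if i < d then w i j else if i0 = j then -1 else 0)"
    obtain c where c: "\<exists>v\<in>{..d}. c v \<noteq> 0" "\<And>j. j < d \<Longrightarrow> (\<Sum>v\<in>{..d}. c v * m j v) = 0"
      using homogeneous_solution[of "{..<d}" "{..d}" m] by auto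
    have eq: "(\<Sum>i<d. c i * w i j) = (if i0 = j then c d else 0)" if "j < d" for j
    proof -
      have "{..d} = insert d {..<d}" by auto
      then have "(\<Sum>v\<in>{..d}. c v * m j v) = c d * m j d + (\<Sum>i<d. c i * m j i)" by simp
      also have "(\<Sum>i<d. c i * m j i) = (\<Sum>i<d. c i * w i j)" by (simp add: m_def)
      finally show ?thesis using c(2)[OF that] by (auto simp: m_def algebra_simps split: if_splits)
    qed
    have "c d \<noteq> 0"
    proof
      assume "c d = 0"
      with eq have "\<forall>i<d. c i = 0" by (intro inj) auto
      with \<open>c d = 0\<close> c(1) show False by (auto simp: le_less)
    qed
    with eq show ?thesis by blast
  qed
  then obtain A \<delta> where A: "\<And>i. i < d \<Longrightarrow> \<delta> i \<noteq> 0" 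
    "\<And>i j. i < d \<Longrightarrow> j < d \<Longrightarrow> (\<Sum>k<d. A i k * w k j) = (if i = j then \<delta> i else 0)"
    by metis
  define \<Delta> where "\<Delta> = (\<Prod>i<d. \<delta> i)"
  define adj where "adj = (\<lambda>i j. if i < d \<and> j < d then (\<Prod>k\<in>{..<d} - {i}. \<delta> k) * A i j else 0)"
  have "mat_mult d adj w = scale_mat \<Delta> (id_mat d)"
  proof (rule square_mats_eqI)
    fix i j assume ij: "i < d" "j < d"
    then have "mat_mult d adj w i j = (\<Prod>k\<in>{..<d} - {i}. \<delta> k) * (\<Sum>k<d. A i k * w k j)"
      by (simp add: mat_mult_def adj_def sum_distrib_left mult.assoc)
    also have "\<dots> = (if i = j then \<Delta> else 0)"
      using ij A(2)[OF ij] prod.remove[of "{..<d}" i \<delta>] by (auto simp: \<Delta>_def mult.commute)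
    finally show "mat_mult d adj w i j = scale_mat \<Delta> (id_mat d) i j" using ij by (simp add: scale_mat_def id_mat_def)
  qed auto
  moreover have "\<Delta> \<noteq> 0" using A(1) by (auto simp: \<Delta>_def)
  moreover have "adj \<in> square_mats d" by (auto simp: adj_def square_mats_def)
  ultimately show ?thesis by blast
qed

definition "adj\<Delta> = (SOME p. snd p \<noteq> 0 \<and> fst p \<in> square_mats d \<and> mat_mult d (fst p) w = scale_mat (snd p) (id_mat d))"
definition "adj = fst adj\<Delta>"
definition "\<Delta> = snd adj\<Delta>"

lemma \<Delta>_nz: "\<Delta> \<noteq> 0" and adj_square_mats: "adj \<in> square_mats d" and adj_w: "mat_mult d adj w = scale_mat \<Delta> (id_mat d)"
proof -
  have "\<exists>p. snd p \<noteq> 0 \<and> fst p \<in> square_mats d \<and> mat_mult d (fst p) w = scale_mat (snd p) (id_mat d)"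
    using adj_exists by auto
  from someI_ex[OF this] show "\<Delta> \<noteq> 0" "adj \<in> square_mats d" "mat_mult d adj w = scale_mat \<Delta> (id_mat d)"
    by (auto simp: adj_def \<Delta>_def adj\<Delta>_def)
qed

text \<open>This is \<open>U_eq\<close> for r = 1, solved for the twisted matrix. It makes the q-th
  power of each entry linear in the entries, up to the denominator \<open>\<Delta>\<close>, and is
  the source of the finite dimension.\<close>

lemma U_reduce:
  assumes "i < d" "j < d"
  shows "fps_of_poly \<Delta> * U i j ^ q = (\<Sum>k<d. fps_of_poly (adj i k) * U k j)"
proof -
  have "U = mat_mult d (map_mat fps_of_poly w) (twist q U)"
    using U_eq[of "Suc 0"] unfolding W_1 by simp
  then have "mat_mult d (map_mat fps_of_poly adj) U = mat_mult d (mat_mult d (map_mat fps_of_poly adj) (map_mat fps_of_poly w)) (twist q U)"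
    by (simp add: mat_mult_assoc)
  also have "mat_mult d (map_mat fps_of_poly adj) (map_mat fps_of_poly w) = scale_mat (fps_of_poly \<Delta>) (id_mat d)"
    using arg_cong[OF adj_w, of "map_mat fps_of_poly"]
    by (simp add: map_mat_mat_mult[OF ring_hom_fun_fps_of_poly] map_mat_scale_mat[OF ring_hom_fun_fps_of_poly] map_mat_id_mat[OF ring_hom_fun_fps_of_poly])
  also have "mat_mult d (scale_mat (fps_of_poly \<Delta>) (id_mat d)) (twist q U) = scale_mat (fps_of_poly \<Delta>) (twist q U)"
    by (simp add: mat_mult_scale_mat_left mat_mult_id_mat_left twist_in_square_mats)
  finally have "mat_mult d (map_mat fps_of_poly adj) U i j = scale_mat (fps_of_poly \<Delta>) (twist q U) i j" by simp
  then show ?thesis using assms by (simp add: mat_mult_def scale_mat_def twist_def map_mat_def)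
qed

end

section \<open>Polynomial functions of a matrix\<close>

definition mon :: "nat \<Rightarrow> (nat \<times> nat \<Rightarrow> nat) \<Rightarrow> (nat \<Rightarrow> nat \<Rightarrow> 'r :: comm_ring_1) \<Rightarrow> 'r"
  where "mon d e y = (\<Prod>x\<in>{..<d} \<times> {..<d}. y (fst x) (snd x) ^ e x)"

lemma mon_add: "mon d (\<lambda>x. e x + e' x) y = mon d e y * mon d e' y"
  by (simp add: mon_def power_add prod.distrib)

lemma mon_0 [simp]: "mon d (\<lambda>_. 0) y = 1"
  by (simp add: mon_def)

lemma mon_scale_mat: "mon d e (scale_mat c y) = c ^ (\<Sum>x\<in>{..<d} \<times> {..<d}. e x) * mon d e y"
  by (simp add: mon_def scale_mat_def power_mult_distrib prod.distrib power_sum)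

lemma mon_map_mat: "ring_hom_fun \<phi> \<Longrightarrow> \<phi> (mon d e y) = mon d e (map_mat \<phi> y)"
  by (simp add: mon_def map_mat_def ring_hom_fun_prod ring_hom_fun_power)

lemma mon_mult_of_nat: "mon d (\<lambda>x. e x * n) y = mon d e y ^ n"
  by (simp add: mon_def power_mult prod_power_distrib)

definition sg :: "'x \<Rightarrow> 'x \<Rightarrow> nat" where "sg x = (\<lambda>z. if z = x then 1 else 0)"

lemma mon_sg: 
  assumes "i < d" "j < d"
  shows "mon d (sg (i, j)) y = y i j"
proof -
  have "mon d (sg (i, j)) y = (\<Prod>x\<in>{..<d} \<times> {..<d}. if x = (i, j) then y i j else 1)"
    unfolding mon_def by (intro prod.cong) (auto simp: sg_def)
  also have "\<dots> = y i j" using assms by (subst prod.delta) auto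
  finally show ?thesis .
qed

text \<open>Polynomial expressions in the entries of a matrix, kept as functions so that a relation
  between the entries of \<open>U\<close> can be evaluated at a constant multiple or at a twist of
  \<open>U\<close>. The set \<open>F\<close> restricts the coefficients, to have them fixed by a
  power of Frobenius.\<close>

inductive_set poly_funs :: "nat \<Rightarrow> 'k :: field set \<Rightarrow> ((nat \<Rightarrow> nat \<Rightarrow> 'k fps) \<Rightarrow> 'k fps) set" for d F where
  poly_funs_const: "(\<And>n. coeff p n \<in> F) \<Longrightarrow> (\<lambda>_. fps_of_poly p) \<in> poly_funs d F"
| poly_funs_var: "i < d \<Longrightarrow> j < d \<Longrightarrow> (\<lambda>y. y i j) \<in> poly_funs d F"
| poly_funs_add: "R \<in> poly_funs d F \<Longrightarrow> R' \<in> poly_funs d F \<Longrightarrow> (\<lambda>y. R y + R' y) \<in> poly_funs d F"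
| poly_funs_mult: "R \<in> poly_funs d F \<Longrightarrow> R' \<in> poly_funs d F \<Longrightarrow> (\<lambda>y. R y * R' y) \<in> poly_funs d F"

lemma poly_funs_const' [simp]: "(\<lambda>_. fps_of_poly p) \<in> poly_funs d UNIV"
  by (rule poly_funs_const) auto

lemma poly_funs_01 [simp]: "(\<lambda>_. 0) \<in> poly_funs d UNIV" "(\<lambda>_. 1) \<in> poly_funs d UNIV"
  using poly_funs_const'[of 0 d] poly_funs_const'[of 1 d] by simp_all

lemma poly_funs_diff: "R \<in> poly_funs d UNIV \<Longrightarrow> R' \<in> poly_funs d UNIV \<Longrightarrow> (\<lambda>y. R y - R' y) \<in> poly_funs d UNIV"
proof -
  assume "R \<in> poly_funs d UNIV" "R' \<in> poly_funs d UNIV"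
  then have "(\<lambda>y. R y + fps_of_poly (-1) * R' y) \<in> poly_funs d UNIV"
    by (intro poly_funs_add poly_funs_mult poly_funs_const')
  then show ?thesis by (simp add: fps_of_poly_uminus)
qed

lemma poly_funs_sum: "(\<And>x. x \<in> A \<Longrightarrow> R x \<in> poly_funs d UNIV) \<Longrightarrow> (\<lambda>y. \<Sum>x\<in>A. R x y) \<in> poly_funs d UNIV"
  by (induction A rule: infinite_finite_induct) (auto intro: poly_funs_add)

lemma poly_funs_prod: "(\<And>x. x \<in> A \<Longrightarrow> R x \<in> poly_funs d UNIV) \<Longrightarrow> (\<lambda>y. \<Prod>x\<in>A. R x y) \<in> poly_funs d UNIV"
  by (induction A rule: infinite_finite_induct) (auto intro: poly_funs_mult)

lemma poly_funs_power: "R \<in> poly_funs d UNIV \<Longrightarrow> (\<lambda>y. R y ^ n) \<in> poly_funs d UNIV"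
  by (induction n) (auto intro: poly_funs_mult)

lemma poly_funs_mon [simp]: "mon d e \<in> poly_funs d UNIV"
  unfolding mon_def [abs_def] by (intro poly_funs_prod poly_funs_power poly_funs_var) auto

lemma poly_funs_const_mult_mat:
  assumes "R \<in> poly_funs d UNIV"
  shows "(\<lambda>y. R (mat_mult d (map_mat fps_const c) y)) \<in> poly_funs d UNIV"
  using assms
proof (induction rule: poly_funs.induct)
  case (poly_funs_var i j)
  have "(\<lambda>y. \<Sum>k<d. fps_of_poly [:c i k:] * y k j) \<in> poly_funs d UNIV"
    using poly_funs_var by (intro poly_funs_sum poly_funs_mult poly_funs_const' poly_funs.poly_funs_var) auto
  also have "(\<lambda>y. \<Sum>k<d. fps_of_poly [:c i k:] * y k j) = (\<lambda>y. mat_mult d (map_mat fps_const c) y i j)"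
    using poly_funs_var by (auto simp: mat_mult_def map_mat_def fps_of_poly_const)
  finally show ?case .
qed (auto intro: poly_funs_add poly_funs_mult)

lemma poly_funs_mono: "R \<in> poly_funs d F \<Longrightarrow> F \<subseteq> F' \<Longrightarrow> R \<in> poly_funs d F'"
  by (induction rule: poly_funs.induct) (auto intro: poly_funs.intros)

section \<open>The finite-dimensional algebra generated by the entries of the limit\<close>

context frob_matrix
begin

abbreviation (input) mo where "mo e \<equiv> mon d e U"
abbreviation (input) fop :: "'k poly \<Rightarrow> 'k fps" where "fop \<equiv> fps_of_poly"

definition Expo :: "(nat \<times> nat \<Rightarrow> nat) set"
  where "Expo = {e. \<forall>x. (x \<in> {..<d} \<times> {..<d} \<longrightarrow> e x \<in> {..<q}) \<and> (x \<notin> {..<d} \<times> {..<d} \<longrightarrow> e x = 0)}"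

lemma finite_Expo: "finite Expo"
  unfolding Expo_def by (rule finite_set_of_finite_funs) auto

definition comb :: "(nat \<times> nat \<Rightarrow> nat) set \<Rightarrow> ((nat \<times> nat \<Rightarrow> nat) \<Rightarrow> 'k poly) \<Rightarrow> 'k fps"
  where "comb S a = (\<Sum>e\<in>S. fop (a e) * mo e)"

definition comb_span :: "(nat \<times> nat \<Rightarrow> nat) set \<Rightarrow> 'k fps set"
  where "comb_span S = range (comb S)"

lemma comb_add: "comb S a + comb S b = comb S (\<lambda>e. a e + b e)"
  by (simp add: comb_def fps_of_poly_add algebra_simps sum.distrib)

lemma comb_mult: "fop p * comb S a = comb S (\<lambda>e. p * a e)"
  by (simp add: comb_def fps_of_poly_mult sum_distrib_left mult.assoc)

lemma comb_span_add: "x \<in> comb_span S \<Longrightarrow> y \<in> comb_span S \<Longrightarrow> x + y \<in> comb_span S"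
  by (auto simp: comb_span_def comb_add)

lemma comb_span_mult: "x \<in> comb_span S \<Longrightarrow> fop p * x \<in> comb_span S"
  by (auto simp: comb_span_def comb_mult)

lemma comb_span_0: "0 \<in> comb_span S"
  unfolding comb_span_def by (rule image_eqI[of _ _ "\<lambda>_. 0"]) (auto simp: comb_def)

lemma comb_span_sum: "(\<And>x. x \<in> A \<Longrightarrow> f x \<in> comb_span S) \<Longrightarrow> (\<Sum>x\<in>A. f x) \<in> comb_span S"
  by (induction A rule: infinite_finite_induct) (auto intro: comb_span_add comb_span_0)

lemma comb_span_mon: 
  assumes "finite S" "e \<in> S" shows "mo e \<in> comb_span S"
proof -
  have "comb S (\<lambda>e'. if e' = e then 1 else 0) = (\<Sum>e'\<in>S. if e' = e then mo e else 0)"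
    unfolding comb_def by (intro sum.cong) auto
  also have "\<dots> = mo e" using assms by simp
  finally show ?thesis unfolding comb_span_def by (metis rangeI)
qed

lemma comb_span_power_mono: "fop (p ^ n) * x \<in> comb_span S \<Longrightarrow> n \<le> m \<Longrightarrow> fop (p ^ m) * x \<in> comb_span S"
  using comb_span_mult[of "fop (p ^ n) * x" S "p ^ (m - n)"]
  by (simp add: fps_of_poly_mult [symmetric] mult.assoc [symmetric] power_add [symmetric] del: fps_of_poly_mult)

text \<open>Replacing a factor \<open>U i j ^ q\<close> by a linear form through
  \<open>U_reduce\<close> lowers the total degree by q - 1, so the reduction ends with all exponents
  below q.\<close>

lemma mon_reduce: "\<exists>n. fop (\<Delta> ^ n) * mo e \<in> comb_span Expo"
proof (induction "\<Sum>x\<in>{..<d} \<times> {..<d}. e x" arbitrary: e rule: less_induct)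
  case less
  let ?I = "{..<d} \<times> {..<d}"
  show ?case
  proof (cases "\<forall>x\<in>?I. e x < q")
    case True
    define e' where "e' = (\<lambda>x. if x \<in> ?I then e x else 0)"
    have "e' \<in> Expo" using True by (auto simp: e'_def Expo_def)
    moreover have "mo e = mo e'" unfolding mon_def by (intro prod.cong) (auto simp: e'_def)
    ultimately have "mo e \<in> comb_span Expo" using comb_span_mon[OF finite_Expo] by simp
    then show ?thesis by (intro exI[of _ 0]) auto
  next
    case False
    then obtain i j where ij: "i < d" "j < d" "e (i, j) \<ge> q" by force
    define e' where "e' = (\<lambda>x. if x = (i, j) then e x - q else e x)"
    have e: "e = (\<lambda>x. sg (i, j) x * q + e' x)" using ij by (auto simp: e'_def sg_def fun_eq_iff)
    have mo_e: "mo e = U i j ^ q * mo e'"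
      by (subst e) (simp only: mon_add mon_mult_of_nat mon_sg[OF ij(1,2)])
    have sum_sg: "(\<Sum>x\<in>?I. sg (k, l) x) = 1" if "k < d" "l < d" for k l
      unfolding sg_def using that by (subst sum.delta) auto
    have sum_e: "(\<Sum>x\<in>?I. e x) = q + (\<Sum>x\<in>?I. e' x)"
      by (subst e) (simp add: sum.distrib sum_distrib_right [symmetric] sum_sg[OF ij(1,2)])
    have "\<exists>n. fop (\<Delta> ^ n) * mo (\<lambda>x. sg (k, j) x + e' x) \<in> comb_span Expo" if "k < d" for k
      using q_ge_2 ij that by (intro less) (simp add: sum_e sum.distrib sum_sg)
    then obtain n where n: "\<And>k. k < d \<Longrightarrow> fop (\<Delta> ^ n k) * mo (\<lambda>x. sg (k, j) x + e' x) \<in> comb_span Expo"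
      by metis
    define N where "N = (\<Sum>k<d. n k)"
    have "fop (\<Delta> ^ N) * mo (\<lambda>x. sg (k, j) x + e' x) \<in> comb_span Expo" if "k < d" for k
      using that unfolding N_def by (intro comb_span_power_mono[OF n] member_le_sum) auto
    then have "(\<Sum>k<d. fop (adj i k) * (fop (\<Delta> ^ N) * mo (\<lambda>x. sg (k, j) x + e' x))) \<in> comb_span Expo"
      by (intro comb_span_sum) (rule comb_span_mult, simp)
    also have "(\<Sum>k<d. fop (adj i k) * (fop (\<Delta> ^ N) * mo (\<lambda>x. sg (k, j) x + e' x))) =
      fop (\<Delta> ^ N) * (\<Sum>k<d. fop (adj i k) * U k j) * mo e'"
      using ij by (simp add: sum_distrib_left sum_distrib_right mon_add mon_sg algebra_simps)
    also have "\<dots> = fop (\<Delta> ^ Suc N) * mo e"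
      by (simp add: U_reduce[OF ij(1,2), symmetric] mo_e fps_of_poly_mult)
    finally show ?thesis by blast
  qed
qed

definition comb_indep :: "(nat \<times> nat \<Rightarrow> nat) set \<Rightarrow> bool"
  where "comb_indep S \<longleftrightarrow> (\<forall>a. comb S a = 0 \<longrightarrow> (\<forall>e\<in>S. a e = 0))"

text \<open>Maximality among the reduced monomials suffices for a K(X)-basis of the whole algebra,
  by \<open>mon_reduce\<close>. The monomial 1 is forced into the basis because later the coordinate
  at 1 is the one that recognises polynomials.\<close>

definition is_basis where
  "is_basis S \<longleftrightarrow> S \<subseteq> Expo \<and> (\<lambda>_. 0) \<in> S \<and> comb_indep S \<and> (\<forall>e\<in>Expo - S. \<not> comb_indep (insert e S))"

lemma ex_basis: "\<exists>S. is_basis S"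
proof -
  define \<A> where "\<A> = {S. S \<subseteq> Expo \<and> (\<lambda>_. 0) \<in> S \<and> comb_indep S}"
  have "finite \<A>" by (rule finite_subset[of _ "Pow Expo"]) (auto simp: \<A>_def finite_Expo)
  moreover have "{\<lambda>_. 0} \<in> \<A>" by (auto simp: \<A>_def Expo_def comb_indep_def comb_def)
  ultimately obtain S where S: "S \<in> \<A>" "\<And>T. T \<in> \<A> \<Longrightarrow> S \<subseteq> T \<Longrightarrow> S = T"
    using finite_has_maximal[of \<A>] by auto
  have "\<not> comb_indep (insert e S)" if "e \<in> Expo - S" for e
    using that S(1) S(2)[of "insert e S"] by (auto simp: \<A>_def)
  with S(1) have "is_basis S" unfolding is_basis_def by (auto simp: \<A>_def)
  then show ?thesis by blast
qed

definition S where "S = (SOME S. is_basis S)"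
definition D where "D = card S"

lemma S: "is_basis S"
  using someI_ex[OF ex_basis] by (simp add: S_def)

lemma S_sub: "S \<subseteq> Expo" and S_0: "(\<lambda>_. 0) \<in> S" and S_comb_indep: "comb_indep S"
  using S by (auto simp: is_basis_def)

lemma finite_S: "finite S"
  using S_sub finite_Expo finite_subset by blast

lemma D_pos: "D > 0"
  using S_0 finite_S by (auto simp: D_def card_gt_0_iff)

lemma comb_S_0: "comb S a = 0 \<Longrightarrow> e \<in> S \<Longrightarrow> a e = 0"
  using S_comb_indep by (auto simp: comb_indep_def)

lemma comb_span_Expo:
  assumes "e \<in> Expo"
  shows "\<exists>\<delta>. \<delta> \<noteq> 0 \<and> fop \<delta> * mo e \<in> comb_span S"
proof (cases "e \<in> S")
  case True
  then show ?thesis by (intro exI[of _ 1]) (auto simp: comb_span_mon finite_S)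
next
  case False
  then have "\<not> comb_indep (insert e S)" using S assms by (auto simp: is_basis_def)
  then obtain a e' where a: "comb (insert e S) a = 0" "e' \<in> insert e S" "a e' \<noteq> 0"
    unfolding comb_indep_def by blast
  have eq: "fop (a e) * mo e + comb S a = 0"
    using a(1) False finite_S by (simp add: comb_def)
  have "a e \<noteq> 0"
  proof
    assume "a e = 0"
    with eq have "comb S a = 0" by simp
    with a \<open>a e = 0\<close> show False using comb_S_0[of a] by auto
  qed
  moreover have "fop (a e) * mo e = fop (-1) * comb S a"
    using eq by (simp add: fps_of_poly_uminus eq_neg_iff_add_eq_0)
  then have "fop (a e) * mo e \<in> comb_span S" using comb_span_mult[of "comb S a" S "-1"] by (simp add: comb_span_def)
  ultimately show ?thesis by blast
qed

lemma comb_span_S_finite: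
  assumes "finite T"
  shows "\<exists>\<delta>. \<delta> \<noteq> 0 \<and> (\<forall>e\<in>T. fop \<delta> * mo e \<in> comb_span S)"
proof -
  obtain \<delta> where \<delta>: "\<And>e. e \<in> Expo \<Longrightarrow> \<delta> e \<noteq> 0" "\<And>e. e \<in> Expo \<Longrightarrow> fop (\<delta> e) * mo e \<in> comb_span S"
    using comb_span_Expo by metis
  define \<delta>1 where "\<delta>1 = (\<Prod>e\<in>Expo. \<delta> e)"
  have \<delta>1: "fop \<delta>1 * mo e \<in> comb_span S" if "e \<in> Expo" for e
  proof -
    have "fop (\<Prod>e\<in>Expo - {e}. \<delta> e) * (fop (\<delta> e) * mo e) \<in> comb_span S"
      using that by (intro comb_span_mult \<delta>)
    also have "fop (\<Prod>e\<in>Expo - {e}. \<delta> e) * (fop (\<delta> e) * mo e) = fop \<delta>1 * mo e"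
      unfolding \<delta>1_def using prod.remove[OF finite_Expo that, of \<delta>]
      by (simp add: fps_of_poly_mult [symmetric] mult.assoc [symmetric] mult.commute del: fps_of_poly_mult)
    finally show ?thesis .
  qed
  obtain n where n: "\<And>e. fop (\<Delta> ^ n e) * mo e \<in> comb_span Expo" using mon_reduce by metis
  define N where "N = (\<Sum>e\<in>T. n e)"
  have "fop (\<delta>1 * \<Delta> ^ N) * mo e \<in> comb_span S" if "e \<in> T" for e
  proof -
    have "fop (\<Delta> ^ N) * mo e \<in> comb_span Expo"
      unfolding N_def using that assms by (intro comb_span_power_mono[OF n] member_le_sum) auto
    then obtain a where a: "fop (\<Delta> ^ N) * mo e = comb Expo a" by (auto simp: comb_span_def)
    have "fop (\<delta>1 * \<Delta> ^ N) * mo e = fop \<delta>1 * comb Expo a"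
      by (simp add: a [symmetric] fps_of_poly_mult mult.assoc)
    also have "\<dots> = (\<Sum>e\<in>Expo. fop (a e) * (fop \<delta>1 * mo e))"
      by (simp add: comb_def sum_distrib_left mult_ac)
    also have "\<dots> \<in> comb_span S" by (intro comb_span_sum) (rule comb_span_mult, rule \<delta>1)
    finally show ?thesis .
  qed
  moreover have "\<delta>1 * \<Delta> ^ N \<noteq> 0" using \<delta>(1) finite_Expo \<Delta>_nz by (auto simp: \<delta>1_def)
  ultimately show ?thesis by blast
qed

text \<open>The multiplication table of the basis together with the entries of \<open>U\<close>
  themselves: a common denominator for these monomials, \<open>\<delta>0\<close>, controls the
  denominators in all of \<open>B\<close>.\<close>

definition T0 where "T0 = (\<lambda>(e, e') x. e x + e' x :: nat) ` (S \<times> S) \<union> sg ` ({..<d} \<times> {..<d})"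

lemma finite_T0: "finite T0"
  by (auto simp: T0_def finite_S)

definition \<delta>0 where "\<delta>0 = (SOME \<delta>. \<delta> \<noteq> 0 \<and> (\<forall>e\<in>T0. fop \<delta> * mo e \<in> comb_span S))"

lemma \<delta>0_nz: "\<delta>0 \<noteq> 0" and \<delta>0: "e \<in> T0 \<Longrightarrow> fop \<delta>0 * mo e \<in> comb_span S"
  using someI_ex[OF comb_span_S_finite[OF finite_T0]] by (auto simp: \<delta>0_def)

lemma \<delta>0_mult: "x \<in> comb_span S \<Longrightarrow> y \<in> comb_span S \<Longrightarrow> fop \<delta>0 * (x * y) \<in> comb_span S"
proof -
  assume "x \<in> comb_span S" "y \<in> comb_span S"
  then obtain a b where ab: "x = comb S a" "y = comb S b" by (auto simp: comb_span_def)
  have xy: "x * y = (\<Sum>e\<in>S. \<Sum>e'\<in>S. fop (a e * b e') * mo (\<lambda>x. e x + e' x))"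
    unfolding ab comb_def sum_product
    by (intro sum.cong refl) (simp add: mon_add fps_of_poly_mult mult_ac)
  have "fop \<delta>0 * (x * y) = (\<Sum>e\<in>S. \<Sum>e'\<in>S. fop (a e * b e') * (fop \<delta>0 * mo (\<lambda>x. e x + e' x)))"
    unfolding xy sum_distrib_left by (intro sum.cong refl) (simp only: mult_ac)
  also have "\<dots> \<in> comb_span S"
    by (intro comb_span_sum) (rule comb_span_mult, rule \<delta>0, auto simp: T0_def)
  finally show ?thesis .
qed

text \<open>The subring of K[[X]] generated by K[X] and the entries of \<open>U\<close>.\<close>

definition B where "B = (\<lambda>R. R U) ` poly_funs d UNIV"

lemma B_add: "x \<in> B \<Longrightarrow> y \<in> B \<Longrightarrow> x + y \<in> B"
  by (auto simp: B_def intro!: image_eqI[where f = "\<lambda>R. R U"] poly_funs_add)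

lemma B_mult: "x \<in> B \<Longrightarrow> y \<in> B \<Longrightarrow> x * y \<in> B"
  by (auto simp: B_def intro!: image_eqI[where f = "\<lambda>R. R U"] poly_funs_mult)

lemma B_const: "fop p \<in> B"
  unfolding B_def by (rule image_eqI[where f = "\<lambda>R. R U", OF _ poly_funs_const']) auto

lemma B_U: "U i j \<in> B"
proof (cases "i < d \<and> j < d")
  case True
  then show ?thesis unfolding B_def 
    by (intro image_eqI[where f = "\<lambda>R. R U" and x = "\<lambda>y. y i j"] poly_funs_var) auto
next
  case False
  then have "U i j = fop 0" using cmD[OF U_square_mats] by auto
  then show ?thesis using B_const by metis
qed

lemma B_0: "0 \<in> B" using B_const[of 0] by simp
lemma B_1: "1 \<in> B" using B_const[of 1] by simp

lemma B_sum: "(\<And>x. x \<in> A \<Longrightarrow> f x \<in> B) \<Longrightarrow> (\<Sum>x\<in>A. f x) \<in> B"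
  by (induction A rule: infinite_finite_induct) (auto intro: B_add B_0)

lemma B_power: "x \<in> B \<Longrightarrow> x ^ n \<in> B"
  by (induction n) (auto intro: B_mult B_1)

lemma B_mon: "mo e \<in> B"
  unfolding B_def using poly_funs_mon by blast

lemma B_comb: "comb T a \<in> B"
  unfolding comb_def by (intro B_sum B_mult B_const B_mon)

lemma B_comb_span: "z \<in> B \<Longrightarrow> \<exists>n. fop (\<delta>0 ^ n) * z \<in> comb_span S"
proof -
  have "\<exists>n. fop (\<delta>0 ^ n) * R U \<in> comb_span S" if "R \<in> poly_funs d UNIV" for R
    using that
  proof (induction rule: poly_funs.induct)
    case (poly_funs_const p)
    have "fop p * mo (\<lambda>_. 0) \<in> comb_span S" by (intro comb_span_mult comb_span_mon finite_S S_0)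
    then show ?case by (intro exI[of _ 0]) auto
  next
    case (poly_funs_var i j)
    then have "fop \<delta>0 * mo (sg (i, j)) \<in> comb_span S" by (intro \<delta>0) (auto simp: T0_def)
    then show ?case using poly_funs_var by (intro exI[of _ 1]) (auto simp: mon_sg)
  next
    case (poly_funs_add R R')
    then obtain n n' where n: "fop (\<delta>0 ^ n) * R U \<in> comb_span S" "fop (\<delta>0 ^ n') * R' U \<in> comb_span S" by blast
    have "fop (\<delta>0 ^ (n + n')) * R U \<in> comb_span S" "fop (\<delta>0 ^ (n + n')) * R' U \<in> comb_span S"
      by (auto intro: comb_span_power_mono[OF n(1)] comb_span_power_mono[OF n(2)])
    from comb_span_add[OF this] show ?case by (auto simp: algebra_simps)
  next
    case (poly_funs_mult R R')
    then obtain n n' where n: "fop (\<delta>0 ^ n) * R U \<in> comb_span S" "fop (\<delta>0 ^ n') * R' U \<in> comb_span S" by blast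
    from \<delta>0_mult[OF this] have "fop (\<delta>0 ^ (Suc (n + n'))) * (R U * R' U) \<in> comb_span S"
      by (simp add: fps_of_poly_mult power_add mult_ac)
    then show ?case by blast
  qed
  then show "z \<in> B \<Longrightarrow> ?thesis" by (auto simp: B_def)
qed

end

lemma ring_hom_fun_fps_const: "ring_hom_fun fps_const"
  by (auto simp: ring_hom_fun_def)

section \<open>Polynomial multiples of small combinations, and the constant matrices preserving all
  relations\<close>

context frob_matrix
begin

text \<open>
  If a combination \<open>\<theta>\<close> of small degree does not vanish, then one of its multiples is a
  nonzero polynomial of small degree, so that \<open>\<theta>\<close> cannot vanish to high order.
\<close>

lemma comb_multiple_eq_poly:
  "\<exists>\<kappa>. \<forall>A a. (\<forall>e\<in>S. \<forall>n\<ge>A. coeff (a e) n = 0) \<longrightarrow> comb S a \<noteq> 0 \<longrightarrow>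
     (\<exists>b f. f \<noteq> 0 \<and> degree f \<le> D * (A + \<kappa>) \<and> comb S a * (fop \<delta>0 * comb S b) = fop f)"
proof -
  have "\<exists>s. fop \<delta>0 * mo (\<lambda>x. fst p x + snd p x) = comb S s" if "p \<in> S \<times> S" for p
  proof -
    have "(\<lambda>x. fst p x + snd p x) \<in> T0"
      unfolding T0_def using that by (intro UnI1 image_eqI[of _ _ p]) (auto simp: split_beta)
    from \<delta>0[OF this] show ?thesis by (auto simp: comb_span_def)
  qed
  then have "\<exists>s. \<forall>p\<in>S \<times> S. fop \<delta>0 * mo (\<lambda>x. fst p x + snd p x) = comb S (s p)"
    by (intro bchoice) blast
  then obtain s where s: "\<And>p. p \<in> S \<times> S \<Longrightarrow> fop \<delta>0 * mo (\<lambda>x. fst p x + snd p x) = comb S (s p)"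
    by blast
  \<comment> \<open>\<open>\<kappa>\<close> exceeds every degree in the multiplication table, so its
    entries add less than \<open>\<kappa>\<close> to the degrees in a product.\<close>
  define \<kappa> where "\<kappa> = Suc (\<Sum>p\<in>S \<times> S. \<Sum>e\<in>S. degree (s p e))"
  have \<kappa>: "coeff (s (e, e') e'') n = 0" if "e \<in> S" "e' \<in> S" "e'' \<in> S" "n \<ge> \<kappa>" for e e' e'' n
  proof (rule coeff_eq_0)
    have "degree (s (e, e') e'') \<le> (\<Sum>x\<in>S. degree (s (e, e') x))"
      using member_le_sum[of e'' S "\<lambda>x. degree (s (e, e') x)"] that finite_S by simp
    also have "\<dots> \<le> (\<Sum>p\<in>S \<times> S. \<Sum>e\<in>S. degree (s p e))"
      using member_le_sum[of "(e, e')" "S \<times> S" "\<lambda>p. \<Sum>e\<in>S. degree (s p e)"] that finite_S by simp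
    finally show "degree (s (e, e') e'') < n" using that by (simp add: \<kappa>_def)
  qed
  show ?thesis
  proof (rule exI[of _ \<kappa>], intro allI impI)
    fix A a
    assume a: "\<forall>e\<in>S. \<forall>n\<ge>A. coeff (a e) n = 0" and nz: "comb S a \<noteq> 0"
    \<comment> \<open>The least length for which the D L unknown coefficients of b outnumber the (D
      - 1)(A + L + \<kappa>) equations that kill every coordinate of the product except the one at
      1.\<close>
    define L where "L = (D - 1) * (A + \<kappa>) + 1"
    define z0 where "z0 = (\<lambda>_ :: nat \<times> nat. 0 :: nat)"
    define G where "G = (\<lambda>e'' (e', i). \<Sum>e\<in>S. a e * monom 1 i * s (e, e') e'')"
    have "card ((S - {z0}) \<times> {..<A + L + \<kappa>}) = (D - 1) * (A + L + \<kappa>)"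
      using S_0 finite_S by (simp add: card_cartesian_product D_def z0_def)
    also have "\<dots> < card (S \<times> {..<L})"
    proof -
      obtain D' where D': "D = Suc D'" using D_pos by (cases D) auto
      then show ?thesis by (simp add: card_cartesian_product L_def D_def [symmetric] algebra_simps)
    qed
    finally obtain c where c: "\<exists>v\<in>S \<times> {..<L}. c v \<noteq> 0"
      "\<And>e'' n. e'' \<in> S - {z0} \<Longrightarrow> n < A + L + \<kappa> \<Longrightarrow> (\<Sum>v\<in>S \<times> {..<L}. c v * coeff (G e'' v) n) = 0"
      using homogeneous_solution[of "(S - {z0}) \<times> {..<A + L + \<kappa>}" "S \<times> {..<L}" "\<lambda>(e'', n) v. coeff (G e'' v) n"]
        finite_S by (auto 4 4)
    define b where "b = (\<lambda>e'. \<Sum>i<L. monom (c (e', i)) i)"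
    define F where "F = (\<lambda>e''. \<Sum>e\<in>S. \<Sum>e'\<in>S. a e * b e' * s (e, e') e'')"
    have F_G: "F e'' = (\<Sum>v\<in>S \<times> {..<L}. [:c v:] * G e'' v)" for e''
    proof -
      have "F e'' = (\<Sum>e'\<in>S. \<Sum>e\<in>S. \<Sum>i<L. a e * monom (c (e', i)) i * s (e, e') e'')"
        unfolding F_def by (subst sum.swap) (simp add: b_def sum_distrib_left sum_distrib_right)
      also have "\<dots> = (\<Sum>e'\<in>S. \<Sum>i<L. \<Sum>e\<in>S. a e * monom (c (e', i)) i * s (e, e') e'')"
        by (intro sum.cong refl) (rule sum.swap)
      also have "\<dots> = (\<Sum>e'\<in>S. \<Sum>i<L. [:c (e', i):] * G e'' (e', i))"
      proof (intro sum.cong refl)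
        fix e' i
        have m: "monom (c (e', i)) i = smult (c (e', i)) (monom 1 i)" by (simp add: smult_monom)
        show "(\<Sum>e\<in>S. a e * monom (c (e', i)) i * s (e, e') e'') = [:c (e', i):] * G e'' (e', i)"
          unfolding m G_def prod.case sum_distrib_left by (intro sum.cong) auto
      qed
      finally show ?thesis by (simp add: sum.cartesian_product split_beta)
    qed
    have coeff_F: "coeff (F e'') n = (\<Sum>v\<in>S \<times> {..<L}. c v * coeff (G e'' v) n)" for e'' n
      by (simp add: F_G coeff_sum)
    have big: "coeff (G e'' v) n = 0" if "e'' \<in> S" "n \<ge> A + L + \<kappa>" and vS: "v \<in> S \<times> {..<L}" for e'' v n
    proof -
      obtain e' i where v: "v = (e', i)" "e' \<in> S" "i < L" using vS by auto
      have "coeff (a e * monom 1 i * s (e, e') e'') n = 0" if e: "e \<in> S" for e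
      proof -
        have "coeff (a e * monom 1 i) k * coeff (s (e, e') e'') (n - k) = 0" if "k \<le> n" for k
        proof (cases "k \<ge> A + L")
          case True
          then have "coeff (a e * monom 1 i) k = 0" 
            using a e v by (subst mult.commute) (simp add: coeff_monom_mult)
          then show ?thesis by simp
        next
          case False
          then show ?thesis using \<kappa>[OF e v(2) \<open>e'' \<in> S\<close>, of "n - k"] \<open>n \<ge> A + L + \<kappa>\<close> by auto
        qed
        then show ?thesis by (subst coeff_mult) (intro sum.neutral, auto)
      qed
      then show ?thesis by (simp add: G_def v coeff_sum)
    qed
    have F0: "F e'' = 0" if "e'' \<in> S" "e'' \<noteq> z0" for e''
    proof (rule poly_eqI)
      fix n show "coeff (F e'') n = coeff 0 n"
        using c(2)[of e'' n] big[of e'' n] that by (cases "n < A + L + \<kappa>") (auto simp: coeff_F)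
    qed
    have ab: "comb S a * comb S b * fop \<delta>0 = fop (F z0)"
    proof -
      have "comb S a * comb S b = (\<Sum>e\<in>S. \<Sum>e'\<in>S. fop (a e * b e') * mo (\<lambda>x. e x + e' x))"
        unfolding comb_def sum_product
        by (intro sum.cong refl) (simp add: mon_add fps_of_poly_mult mult_ac)
      then have "comb S a * comb S b * fop \<delta>0 = 
          (\<Sum>e\<in>S. \<Sum>e'\<in>S. fop (a e * b e') * mo (\<lambda>x. e x + e' x)) * fop \<delta>0" by simp
      also have "\<dots> = (\<Sum>e\<in>S. \<Sum>e'\<in>S. fop (a e * b e') * (fop \<delta>0 * mo (\<lambda>x. e x + e' x)))"
        unfolding sum_distrib_right by (intro sum.cong refl) (simp only: mult_ac)
      also have "\<dots> = (\<Sum>e\<in>S. \<Sum>e'\<in>S. fop (a e * b e') * (\<Sum>e''\<in>S. fop (s (e, e') e'') * mo e''))"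
      proof (intro sum.cong refl arg_cong2[where f = "(*)"])
        fix e e' assume "e \<in> S" "e' \<in> S"
        then show "fop \<delta>0 * mo (\<lambda>x. e x + e' x) = (\<Sum>e''\<in>S. fop (s (e, e') e'') * mo e'')"
          using s[of "(e, e')"] by (simp add: comb_def)
      qed
      also have "\<dots> = (\<Sum>e\<in>S. \<Sum>e'\<in>S. \<Sum>e''\<in>S. fop (a e * b e' * s (e, e') e'') * mo e'')"
        by (simp add: sum_distrib_left fps_of_poly_mult mult.assoc)
      also have "\<dots> = (\<Sum>e''\<in>S. \<Sum>e\<in>S. \<Sum>e'\<in>S. fop (a e * b e' * s (e, e') e'') * mo e'')"
        by (rule trans[OF sum.cong[OF refl sum.swap] sum.swap])
      also have "\<dots> = comb S F"
        unfolding comb_def F_def fps_of_poly_sum sum_distrib_right ..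
      also have "\<dots> = fop (F z0) * mo z0"
        unfolding comb_def using S_0 finite_S F0
        by (subst sum.remove[of _ z0]) (auto simp: z0_def intro!: sum.neutral)
      finally show ?thesis by (simp add: z0_def)
    qed
    have "comb S b \<noteq> 0"
    proof
      assume "comb S b = 0"
      then have b0: "b e = 0" if "e \<in> S" for e using comb_S_0 that by blast
      from c(1) obtain e i where ei: "e \<in> S" "i < L" "c (e, i) \<noteq> 0" by auto
      have "coeff (b e) i = (\<Sum>i'<L. if i' = i then c (e, i') else 0)"
        by (simp add: b_def coeff_sum)
      also have "\<dots> = c (e, i)" using ei by simp
      finally show False using b0 ei by simp
    qed
    with nz \<delta>0_nz have "fop (F z0) \<noteq> 0" by (subst ab [symmetric]) simp
    then have "F z0 \<noteq> 0" by simp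
    moreover have "degree (F z0) \<le> D * (A + \<kappa>)"
    proof (rule degree_le, intro allI impI)
      fix n assume n: "D * (A + \<kappa>) < n"
      have "D * (A + \<kappa>) + 1 = A + L + \<kappa>" using D_pos by (cases D) (auto simp: L_def)
      with n have "n \<ge> A + L + \<kappa>" by linarith
      then show "coeff (F z0) n = 0" using big S_0 by (auto simp: coeff_F z0_def intro!: sum.neutral)
    qed
    moreover have "comb S a * (fop \<delta>0 * comb S b) = fop (F z0)" using ab by (simp add: mult_ac)
    ultimately show "\<exists>b f. f \<noteq> 0 \<and> degree f \<le> D * (A + \<kappa>) \<and> comb S a * (fop \<delta>0 * comb S b) = fop f"
      by blast
  qed
qed

abbreviation (input) cU :: "(nat \<Rightarrow> nat \<Rightarrow> 'k) \<Rightarrow> nat \<Rightarrow> nat \<Rightarrow> 'k fps"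
  where "cU c \<equiv> mat_mult d (map_mat fps_const c) U"

lemma cU_0:
  assumes "c \<in> square_mats d"
  shows "fps_nth (cU c i j) 0 = c i j"
proof (cases "i < d \<and> j < d")
  case True
  then have "fps_nth (cU c i j) 0 = (\<Sum>k<d. c i k * id_mat d k j)"
    by (simp add: mat_mult_def map_mat_def fps_sum_nth U_0)
  also have "\<dots> = mat_mult d c (id_mat d) i j" using True by (simp add: mat_mult_def)
  finally show ?thesis by (simp add: mat_mult_id_mat_right assms)
next
  case False
  then show ?thesis using cmD[OF assms False] by (auto simp: mat_mult_def)
qed

text \<open>Each c in \<open>H\<close> induces a K(X)-linear ring homomorphism u -> cu, and distinct
  homomorphisms are linearly independent (Dedekind), while a linear map on the algebra is determined
  by its \<open>D\<close> values on the basis.\<close>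

lemma card_le_D:
  assumes "finite H" "H \<subseteq> square_mats d" 
    and H: "\<And>c R. c \<in> H \<Longrightarrow> R \<in> poly_funs d UNIV \<Longrightarrow> R U = 0 \<Longrightarrow> R (cU c) = 0"
  shows "card H \<le> D"
proof (rule ccontr)
  assume "\<not> ?thesis"
  then have "card S < card H" by (simp add: D_def)
  then obtain \<omega> where \<omega>: "\<exists>c\<in>H. \<omega> c \<noteq> 0" 
    "\<And>e. e \<in> S \<Longrightarrow> (\<Sum>c\<in>H. \<omega> c * mon d e (cU c)) = 0"
    using homogeneous_solution[of S H "\<lambda>e c. mon d e (cU c)"] finite_S assms(1) by blast
  have all: "(\<Sum>c\<in>H. \<omega> c * mon d e (cU c)) = 0" for e
  proof -
    obtain \<delta> where \<delta>: "\<delta> \<noteq> 0" "fop \<delta> * mo e \<in> comb_span S" using comb_span_S_finite[of "{e}"] by auto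
    then obtain a where a: "fop \<delta> * mo e = comb S a" by (auto simp: comb_span_def)
    \<comment> \<open>The expression of a multiple of a monomial in the basis is itself a relation
      of \<open>U\<close>. It persists for every c in \<open>H\<close>, so the dependence spreads
      from the basis to all monomials.\<close>
    define R where "R = (\<lambda>y. fop \<delta> * mon d e y - (\<Sum>e\<in>S. fop (a e) * mon d e y))"
    have "R \<in> poly_funs d UNIV"
      unfolding R_def by (intro poly_funs_diff poly_funs_sum poly_funs_mult poly_funs_const' poly_funs_mon)
    moreover have "R U = 0" using a by (simp add: R_def comb_def)
    ultimately have R: "R (cU c) = 0" if "c \<in> H" for c using H that by blast
    have "fop \<delta> * (\<Sum>c\<in>H. \<omega> c * mon d e (cU c)) = (\<Sum>c\<in>H. \<omega> c * (\<Sum>e\<in>S. fop (a e) * mon d e (cU c)))"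
    proof -
      have "fop \<delta> * (\<Sum>c\<in>H. \<omega> c * mon d e (cU c)) = (\<Sum>c\<in>H. \<omega> c * (fop \<delta> * mon d e (cU c)))"
        by (simp add: sum_distrib_left mult_ac)
      also have "\<dots> = (\<Sum>c\<in>H. \<omega> c * (\<Sum>e\<in>S. fop (a e) * mon d e (cU c)))"
        using R by (intro sum.cong) (auto simp: R_def)
      finally show ?thesis .
    qed
    also have "\<dots> = (\<Sum>e\<in>S. fop (a e) * (\<Sum>c\<in>H. \<omega> c * mon d e (cU c)))"
      unfolding sum_distrib_left by (subst sum.swap) (simp add: mult_ac)
    also have "\<dots> = 0" by (simp add: \<omega>(2))
    finally show ?thesis using \<delta> by simp
  qed
  from \<omega>(1) obtain c0 where c0: "c0 \<in> H" "\<omega> c0 \<noteq> 0" by blast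
  have "\<exists>x. fst x < d \<and> snd x < d \<and> cU c (fst x) (snd x) \<noteq> cU c0 (fst x) (snd x)" if "c \<in> H - {c0}" for c
  proof -
    have "c \<noteq> c0" "c \<in> square_mats d" "c0 \<in> square_mats d" using that c0 assms(2) by auto
    then obtain i j where "i < d" "j < d" "c i j \<noteq> c0 i j" using square_mats_eqI by blast
    then show ?thesis using cU_0[OF \<open>c \<in> square_mats d\<close>, of i j] cU_0[OF \<open>c0 \<in> square_mats d\<close>, of i j]
      by (intro exI[of _ "(i, j)"]) auto
  qed
  then obtain x where x: "\<And>c. c \<in> H - {c0} \<Longrightarrow> fst (x c) < d \<and> snd (x c) < d \<and> 
      cU c (fst (x c)) (snd (x c)) \<noteq> cU c0 (fst (x c)) (snd (x c))"
    by metis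
  \<comment> \<open>The factor for c' kills the term of c' and keeps that of \<open>c0\<close>.
    Multiplying by it means multiplying by one more entry and subtracting a fixed series times the
    old sum, so the dependence for all monomials survives.\<close>
  define fac where "fac = (\<lambda>c' c. cU c (fst (x c')) (snd (x c')) - cU c' (fst (x c')) (snd (x c')))"
  have fac_eq: "fac c' c = cU c (fst (x c')) (snd (x c')) - cU c' (fst (x c')) (snd (x c'))" for c' c
    by (simp add: fac_def)
  have fac: "(\<Sum>c\<in>H. \<omega> c * (\<Prod>c'\<in>T. fac c' c) * mon d e (cU c)) = 0" if "T \<subseteq> H - {c0}" for T e
  proof -
    have "finite T" using that assms(1) finite_subset by blast
    from this that show ?thesis
    proof (induction T arbitrary: e rule: finite_induct)
      case empty
      then show ?case using all by simp
    next
      case (insert c' T)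
      define e' where "e' = (\<lambda>z. sg (x c') z + e z)"
      have e': "mon d e' (cU c) = cU c (fst (x c')) (snd (x c')) * mon d e (cU c)" for c
        using x[of c'] insert.prems unfolding e'_def mon_add 
        by (cases "x c'") (simp add: mon_sg)
      have "(\<Sum>c\<in>H. \<omega> c * (\<Prod>c'\<in>insert c' T. fac c' c) * mon d e (cU c)) = 
        (\<Sum>c\<in>H. \<omega> c * (\<Prod>c'\<in>T. fac c' c) * mon d e' (cU c)) -
        cU c' (fst (x c')) (snd (x c')) * (\<Sum>c\<in>H. \<omega> c * (\<Prod>c'\<in>T. fac c' c) * mon d e (cU c))"
        using insert.hyps unfolding e'
        by (simp add: fac_eq[of c'] sum_distrib_left sum_subtractf [symmetric] algebra_simps)
      also have "\<dots> = 0" using insert by simp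
      finally show ?case .
    qed
  qed
  from fac[of "H - {c0}" "\<lambda>_. 0"] 
  have "(\<Sum>c\<in>H. \<omega> c * (\<Prod>c'\<in>H - {c0}. fac c' c)) = 0" by simp
  also have "(\<Sum>c\<in>H. \<omega> c * (\<Prod>c'\<in>H - {c0}. fac c' c)) = (\<Sum>c\<in>{c0}. \<omega> c * (\<Prod>c'\<in>H - {c0}. fac c' c))"
  proof (intro sum.mono_neutral_right ballI)
    fix c assume "c \<in> H - {c0}"
    moreover have "fac c c = 0" by (simp add: fac_def)
    ultimately show "\<omega> c * (\<Prod>c'\<in>H - {c0}. fac c' c) = 0"
      using assms(1) by auto
  qed (use assms c0 in auto)
  finally have "(\<Prod>c'\<in>H - {c0}. fac c' c0) = 0" using c0 by simp
  then obtain c' where "c' \<in> H - {c0}" "fac c' c0 = 0" using assms(1) by auto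
  then show False using x[of c'] by (auto simp: fac_def)
qed

lemma pow_q_mult: "(z :: 'k) ^ (q ^ N) = z \<Longrightarrow> z ^ (q ^ (N * k)) = z"
  by (induction k) (auto simp: power_add power_mult)

text \<open>Only finitely many coefficients occur, and each lies in a finite field by
  \<open>algebraic\<close>. A relation then commutes with the q^r-th power map once r is a multiple
  of N.\<close>

lemma poly_funs_finite_field:
  assumes "R \<in> poly_funs d (UNIV :: 'k set)"
  shows "\<exists>N>0. R \<in> poly_funs d {z. z ^ (q ^ N) = z}"
  using assms
proof (induction rule: poly_funs.induct)
  case (poly_funs_const p)
  obtain N where N: "\<And>z :: 'k. N z > 0 \<and> z ^ (q ^ N z) = z" using algebraic by metis
  define M where "M = (\<Prod>n\<le>degree p. N (coeff p n))"
  have "coeff p n ^ (q ^ M) = coeff p n" for n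
  proof (cases "n \<le> degree p")
    case True
    then have "M = N (coeff p n) * (\<Prod>n\<in>{..degree p} - {n}. N (coeff p n))"
      unfolding M_def by (intro prod.remove) auto
    then show ?thesis using N pow_q_mult by metis
  next
    case False
    then have "coeff p n = 0" by (simp add: coeff_eq_0)
    then show ?thesis by (simp add: power_0_left)
  qed
  moreover have "M > 0" using N by (auto simp: M_def)
  ultimately show ?case using poly_funs.poly_funs_const[of p "{z. z ^ (q ^ M) = z}"] by auto
next
  case (poly_funs_var i j)
  then show ?case using poly_funs.poly_funs_var by blast
next
  case (poly_funs_add R R')
  then obtain N N' where N: "N > 0" "R \<in> poly_funs d {z. z ^ (q ^ N) = z}" "N' > 0" "R' \<in> poly_funs d {z. z ^ (q ^ N') = z}"
    by blast
  have "R \<in> poly_funs d {z. z ^ (q ^ (N * N')) = z}" 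
    by (rule poly_funs_mono[OF N(2)]) (use pow_q_mult in auto)
  moreover have "R' \<in> poly_funs d {z. z ^ (q ^ (N * N')) = z}" 
    by (rule poly_funs_mono[OF N(4)]) (use pow_q_mult[of _ N' N] in \<open>auto simp: mult.commute\<close>)
  ultimately show ?case using N poly_funs.poly_funs_add by (intro exI[of _ "N * N'"]) auto
next
  case (poly_funs_mult R R')
  then obtain N N' where N: "N > 0" "R \<in> poly_funs d {z. z ^ (q ^ N) = z}" "N' > 0" "R' \<in> poly_funs d {z. z ^ (q ^ N') = z}"
    by blast
  have "R \<in> poly_funs d {z. z ^ (q ^ (N * N')) = z}" 
    by (rule poly_funs_mono[OF N(2)]) (use pow_q_mult in auto)
  moreover have "R' \<in> poly_funs d {z. z ^ (q ^ (N * N')) = z}" 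
    by (rule poly_funs_mono[OF N(4)]) (use pow_q_mult[of _ N' N] in \<open>auto simp: mult.commute\<close>)
  ultimately show ?case using N poly_funs.poly_funs_mult by (intro exI[of _ "N * N'"]) auto
qed

abbreviation (input) cls :: "nat \<Rightarrow> 'k \<Rightarrow> nat \<Rightarrow> nat \<Rightarrow> 'k"
  where "cls r x \<equiv> map_mat (\<lambda>p. poly p x) (W r)"

text \<open>
  If \<open>u \<mapsto> c'u\<close> does not preserve the relation \<open>R\<close>, then some multiple of \<open>R (c'u)\<close> is a
  nonzero polynomial \<open>f\<close>. At a point whose Frobenius acts as \<open>c'\<close> the relation \<open>R\<close> is transported
  to \<open>R (c'u)\<close> modulo the point, so that \<open>f\<close> vanishes there.
\<close>

lemma few_points_outside_stabilizer:
  assumes c: "c \<in> square_mats d" "mat_mult d c' c = id_mat d" 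
    and R: "R \<in> poly_funs d UNIV" "R U = 0" "R (cU c') \<noteq> 0"
  shows "\<exists>f N. f \<noteq> 0 \<and> N > 0 \<and> 
    (\<forall>r x. N dvd r \<longrightarrow> x ^ (q ^ r) = x \<longrightarrow> cls r x = c \<longrightarrow> poly f x = 0)"
proof -
  obtain N where N: "N > 0" "R \<in> poly_funs d {z. z ^ (q ^ N) = z}" using poly_funs_finite_field[OF R(1)] by blast
  define \<theta> where "\<theta> = R (cU c')"
  have "\<theta> \<in> B" unfolding \<theta>_def B_def using poly_funs_const_mult_mat[OF R(1), of c'] by (intro image_eqI) auto
  then obtain n where "fop (\<delta>0 ^ n) * \<theta> \<in> comb_span S" using B_comb_span by blast
  then obtain a where a: "fop (\<delta>0 ^ n) * \<theta> = comb S a" by (auto simp: comb_span_def)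
  have "comb S a \<noteq> 0" using a R(3) \<delta>0_nz unfolding \<theta>_def
    by (metis fps_of_poly_0 fps_of_poly_eq_iff mult_eq_0_iff power_not_zero)
  obtain \<kappa> where \<kappa>: "\<forall>A a. (\<forall>e\<in>S. \<forall>n\<ge>A. coeff (a e) n = 0) \<longrightarrow> comb S a \<noteq> 0 \<longrightarrow>
     (\<exists>b f. f \<noteq> 0 \<and> degree f \<le> D * (A + \<kappa>) \<and> comb S a * (fop \<delta>0 * comb S b) = fop f)"
    using comb_multiple_eq_poly by blast
  define A where "A = Suc (\<Sum>e\<in>S. degree (a e))"
  have "coeff (a e) n = 0" if "e \<in> S" "n \<ge> A" for e n
  proof (rule coeff_eq_0)
    have "degree (a e) \<le> (\<Sum>e\<in>S. degree (a e))"
      using member_le_sum[of e S "\<lambda>e. degree (a e)"] that finite_S by simp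
    then show "degree (a e) < n" using that by (simp add: A_def)
  qed
  with \<kappa> \<open>comb S a \<noteq> 0\<close> obtain b f where f: "f \<noteq> 0" "comb S a * (fop \<delta>0 * comb S b) = fop f"
    by blast
  define h where "h = fop (\<delta>0 ^ n) * (fop \<delta>0 * comb S b)"
  have h: "h \<in> B" unfolding h_def by (intro B_mult B_const B_comb)
  have "\<theta> * h = (fop (\<delta>0 ^ n) * \<theta>) * (fop \<delta>0 * comb S b)" by (simp only: h_def mult_ac)
  then have \<theta>h: "\<theta> * h = fop f" unfolding a f(2) .
  have B_fps_const: "fps_const z \<in> B" for z
    using B_const[of "[:z:]"] by (simp add: fps_of_poly_const)
  have "poly (\<delta>0 * f) x = 0" if x: "N dvd r" "x ^ (q ^ r) = x" "cls r x = c" for r x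
  proof -
    define l where "l = [:-x, 1:]"
    define Q where "Q = q ^ r"
    \<comment> \<open>The ideal generated by X - x is taken in \<open>B\<close>: in K[[X]] itself X
      - x is a unit unless x = 0.\<close>
    define J where "J = (\<lambda>z. fop l * z) ` B"
    have J_add: "u + v \<in> J" if "u \<in> J" "v \<in> J" for u v
      using that by (auto simp: J_def distrib_left [symmetric] intro!: imageI B_add)
    have J_mult: "u * v \<in> J" if "u \<in> J" "v \<in> B" for u v
      using that by (auto simp: J_def mult.assoc intro!: imageI B_mult)
    have J_mult': "v * u \<in> J" if "u \<in> J" "v \<in> B" for u v
      using J_mult[OF that] by (simp add: mult.commute)
    have J_0: "0 \<in> J" unfolding J_def by (rule image_eqI[of _ _ 0]) (auto simp: B_0)
    have J_minus: "- u \<in> J" if "u \<in> J" for u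
      using J_mult[OF that B_const[of "-1"]] by (simp add: fps_of_poly_uminus)
    have J_diff: "u - v \<in> J" if "u \<in> J" "v \<in> J" for u v
      using J_add[OF that(1) J_minus[OF that(2)]] by simp
    have J_sum: "(\<Sum>x\<in>T. g x) \<in> J" if "\<And>x. x \<in> T \<Longrightarrow> g x \<in> J" for T :: "nat set" and g
      using that by (induction T rule: infinite_finite_induct) (auto intro: J_add J_0)
    have J_poly: "fop p \<in> J" if "poly p x = 0" for p
    proof -
      from that have "l dvd p" by (simp add: l_def poly_eq_0_iff_dvd)
      then show ?thesis by (auto simp: J_def fps_of_poly_mult intro!: imageI B_const)
    qed
    have UQ: "twist Q U i j \<in> B" for i j by (simp add: twist_def B_power B_U)
    have cUB: "cU c' i j \<in> B" for i j
      by (auto simp: mat_mult_def map_mat_def B_0 intro!: B_sum B_mult B_fps_const B_U)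
    have J_mat_mult: "mat_mult d (map_mat fps_const M) V i j \<in> J" if "\<And>i j. V i j \<in> J" for M V i j
      using that B_fps_const by (auto simp: mat_mult_def map_mat_def J_0 intro!: J_sum J_mult')
    \<comment> \<open>Modulo X - x the matrix \<open>W r\<close> becomes c, so \<open>U_eq\<close>
      says that c'U is the twist of \<open>U\<close> by Q.\<close>
    have diff: "cU c' i j - twist Q U i j \<in> J" for i j
    proof -
      have 1: "U = mat_mult d (map_mat fop (W r)) (twist Q U)" unfolding Q_def by (rule U_eq)
      have cc: "mat_mult d (map_mat fps_const c') (map_mat fps_const c) = id_mat d"
        using arg_cong[OF c(2), of "map_mat fps_const"]
        by (simp add: map_mat_mat_mult[OF ring_hom_fun_fps_const] map_mat_id_mat[OF ring_hom_fun_fps_const])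
      have 2: "mat_mult d (map_mat fps_const c') (mat_mult d (map_mat fps_const c) (twist Q U)) = twist Q U"
        unfolding mat_mult_assoc[symmetric] cc by (rule mat_mult_id_mat_left) (simp add: twist_in_square_mats Q_def)
      have "cU c' i j - twist Q U i j = mat_mult d (map_mat fps_const c') (\<lambda>i j. mat_mult d (\<lambda>i j. map_mat fop (W r) i j - map_mat fps_const c i j) (twist Q U) i j) i j"
      proof -
        have "cU c' i j = mat_mult d (map_mat fps_const c') (mat_mult d (map_mat fop (W r)) (twist Q U)) i j"
          using 1 by simp
        moreover have "twist Q U i j = mat_mult d (map_mat fps_const c') (mat_mult d (map_mat fps_const c) (twist Q U)) i j"
          using 2 by simp
        ultimately show ?thesis unfolding mat_mult_diff_left mat_mult_diff_right by (simp only:)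
      qed
      also have "\<dots> \<in> J"
      proof -
        have "map_mat fop (W r) i j - map_mat fps_const c i j = fop (W r i j - [:c i j:])" for i j
          by (simp add: map_mat_def fps_of_poly_const [symmetric] fps_of_poly_diff)
        moreover have "poly (W r i j - [:c i j:]) x = 0" for i j
          using x(3) by (auto simp: map_mat_def)
        ultimately have "map_mat fop (W r) i j - map_mat fps_const c i j \<in> J" for i j
          using J_poly by metis
        then have "mat_mult d (\<lambda>i j. map_mat fop (W r) i j - map_mat fps_const c i j) (twist Q U) i j \<in> J" for i j
          using UQ by (auto simp: mat_mult_def J_0 intro!: J_sum J_mult)
        then show ?thesis by (rule J_mat_mult)
      qed
      finally show ?thesis .
    qed
    have in_B: "R' (cU c') \<in> B \<and> R' (twist Q U) \<in> B" if "R' \<in> poly_funs d UNIV" for R'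
      using that by (induction rule: poly_funs.induct) (auto intro: B_add B_mult B_const cUB UQ)
    have cong: "R' (cU c') - R' (twist Q U) \<in> J" if "R' \<in> poly_funs d UNIV" for R'
      using that
    proof (induction rule: poly_funs.induct)
      case (poly_funs_add R R')
      then show ?case using J_add[OF poly_funs_add.IH] by (simp add: algebra_simps)
    next
      case (poly_funs_mult R R')
      have "(R (cU c') - R (twist Q U)) * R' (cU c') + R (twist Q U) * (R' (cU c') - R' (twist Q U)) \<in> J"
        using poly_funs_mult in_B by (intro J_add J_mult J_mult') auto
      then show ?case by (simp add: algebra_simps)
    qed (use diff J_0 in auto)
    have xF: "poly p x ^ Q = poly p x" if "\<And>n. coeff p n ^ Q = coeff p n" for p
    proof -
      have "(\<Sum>i\<le>degree p. coeff p i * x ^ i) ^ Q = (\<Sum>i\<le>degree p. (coeff p i * x ^ i) ^ Q)"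
        unfolding Q_def by (rule frob_sum[OF char_k])
      also have "\<dots> = (\<Sum>i\<le>degree p. coeff p i * x ^ i)"
      proof (intro sum.cong refl)
        fix i
        have "(x ^ i) ^ Q = (x ^ Q) ^ i" by (metis power_mult mult.commute)
        then show "(coeff p i * x ^ i) ^ Q = coeff p i * x ^ i"
          using that x(2) by (simp add: power_mult_distrib Q_def)
      qed
      finally show ?thesis by (simp add: poly_altdef)
    qed
    \<comment> \<open>Here the coefficients are fixed by the Q-th power map, and so is x. A
      polynomial p in X is congruent to p(x), which is its own Q-th power, and hence to p^Q modulo X
      - x.\<close>
    have frob: "R' (twist Q U) - R' U ^ Q \<in> J" if "R' \<in> poly_funs d {z. z ^ Q = z}" for R'
      using that
    proof (induction rule: poly_funs.induct)
      case (poly_funs_const p)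
      then have "poly (p - p ^ Q) x = 0" using xF[of p] by simp
      from J_poly[OF this] show ?case by (simp add: fps_of_poly_diff fps_of_poly_power)
    next
      case (poly_funs_var i j)
      then show ?case by (simp add: twist_def J_0)
    next
      case (poly_funs_add R R')
      have "(R U + R' U) ^ Q = R U ^ Q + R' U ^ Q" unfolding Q_def by (rule frob_add[OF char_fps])
      then show ?case using J_add[OF poly_funs_add.IH] by (simp add: algebra_simps)
    next
      case (poly_funs_mult R R')
      have R: "R \<in> poly_funs d UNIV" "R' \<in> poly_funs d UNIV" using poly_funs_mult.hyps poly_funs_mono by blast+
      then have "R U \<in> B" by (auto simp: B_def)
      then have "(R (twist Q U) - R U ^ Q) * R' (twist Q U) + R U ^ Q * (R' (twist Q U) - R' U ^ Q) \<in> J"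
        using poly_funs_mult.IH R in_B by (intro J_add J_mult J_mult') (auto intro: B_power)
      then show ?case by (simp add: algebra_simps power_mult_distrib)
    qed
    have "R \<in> poly_funs d {z. z ^ Q = z}"
      using x(1) unfolding Q_def by (intro poly_funs_mono[OF N(2)]) (auto elim!: dvdE intro: pow_q_mult)
    from frob[OF this] have "R (twist Q U) \<in> J"
      using R(2) q_pos by (simp add: Q_def power_0_left del: q_pos)
    from J_add[OF cong[OF R(1)] this] have "\<theta> \<in> J" by (simp add: \<theta>_def)
    then have "fop f \<in> J" using J_mult h \<theta>h by metis
    then obtain z where z: "z \<in> B" "fop f = fop l * z" by (auto simp: J_def)
    obtain m where "fop (\<delta>0 ^ m) * z \<in> comb_span S" using B_comb_span z by blast
    then obtain a' where a': "fop (\<delta>0 ^ m) * z = comb S a'" by (auto simp: comb_span_def)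
    \<comment> \<open>From f in (X - x) B to a zero of a polynomial: after clearing denominators,
      the coordinates at the monomial 1 are compared.\<close>
    define z0 where "z0 = (\<lambda>_ :: nat \<times> nat. 0 :: nat)"
    define g where "g = (\<lambda>e. if e = z0 then \<delta>0 ^ m * f else 0)"
    have "comb S g = (\<Sum>e\<in>S. if e = z0 then fop (\<delta>0 ^ m * f) else 0)"
      unfolding comb_def by (intro sum.cong) (auto simp: g_def z0_def)
    also have "\<dots> = fop (\<delta>0 ^ m * f)" using S_0 finite_S by (simp add: z0_def)
    also have "\<dots> = fop l * comb S a'" by (simp add: a' [symmetric] fps_of_poly_mult z(2) mult_ac)
    also have "\<dots> = comb S (\<lambda>e. l * a' e)" by (rule comb_mult)
    finally have eq: "comb S g = comb S (\<lambda>e. l * a' e)" .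
    have "comb S (\<lambda>e. g e + (- 1) * (l * a' e)) = comb S g + fop (-1) * comb S (\<lambda>e. l * a' e)"
      unfolding comb_mult comb_add ..
    also have "\<dots> = 0" unfolding eq by (simp add: fps_of_poly_uminus)
    finally have "g z0 + (- 1) * (l * a' z0) = 0" using S_0 by (intro comb_S_0) (auto simp: z0_def)
    then have "\<delta>0 ^ m * f = l * a' z0" by (simp add: g_def)
    from arg_cong[OF this, of "\<lambda>p. poly p x"] show ?thesis by (auto simp: l_def)
  qed
  moreover have "\<delta>0 * f \<noteq> 0" using f(1) \<delta>0_nz by simp
  ultimately show ?thesis using N(1) by blast
qed

end

section \<open>Congruences and multiplicities\<close>

lemma dvd_prod_diff:
  fixes f g :: "'i \<Rightarrow> 'r :: comm_ring_1"
  assumes "\<And>x. x \<in> A \<Longrightarrow> m dvd f x - g x"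
  shows "m dvd (\<Prod>x\<in>A. f x) - (\<Prod>x\<in>A. g x)"
  using assms
proof (induction A rule: infinite_finite_induct)
  case (insert x A)
  have "m dvd (f x - g x) * prod f A + g x * (prod f A - prod g A)"
    using insert by (intro dvd_add dvd_mult dvd_mult2) auto
  then show ?case using insert by (simp add: algebra_simps)
qed auto

lemma dvd_power_diff:
  fixes x y :: "'r :: comm_ring_1"
  assumes "m dvd x - y"
  shows "m dvd x ^ n - y ^ n"
  using dvd_prod_diff[of "{..<n}" m "\<lambda>_. x" "\<lambda>_. y"] assms by simp

lemma dvd_mon_diff: "(\<And>i j. m dvd y i j - y' i j) \<Longrightarrow> m dvd mon d e y - mon d e y'"
  unfolding mon_def by (intro dvd_prod_diff dvd_power_diff) auto

lemma dvd_mult_diff: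
  fixes x y :: "'r :: comm_ring_1"
  assumes "m dvd x - y" "m dvd x' - y'"
  shows "m dvd x * x' - y * y'"
proof -
  have "m dvd (x - y) * x' + y * (x' - y')" using assms by (intro dvd_add dvd_mult dvd_mult2)
  then show ?thesis by (simp add: algebra_simps)
qed

lemma degree_mon_le: 
  assumes "\<And>i j. degree (y i j) \<le> n"
  shows "degree (mon d e y) \<le> (\<Sum>x\<in>{..<d} \<times> {..<d}. e x) * n"
proof -
  have "degree (mon d e y) \<le> (\<Sum>x\<in>{..<d} \<times> {..<d}. degree (y (fst x) (snd x) ^ e x))"
    unfolding mon_def 
    using degree_prod_sum_le[of "{..<d} \<times> {..<d}" "\<lambda>x. y (fst x) (snd x) ^ e x"] by (simp add: o_def)
  also have "\<dots> \<le> (\<Sum>x\<in>{..<d} \<times> {..<d}. e x * n)"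
    using assms by (intro sum_mono order_trans[OF degree_power_le]) (simp add: mult.commute)
  finally show ?thesis by (simp add: sum_distrib_right)
qed

lemma sum_multiplicities_le:
  fixes P :: "'a :: field poly"
  assumes "P \<noteq> 0" "finite Xp" "\<And>x. x \<in> Xp \<Longrightarrow> [:-x, 1:] ^ M dvd P"
  shows "card Xp * M \<le> degree P"
proof -
  define Xp' where "Xp' = (if M = 0 then {} else Xp)"
  have "Xp' \<subseteq> set_mset (proots P)"
    using assms by (auto simp: Xp'_def set_count_proots poly_eq_0_iff_dvd intro: dvd_trans[OF dvd_power])
  have "card Xp * M = (\<Sum>x\<in>Xp'. M)" by (simp add: Xp'_def)
  also have "\<dots> \<le> (\<Sum>x\<in>Xp'. count (proots P) x)"
    using assms by (intro sum_mono) (auto simp: Xp'_def order_divides split: if_splits)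
  also have "\<dots> \<le> (\<Sum>x\<in>set_mset (proots P). count (proots P) x)"
    using \<open>Xp' \<subseteq> set_mset (proots P)\<close> by (intro sum_mono2) auto
  also have "\<dots> = size (proots P)" by (simp add: size_multiset_overloaded_eq)
  also have "\<dots> \<le> degree P" by (rule size_proots_le)
  finally show ?thesis .
qed

section \<open>Bivariate polynomials\<close>

text \<open>A bound for the degree in the inner variable, which stands for the point x. The outer
  variable T is the local parameter at x; its degree is left free.\<close>

definition xd :: "nat \<Rightarrow> 'k :: field poly poly \<Rightarrow> bool"
  where "xd n P \<longleftrightarrow> (\<forall>k. degree (coeff P k) \<le> n)"

lemma xd_mono: "xd n P \<Longrightarrow> n \<le> m \<Longrightarrow> xd m P"
  by (meson order_trans xd_def)

lemma xd_mult: "xd n P \<Longrightarrow> xd m R \<Longrightarrow> xd (n + m) (P * R)"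
  unfolding xd_def coeff_mult
  by (intro allI degree_sum_le) (auto intro!: order_trans[OF degree_mult_le] add_mono)

lemma xd_add: "xd n P \<Longrightarrow> xd n R \<Longrightarrow> xd n (P + R)"
  by (auto simp: xd_def intro: degree_add_le)

lemma xd_sum: "(\<And>x. x \<in> A \<Longrightarrow> xd n (f x)) \<Longrightarrow> xd n (\<Sum>x\<in>A. f x)"
  by (induction A rule: infinite_finite_induct) (auto intro: xd_add simp: xd_def[of _ 0])

lemma xd_prod: "(\<And>x. x \<in> A \<Longrightarrow> xd (n x) (f x)) \<Longrightarrow> xd (\<Sum>x\<in>A. n x) (\<Prod>x\<in>A. f x)"
  by (induction A rule: infinite_finite_induct) (auto intro: xd_mult simp: xd_def[of _ 1] coeff_1)

lemma xd_power: "xd n P \<Longrightarrow> xd (k * n) (P ^ k)"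
  using xd_prod[of "{..<k}" "\<lambda>_. n" "\<lambda>_. P"] by simp

lemma xd_const: "degree p \<le> n \<Longrightarrow> xd n [:p:]"
  by (auto simp: xd_def coeff_pCons split: nat.splits)

lemma xd_mon: "(\<And>i j. xd n (y i j)) \<Longrightarrow> xd ((\<Sum>x\<in>{..<d} \<times> {..<d}. e x) * n) (mon d e y)"
  unfolding mon_def sum_distrib_right by (intro xd_prod xd_power)

lemma xd_mat_mult: "(\<And>i j. xd n (A i j)) \<Longrightarrow> (\<And>i j. xd m (B i j)) \<Longrightarrow> xd (n + m) (mat_mult d A B i j)"
  by (auto simp: mat_mult_def xd_def[of _ 0] intro!: xd_sum xd_mult)

text \<open>The polynomial \<open>p(x + T)\<close>, as a polynomial in \<open>T\<close> with coefficients in \<open>K[x]\<close>.\<close>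

definition taylor :: "'k :: field poly \<Rightarrow> 'k poly poly"
  where "taylor p = poly (map_poly (\<lambda>c. [:[:c:]:]) p) [:[:0, 1:], 1:]"

lemma taylor_pCons: "taylor (pCons a p) = [:[:a:]:] + [:[:0, 1:], 1:] * taylor p"
  by (simp add: taylor_def map_poly_pCons)

lemma taylor_0: "taylor 0 = 0" by (simp add: taylor_def)

lemma xd_taylor: "xd (degree p) (taylor p)"
proof (induction p)
  case (pCons a p)
  show ?case
  proof (cases "p = 0")
    case True
    then show ?thesis by (simp add: taylor_pCons taylor_0 xd_const)
  next
    case False
    have "xd 1 [:[:0, 1 :: 'a:], 1:]" by (auto simp: xd_def coeff_pCons split: nat.splits)
    from xd_mult[OF this pCons.IH] have "xd (degree (pCons a p)) ([:[:0, 1:], 1:] * taylor p)"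
      using False by simp
    then show ?thesis unfolding taylor_pCons by (intro xd_add xd_const) auto
  qed
qed (simp add: taylor_0 xd_def)

abbreviation spec :: "'k :: field \<Rightarrow> 'k poly poly \<Rightarrow> 'k poly"
  where "spec x \<equiv> map_poly (\<lambda>p. poly p x)"

lemma ring_hom_fun_spec: "ring_hom_fun (spec x)"
  by (rule ring_hom_fun_map_poly[OF ring_hom_fun_poly])

lemma spec_const: "spec x [:p:] = [:poly p x:]"
  by (simp add: map_poly_pCons)

lemma spec_taylor: "spec x (taylor p) = pcompose p [:x, 1:]"
proof (induction p)
  case (pCons a p)
  have "spec x (taylor (pCons a p)) = spec x [:[:a:]:] + spec x [:[:0, 1:], 1:] * spec x (taylor p)"
    unfolding taylor_pCons ring_hom_fun_add[OF ring_hom_fun_spec] ring_hom_fun_mult[OF ring_hom_fun_spec] ..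
  then show ?case by (simp add: pCons.IH pcompose_pCons map_poly_pCons)
qed (simp add: taylor_0)

lemma ring_hom_fun_pcompose: "ring_hom_fun (\<lambda>p. pcompose p r)"
  by (auto simp: ring_hom_fun_def pcompose_add pcompose_mult pcompose_1)

section \<open>Local expansion of the auxiliary polynomial\<close>

context frob_matrix
begin

lemma mon_W_U: "fps_X ^ (q ^ r) dvd fop (mon d e (W r)) - mo e"
  unfolding mon_map_mat[OF ring_hom_fun_fps_of_poly]
  by (rule dvd_mon_diff) (use U_W[of r] in \<open>auto simp: map_mat_def dvd_diff_commute\<close>)

text \<open>Let \<open>j1\<close> be the first index with a nonzero coefficient. If the sum were
  zero, the terms after \<open>j1\<close> would force X^Q, with Q = q^r, to divide the combination
  at \<open>j1\<close>, first for \<open>W r\<close> and then for \<open>U\<close>, which agree to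
  order Q. But that combination has a nonzero polynomial multiple of degree below Q.\<close>

lemma nonvanishing:
  assumes deg: "\<And>e j n. e \<in> S \<Longrightarrow> n \<ge> A \<Longrightarrow> coeff (a e j) n = 0"
    and \<kappa>: "\<forall>A a. (\<forall>e\<in>S. \<forall>n\<ge>A. coeff (a e) n = 0) \<longrightarrow> comb S a \<noteq> 0 \<longrightarrow>
     (\<exists>b f. f \<noteq> 0 \<and> degree f \<le> D * (A + \<kappa>) \<and> comb S a * (fop \<delta>0 * comb S b) = fop f)"
    and Q: "D * (A + \<kappa>) < q ^ r"
    and nz: "e0 \<in> S" "j0 < J" "a e0 j0 \<noteq> 0"
  shows "(\<Sum>j<J. [:0, 1:] ^ (j * q ^ r) * (\<Sum>e\<in>S. a e j * mon d e (W r))) \<noteq> 0"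
proof
  define Q where "Q = q ^ r"
  define G where "G = (\<lambda>j. \<Sum>e\<in>S. a e j * mon d e (W r))"
  assume eq0: "(\<Sum>j<J. [:0, 1:] ^ (j * q ^ r) * (\<Sum>e\<in>S. a e j * mon d e (W r))) = 0"
  define j1 where "j1 = (LEAST j. \<exists>e\<in>S. a e j \<noteq> 0)"
  have "\<exists>j. \<exists>e\<in>S. a e j \<noteq> 0" using nz by blast
  from LeastI_ex[OF this] have j1: "\<exists>e\<in>S. a e j1 \<noteq> 0" by (simp add: j1_def)
  have "j1 \<le> j0" unfolding j1_def using nz by (intro Least_le) blast
  then have "j1 < J" using nz by simp
  have G0: "G j = 0" if "j < j1" for j
    using that not_less_Least[of j "\<lambda>j. \<exists>e\<in>S. a e j \<noteq> 0"] by (auto simp: G_def j1_def intro!: sum.neutral)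
  have "0 = (\<Sum>j<J. [:0, 1:] ^ (j * Q) * G j)" using eq0 by (simp add: Q_def G_def)
  also have "\<dots> = [:0, 1:] ^ (j1 * Q) * G j1 + (\<Sum>j\<in>{..<J} - {j1}. [:0, 1:] ^ (j * Q) * G j)"
    using \<open>j1 < J\<close> by (intro sum.remove) auto
  finally have "[:0, 1:] ^ (j1 * Q) * G j1 = - (\<Sum>j\<in>{..<J} - {j1}. [:0, 1:] ^ (j * Q) * G j)"
    by (simp add: eq_neg_iff_add_eq_0)
  also have "[:0, 1:] ^ (j1 * Q + Q) dvd \<dots>"
    unfolding dvd_minus_iff
  proof (rule dvd_sum)
    fix j assume "j \<in> {..<J} - {j1}"
    show "[:0, 1:] ^ (j1 * Q + Q) dvd [:0, 1:] ^ (j * Q) * G j"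
    proof (cases "j < j1")
      case False
      with \<open>j \<in> _\<close> have "Suc j1 * Q \<le> j * Q" by (intro mult_right_mono) auto
      then have "([:0, 1:] :: 'k poly) ^ (j1 * Q + Q) dvd [:0, 1:] ^ (j * Q)" by (intro le_imp_power_dvd) auto
      then show ?thesis by (rule dvd_mult2)
    qed (simp add: G0)
  qed
  finally have "[:0, 1:] ^ Q dvd G j1"
    by (simp add: power_add dvd_mult_cancel_left)
  then have "fop ([:0, 1:] ^ Q) dvd fop (G j1)" by (rule fps_of_poly_dvd)
  then have 1: "fps_X ^ Q dvd fop (G j1)" by (simp add: fps_of_poly_power)
  have "fop (G j1) - comb S (\<lambda>e. a e j1) = (\<Sum>e\<in>S. fop (a e j1) * (fop (mon d e (W r)) - mo e))"
    by (simp add: G_def comb_def fps_of_poly_sum fps_of_poly_mult sum_subtractf [symmetric] algebra_simps)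
  also have "fps_X ^ Q dvd \<dots>" unfolding Q_def by (intro dvd_sum dvd_mult mon_W_U)
  finally have 2: "fps_X ^ Q dvd comb S (\<lambda>e. a e j1)"
    using 1 dvd_diff[of "fps_X ^ Q" "fop (G j1)" "fop (G j1) - comb S (\<lambda>e. a e j1)"] by simp
  have "comb S (\<lambda>e. a e j1) \<noteq> 0" using j1 comb_S_0 by blast
  then obtain b f where f: "f \<noteq> 0" "degree f \<le> D * (A + \<kappa>)" 
      "comb S (\<lambda>e. a e j1) * (fop \<delta>0 * comb S b) = fop f"
    using \<kappa>[rule_format, of A "\<lambda>e. a e j1"] deg by blast
  from 2 f(3) have "fps_X ^ Q dvd fop f" by (metis dvd_mult2)
  then have "coeff f k = 0" if "k < Q" for k
    using that unfolding X_power_dvd_fps_iff by simp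
  moreover have "degree f < Q" using f(2) Q by (simp add: Q_def)
  ultimately have "lead_coeff f = 0" by blast
  with f(1) show False by simp
qed

text \<open>The inverse of \<open>W r\<close> up to the factor \<open>Dl r\<close>: the twists of
  \<open>adj\<close> in reverse order.\<close>

fun AW :: "nat \<Rightarrow> nat \<Rightarrow> nat \<Rightarrow> 'k poly" where
  "AW 0 = id_mat d"
| "AW (Suc r) = mat_mult d (twist (q ^ r) adj) (AW r)"

definition Dl :: "nat \<Rightarrow> 'k poly" where "Dl r = (\<Prod>i<r. \<Delta> ^ (q ^ i))"

lemma AW_W: "mat_mult d (AW r) (W r) = scale_mat (Dl r) (id_mat d)"
proof (induction r)
  case 0
  then show ?case by (simp add: Dl_def mat_mult_id_mat_left scale_mat_def)
next
  case (Suc r)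
  have "mat_mult d (AW (Suc r)) (W (Suc r)) = 
      mat_mult d (twist (q ^ r) adj) (mat_mult d (mat_mult d (AW r) (W r)) (twist (q ^ r) w))"
    by (simp add: mat_mult_assoc)
  also have "\<dots> = scale_mat (Dl r) (mat_mult d (twist (q ^ r) adj) (twist (q ^ r) w))"
    by (simp add: Suc mat_mult_scale_mat_left mat_mult_scale_mat_right mat_mult_id_mat_left twist_in_square_mats w_square_mats)
  also have "mat_mult d (twist (q ^ r) adj) (twist (q ^ r) w) = scale_mat (\<Delta> ^ (q ^ r)) (id_mat d)"
    by (simp add: twist_mat_mult[OF char_poly, symmetric] adj_w twist_scale_mat twist_id_mat)
  also have "scale_mat (Dl r) \<dots> = scale_mat (Dl (Suc r)) (id_mat d)"
    by (simp add: Dl_def scale_mat_def mult.assoc)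
  finally show ?case .
qed

definition a0 :: nat where
  "a0 = degree \<Delta> + (\<Sum>x\<in>{..<d} \<times> {..<d}. degree (w (fst x) (snd x)) + degree (adj (fst x) (snd x)))"

lemma a0: "degree \<Delta> \<le> a0" "degree (w i j) \<le> a0" "degree (adj i j) \<le> a0"
proof -
  have "degree (w i j) + degree (adj i j) \<le> (\<Sum>x\<in>{..<d} \<times> {..<d}. degree (w (fst x) (snd x)) + degree (adj (fst x) (snd x)))"
  proof (cases "i < d \<and> j < d")
    case True
    then show ?thesis
      using member_le_sum[of "(i, j)" "{..<d} \<times> {..<d}" "\<lambda>x. degree (w (fst x) (snd x)) + degree (adj (fst x) (snd x))"]
      by simp
  qed (auto simp: cmD[OF w_square_mats] cmD[OF adj_square_mats])
  then show "degree (w i j) \<le> a0" "degree (adj i j) \<le> a0" by (auto simp: a0_def)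
qed (simp add: a0_def)

lemma degree_mat_mult_le: 
  fixes A B :: "nat \<Rightarrow> nat \<Rightarrow> 'k poly"
  assumes "\<And>i j. degree (A i j) \<le> m" "\<And>i j. degree (B i j) \<le> n"
  shows "degree (mat_mult d A B i j) \<le> m + n"
  using assms by (auto simp: mat_mult_def intro!: degree_sum_le order_trans[OF degree_mult_le] add_mono)

lemma two_q: "m + m \<le> m * q"
  by (metis mult_2_right mult_le_mono2 q_ge_2)

lemma degree_twist_le: "(\<And>i j. degree (A i j) \<le> n) \<Longrightarrow> degree (twist Q A i j) \<le> n * Q" 
  for A :: "nat \<Rightarrow> nat \<Rightarrow> 'k poly"
  by (auto simp: twist_def intro!: order_trans[OF degree_power_le] mult_right_mono)

lemma degree_W: "degree (W r i j) \<le> a0 * q ^ r"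
proof (induction r arbitrary: i j)
  case (Suc r)
  have "degree (W (Suc r) i j) \<le> a0 * q ^ r + a0 * q ^ r"
    unfolding W.simps by (intro degree_mat_mult_le Suc degree_twist_le a0)
  also have "\<dots> \<le> a0 * q ^ Suc r" using two_q[of "a0 * q ^ r"] by (simp add: mult_ac)
  finally show ?case .
qed (auto simp: id_mat_def)

lemma degree_AW: "degree (AW r i j) \<le> a0 * q ^ r"
proof (induction r arbitrary: i j)
  case (Suc r)
  have "degree (AW (Suc r) i j) \<le> a0 * q ^ r + a0 * q ^ r"
    unfolding AW.simps by (intro degree_mat_mult_le Suc degree_twist_le a0)
  also have "\<dots> \<le> a0 * q ^ Suc r" using two_q[of "a0 * q ^ r"] by (simp add: mult_ac)
  finally show ?case .
qed (auto simp: id_mat_def)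

lemma degree_Dl: "degree (Dl r) \<le> a0 * q ^ r"
proof (induction r)
  case (Suc r)
  have "degree (Dl (Suc r)) \<le> a0 * q ^ r + a0 * q ^ r"
    using Suc a0(1) by (auto simp: Dl_def intro!: order_trans[OF degree_mult_le] add_mono order_trans[OF degree_power_le] mult_right_mono)
  also have "\<dots> \<le> a0 * q ^ Suc r" using two_q[of "a0 * q ^ r"] by (simp add: mult_ac)
  finally show ?case .
qed (simp add: Dl_def)

text \<open>Bounds the total degrees of the basis monomials, so that one power
  \<open>Dl \<mu> ^ Ke\<close> clears the denominators of all of them.\<close>

definition Ke :: nat where "Ke = (\<Sum>e\<in>S. \<Sum>x\<in>{..<d} \<times> {..<d}. e x)"

lemma Ke: "e \<in> S \<Longrightarrow> (\<Sum>x\<in>{..<d} \<times> {..<d}. e x) \<le> Ke"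
  unfolding Ke_def using member_le_sum[of e S "\<lambda>e. \<Sum>x\<in>{..<d} \<times> {..<d}. e x"] finite_S by simp

text \<open>For x of class c this is \<open>Dl \<mu>\<close> at x times the matrix W_2\<mu>(x + T)
  modulo T^(q^\<mu>): its second factor, the twisted \<open>W \<mu>\<close>, is constant there and
  equals the inverse of W_\<mu>(x) times c, which \<open>AW \<mu>\<close> expresses with small
  degree in x.\<close>

definition Y :: "nat \<Rightarrow> (nat \<Rightarrow> nat \<Rightarrow> 'k) \<Rightarrow> nat \<Rightarrow> nat \<Rightarrow> 'k poly poly"
  where "Y \<mu> c = mat_mult d (map_mat taylor (W \<mu>)) (mat_mult d (map_mat (\<lambda>p. [:p:]) (AW \<mu>)) (map_mat (\<lambda>z. [:[:z:]:]) c))"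

text \<open>The local expansion of one term of the auxiliary polynomial, times
  \<open>Dl \<mu> ^ Ke\<close>. With Q = q^(2\<mu>), the jQ-th power of x + T is replaced by x^j, to
  which it is congruent modulo T^Q when x^Q = x; this keeps the degree in x far below that of the
  term itself.\<close>

definition \<Psi> :: "nat \<Rightarrow> (nat \<Rightarrow> nat \<Rightarrow> 'k) \<Rightarrow> (nat \<times> nat \<Rightarrow> nat) \<Rightarrow> nat \<Rightarrow> 'k poly \<Rightarrow> 'k poly poly"
  where "\<Psi> \<mu> c e j p = taylor p * [:[:0, 1:] ^ j:] * [:Dl \<mu>:] ^ (Ke - (\<Sum>x\<in>{..<d} \<times> {..<d}. e x)) * mon d e (Y \<mu> c)"

lemma xd_\<Psi>:
  assumes "e \<in> S"
  shows "xd (degree p + j + 2 * Ke * a0 * q ^ \<mu>) (\<Psi> \<mu> c e j p)"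
proof -
  define k where "k = (\<Sum>x\<in>{..<d} \<times> {..<d}. e x)"
  have "k \<le> Ke" using Ke[OF assms] by (simp add: k_def)
  have Y: "xd (a0 * q ^ \<mu> + (a0 * q ^ \<mu> + 0)) (Y \<mu> c i l)" for i l
    unfolding Y_def
  proof (intro xd_mat_mult)
    show "xd (a0 * q ^ \<mu>) (map_mat taylor (W \<mu>) i j)" for i j
      unfolding map_mat_def by (rule xd_mono[OF xd_taylor degree_W])
  qed (auto simp: map_mat_def intro!: xd_const degree_AW)
  have "xd (degree p + j + (Ke - k) * (a0 * q ^ \<mu>) + k * (a0 * q ^ \<mu> + (a0 * q ^ \<mu> + 0))) (\<Psi> \<mu> c e j p)"
    unfolding \<Psi>_def k_def[symmetric] 
  proof (intro xd_mult xd_power xd_taylor)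
    show "xd (k * (a0 * q ^ \<mu> + (a0 * q ^ \<mu> + 0))) (mon d e (Y \<mu> c))"
      unfolding k_def by (rule xd_mon[OF Y])
  qed (auto intro!: xd_const degree_Dl simp: degree_power_eq)
  moreover have "(Ke - k) * (a0 * q ^ \<mu>) + k * (a0 * q ^ \<mu> + (a0 * q ^ \<mu> + 0)) \<le> 2 * Ke * a0 * q ^ \<mu>"
  proof -
    define z where "z = a0 * q ^ \<mu>"
    have "(Ke - k) * z + k * (z + (z + 0)) = Ke * z + k * z"
      using \<open>k \<le> Ke\<close> by (simp add: diff_mult_distrib algebra_simps)
    also have "\<dots> \<le> Ke * z + Ke * z" using \<open>k \<le> Ke\<close> by (intro add_mono mult_right_mono) auto
    finally show ?thesis by (simp add: z_def algebra_simps)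
  qed
  ultimately show ?thesis by (elim xd_mono) linarith
qed

lemma spec_\<Psi>:
  assumes e: "e \<in> S" and x: "x ^ (q ^ (2 * \<mu>)) = x" "cls (2 * \<mu>) x = c"
  defines "\<delta> \<equiv> poly (Dl \<mu>) x" and "M \<equiv> q ^ \<mu>"
  shows "[:0, 1:] ^ M dvd spec x (\<Psi> \<mu> c e j p) - 
     [:\<delta>:] ^ Ke * pcompose (p * [:0, 1:] ^ (j * q ^ (2 * \<mu>)) * mon d e (W (2 * \<mu>))) [:x, 1:]"
proof -
  define sh where "sh = (\<lambda>p :: 'k poly. pcompose p [:x, 1:])"
  have sh: "ring_hom_fun sh" unfolding sh_def by (rule ring_hom_fun_pcompose)
  define k where "k = (\<Sum>x\<in>{..<d} \<times> {..<d}. e x)"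
  have "k \<le> Ke" using Ke[OF e] by (simp add: k_def)
  define M0 where "M0 = twist M (cls \<mu> x)"
  have W2: "W (2 * \<mu>) = mat_mult d (W \<mu>) (twist M (W \<mu>))"
    using W_add[of \<mu> \<mu>] by (simp add: M_def mult_2)
  have c: "c = mat_mult d (cls \<mu> x) M0"
    unfolding x(2)[symmetric] W2 M0_def by (simp add: map_mat_mat_mult[OF ring_hom_fun_poly] map_mat_twist[OF ring_hom_fun_poly])
  have M0_square_mats: "M0 \<in> square_mats d"
    unfolding M0_def by (intro twist_in_square_mats map_mat_in_square_mats ring_hom_fun_poly W_square_mats) (auto simp: M_def)
  have AWc: "mat_mult d (map_mat (\<lambda>p. poly p x) (AW \<mu>)) c = scale_mat \<delta> M0"
    using arg_cong[OF AW_W[of \<mu>], of "map_mat (\<lambda>p. poly p x)"]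
    by (simp add: c mat_mult_assoc[symmetric] map_mat_mat_mult[OF ring_hom_fun_poly] map_mat_scale_mat[OF ring_hom_fun_poly] map_mat_id_mat[OF ring_hom_fun_poly]
        mat_mult_scale_mat_left mat_mult_id_mat_left M0_square_mats \<delta>_def)
  define V where "V = mat_mult d (map_mat sh (W \<mu>)) (map_mat (\<lambda>z. [:z:]) M0)"
  have specY: "map_mat (spec x) (Y \<mu> c) = scale_mat [:\<delta>:] V"
  proof -
    have 1: "map_mat (spec x) (map_mat taylor (W \<mu>)) = map_mat sh (W \<mu>)"
      by (simp add: map_mat_def sh_def spec_taylor)
    have 2: "map_mat (spec x) (map_mat (\<lambda>p. [:p:]) (AW \<mu>)) = map_mat (\<lambda>z. [:z:]) (map_mat (\<lambda>p. poly p x) (AW \<mu>))"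
      by (simp add: map_mat_def spec_const)
    have 3: "map_mat (spec x) (map_mat (\<lambda>z. [:[:z:]:]) c) = map_mat (\<lambda>z. [:z:]) c"
      by (simp add: map_mat_def spec_const)
    have "map_mat (spec x) (Y \<mu> c) = mat_mult d (map_mat sh (W \<mu>)) (map_mat (\<lambda>z. [:z:]) (scale_mat \<delta> M0))"
      unfolding Y_def map_mat_mat_mult[OF ring_hom_fun_spec] 1 2 3 AWc[symmetric] map_mat_mat_mult[OF ring_hom_fun_const_poly] ..
    also have "\<dots> = scale_mat [:\<delta>:] V"
      unfolding V_def map_mat_scale_mat[OF ring_hom_fun_const_poly] mat_mult_scale_mat_right ..
    finally show ?thesis .
  qed
  \<comment> \<open>p(x + T) - p(x) is divisible by T, hence its M-th power by T^M: a twist by M is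
    constant to order M at x.\<close>
  have frob_sh: "[:0, 1:] ^ M dvd sh p ^ M - [:poly p x ^ M:]" for p
  proof -
    have "poly (sh p - [:poly p x:]) 0 = 0" by (simp add: sh_def poly_pcompose)
    then have "[:0, 1:] dvd sh p - [:poly p x:]" 
      by (metis poly_eq_0_iff_dvd minus_zero)
    then have "[:0, 1:] ^ M dvd (sh p - [:poly p x:]) ^ M" by (rule dvd_power_same)
    also have "(sh p - [:poly p x:]) ^ M = sh p ^ M - [:poly p x ^ M:]"
      unfolding M_def frob_diff[OF char_poly] by (simp add: poly_const_pow)
    finally show ?thesis .
  qed
  have shW: "[:0, 1:] ^ M dvd V i l - map_mat sh (W (2 * \<mu>)) i l" for i l
  proof -
    have "map_mat sh (W (2 * \<mu>)) = mat_mult d (map_mat sh (W \<mu>)) (twist M (map_mat sh (W \<mu>)))"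
      unfolding W2 map_mat_mat_mult[OF sh] map_mat_twist[OF sh] ..
    then have "V i l - map_mat sh (W (2 * \<mu>)) i l = 
        mat_mult d (map_mat sh (W \<mu>)) (\<lambda>i l. map_mat (\<lambda>z. [:z:]) M0 i l - twist M (map_mat sh (W \<mu>)) i l) i l"
      unfolding V_def mat_mult_diff_right by (simp only:)
    also have "[:0, 1:] ^ M dvd \<dots>"
    proof -
      have "[:0, 1:] ^ M dvd map_mat (\<lambda>z. [:z:]) M0 i l - twist M (map_mat sh (W \<mu>)) i l" for i l
        using frob_sh[of "W \<mu> i l"] by (simp add: map_mat_def M0_def twist_def dvd_diff_commute)
      then show ?thesis by (auto simp: mat_mult_def intro!: dvd_sum dvd_mult)
    qed
    finally show ?thesis .
  qed
  have Xp: "[:0, 1:] ^ M dvd [:x ^ j:] - sh ([:0, 1:] ^ (j * q ^ (2 * \<mu>)))"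
  proof -
    have Q: "q ^ (2 * \<mu>) = M * M" by (simp add: M_def power_add [symmetric] mult_2)
    have "[:0, 1:] ^ M dvd sh [:0, 1:] ^ M - [:x ^ M:]" using frob_sh[of "[:0, 1:]"] by simp
    then have "[:0, 1:] ^ M dvd (sh [:0, 1:] ^ M) ^ (M * j) - [:x ^ M:] ^ (M * j)" by (rule dvd_power_diff)
    moreover have "[:x ^ M:] ^ (M * j) = [:x ^ j:]"
      using x(1) by (simp add: poly_const_pow Q power_mult [symmetric]) (simp add: power_mult)
    moreover have "(sh [:0, 1:] ^ M) ^ (M * j) = sh ([:0, 1:] ^ (j * q ^ (2 * \<mu>)))"
      unfolding ring_hom_fun_power[OF sh] power_mult [symmetric] Q by (simp only: mult_ac)
    ultimately show ?thesis by (simp add: dvd_diff_commute)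
  qed
  have "spec x (\<Psi> \<mu> c e j p) = sh p * [:x ^ j:] * [:\<delta>:] ^ (Ke - k) * mon d e (scale_mat [:\<delta>:] V)"
    unfolding \<Psi>_def k_def[symmetric] ring_hom_fun_mult[OF ring_hom_fun_spec] ring_hom_fun_power[OF ring_hom_fun_spec] spec_const 
      spec_taylor mon_map_mat[OF ring_hom_fun_spec] specY
    by (simp add: sh_def \<delta>_def)
  also have "\<dots> = sh p * [:x ^ j:] * [:\<delta>:] ^ Ke * mon d e V"
  proof -
    have "[:\<delta>:] ^ (Ke - k) * [:\<delta>:] ^ k = [:\<delta>:] ^ Ke"
      using \<open>k \<le> Ke\<close> by (simp only: power_add [symmetric]) simp
    then show ?thesis by (simp only: mon_scale_mat k_def[symmetric] mult.assoc) (simp add: mult_ac)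
  qed
  finally have 1: "spec x (\<Psi> \<mu> c e j p) = [:\<delta>:] ^ Ke * (sh p * [:x ^ j:] * mon d e V)"
    by (simp only: mult_ac)
  have "[:0, 1:] ^ M dvd sh p * [:x ^ j:] * mon d e V - 
      sh p * sh ([:0, 1:] ^ (j * q ^ (2 * \<mu>))) * mon d e (map_mat sh (W (2 * \<mu>)))"
    by (intro dvd_mult_diff Xp dvd_mon_diff shW) auto
  also have "sh p * sh ([:0, 1:] ^ (j * q ^ (2 * \<mu>))) * mon d e (map_mat sh (W (2 * \<mu>))) =
     sh (p * [:0, 1:] ^ (j * q ^ (2 * \<mu>)) * mon d e (W (2 * \<mu>)))"
    by (simp add: ring_hom_fun_mult[OF sh] mon_map_mat[OF sh])
  finally show ?thesis unfolding 1 right_diff_distrib[symmetric] sh_def by (rule dvd_mult)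
qed

end

section \<open>Points over finite fields and the upper bound for one class\<close>

lemma card_frob_fixed:
  fixes Q :: nat
  assumes "of_nat Q = (0 :: 'k :: alg_closed_field)" "Q > 1"
  shows "finite {x :: 'k. x ^ Q = x}" "card {x :: 'k. x ^ Q = x} = Q"
proof -
  define p where "p = (monom 1 Q - monom 1 1 :: 'k poly)"
  have deg: "degree p = Q"
    unfolding p_def using assms by (subst diff_conv_add_uminus, subst degree_add_eq_left) (auto simp: degree_monom_eq)
  then have nz: "p \<noteq> 0" using assms by auto
  \<comment> \<open>The derivative -1 excludes double roots.\<close>
  have pd: "pderiv p = -1"
    by (simp add: p_def pderiv_diff pderiv_monom assms)
  obtain A where A: "size A = degree p" "p = smult (lead_coeff p) (\<Prod>x\<in>#A. [:-x, 1:])"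
    using alg_closed_imp_factorization[OF nz] by blast
  have roots: "poly p x = 0 \<longleftrightarrow> x \<in># A" for x
  proof -
    have "poly p x = 0 \<longleftrightarrow> poly (\<Prod>x\<in>#A. [:-x, 1:]) x = 0"
      by (subst A(2)) (use nz in simp)
    also have "\<dots> \<longleftrightarrow> x \<in># A" by (auto simp: poly_prod_mset)
    finally show ?thesis .
  qed
  have cnt: "count A x \<le> 1" for x
  proof (rule ccontr)
    assume "\<not> count A x \<le> 1"
    then have "{#x, x#} \<subseteq># A" by (auto simp: subseteq_mset_def)
    then obtain A' where "A = {#x, x#} + A'" by (auto simp: subset_mset.le_iff_add)
    then have "p = [:-x, 1:] * ([:-x, 1:] * smult (lead_coeff p) (\<Prod>x\<in>#A'. [:-x, 1:]))"
      using A(2) by (simp add: mult.assoc)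
    then obtain r where "p = [:-x, 1:] * ([:-x, 1:] * r)" by blast
    then have "pderiv p = pderiv ([:-x, 1:] * ([:-x, 1:] * r))" by (rule arg_cong)
    then have "poly (pderiv p) x = 0" unfolding pderiv_mult by simp
    then show False by (simp add: pd)
  qed
  have eq: "{x. x ^ Q = x} = set_mset A"
    using roots by (auto simp: p_def poly_monom)
  have "size A = (\<Sum>x\<in>set_mset A. count A x)" by (simp add: size_multiset_overloaded_eq)
  also have "\<dots> = (\<Sum>x\<in>set_mset A. 1)"
    using cnt by (intro sum.cong refl antisym) (auto simp: Suc_le_eq)
  finally have "card (set_mset A) = Q" using A(1) deg by simp
  then show "finite {x :: 'k. x ^ Q = x}" "card {x :: 'k. x ^ Q = x} = Q"
    unfolding eq by simp_all
qed

context frob_matrix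
begin

lemma card_fixed: "r > 0 \<Longrightarrow> finite {x :: 'k. x ^ (q ^ r) = x}" "r > 0 \<Longrightarrow> card {x :: 'k. x ^ (q ^ r) = x} = q ^ r"
proof -
  assume r: "r > 0"
  have "CHAR('k) dvd q" using a_pos by (simp add: q_eq)
  then have "CHAR('k) dvd q ^ r" using r by (meson dvd_power dvd_trans)
  then have "of_nat (q ^ r) = (0 :: 'k)" by (simp add: of_nat_eq_0_iff_char_dvd del: of_nat_power)
  moreover have "q ^ r > 1" using q_ge_2 r by (intro one_less_power) auto
  ultimately show "finite {x :: 'k. x ^ (q ^ r) = x}" "card {x :: 'k. x ^ (q ^ r) = x} = q ^ r"
    by (rule card_frob_fixed)+
qed

text \<open>Outside the finitely many zeros of \<open>\<Delta>\<close> the polynomial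
  \<open>Dl r\<close> does not vanish, so the matrix \<open>W r\<close> is invertible at x.\<close>

definition pts :: "nat \<Rightarrow> 'k set" where "pts r = {x. x ^ (q ^ r) = x \<and> poly \<Delta> x \<noteq> 0}"

lemma finite_pts: "r > 0 \<Longrightarrow> finite (pts r)"
  by (rule finite_subset[OF _ card_fixed(1)]) (auto simp: pts_def)

text \<open>Vanishing to order M is imposed on the expansion \<open>PT\<close> as a polynomial in x,
  hence at all points of the class at once: M coefficients in T, each of degree below A + J + c1 M
  in x, against D J A unknowns. The number of points is then at most the degree of P divided by
  M.\<close>

lemma auxiliary_polynomial:
  fixes \<mu> A J m0 \<kappa> :: nat and c :: "nat \<Rightarrow> nat \<Rightarrow> 'k"
  defines "Q \<equiv> q ^ (2 * \<mu>)" and "M \<equiv> q ^ \<mu>" and "c1 \<equiv> 2 * Ke * a0"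
  assumes \<mu>: "\<mu> > 0"
    and \<kappa>: "\<forall>A a. (\<forall>e\<in>S. \<forall>n\<ge>A. coeff (a e) n = 0) \<longrightarrow> comb S a \<noteq> 0 \<longrightarrow>
     (\<exists>b f. f \<noteq> 0 \<and> degree f \<le> D * (A + \<kappa>) \<and> comb S a * (fop \<delta>0 * comb S b) = fop f)"
    and A: "D * (A + \<kappa>) < Q" and count: "M * (A + J + c1 * M) < D * J * A"
  shows "card {x\<in>pts (2 * \<mu>). cls (2 * \<mu>) x = c} * M \<le> A + J * Q + Ke * a0 * Q"
proof -
  define Bd where "Bd = A + J + c1 * M"
  define V where "V = S \<times> {..<J} \<times> {..<A}"
  define Xp where "Xp = ([:0, 1:] :: 'k poly)"
  define PV where "PV = (\<lambda>(e, j, i). \<Psi> \<mu> c e j (Xp ^ i))"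
  have finV: "finite V" by (simp add: V_def finite_S)
  have "card ({..<M} \<times> {..<Bd}) < card V"
    using count by (simp add: V_def card_cartesian_product Bd_def D_def mult_ac)
  then obtain cf where cf: "\<exists>v\<in>V. cf v \<noteq> 0"
    "\<And>k n. k < M \<Longrightarrow> n < Bd \<Longrightarrow> (\<Sum>v\<in>V. cf v * coeff (coeff (PV v) k) n) = 0"
    using homogeneous_solution[of "{..<M} \<times> {..<Bd}" V "\<lambda>(k, n) v. coeff (coeff (PV v) k) n"] finV
    by (auto 4 4)
  define PT where "PT = (\<Sum>v\<in>V. [:[:cf v:]:] * PV v)"
  have PT0: "coeff PT k = 0" if "k < M" for k
  proof (rule poly_eqI)
    fix n
    have "coeff (coeff PT k) n = (\<Sum>v\<in>V. cf v * coeff (coeff (PV v) k) n)"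
      by (simp add: PT_def coeff_sum)
    also have "\<dots> = 0"
    proof (cases "n < Bd")
      case False
      show ?thesis
      proof (intro sum.neutral ballI)
        fix v assume "v \<in> V"
        then obtain e j i where v: "v = (e, j, i)" "e \<in> S" "j < J" "i < A" by (auto simp: V_def)
        have "xd (degree (Xp ^ i) + j + c1 * M) (PV v)"
          using xd_\<Psi>[OF v(2), of "Xp ^ i" j \<mu> c] by (simp add: PV_def v c1_def M_def)
        then have "degree (coeff (PV v) k) \<le> i + j + c1 * M" by (simp add: xd_def Xp_def degree_power_eq)
        with False v have "degree (coeff (PV v) k) < n" by (simp add: Bd_def)
        then show "cf v * coeff (coeff (PV v) k) n = 0" by (simp add: coeff_eq_0)
      qed
    qed (use cf that in auto)
    finally show "coeff (coeff PT k) n = coeff 0 n" by simp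
  qed
  define a where "a = (\<lambda>e j. \<Sum>i<A. [:cf (e, j, i):] * Xp ^ i)"
  have coeff_a: "coeff (a e j) n = (if n < A then cf (e, j, n) else 0)" for e j n
  proof -
    have "coeff (a e j) n = (\<Sum>i<A. if i = n then cf (e, j, i) else 0)"
      unfolding a_def coeff_sum
    proof (intro sum.cong refl)
      fix i
      have "[:cf (e, j, i):] * Xp ^ i = monom (cf (e, j, i)) i" by (simp add: Xp_def monom_altdef)
      then show "coeff ([:cf (e, j, i):] * Xp ^ i) n = (if i = n then cf (e, j, i) else 0)" by simp
    qed
    also have "\<dots> = (if n < A then cf (e, j, n) else 0)" by simp
    finally show ?thesis .
  qed
  define P where "P = (\<Sum>j<J. Xp ^ (j * Q) * (\<Sum>e\<in>S. a e j * mon d e (W (2 * \<mu>))))"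
  have "P \<noteq> 0"
  proof -
    obtain e j i where v: "e \<in> S" "j < J" "i < A" "cf (e, j, i) \<noteq> 0" using cf(1) by (auto simp: V_def)
    have "a e j \<noteq> 0" using coeff_a[of e j i] v by auto
    then show ?thesis
      unfolding P_def Q_def Xp_def using v A \<kappa> coeff_a unfolding Q_def
      by (intro nonvanishing[of A a \<kappa> "2 * \<mu>" e j J]) auto
  qed
  have P_V: "P = (\<Sum>v\<in>V. [:cf v:] * (case v of (e, j, i) \<Rightarrow> Xp ^ i * Xp ^ (j * Q) * mon d e (W (2 * \<mu>))))"
  proof -
    have "P = (\<Sum>j<J. \<Sum>e\<in>S. \<Sum>i<A. [:cf (e, j, i):] * (Xp ^ i * Xp ^ (j * Q) * mon d e (W (2 * \<mu>))))"
      unfolding P_def a_def sum_distrib_left sum_distrib_right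
      by (intro sum.cong refl) (simp only: mult_ac)
    also have "\<dots> = (\<Sum>e\<in>S. \<Sum>j<J. \<Sum>i<A. [:cf (e, j, i):] * (Xp ^ i * Xp ^ (j * Q) * mon d e (W (2 * \<mu>))))"
      by (rule sum.swap)
    finally show ?thesis by (simp add: V_def sum.cartesian_product split_beta)
  qed
  have "[:-x, 1:] ^ M dvd P" if x: "x \<in> pts (2 * \<mu>)" "cls (2 * \<mu>) x = c" for x
  proof -
    define \<delta> where "\<delta> = poly (Dl \<mu>) x"
    have "\<delta> \<noteq> 0" using x by (simp add: \<delta>_def Dl_def pts_def poly_prod)
    define sh where "sh = (\<lambda>p :: 'k poly. pcompose p [:x, 1:])"
    have sh: "ring_hom_fun sh" unfolding sh_def by (rule ring_hom_fun_pcompose)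
    have "spec x PT - [:\<delta>:] ^ Ke * sh P = (\<Sum>v\<in>V. [:cf v:] * (spec x (PV v) - 
       [:\<delta>:] ^ Ke * sh (case v of (e, j, i) \<Rightarrow> Xp ^ i * Xp ^ (j * Q) * mon d e (W (2 * \<mu>)))))"
    proof -
      have 1: "sh P = (\<Sum>v\<in>V. [:cf v:] * sh (case v of (e, j, i) \<Rightarrow> Xp ^ i * Xp ^ (j * Q) * mon d e (W (2 * \<mu>))))"
        unfolding P_V ring_hom_fun_sum[OF sh] ring_hom_fun_mult[OF sh] by (simp add: sh_def)
      have 2: "spec x PT = (\<Sum>v\<in>V. [:cf v:] * spec x (PV v))"
        unfolding PT_def ring_hom_fun_sum[OF ring_hom_fun_spec] ring_hom_fun_mult[OF ring_hom_fun_spec] by (simp add: map_poly_pCons)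
      show ?thesis
        unfolding 1 2 right_diff_distrib sum_subtractf sum_distrib_left by (simp only: mult_ac)
    qed
    also have "Xp ^ M dvd \<dots>"
    proof (rule dvd_sum)
      fix v assume "v \<in> V"
      then obtain e j i where v: "v = (e, j, i)" "e \<in> S" by (auto simp: V_def)
      have "x ^ (q ^ (2 * \<mu>)) = x" using x(1) by (simp add: pts_def)
      from spec_\<Psi>[OF v(2) this x(2), of j "Xp ^ i"] 
      show "Xp ^ M dvd [:cf v:] * (spec x (PV v) - 
        [:\<delta>:] ^ Ke * sh (case v of (e, j, i) \<Rightarrow> Xp ^ i * Xp ^ (j * Q) * mon d e (W (2 * \<mu>))))"
        unfolding v(1) PV_def prod.case Xp_def \<delta>_def sh_def M_def Q_def by (rule dvd_mult)
    qed
    finally have 1: "Xp ^ M dvd spec x PT - [:\<delta>:] ^ Ke * sh P" .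
    have "Xp ^ M dvd spec x PT"
      unfolding Xp_def X_power_dvd_poly_iff by (simp add: coeff_map_poly PT0)
    with 1 have "Xp ^ M dvd [:\<delta>:] ^ Ke * sh P"
      using dvd_diff[OF \<open>Xp ^ M dvd spec x PT\<close> 1] by simp
    then have "Xp ^ M dvd sh P" using \<open>\<delta> \<noteq> 0\<close> by (simp add: poly_const_pow dvd_smult_iff)
    then obtain r where "sh P = Xp ^ M * r" by (elim dvdE)
    then have "pcompose (sh P) [:-x, 1:] = [:-x, 1:] ^ M * pcompose r [:-x, 1:]"
      by (simp add: ring_hom_fun_mult[OF ring_hom_fun_pcompose] ring_hom_fun_power[OF ring_hom_fun_pcompose] Xp_def pcompose_pCons)
    moreover have "pcompose (sh P) [:-x, 1:] = P"
      by (simp add: sh_def pcompose_assoc [symmetric] pcompose_pCons)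
    ultimately show ?thesis by simp
  qed
  then have "card {x\<in>pts (2 * \<mu>). cls (2 * \<mu>) x = c} * M \<le> degree P"
    using \<open>P \<noteq> 0\<close> \<mu> by (intro sum_multiplicities_le) (auto intro: finite_subset[OF _ finite_pts])
  also have "degree P \<le> A + J * Q + Ke * a0 * Q"
  proof -
    have "degree (Xp ^ (j * Q) * (a e j * mon d e (W (2 * \<mu>)))) \<le> A + J * Q + Ke * a0 * Q"
      if "j < J" "e \<in> S" for j e
    proof -
      have "degree (mon d e (W (2 * \<mu>))) \<le> (\<Sum>x\<in>{..<d} \<times> {..<d}. e x) * (a0 * Q)"
        unfolding Q_def by (rule degree_mon_le[OF degree_W])
      also have "\<dots> \<le> Ke * (a0 * Q)" using Ke[OF that(2)] by (intro mult_right_mono) auto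
      finally have 1: "degree (mon d e (W (2 * \<mu>))) \<le> Ke * a0 * Q" by (simp add: mult_ac)
      have 2: "degree (a e j) \<le> A" by (rule degree_le) (simp add: coeff_a)
      have "degree (Xp ^ (j * Q)) = j * Q" by (simp add: Xp_def degree_power_eq)
      also have "\<dots> \<le> J * Q" using that by (intro mult_right_mono) auto
      finally have 3: "degree (Xp ^ (j * Q)) \<le> J * Q" .
      have "degree (Xp ^ (j * Q) * (a e j * mon d e (W (2 * \<mu>)))) \<le> 
          degree (Xp ^ (j * Q)) + (degree (a e j) + degree (mon d e (W (2 * \<mu>))))"
        by (intro order_trans[OF degree_mult_le] add_left_mono degree_mult_le)
      with 1 2 3 show ?thesis by linarith
    qed
    then show ?thesis unfolding P_def sum_distrib_left by (intro degree_sum_le finite_S) auto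
  qed
  finally show ?thesis .
qed

text \<open>The degree bound divided by M is about J Q / M = J M, so J must be close to M / D. The
  nonvanishing condition leaves A room up to about Q / D, and A near Q / (2D) meets both
  requirements of \<open>auxiliary_polynomial\<close>.\<close>

lemma class_bound:
  "\<exists>C::real. C \<ge> 0 \<and> (\<forall>\<mu>>0. \<forall>c. real (card {x\<in>pts (2 * \<mu>). cls (2 * \<mu>) x = c}) \<le> q ^ (2 * \<mu>) / D + C * q ^ \<mu>)"
proof -
  obtain \<kappa> where \<kappa>: "\<forall>A a. (\<forall>e\<in>S. \<forall>n\<ge>A. coeff (a e) n = 0) \<longrightarrow> comb S a \<noteq> 0 \<longrightarrow>
     (\<exists>b f. f \<noteq> 0 \<and> degree f \<le> D * (A + \<kappa>) \<and> comb S a * (fop \<delta>0 * comb S b) = fop f)"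
    using comb_multiple_eq_poly by blast
  define c1 where "c1 = 2 * Ke * a0"
  \<comment> \<open>The surplus \<open>m0\<close> in D J makes \<open>m0 * A\<close> cover (2 + c1)
    Q, because Q < 4 D A.\<close>
  define m0 where "m0 = 4 * D * (2 + c1)"
  \<comment> \<open>Below this threshold the trivial bound Q = M * M is at most
    \<open>M0 * M\<close>; above it the roundings in A and J are harmless.\<close>
  define M0 where "M0 = 2 * D * \<kappa> + 1 + m0 + 3 * D"
  define C where "C = real M0 + m0 + D + 2 + Ke * a0"
  show ?thesis
  proof (intro exI[of _ C] conjI allI impI)
    fix \<mu> :: nat and c :: "nat \<Rightarrow> nat \<Rightarrow> 'k" assume \<mu>: "\<mu> > 0"
    define n where "n = card {x\<in>pts (2 * \<mu>). cls (2 * \<mu>) x = c}"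
    define M where "M = q ^ \<mu>"
    define Q where "Q = q ^ (2 * \<mu>)"
    have QM: "Q = M * M" by (simp add: Q_def M_def power_add [symmetric] mult_2)
    have "M > 0" by (simp add: M_def)
    have "real n \<le> Q / D + C * M"
    proof (cases "M < M0")
      case True
      have "n \<le> card {x :: 'k. x ^ (q ^ (2 * \<mu>)) = x}"
        unfolding n_def using \<mu> by (intro card_mono card_fixed) (auto simp: pts_def)
      also have "\<dots> = Q" using \<mu> by (simp add: card_fixed Q_def)
      also have "Q \<le> M0 * M" using True by (simp add: QM)
      finally have "real n \<le> real M0 * real M" using of_nat_mono by fastforce
      also have "\<dots> \<le> C * M" by (intro mult_right_mono) (auto simp: C_def)
      finally show ?thesis by (simp add: add_increasing)
    next
      case False
      then have MM0: "M \<ge> M0" by simp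
      define A where "A = Q div (2 * D)"
      define J where "J = (M + m0) div D + 1"
      have D: "D > 0" by (rule D_pos)
      have "M * 1 \<le> M * M" using \<open>M > 0\<close> by (intro mult_left_mono) auto
      then have QgeM: "Q \<ge> M" by (simp add: QM)
      have "2 * (D * A) \<le> Q" unfolding A_def using times_div_less_eq_dividend[of "2 * D" Q] by (simp add: mult_ac)
      moreover have "2 * (D * \<kappa>) < Q" using MM0 QgeM by (simp add: M0_def)
      ultimately have hA: "D * (A + \<kappa>) < Q" by (simp add: distrib_left)
      have "A \<ge> 1" unfolding A_def using D MM0 QgeM by (simp add: M0_def div_greater_zero_iff Suc_le_eq)
      have "Q < 2 * D * (A + 1)" unfolding A_def using dividend_less_times_div[of "2 * D" Q] D by (simp add: algebra_simps)
      also have "\<dots> \<le> 2 * D * (2 * A)" using \<open>A \<ge> 1\<close> by (intro mult_left_mono) auto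
      finally have QA: "Q < 4 * D * A" by simp
      have J1: "M + m0 \<le> D * J" unfolding J_def using dividend_less_times_div[OF D, of "M + m0"] by (simp add: algebra_simps)
      have J2: "D * J \<le> M + m0 + D" unfolding J_def by (simp add: algebra_simps)
      have "J \<le> D * J" using D by simp
      with J2 have "J \<le> M + m0 + D" by linarith
      also have "\<dots> \<le> 2 * M" using MM0 by (simp add: M0_def)
      finally have J3: "M * J \<le> 2 * Q" unfolding QM using mult_left_mono[of J "2 * M" M] by simp
      have "M * (A + J + c1 * M) = M * A + M * J + c1 * Q" by (simp add: QM algebra_simps)
      also have "\<dots> \<le> M * A + (2 + c1) * Q" using J3 by (simp add: algebra_simps)
      also have "\<dots> < M * A + (2 + c1) * (4 * D * A)" using QA by (intro add_strict_left_mono mult_strict_left_mono) auto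
      also have "\<dots> = (M + m0) * A" by (simp add: m0_def algebra_simps)
      also have "\<dots> \<le> D * J * A" using J1 by (intro mult_right_mono) auto
      finally have hc: "M * (A + J + c1 * M) < D * J * A" .
      have "n * M \<le> A + J * Q + Ke * a0 * Q"
        unfolding n_def M_def Q_def
        by (rule auxiliary_polynomial[OF \<mu> \<kappa>]) (use hA hc in \<open>simp_all add: M_def Q_def c1_def\<close>)
      also have "A \<le> Q" by (simp add: A_def)
      finally have "n * M \<le> M * (M * (1 + J + Ke * a0))" unfolding QM by (simp add: algebra_simps)
      then have "n \<le> M * (1 + J + Ke * a0)" using \<open>M > 0\<close> by (simp add: mult.commute)
      then have "real n \<le> real (M * (1 + J + Ke * a0))" by linarith
      also have "\<dots> = M * real J + M * (1 + real (Ke * a0))" by (simp add: algebra_simps)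
      also have "M * real J \<le> M * ((M + m0 + D) / D)"
      proof (intro mult_left_mono)
        have "real (D * J) \<le> real (M + m0 + D)" using J2 by linarith
        then show "real J \<le> (M + m0 + D) / D" using D by (simp add: field_simps)
      qed auto
      also have "M * ((M + m0 + D) / D) = Q / D + M * ((m0 + D) / D)"
        by (simp add: QM add_divide_distrib algebra_simps)
      also have "M * ((m0 + D) / D) \<le> M * real (m0 + D)"
        using D frac_le[of "real (m0 + D)" "real (m0 + D)" 1 "real D"] by (intro mult_left_mono) auto
      finally have "real n \<le> Q / D + M * (real (m0 + D) + 1 + real (Ke * a0))" by (simp add: algebra_simps)
      also have "\<dots> \<le> Q / D + M * C" by (intro add_left_mono mult_left_mono) (auto simp: C_def)
      finally show ?thesis by (simp add: mult.commute)
    qed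
    then show "real (card {x\<in>pts (2 * \<mu>). cls (2 * \<mu>) x = c}) \<le> q ^ (2 * \<mu>) / D + C * q ^ \<mu>"
      by (simp add: n_def M_def Q_def)
  qed (auto simp: C_def)
qed

section \<open>From upper bounds to character sums\<close>

lemma mat_mult_left_cancel: "mat_mult d c' c = id_mat d \<Longrightarrow> mat_mult d c a = mat_mult d c b \<Longrightarrow> a \<in> square_mats d \<Longrightarrow> b \<in> square_mats d \<Longrightarrow> a = b"
  by (metis mat_mult_assoc mat_mult_id_mat_left)

text \<open>Left multiplication by c is injective on the finite set \<open>H\<close>, hence onto, so
  the identity is attained inside \<open>H\<close>.\<close>

lemma invertible_closed:
  assumes fin: "finite H" "H \<subseteq> square_mats d" and one: "id_mat d \<in> H"
    and mult: "\<And>a b. a \<in> H \<Longrightarrow> b \<in> H \<Longrightarrow> mat_mult d a b \<in> H"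
    and c: "c \<in> H" "c' \<in> square_mats d" "mat_mult d c' c = id_mat d"
  shows "c' \<in> H"
proof -
  have inj: "inj_on (mat_mult d c) H"
    using fin c(3) by (intro inj_onI) (auto intro: mat_mult_left_cancel)
  have "mat_mult d c ` H = H"
    using fin inj mult c by (intro endo_inj_surj) auto
  then obtain h where h: "h \<in> H" "mat_mult d c h = id_mat d" using one by (metis imageE)
  have "c' = h" by (metis c(2,3) h fin(2) mat_mult_assoc mat_mult_id_mat_left mat_mult_id_mat_right subsetD)
  then show ?thesis using h by simp
qed

text \<open>Up to a bounded number, all points have their class in the stabiliser \<open>H\<close>
  of the relations. Since \<open>H\<close> has at most \<open>D\<close> elements and no class holds
  more than Q/D + O(M) points, each class in \<open>H\<close> holds Q/D + O(M). So only the values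
  of \<chi> on \<open>H\<close> matter, and \<open>lam\<close> tells whether \<chi> is trivial
  there.\<close>

lemma character_sum:
  fixes \<chi> :: "(nat \<Rightarrow> nat \<Rightarrow> 'k) \<Rightarrow> complex"
  assumes fin: "finite G" "G \<subseteq> square_mats d" and one: "id_mat d \<in> G"
    and mult: "\<And>a b. a \<in> G \<Longrightarrow> b \<in> G \<Longrightarrow> mat_mult d a b \<in> G"
    and inv: "\<And>c. c \<in> G \<Longrightarrow> \<exists>c'\<in>G. mat_mult d c' c = id_mat d"
    and cls: "\<And>r x. r > 0 \<Longrightarrow> x \<in> pts r \<Longrightarrow> cls r x \<in> G"
    and \<chi>: "\<And>a b. a \<in> G \<Longrightarrow> b \<in> G \<Longrightarrow> \<chi> (mat_mult d a b) = \<chi> a * \<chi> b" "\<And>a. a \<in> G \<Longrightarrow> cmod (\<chi> a) = 1"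
  shows "\<exists>lam\<in>{0, 1}. \<exists>(C::real) N. N > (0::nat) \<and> (\<forall>\<mu>>0. N dvd \<mu> \<longrightarrow> 
    cmod ((\<Sum>x\<in>pts (2 * \<mu>). \<chi> (cls (2 * \<mu>) x)) - lam * of_nat (q ^ (2 * \<mu>))) \<le> C * q ^ \<mu>)"
proof -
  define H where "H = {c \<in> G. \<forall>R\<in>poly_funs d UNIV. R U = 0 \<longrightarrow> R (cU c) = 0}"
  have finH: "finite H" "H \<subseteq> G" "H \<subseteq> square_mats d" using fin by (auto simp: H_def)
  have "card H \<le> D" using finH by (intro card_le_D) (auto simp: H_def)
  have oneH: "id_mat d \<in> H" using one by (simp add: H_def map_mat_id_mat[OF ring_hom_fun_fps_const] mat_mult_id_mat_left)
  have multH: "mat_mult d a b \<in> H" if "a \<in> H" "b \<in> H" for a b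
    unfolding H_def
  proof (intro CollectI conjI ballI impI)
    show "mat_mult d a b \<in> G" using that mult by (auto simp: H_def)
    fix R assume R: "R \<in> poly_funs d UNIV" "R U = 0"
    have "R (cU a) = 0" using that R by (auto simp: H_def)
    moreover have "R' (cU b) = 0" if "R' \<in> poly_funs d UNIV" "R' U = 0" for R'
      using \<open>b \<in> H\<close> that by (auto simp: H_def)
    ultimately have "R (mat_mult d (map_mat fps_const a) (cU b)) = 0"
      using poly_funs_const_mult_mat[OF R(1), of a] by blast
    then show "R (cU (mat_mult d a b)) = 0" by (simp add: mat_mult_assoc map_mat_mat_mult[OF ring_hom_fun_fps_const])
  qed
  have "\<exists>f N. f \<noteq> 0 \<and> N > 0 \<and> 
    (\<forall>r x. N dvd r \<longrightarrow> x ^ (q ^ r) = x \<longrightarrow> cls r x = c \<longrightarrow> poly f x = 0)" if c: "c \<in> G - H" for c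
  proof -
    obtain c' where c': "c' \<in> G" "mat_mult d c' c = id_mat d" using inv c by blast
    \<comment> \<open>For \<open>few_points_outside_stabilizer\<close> it is the inverse c' that
      must violate a relation, whereas c is the matrix known to lie outside \<open>H\<close>; the
      closure of \<open>H\<close> under inverses mediates.\<close>
    have "c' \<notin> H"
    proof
      assume "c' \<in> H"
      obtain c'' where c'': "c'' \<in> G" "mat_mult d c'' c' = id_mat d" using inv c' by blast
      have "c'' \<in> H"
        by (rule invertible_closed[OF finH(1,3) oneH multH \<open>c' \<in> H\<close> _ c''(2)]) (use fin c'' in auto)
      moreover have "c'' = c"
        by (metis DiffD1 c c''(1,2) c'(2) fin(2) mat_mult_assoc mat_mult_id_mat_left mat_mult_id_mat_right subsetD)
      ultimately show False using c by simp
    qed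
    then obtain R where "R \<in> poly_funs d UNIV" "R U = 0" "R (cU c') \<noteq> 0" using c' by (auto simp: H_def)
    moreover have "c \<in> square_mats d" using c fin by auto
    ultimately show ?thesis using c'(2) by (intro few_points_outside_stabilizer) auto
  qed
  then have "\<exists>h. \<forall>c\<in>G - H. fst (h c) \<noteq> 0 \<and> snd (h c) > (0::nat) \<and>
    (\<forall>r x. snd (h c) dvd r \<longrightarrow> x ^ (q ^ r) = x \<longrightarrow> cls r x = c \<longrightarrow> poly (fst (h c)) x = 0)"
    by (intro bchoice) force
  then obtain h where h: "\<And>c. c \<in> G - H \<Longrightarrow> fst (h c) \<noteq> 0 \<and> snd (h c) > (0::nat) \<and>
    (\<forall>r x. snd (h c) dvd r \<longrightarrow> x ^ (q ^ r) = x \<longrightarrow> cls r x = c \<longrightarrow> poly (fst (h c)) x = 0)"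
    by blast
  define f where "f = (\<lambda>c. fst (h c))"
  define N where "N = (\<lambda>c. snd (h c))"
  have fN: "f c \<noteq> 0" "N c > 0" "N c dvd r \<Longrightarrow> x ^ (q ^ r) = x \<Longrightarrow> cls r x = c \<Longrightarrow> poly (f c) x = 0" 
    if "c \<in> G - H" for c r x
    using h[OF that] by (auto simp: f_def N_def)
  define N0 where "N0 = (\<Prod>c\<in>G - H. N c)"
  have N0: "N0 > 0" "\<And>c. c \<in> G - H \<Longrightarrow> N c dvd N0"
    using fN(2) fin by (auto simp: N0_def intro!: prod_pos dvd_prodI)
  define C1 where "C1 = (\<Sum>c\<in>G - H. degree (f c))"
  from class_bound obtain C :: real where "C \<ge> 0 \<and> (\<forall>\<mu>>0. \<forall>c.
      real (card {x\<in>pts (2 * \<mu>). cls (2 * \<mu>) x = c}) \<le> q ^ (2 * \<mu>) / D + C * q ^ \<mu>)"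
    by (elim exE)
  then have C: "C \<ge> 0" "\<And>\<mu> c. \<mu> > 0 \<Longrightarrow>
      real (card {x\<in>pts (2 * \<mu>). cls (2 * \<mu>) x = c}) \<le> q ^ (2 * \<mu>) / D + C * q ^ \<mu>"
    by simp_all
  define lam where "lam = (if \<forall>c\<in>H. \<chi> c = 1 then 1 else 0 :: complex)"
  define C2 where "C2 = real (degree \<Delta>) + C1 + D * C"
  define C3 where "C3 = real (degree \<Delta>) + 2 * C1 + card H * C2"
  have "cmod ((\<Sum>x\<in>pts (2 * \<mu>). \<chi> (cls (2 * \<mu>) x)) - lam * of_nat (q ^ (2 * \<mu>))) \<le> C3 * q ^ \<mu>"
    if \<mu>: "\<mu> > 0" "N0 dvd \<mu>" for \<mu>
  proof -
    define Q where "Q = q ^ (2 * \<mu>)"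
    define M where "M = real (q ^ \<mu>)"
    have "M \<ge> 1" unfolding M_def using q_pos by (simp add: Suc_le_eq)
    define n where "n = (\<lambda>c. card {x\<in>pts (2 * \<mu>). cls (2 * \<mu>) x = c})"
    have finP: "finite (pts (2 * \<mu>))" using \<mu> by (intro finite_pts) auto
    have sub: "cls (2 * \<mu>) ` pts (2 * \<mu>) \<subseteq> G" using cls \<mu> by auto
    have sum_n: "(\<Sum>x\<in>pts (2 * \<mu>). \<chi> (cls (2 * \<mu>) x)) = (\<Sum>c\<in>G. of_nat (n c) * \<chi> c)"
    proof -
      have "(\<Sum>x\<in>pts (2 * \<mu>). \<chi> (cls (2 * \<mu>) x)) = 
          (\<Sum>c\<in>G. \<Sum>x\<in>{x\<in>pts (2 * \<mu>). cls (2 * \<mu>) x = c}. \<chi> (cls (2 * \<mu>) x))"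
        by (rule sum.group [symmetric]) (use finP fin sub in auto)
      also have "\<dots> = (\<Sum>c\<in>G. of_nat (n c) * \<chi> c)"
        by (intro sum.cong) (auto simp: n_def)
      finally show ?thesis .
    qed
    have card_n: "card (pts (2 * \<mu>)) = (\<Sum>c\<in>G. n c)"
    proof -
      have "card (pts (2 * \<mu>)) = (\<Sum>c\<in>G. \<Sum>x\<in>{x\<in>pts (2 * \<mu>). cls (2 * \<mu>) x = c}. 1)"
        by (subst sum.group) (use finP fin sub in auto)
      then show ?thesis by (simp add: n_def)
    qed
    have split: "(\<Sum>c\<in>G. g c) = (\<Sum>c\<in>H. g c) + (\<Sum>c\<in>G - H. g c)" for g :: "_ \<Rightarrow> 'z :: comm_monoid_add"
      using sum.subset_diff[OF finH(2) fin(1), of g] by (simp add: add.commute)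
    have n_out: "n c \<le> degree (f c)" if c: "c \<in> G - H" for c
    proof -
      have "N c dvd 2 * \<mu>" using N0(2)[OF c] \<mu>(2) by (meson dvd_mult dvd_trans)
      then have "n c \<le> card {x. poly (f c) x = 0}"
        unfolding n_def using fN(1,3)[OF c] by (intro card_mono poly_roots_finite) (auto simp: pts_def)
      also have "\<dots> \<le> degree (f c)" by (rule card_poly_roots_bound[OF fN(1)[OF c]])
      finally show ?thesis .
    qed
    have out: "(\<Sum>c\<in>G - H. n c) \<le> C1" unfolding C1_def by (intro sum_mono n_out)
    have outR: "(\<Sum>c\<in>G - H. real (n c)) \<le> C1" using out by (metis of_nat_le_iff of_nat_sum)
    have total: "card (pts (2 * \<mu>)) \<le> Q" "Q \<le> card (pts (2 * \<mu>)) + degree \<Delta>"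
    proof -
      have Q: "card {x :: 'k. x ^ (q ^ (2 * \<mu>)) = x} = Q" "finite {x :: 'k. x ^ (q ^ (2 * \<mu>)) = x}"
        using \<mu> by (simp_all add: card_fixed Q_def)
      show "card (pts (2 * \<mu>)) \<le> Q" 
        unfolding Q(1)[symmetric] by (intro card_mono Q) (auto simp: pts_def)
      have "Q \<le> card (pts (2 * \<mu>) \<union> {x. poly \<Delta> x = 0})"
        unfolding Q(1)[symmetric] using finP \<Delta>_nz by (intro card_mono) (auto simp: pts_def poly_roots_finite)
      also have "\<dots> \<le> card (pts (2 * \<mu>)) + card {x. poly \<Delta> x = 0}" by (rule card_Un_le)
      also have "card {x. poly \<Delta> x = 0} \<le> degree \<Delta>" by (rule card_poly_roots_bound[OF \<Delta>_nz])
      finally show "Q \<le> card (pts (2 * \<mu>)) + degree \<Delta>" by simp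
    qed
    have out_norm: "cmod (\<Sum>c\<in>G - H. of_nat (n c) * \<chi> c) \<le> C1"
    proof -
      have "cmod (\<Sum>c\<in>G - H. of_nat (n c) * \<chi> c) \<le> (\<Sum>c\<in>G - H. real (n c))"
        by (rule sum_norm_le) (simp add: norm_mult \<chi>)
      also have "\<dots> \<le> C1" using out by (metis of_nat_le_iff of_nat_sum)
      finally show ?thesis .
    qed
    have C2_nn: "C2 \<ge> 0" using C by (simp add: C2_def)
    \<comment> \<open>The lower bound for one class: the total minus the few points outside
      \<open>H\<close> and minus the upper bounds for the other classes of \<open>H\<close>, of
      which there are at most D - 1.\<close>
    have dev: "\<bar>real (n c) - Q / D\<bar> \<le> C2 * M" if c: "c \<in> H" for c
    proof -
      have up: "real (n c) \<le> Q / D + C * M" for c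
        using C(2)[OF \<mu>(1), of c] by (simp add: n_def Q_def M_def)
      have "(\<Sum>c\<in>G. n c) = n c + (\<Sum>c\<in>H - {c}. n c) + (\<Sum>c\<in>G - H. n c)"
        using sum.remove[OF finH(1) c, of n] by (simp add: split)
      then have "real (card (pts (2 * \<mu>))) = n c + (\<Sum>c\<in>H - {c}. real (n c)) + (\<Sum>c\<in>G - H. n c)"
        by (simp add: card_n)
      also have "(\<Sum>c\<in>H - {c}. real (n c)) \<le> (\<Sum>c\<in>H - {c}. Q / D + C * M)" by (intro sum_mono up)
      also have "\<dots> = (real (card H) - 1) * (Q / D + C * M)"
      proof -
        have "card H > 0" using finH c by (auto simp: card_gt_0_iff)
        then show ?thesis using finH c by (simp add: of_nat_diff)
      qed
      also have "\<dots> \<le> (real D - 1) * (Q / D + C * M)"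
        using \<open>card H \<le> D\<close> C \<open>M \<ge> 1\<close> by (intro mult_right_mono) auto
      also have "\<dots> = Q - Q / D + (real D - 1) * (C * M)" using D_pos by (simp add: field_simps)
      also have "\<dots> \<le> Q - Q / D + D * (C * M)" using C \<open>M \<ge> 1\<close> by (simp add: algebra_simps)
      finally have "real (card (pts (2 * \<mu>))) \<le> n c + (Q - Q / D + D * (C * M)) + C1" using outR by simp
      with total have lo: "Q / D - real (n c) \<le> degree \<Delta> + C1 + D * C * M" by simp
      have "degree \<Delta> + C1 \<le> (degree \<Delta> + C1) * M" using \<open>M \<ge> 1\<close> mult_left_mono[of 1 M "real (degree \<Delta> + C1)"] by simp
      with lo have lo': "Q / D - real (n c) \<le> C2 * M" by (simp add: C2_def algebra_simps)
      have "C * M \<le> D * (C * M)"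
        using mult_right_mono[of 1 "real D" "C * M"] D_pos C(1) \<open>M \<ge> 1\<close> by simp
      also have "\<dots> \<le> C2 * M" using \<open>M \<ge> 1\<close> by (simp add: C2_def algebra_simps)
      finally show ?thesis using up[of c] lo' by linarith
    qed
    have C3_ge: "real (degree \<Delta> + 2 * C1) + card H * C2 * M \<le> C3 * M"
      using \<open>M \<ge> 1\<close> mult_left_mono[of 1 M "real (degree \<Delta> + 2 * C1)"] by (simp add: C3_def algebra_simps)
    have "cmod ((\<Sum>c\<in>G. of_nat (n c) * \<chi> c) - lam * of_nat Q) \<le> C3 * M"
    proof (cases "\<forall>c\<in>H. \<chi> c = 1")
      case True
      have "(\<Sum>c\<in>H. of_nat (n c) * \<chi> c) = of_nat (\<Sum>c\<in>H. n c)" using True by simp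
      also have "(\<Sum>c\<in>H. n c) = card (pts (2 * \<mu>)) - (\<Sum>c\<in>G - H. n c)" by (simp add: card_n split)
      also have "of_nat \<dots> = of_nat (card (pts (2 * \<mu>))) - (of_nat (\<Sum>c\<in>G - H. n c) :: complex)"
        by (subst of_nat_diff) (simp_all add: card_n split)
      finally have "(\<Sum>c\<in>G. of_nat (n c) * \<chi> c) - lam * of_nat Q = 
          (\<Sum>c\<in>G - H. of_nat (n c) * \<chi> c) - (of_nat (\<Sum>c\<in>G - H. n c) + (of_nat Q - of_nat (card (pts (2 * \<mu>)))))"
        using True by (simp add: split lam_def)
      also have "cmod \<dots> \<le> C1 + (C1 + degree \<Delta>)"
      proof -
        have 1: "cmod (of_nat (\<Sum>c\<in>G - H. n c)) \<le> C1" using out by (simp only: norm_of_nat of_nat_le_iff)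
        have "of_nat Q - of_nat (card (pts (2 * \<mu>))) = (of_nat (Q - card (pts (2 * \<mu>))) :: complex)"
          using total by (simp add: of_nat_diff)
        then have 2: "cmod (of_nat Q - of_nat (card (pts (2 * \<mu>)))) \<le> degree \<Delta>"
          using total by (simp only: norm_of_nat of_nat_le_iff)
        show ?thesis unfolding of_nat_add
          by (rule order_trans[OF norm_triangle_ineq4], rule add_mono[OF out_norm],
              rule order_trans[OF norm_triangle_ineq], rule add_mono[OF 1 2])
      qed
      also have "\<dots> \<le> C3 * M" using C3_ge C2_nn \<open>M \<ge> 1\<close> by (intro order_trans[OF _ C3_ge]) auto
      finally show ?thesis .
    next
      case False
      then obtain h where h: "h \<in> H" "\<chi> h \<noteq> 1" by blast
      have bij: "bij_betw (mat_mult d h) H H"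
      proof -
        obtain h' where h': "h' \<in> G" "mat_mult d h' h = id_mat d" using inv h finH by blast
        have "inj_on (mat_mult d h) H"
          using finH h'(2) by (intro inj_onI) (auto intro: mat_mult_left_cancel)
        then show ?thesis
          using endo_inj_surj[OF finH(1) _ \<open>inj_on (mat_mult d h) H\<close>] multH h by (auto simp: bij_betw_def)
      qed
      have "\<chi> h * (\<Sum>c\<in>H. \<chi> c) = (\<Sum>c\<in>H. \<chi> (mat_mult d h c))"
        unfolding sum_distrib_left using h finH by (intro sum.cong) (auto simp: \<chi> subset_iff)
      also have "\<dots> = (\<Sum>c\<in>H. \<chi> c)" by (rule sum.reindex_bij_betw[OF bij])
      finally have "(\<chi> h - 1) * (\<Sum>c\<in>H. \<chi> c) = 0" by (simp add: algebra_simps)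
      with h have sum0: "(\<Sum>c\<in>H. \<chi> c) = 0" by simp
      have "(\<Sum>c\<in>G. of_nat (n c) * \<chi> c) - lam * of_nat Q = (\<Sum>c\<in>H. of_nat (n c) * \<chi> c) + (\<Sum>c\<in>G - H. of_nat (n c) * \<chi> c)"
        using False by (auto simp: lam_def split)
      also have "(\<Sum>c\<in>H. of_nat (n c) * \<chi> c) = (\<Sum>c\<in>H. of_real (real (n c) - Q / D) * \<chi> c)"
      proof -
        have "(\<Sum>c\<in>H. of_real (Q / D) * \<chi> c) = 0" by (simp only: sum_distrib_left [symmetric] sum0 mult_zero_right)
        then show ?thesis by (simp only: of_real_diff of_real_of_nat_eq left_diff_distrib sum_subtractf diff_zero)
      qed
      also have "cmod (\<dots> + (\<Sum>c\<in>G - H. of_nat (n c) * \<chi> c)) \<le> (\<Sum>c\<in>H. C2 * M) + C1"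
      proof -
        have "cmod (\<Sum>c\<in>H. of_real (real (n c) - Q / D) * \<chi> c) \<le> (\<Sum>c\<in>H. C2 * M)"
        proof (rule sum_norm_le)
          fix c assume c: "c \<in> H"
          then have "cmod (\<chi> c) = 1" using finH \<chi>(2) by auto
          then show "cmod (of_real (real (n c) - Q / D) * \<chi> c) \<le> C2 * M"
            using dev[OF c] by (simp only: norm_mult norm_of_real mult_1_right)
        qed
        then show ?thesis by (rule order_trans[OF norm_triangle_ineq add_mono[OF _ out_norm]])
      qed
      also have "\<dots> \<le> C3 * M" using C3_ge C2_nn \<open>M \<ge> 1\<close> by (intro order_trans[OF _ C3_ge]) auto
      finally show ?thesis .
    qed
    then show ?thesis unfolding sum_n Q_def M_def .
  qed
  then show ?thesis using N0(1) by (intro bexI[of _ lam] exI[of _ C3] exI[of _ N0]) (auto simp: lam_def)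
qed

end

section \<open>Polynomials over a finite field and the algebraic closure\<close>

abbreviation lift_ac :: "'a :: field poly \<Rightarrow> 'a alg_closure poly"
  where "lift_ac \<equiv> map_poly to_ac"

abbreviation (input) XX :: "'a :: comm_ring_1 poly" where "XX \<equiv> [:0, 1:]"

lemma ring_hom_fun_to_ac: "ring_hom_fun to_ac"
  by (auto simp: ring_hom_fun_def)

lemma ring_hom_fun_lift_ac: "ring_hom_fun lift_ac"
  by (rule ring_hom_fun_map_poly[OF ring_hom_fun_to_ac])

lemmas lift_ac_mult = ring_hom_fun_mult[OF ring_hom_fun_lift_ac] and lift_ac_add = ring_hom_fun_add[OF ring_hom_fun_lift_ac]
  and lift_ac_diff = ring_hom_fun_diff[OF ring_hom_fun_lift_ac] and lift_ac_power = ring_hom_fun_power[OF ring_hom_fun_lift_ac]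

lemma coeff_lift_ac [simp]: "coeff (lift_ac f) n = to_ac (coeff f n)"
  by (simp add: coeff_map_poly)

lemma degree_lift_ac [simp]: "degree (lift_ac f) = degree f"
  by (rule degree_map_poly) auto

lemma lift_ac_eq_iff [simp]: "lift_ac f = lift_ac f' \<longleftrightarrow> f = f'"
  by (auto simp: poly_eq_iff)

lemma lift_ac_eq_0_iff [simp]: "lift_ac f = 0 \<longleftrightarrow> f = 0"
  using lift_ac_eq_iff[of f 0] by (simp del: lift_ac_eq_iff)

lemma lift_ac_dvd_iff [simp]: "lift_ac g dvd lift_ac f \<longleftrightarrow> g dvd f"
proof
  assume "g dvd f" then show "lift_ac g dvd lift_ac f" by (auto simp: dvd_def lift_ac_mult)
next
  assume dvd: "lift_ac g dvd lift_ac f"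
  show "g dvd f"
  proof (cases "g = 0")
    case False
    have "lift_ac (f mod g) = lift_ac f - lift_ac g * lift_ac (f div g)"
      by (simp add: lift_ac_mult [symmetric] lift_ac_diff [symmetric] minus_mult_div_eq_mod)
    then have "lift_ac g dvd lift_ac (f mod g)" using dvd by simp
    moreover have "f mod g = 0 \<or> degree (lift_ac (f mod g)) < degree (lift_ac g)"
      using degree_mod_less[OF False] by auto
    ultimately have "f mod g = 0" by (meson dvd_imp_degree_le lift_ac_eq_0_iff linorder_not_le)
    then show ?thesis by (simp add: dvd_eq_mod_eq_0)
  qed (use dvd in auto)
qed

lemma lift_ac_reflect: "lift_ac (reflect_poly f) = reflect_poly (lift_ac f)"
  by (intro poly_eqI) (simp add: coeff_reflect_poly)

lemma lift_ac_XX [simp]: "lift_ac XX = XX"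
  by (simp add: map_poly_pCons)

lemma card_ge_2: "CARD('a :: finite_field) \<ge> 2"
proof -
  have "card {0, 1 :: 'a} \<le> CARD('a)" by (intro card_mono) auto
  then show ?thesis by simp
qed

lemma char_ac: "prime CHAR('a :: finite_field alg_closure)"
  "CARD('a) = CHAR('a alg_closure) ^ ff_degree TYPE('a)" "ff_degree TYPE('a) > 0"
proof -
  show "prime CHAR('a alg_closure)" by simp
  show *: "CARD('a) = CHAR('a alg_closure) ^ ff_degree TYPE('a)" using ff_degree[where 'a = 'a] by simp
  show "ff_degree TYPE('a) > 0" using * card_ge_2[where 'a = 'a] by (cases "ff_degree TYPE('a)") auto
qed

lemmas frob_ac_add = frob_add[OF char_ac(1,2)] and frob_ac_minus = frob_minus[OF char_ac(1,2)]
  and frob_ac_diff = frob_diff[OF char_ac(1,2)]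

lemma ring_hom_fun_frob_ac: "ring_hom_fun (\<lambda>z :: 'a :: finite_field alg_closure. z ^ (CARD('a) ^ s))"
  by (auto simp: ring_hom_fun_def frob_ac_add power_mult_distrib power_0_left)

lemma of_nat_card_ac: "r > 0 \<Longrightarrow> of_nat (CARD('a :: finite_field) ^ r) = (0 :: 'a alg_closure)"
proof -
  assume r: "r > 0"
  have "CHAR('a alg_closure) dvd CARD('a)" using char_ac[where 'a = 'a] by (metis dvd_power)
  then have "CHAR('a alg_closure) dvd CARD('a) ^ r" using r by (meson dvd_power dvd_trans)
  then show ?thesis by (simp only: of_nat_eq_0_iff_char_dvd)
qed

lemma card_frob_ac:
  assumes "r > 0"
  shows "finite {x :: 'a :: finite_field alg_closure. x ^ (CARD('a) ^ r) = x}"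
    "card {x :: 'a :: finite_field alg_closure. x ^ (CARD('a) ^ r) = x} = CARD('a) ^ r"
proof -
  have "CARD('a) ^ r > 1" using card_ge_2[where 'a = 'a] assms by (intro one_less_power) auto
  then show "finite {x :: 'a alg_closure. x ^ (CARD('a) ^ r) = x}"
    "card {x :: 'a alg_closure. x ^ (CARD('a) ^ r) = x} = CARD('a) ^ r"
    using card_frob_fixed[OF of_nat_card_ac[OF assms, where 'a = 'a]] by auto
qed

lemma frob_fixed_iff: "(z :: 'a :: finite_field alg_closure) ^ CARD('a) = z \<longleftrightarrow> z \<in> range to_ac"
proof -
  have sub: "range to_ac \<subseteq> {z :: 'a alg_closure. z ^ CARD('a) = z}"
    by (auto simp: to_ac_power [symmetric] finite_field_power_card_eq_same simp del: to_ac_power)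
  have "card (range (to_ac :: 'a \<Rightarrow> _)) = CARD('a)" by (rule card_image) (rule inj_to_ac)
  then have "range to_ac = {z :: 'a alg_closure. z ^ CARD('a) = z}"
    using card_frob_ac[of 1, where 'a = 'a] by (intro card_subset_eq sub) auto
  then show ?thesis by blast
qed

lemma frob_power_mult: "(z :: 'a :: finite_field alg_closure) ^ (CARD('a) ^ r) = z \<Longrightarrow> z ^ (CARD('a) ^ (r * k)) = z"
  by (induction k) (auto simp: power_add power_mult)

lemma frob_ac_inj: "(x :: 'a :: finite_field alg_closure) ^ (CARD('a) ^ s) = y ^ (CARD('a) ^ s) \<Longrightarrow> x = y"
proof -
  assume "x ^ (CARD('a) ^ s) = y ^ (CARD('a) ^ s)"
  then have "(x - y) ^ (CARD('a) ^ s) = 0" by (simp add: frob_ac_diff)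
  then show ?thesis by simp
qed

lemma poly_frob: "poly (lift_ac f) (x ^ (CARD('a) ^ s)) = poly (lift_ac f) x ^ (CARD('a) ^ s)"
  for f :: "'a :: finite_field poly"
proof -
  have *: "to_ac c ^ (CARD('a) ^ s) = to_ac c" for c :: 'a
    using finite_field_power_card_power_eq_same[of "CARD('a) ^ s" s c] by (simp flip: to_ac_power)
  show ?thesis
    unfolding poly_altdef ring_hom_fun_sum[OF ring_hom_fun_frob_ac] 
    by (simp add: power_mult_distrib * power_mult [symmetric] mult.commute)
qed

lemma ac_frob_periodic: "\<exists>n>0. (z :: 'a :: finite_field alg_closure) ^ (CARD('a) ^ n) = z"
proof -
  obtain p :: "'a poly" where p: "p \<noteq> 0" "poly (lift_ac p) z = 0" by (rule alg_closure_algebraic)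
  have "range (\<lambda>i. z ^ (CARD('a) ^ i)) \<subseteq> {x. poly (lift_ac p) x = 0}"
    using p(2) by (auto simp: poly_frob)
  then have "finite (range (\<lambda>i. z ^ (CARD('a) ^ i)))"
    using p(1) poly_roots_finite finite_subset by (metis lift_ac_eq_0_iff)
  then have "\<not> inj (\<lambda>i. z ^ (CARD('a) ^ i))" using finite_imageD infinite_UNIV_nat by blast
  then obtain i j where ij: "i < j" "z ^ (CARD('a) ^ i) = z ^ (CARD('a) ^ j)"
    unfolding inj_def by (metis linorder_neqE_nat)
  have "z ^ (CARD('a) ^ j) = (z ^ (CARD('a) ^ (j - i))) ^ (CARD('a) ^ i)"
    using ij(1) by (simp add: power_mult [symmetric] power_add [symmetric])
  with ij(2) have "z ^ (CARD('a) ^ (j - i)) = z" by (metis frob_ac_inj)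
  then show ?thesis using ij(1) by (intro exI[of _ "j - i"]) auto
qed

section \<open>Norms of linear polynomials\<close>

definition lin_norm :: "nat \<Rightarrow> 'a :: finite_field alg_closure \<Rightarrow> 'a alg_closure poly"
  where "lin_norm r x = (\<Prod>i<r. [:- (x ^ (CARD('a) ^ i)), 1:])"

text \<open>If x is fixed by the q^r-th power map, with q = \<open>CARD('a)\<close>, this is the
  norm to F_q[t] of the linear polynomial with root x, a power of the minimal polynomial of
  x.\<close>

definition norm_poly :: "nat \<Rightarrow> 'a :: finite_field alg_closure \<Rightarrow> 'a poly"
  where "norm_poly r x = map_poly of_ac (lin_norm r x)"

lemma lift_ac_map_of_ac:
  fixes p :: "'a :: finite_field alg_closure poly"
  assumes "map_poly (\<lambda>z. z ^ CARD('a)) p = p"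
  shows "lift_ac (map_poly of_ac p) = p"
proof (rule poly_eqI)
  fix n
  have "coeff p n ^ CARD('a) = coeff p n"
    using arg_cong[OF assms, of "\<lambda>p. coeff p n"] by (simp add: coeff_map_poly power_0_left)
  then show "coeff (lift_ac (map_poly of_ac p)) n = coeff p n"
    by (simp add: frob_fixed_iff to_ac_of_ac coeff_map_poly)
qed

lemma lin_norm_frob:
  fixes x :: "'a :: finite_field alg_closure"
  shows "map_poly (\<lambda>z. z ^ (CARD('a) ^ s)) (lin_norm r x) = lin_norm r (x ^ (CARD('a) ^ s))"
  unfolding lin_norm_def ring_hom_fun_prod[OF ring_hom_fun_map_poly[OF ring_hom_fun_frob_ac]]
  by (intro prod.cong refl)
     (simp add: map_poly_pCons power_0_left frob_ac_minus power_mult [symmetric] mult.commute)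

lemma lin_norm_frob_shift:
  fixes x :: "'a :: finite_field alg_closure"
  assumes "x ^ (CARD('a) ^ r) = x"
  shows "lin_norm r (x ^ CARD('a)) = lin_norm r x"
proof (cases r)
  case (Suc r')
  have 1: "lin_norm (Suc r') (x ^ CARD('a)) = (\<Prod>i<r'. [:- (x ^ (CARD('a) ^ Suc i)), 1:]) * [:- (x ^ (CARD('a) ^ r)), 1:]"
    by (simp add: lin_norm_def power_mult [symmetric] Suc)
  have "lin_norm (Suc r') x = (\<Prod>i<r'. [:- (x ^ (CARD('a) ^ Suc i)), 1:]) * [:- x, 1:]"
    unfolding lin_norm_def prod.lessThan_Suc_shift by simp
  with 1 assms Suc show ?thesis by simp
qed (simp add: lin_norm_def)

lemma lift_ac_norm_poly:
  fixes x :: "'a :: finite_field alg_closure"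
  assumes "x ^ (CARD('a) ^ r) = x"
  shows "lift_ac (norm_poly r x) = lin_norm r x"
  unfolding norm_poly_def
  by (rule lift_ac_map_of_ac) (use lin_norm_frob[of 1 r x] lin_norm_frob_shift[OF assms] in simp)

lemma lin_norm_monic: "lead_coeff (lin_norm r x) = 1" "degree (lin_norm r x) = r"
proof -
  show "lead_coeff (lin_norm r x) = 1" by (simp add: lin_norm_def lead_coeff_prod)
  show "degree (lin_norm r x) = r" unfolding lin_norm_def by (subst degree_prod_sum_eq) auto
qed

lemma norm_poly_monic:
  fixes x :: "'a :: finite_field alg_closure"
  assumes "x ^ (CARD('a) ^ r) = x"
  shows "lead_coeff (norm_poly r x) = 1" "degree (norm_poly r x) = r"
proof -
  have "degree (lift_ac (norm_poly r x)) = r" unfolding lift_ac_norm_poly[OF assms] by (rule lin_norm_monic)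
  then show d: "degree (norm_poly r x) = r" by simp
  have "lead_coeff (lift_ac (norm_poly r x)) = 1" unfolding lift_ac_norm_poly[OF assms] by (rule lin_norm_monic)
  then show "lead_coeff (norm_poly r x) = 1" by (metis coeff_lift_ac degree_lift_ac of_ac_to_ac of_ac_eqI to_ac_1)
qed

lemma lin_norm_add:
  fixes x :: "'a :: finite_field alg_closure"
  shows "lin_norm (r + s) x = lin_norm r x * lin_norm s (x ^ (CARD('a) ^ r))"
proof (induction s)
  case (Suc s)
  then show ?case by (simp add: lin_norm_def power_mult [symmetric] power_add mult_ac)
qed (simp add: lin_norm_def)

lemma lin_norm_mult:
  fixes x :: "'a :: finite_field alg_closure"
  assumes "x ^ (CARD('a) ^ r) = x"
  shows "lin_norm (r * n) x = lin_norm r x ^ n"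
proof (induction n)
  case (Suc n)
  then show ?case using lin_norm_add[of r "r * n" x] by (simp add: assms)
qed (simp add: lin_norm_def)

section \<open>Congruence classes of monic polynomials\<close>

text \<open>
  Two monic polynomials are equivalent if they agree modulo \<open>g\<close> and if their first \<open>k\<close>
  coefficients, starting with the leading one, agree.
\<close>

definition ray_equiv :: "'a :: field poly \<Rightarrow> nat \<Rightarrow> 'a poly \<Rightarrow> 'a poly \<Rightarrow> bool"
  where "ray_equiv g k f f' \<longleftrightarrow> g dvd f - f' \<and> XX ^ k dvd reflect_poly f - reflect_poly f'"

lemma ray_equiv_sym: "ray_equiv g k f f' \<Longrightarrow> ray_equiv g k f' f"
  by (simp add: ray_equiv_def dvd_diff_commute)

lemma ray_equiv_refl [simp]: "ray_equiv g k f f"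
  by (simp add: ray_equiv_def)

lemma ray_equiv_mult: "ray_equiv g k f f' \<Longrightarrow> ray_equiv g k h h' \<Longrightarrow> ray_equiv g k (f * h) (f' * h')"
  by (simp add: ray_equiv_def reflect_poly_mult dvd_mult_diff)

lemma finite_polys: "finite {p :: 'a :: {finite, zero} poly. degree p \<le> n}"
proof (rule finite_imageD)
  show "finite (coeffs ` {p :: 'a poly. degree p \<le> n})"
    by (rule finite_subset[OF _ finite_lists_length_le[of "UNIV :: 'a set" "Suc n"]])
       (auto simp: coeffs_def)
  show "inj_on coeffs {p :: 'a poly. degree p \<le> n}"
    by (intro inj_onI) (simp add: coeffs_eq_iff)
qed

definition ray_class :: "'a :: field poly \<Rightarrow> nat \<Rightarrow> 'a poly \<Rightarrow> 'a poly \<times> 'a poly"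
  where "ray_class g k f = (f mod g, reflect_poly f mod XX ^ k)"

lemma ray_equiv_iff_ray_class: "ray_equiv g k f f' \<longleftrightarrow> ray_class g k f = ray_class g k f'"
  by (auto simp: ray_equiv_def ray_class_def mod_eq_dvd_iff)

lemma ray_equiv_trans: "ray_equiv g k f f' \<Longrightarrow> ray_equiv g k f' f'' \<Longrightarrow> ray_equiv g k f f''"
  by (simp add: ray_equiv_iff_ray_class)

lemma finite_ray_class:
  fixes g :: "'a :: {finite, field} poly"
  assumes "g \<noteq> 0"
  shows "finite (range (ray_class g k))"
proof (rule finite_subset)
  show "finite ({p :: 'a poly. degree p \<le> degree g} \<times> {p :: 'a poly. degree p \<le> k})"
    by (intro finite_cartesian_product finite_polys)
  have "degree (f mod g) \<le> degree g" for f using degree_mod_less[OF assms, of f] by auto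
  moreover have "degree (f mod XX ^ k) \<le> k" for f :: "'a poly"
    using degree_mod_less[of "XX ^ k :: 'a poly" f] by (auto simp: degree_power_eq)
  ultimately show "range (ray_class g k) \<subseteq> {p :: 'a poly. degree p \<le> degree g} \<times> {p :: 'a poly. degree p \<le> k}"
    by (auto simp: ray_class_def)
qed

lemma poly_bezout:
  fixes a b :: "'a :: field poly"
  assumes "coprime a b"
  shows "\<exists>u v. u * a + v * b = 1"
proof -
  define J where "J = {u * a + v * b |u v. True}"
  have J_diff: "x - z * y \<in> J" if xy: "x \<in> J" "y \<in> J" for x y z
  proof -
    from xy obtain u v u' v' where "x = u * a + v * b" "y = u' * a + v' * b" by (auto simp: J_def)
    then have "x - z * y = (u - z * u') * a + (v - z * v') * b" by (simp add: algebra_simps)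
    then show ?thesis unfolding J_def by blast
  qed
  have ab: "a \<in> J" "b \<in> J"
    unfolding J_def by (rule CollectI, rule exI[of _ 1], rule exI[of _ 0], simp,
      rule CollectI, rule exI[of _ 0], rule exI[of _ 1], simp)
  have "a \<noteq> 0 \<or> b \<noteq> 0" using assms by auto
  then have "\<exists>n. \<exists>x\<in>J. x \<noteq> 0 \<and> degree x = n" using ab by auto
  from LeastI_ex[OF this] obtain x where x: "x \<in> J" "x \<noteq> 0"
    "degree x = (LEAST n. \<exists>x\<in>J. x \<noteq> 0 \<and> degree x = n)" by blast
  have min: "degree x \<le> degree y" if "y \<in> J" "y \<noteq> 0" for y
    unfolding x(3) by (rule Least_le) (use that in auto)
  have dvd: "x dvd y" if "y \<in> J" for y
  proof -
    have "y mod x = y - (y div x) * x" by (simp add: minus_div_mult_eq_mod)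
    then have "y mod x \<in> J" using J_diff[OF that x(1)] by simp
    then have "y mod x = 0" using min[of "y mod x"] degree_mod_less[OF x(2), of y] by (meson linorder_not_le)
    then show ?thesis by (simp add: dvd_eq_mod_eq_0)
  qed
  have "x dvd 1" using assms dvd ab by (auto dest: coprime_common_divisor)
  then obtain z where "1 = x * z" by (elim dvdE)
  moreover obtain u v where "x = u * a + v * b" using x(1) by (auto simp: J_def)
  ultimately have "(z * u) * a + (z * v) * b = 1" by (simp add: algebra_simps)
  then show ?thesis by blast
qed

lemma coprime_dvd_cancel_left:
  fixes a b c :: "'a :: field poly"
  assumes "coprime a b" "a dvd b * c"
  shows "a dvd c"
proof -
  obtain u v where "u * a + v * b = 1" using poly_bezout[OF assms(1)] by blast
  then have "c = (u * a + v * b) * c" by simp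
  also have "\<dots> = a * (u * c) + v * (b * c)" by (simp add: algebra_simps)
  also have "a dvd \<dots>" using assms(2) by (intro dvd_add dvd_mult[of a "b * c"]) auto
  finally show ?thesis .
qed

lemma coprime_mult_right: "coprime a b \<Longrightarrow> coprime a c \<Longrightarrow> coprime a (b * c)"
  for a b c :: "'a :: field poly"
proof (rule coprimeI)
  fix d assume *: "coprime a b" "coprime a c" "d dvd a" "d dvd b * c"
  have "coprime d b" using *(1,3) by (meson coprime_divisors dvd_refl)
  then have "d dvd c" using *(4) by (rule coprime_dvd_cancel_left)
  with * show "is_unit d" by (auto dest: coprime_common_divisor)
qed

lemma coprime_power_right: "coprime a b \<Longrightarrow> coprime a (b ^ n)"
  for a b :: "'a :: field poly"
  by (induction n) (auto intro: coprime_mult_right)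

lemma coprime_XX_power: 
  fixes p :: "'a :: field poly"
  assumes "coeff p 0 \<noteq> 0"
  shows "coprime (XX ^ k) p"
proof -
  have "coprime p XX"
  proof (rule coprimeI)
    fix c assume c: "c dvd p" "c dvd XX"
    obtain a r where p: "p = pCons a r" by (cases p)
    have "c dvd p - XX * r" using c by (intro dvd_diff dvd_mult2)
    also have "p - XX * r = [:a:]" by (simp add: p)
    also have "\<dots> dvd 1" using assms p by (simp add: is_unit_const_poly_iff dvd_field_iff)
    finally show "is_unit c" .
  qed
  from coprime_power_right[OF this, of k] show ?thesis by (simp add: coprime_commute)
qed

text \<open>Two powers of f share a class, and f can be cancelled: modulo g by coprimality, modulo
  X^k because the reflection of a monic polynomial has constant term 1.\<close>

lemma ex_power_ray_equiv_1:
  fixes f g :: "'a :: finite_field poly"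
  assumes "g \<noteq> 0" "lead_coeff f = 1" "coprime f g"
  shows "\<exists>n>0. ray_equiv g k (f ^ n) 1"
proof -
  have "finite (range (\<lambda>n. ray_class g k (f ^ n)))"
    by (rule finite_subset[OF _ finite_ray_class[OF assms(1), of k]]) auto
  then have "\<not> inj (\<lambda>n. ray_class g k (f ^ n))" using finite_imageD infinite_UNIV_nat by blast
  then obtain i j where ij: "i < j" "ray_equiv g k (f ^ j) (f ^ i)"
    unfolding inj_def ray_equiv_iff_ray_class by (metis linorder_neqE_nat)
  have f: "f ^ j = f ^ i * f ^ (j - i)" using ij(1) by (simp add: power_add [symmetric])
  have "g dvd f ^ i * (f ^ (j - i) - 1)" using ij(2) f by (simp add: ray_equiv_def algebra_simps)
  moreover have "coprime g f" using assms(3) by (simp add: coprime_commute)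
  ultimately have 1: "g dvd f ^ (j - i) - 1"
    using coprime_dvd_cancel_left[OF coprime_power_right] by blast
  have "XX ^ k dvd reflect_poly (f ^ i) * (reflect_poly (f ^ (j - i)) - 1)"
    using ij(2) f by (simp add: ray_equiv_def algebra_simps reflect_poly_mult)
  moreover have "coprime (XX ^ k) (reflect_poly (f ^ i))"
    using assms(2) by (intro coprime_XX_power) (simp add: lead_coeff_power)
  ultimately have 2: "XX ^ k dvd reflect_poly (f ^ (j - i)) - 1" by (rule coprime_dvd_cancel_left[rotated])
  show ?thesis using ij(1) 1 2 by (intro exI[of _ "j - i"]) (auto simp: ray_equiv_def)
qed

section \<open>Multiplication matrices\<close>

definition mod_mat :: "'k :: field poly \<Rightarrow> 'k poly \<Rightarrow> nat \<Rightarrow> nat \<Rightarrow> 'k"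
  where "mod_mat G f i j = coeff ((f * XX ^ j) mod G) i"

text \<open>
  Multiplication by \<open>f\<close> modulo \<open>G\<close>, together with multiplication by the reversed polynomial
  modulo \<open>X\<^sup>k\<close>, which records the leading coefficients of \<open>f\<close>.
\<close>

definition ray_matrix :: "'k :: field poly \<Rightarrow> nat \<Rightarrow> 'k poly \<Rightarrow> nat \<Rightarrow> nat \<Rightarrow> 'k"
  where "ray_matrix G k f = (\<lambda>i j. let n = degree G in
    if i < n \<and> j < n then mod_mat G f i j
    else if n \<le> i \<and> n \<le> j \<and> i < n + k \<and> j < n + k then mod_mat (XX ^ k) (reflect_poly f) (i - n) (j - n)
    else 0)"

lemma coeff_mod_sum:
  fixes G :: "'k :: field poly"
  shows "coeff ((\<Sum>x\<in>A. smult (c x) (p x)) mod G) i = (\<Sum>x\<in>A. c x * coeff (p x mod G) i)"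
  by (induction A rule: infinite_finite_induct) (auto simp: poly_mod_add_left mod_smult_left)

lemma poly_sum_powers:
  fixes p :: "'k :: field poly"
  assumes "\<And>l. l \<ge> n \<Longrightarrow> coeff p l = 0"
  shows "p = (\<Sum>l<n. smult (coeff p l) (XX ^ l))"
proof (rule poly_eqI)
  fix i
  have "coeff (\<Sum>l<n. smult (coeff p l) (XX ^ l)) i = (\<Sum>l<n. if l = i then coeff p l else 0)"
    unfolding coeff_sum by (intro sum.cong) (auto simp: monom_altdef [symmetric] smult_monom)
  also have "\<dots> = coeff p i" using assms by (auto simp: not_less)
  finally show "coeff p i = coeff (\<Sum>l<n. smult (coeff p l) (XX ^ l)) i" by simp
qed

lemma coeff_mod_ge:
  assumes "G \<noteq> 0" "l \<ge> degree G"
  shows "coeff (p mod G) l = (0 :: 'k :: field)"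
  using degree_mod_less[OF assms(1), of p] assms(2) by (auto intro: coeff_eq_0)

lemma mod_mat_mult:
  assumes "G \<noteq> (0 :: 'k :: field poly)"
  shows "(\<Sum>l<degree G. mod_mat G f i l * mod_mat G f' l j) = mod_mat G (f * f') i j"
proof -
  define p where "p = (f' * XX ^ j) mod G"
  have p: "p = (\<Sum>l<degree G. smult (coeff p l) (XX ^ l))"
    unfolding p_def by (rule poly_sum_powers) (rule coeff_mod_ge[OF assms])
  have "mod_mat G (f * f') i j = coeff ((f * p) mod G) i"
    by (simp add: mod_mat_def p_def mod_mult_right_eq mult.assoc)
  also have "f * p = (\<Sum>l<degree G. smult (coeff p l) (f * XX ^ l))"
    by (subst p) (simp add: sum_distrib_left)
  also have "coeff (\<dots> mod G) i = (\<Sum>l<degree G. coeff p l * mod_mat G f i l)"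
    by (simp add: coeff_mod_sum mod_mat_def)
  finally show ?thesis by (simp add: mod_mat_def p_def mult.commute)
qed

lemma mod_mat_1: "j < degree G \<Longrightarrow> mod_mat G 1 i j = (if i = j then 1 else 0 :: 'k :: field)"
proof -
  assume j: "j < degree G"
  have "(XX ^ j) mod G = (XX ^ j :: 'k poly)"
    using j by (intro mod_poly_less) (simp add: degree_power_eq)
  then show ?thesis by (simp add: mod_mat_def monom_altdef [symmetric] flip: monom_altdef[of 1, simplified])
      (simp add: coeff_linear_power monom_altdef [of 1, simplified, symmetric])
qed

lemma sum_lessThan_add_nat: "(\<Sum>l<n + k. f l) = (\<Sum>l<n. f l) + (\<Sum>l<k. f (n + l) :: 'z :: comm_monoid_add)" for n k :: nat
  by (induction k) (auto simp: add.assoc)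

lemma ray_matrix_square_mats: "ray_matrix G k f \<in> square_mats (degree G + k)"
  by (auto simp: ray_matrix_def square_mats_def Let_def)

lemma XX_power_nz [simp]: "(XX :: 'k :: field poly) ^ k \<noteq> 0"
  by simp

lemma degree_XX_power [simp]: "degree ((XX :: 'k :: field poly) ^ k) = k"
  by (simp add: degree_power_eq)

lemma ray_matrix_mult:
  assumes "G \<noteq> (0 :: 'k :: field poly)"
  shows "mat_mult (degree G + k) (ray_matrix G k f) (ray_matrix G k f') = ray_matrix G k (f * f')"
proof (rule square_mats_eqI)
  define n where "n = degree G"
  fix i j assume ij: "i < degree G + k" "j < degree G + k"
  have "mat_mult (degree G + k) (ray_matrix G k f) (ray_matrix G k f') i j = 
      (\<Sum>l<n. ray_matrix G k f i l * ray_matrix G k f' l j) + (\<Sum>l<k. ray_matrix G k f i (n + l) * ray_matrix G k f' (n + l) j)"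
    using ij by (simp add: mat_mult_def sum_lessThan_add_nat n_def)
  also have "\<dots> = ray_matrix G k (f * f') i j"
  proof (cases "i < n")
    case True
    then have "(\<Sum>l<k. ray_matrix G k f i (n + l) * ray_matrix G k f' (n + l) j) = 0"
      by (intro sum.neutral) (auto simp: ray_matrix_def n_def Let_def)
    moreover have "(\<Sum>l<n. ray_matrix G k f i l * ray_matrix G k f' l j) = ray_matrix G k (f * f') i j"
      using True mod_mat_mult[OF assms, of f i f' j] by (cases "j < n") (auto simp: ray_matrix_def n_def Let_def)
    ultimately show ?thesis by simp
  next
    case False
    then have "(\<Sum>l<n. ray_matrix G k f i l * ray_matrix G k f' l j) = 0"
      by (intro sum.neutral) (auto simp: ray_matrix_def n_def Let_def)
    moreover have "(\<Sum>l<k. ray_matrix G k f i (n + l) * ray_matrix G k f' (n + l) j) = ray_matrix G k (f * f') i j"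
    proof (cases "j < n")
      case True
      then show ?thesis using False by (auto simp: ray_matrix_def n_def Let_def)
    next
      case j: False
      have "(\<Sum>l<k. ray_matrix G k f i (n + l) * ray_matrix G k f' (n + l) j) = 
          (\<Sum>l<k. mod_mat (XX ^ k) (reflect_poly f) (i - n) l * mod_mat (XX ^ k) (reflect_poly f') l (j - n))"
        using False j ij by (intro sum.cong) (auto simp: ray_matrix_def n_def Let_def)
      also have "\<dots> = mod_mat (XX ^ k) (reflect_poly (f * f')) (i - n) (j - n)"
        using mod_mat_mult[of "XX ^ k" "reflect_poly f" "i - n" "reflect_poly f'" "j - n"]
        by (simp add: reflect_poly_mult)
      finally show ?thesis using False j ij by (auto simp: ray_matrix_def n_def Let_def)
    qed
    ultimately show ?thesis by simp
  qed
  finally show "mat_mult (degree G + k) (ray_matrix G k f) (ray_matrix G k f') i j = ray_matrix G k (f * f') i j" .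
qed (auto simp: ray_matrix_square_mats)

lemma ray_matrix_1: "ray_matrix G k 1 = id_mat (degree G + k)"
  by (rule square_mats_eqI[OF ray_matrix_square_mats id_mat_in_square_mats]) (auto simp: ray_matrix_def Let_def id_mat_def mod_mat_1)

lemma ray_matrix_ray_equiv: "ray_equiv G k f f' \<Longrightarrow> ray_matrix G k f = ray_matrix G k f'"
proof -
  have *: "mod_mat H f = mod_mat H f'" if "H dvd f - f'" for H f f' :: "'a :: field poly"
  proof (intro ext)
    fix i j
    have "H dvd f * XX ^ j - f' * XX ^ j" using that by (simp add: left_diff_distrib [symmetric] dvd_mult2)
    then show "mod_mat H f i j = mod_mat H f' i j" by (simp add: mod_mat_def mod_eq_dvd_iff [symmetric])
  qed
  assume "ray_equiv G k f f'"
  then show ?thesis using *[of G f f'] *[of "XX ^ k" "reflect_poly f" "reflect_poly f'"]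
    by (auto simp: ray_matrix_def ray_equiv_def Let_def intro!: ext)
qed

lemma ray_equiv_ray_matrix:
  assumes "ray_matrix G k f = ray_matrix G k f'" "G \<noteq> (0 :: 'k :: field poly)"
  shows "ray_equiv G k f f'"
  unfolding ray_equiv_def
proof
  have *: "H dvd f - f'" if "\<And>i. i < degree H \<Longrightarrow> mod_mat H f i 0 = mod_mat H f' i 0" "H \<noteq> 0" for H f f' :: "'k poly"
  proof -
    have "f mod H = f' mod H"
    proof (rule poly_eqI)
      fix i show "coeff (f mod H) i = coeff (f' mod H) i"
        using that(1)[of i] coeff_mod_ge[OF that(2), of i] by (cases "i < degree H") (auto simp: mod_mat_def)
    qed
    then show ?thesis by (simp add: mod_eq_dvd_iff)
  qed
  show "G dvd f - f'"
  proof (rule *)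
    fix i assume "i < degree G"
    then show "mod_mat G f i 0 = mod_mat G f' i 0"
      using fun_cong[OF fun_cong[OF assms(1), of i], of 0] by (auto simp: ray_matrix_def Let_def)
  qed (rule assms)
  show "XX ^ k dvd reflect_poly f - reflect_poly f'"
  proof (rule *)
    fix i assume "i < degree (XX ^ k :: 'k poly)"
    then show "mod_mat (XX ^ k) (reflect_poly f) i 0 = mod_mat (XX ^ k) (reflect_poly f') i 0"
      using fun_cong[OF fun_cong[OF assms(1), of "degree G + i"], of "degree G"] by (auto simp: ray_matrix_def Let_def)
  qed simp
qed

text \<open>The contribution of the l-th power of the variable to the matrix of a polynomial of
  degree m, whose reflection turns it into the power m - l. Once the matrix is linear in the
  coefficients of the polynomial, Frobenius and specialisation can be carried out on these.\<close>

definition Lam :: "'k :: field poly \<Rightarrow> nat \<Rightarrow> nat \<Rightarrow> nat \<Rightarrow> nat \<Rightarrow> nat \<Rightarrow> 'k"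
  where "Lam G k m l i j = (let n = degree G in
    if i < n \<and> j < n then coeff (XX ^ (l + j) mod G) i
    else if n \<le> i \<and> n \<le> j \<and> i < n + k \<and> j < n + k then coeff (XX ^ (m - l + (j - n)) mod XX ^ k) (i - n)
    else 0)"

lemma ray_matrix_linear:
  assumes "degree f = m"
  shows "ray_matrix G k f i j = (\<Sum>l\<le>m. coeff f l * Lam G k m l i j)"
proof -
  have f: "f = (\<Sum>l\<le>m. smult (coeff f l) (XX ^ l))"
    using poly_sum_powers[of "Suc m" f] assms by (simp add: lessThan_Suc_atMost coeff_eq_0)
  have rf: "reflect_poly f = (\<Sum>l\<le>m. smult (coeff f l) (XX ^ (m - l)))"
  proof (rule poly_eqI)
    fix i
    have "coeff (\<Sum>l\<le>m. smult (coeff f l) (XX ^ (m - l))) i = (\<Sum>l\<le>m. if m - l = i then coeff f l else 0)"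
      unfolding coeff_sum by (intro sum.cong) (auto simp: monom_altdef [symmetric] smult_monom)
    also have "\<dots> = (\<Sum>l\<le>m. if l = m - i then (if i \<le> m then coeff f l else 0) else 0)"
      by (intro sum.cong) auto
    also have "\<dots> = (if i \<le> m then coeff f (m - i) else 0)" by simp
    finally show "coeff (reflect_poly f) i = coeff (\<Sum>l\<le>m. smult (coeff f l) (XX ^ (m - l))) i"
      using assms by (simp add: coeff_reflect_poly)
  qed
  have b1: "mod_mat G f i j = (\<Sum>l\<le>m. coeff f l * coeff (XX ^ (l + j) mod G) i)" for i j
  proof -
    have "f * XX ^ j = (\<Sum>l\<le>m. smult (coeff f l) (XX ^ (l + j)))"
      by (subst f) (simp add: sum_distrib_right power_add)
    then show ?thesis by (simp add: mod_mat_def coeff_mod_sum)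
  qed
  have b2: "mod_mat H (reflect_poly f) i j = (\<Sum>l\<le>m. coeff f l * coeff (XX ^ (m - l + j) mod H) i)" for i j H
  proof -
    have "reflect_poly f * XX ^ j = (\<Sum>l\<le>m. smult (coeff f l) (XX ^ (m - l + j)))"
      unfolding sum_distrib_right by (subst rf, unfold sum_distrib_right, intro sum.cong refl) (simp only: mult_smult_left power_add)
    then show ?thesis by (simp add: mod_mat_def coeff_mod_sum)
  qed
  show ?thesis by (auto simp: ray_matrix_def Lam_def Let_def b1 b2)
qed

lemma lift_ac_mod:
  assumes "g \<noteq> 0"
  shows "lift_ac p mod lift_ac g = lift_ac (p mod g)"
proof -
  have "lift_ac g dvd lift_ac p - lift_ac (p mod g)"
    by (simp add: lift_ac_diff [symmetric] minus_mod_eq_mult_div)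
  then have "lift_ac p mod lift_ac g = lift_ac (p mod g) mod lift_ac g" by (simp add: mod_eq_dvd_iff)
  also have "\<dots> = lift_ac (p mod g)"
    using degree_mod_less[OF assms, of p] by (auto intro: mod_poly_less)
  finally show ?thesis .
qed

lemma Lam_range:
  assumes "g \<noteq> 0"
  shows "Lam (lift_ac g) k m l i j \<in> range to_ac"
proof -
  have 1: "XX ^ n mod lift_ac g = lift_ac (XX ^ n mod g)" for n using lift_ac_mod[OF assms, of "XX ^ n"] by (simp add: lift_ac_power)
  have 2: "XX ^ n mod XX ^ k = lift_ac (XX ^ n mod XX ^ k)" for n :: nat and k
    using lift_ac_mod[of "XX ^ k" "XX ^ n"] by (simp add: lift_ac_power)
  have "coeff (XX ^ n mod lift_ac g) i \<in> range to_ac" for n i by (subst 1) simp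
  moreover have "coeff (XX ^ n mod XX ^ k :: 'a alg_closure poly) i \<in> range to_ac" for n i by (subst 2) simp
  ultimately show ?thesis
    by (auto simp: Lam_def Let_def intro: range_eqI[of _ _ 0])
qed

lemma Lam_frob:
  fixes g :: "'a :: finite_field poly"
  assumes "g \<noteq> 0"
  shows "Lam (lift_ac g) k m l i j ^ (CARD('a) ^ s) = Lam (lift_ac g) k m l i j"
  using frob_power_mult[of "Lam (lift_ac g) k m l i j" 1 s] Lam_range[OF assms, of k m l i j]
  by (simp add: frob_fixed_iff)

lemma ray_matrix_frob:
  fixes g :: "'a :: finite_field poly"
  assumes "g \<noteq> 0"
  shows "twist (CARD('a) ^ s) (ray_matrix (lift_ac g) k f) = ray_matrix (lift_ac g) k (map_poly (\<lambda>z. z ^ (CARD('a) ^ s)) f)"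
proof (intro ext)
  fix i j
  define m where "m = degree f"
  have "degree (map_poly (\<lambda>z. z ^ (CARD('a) ^ s)) f) = m"
    unfolding m_def by (rule degree_map_poly) auto
  then have "ray_matrix (lift_ac g) k (map_poly (\<lambda>z. z ^ (CARD('a) ^ s)) f) i j = 
     (\<Sum>l\<le>m. coeff f l ^ (CARD('a) ^ s) * Lam (lift_ac g) k m l i j)"
    by (subst ray_matrix_linear) (auto simp: coeff_map_poly power_0_left)
  also have "\<dots> = (\<Sum>l\<le>m. coeff f l * Lam (lift_ac g) k m l i j) ^ (CARD('a) ^ s)"
    unfolding ring_hom_fun_sum[OF ring_hom_fun_frob_ac] by (simp add: power_mult_distrib Lam_frob[OF assms])
  also have "\<dots> = twist (CARD('a) ^ s) (ray_matrix (lift_ac g) k f) i j"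
    unfolding twist_def by (subst ray_matrix_linear[of f m]) (auto simp: m_def)
  finally show "twist (CARD('a) ^ s) (ray_matrix (lift_ac g) k f) i j = ray_matrix (lift_ac g) k (map_poly (\<lambda>z. z ^ (CARD('a) ^ s)) f) i j" ..
qed

lemma ray_equiv_lift_ac [simp]: "ray_equiv (lift_ac g) k (lift_ac f) (lift_ac f') \<longleftrightarrow> ray_equiv g k f f'"
proof -
  have "XX ^ k dvd reflect_poly (lift_ac f) - reflect_poly (lift_ac f') \<longleftrightarrow> lift_ac (XX ^ k) dvd lift_ac (reflect_poly f - reflect_poly f')"
    by (simp add: lift_ac_power lift_ac_diff lift_ac_reflect del: lift_ac_dvd_iff)
  then show ?thesis by (simp add: ray_equiv_def lift_ac_diff [symmetric])
qed

lemma coprime_norm_poly: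
  fixes x :: "'a :: finite_field alg_closure"
  assumes "poly (lift_ac g) x \<noteq> 0" "x ^ (CARD('a) ^ r) = x"
  shows "coprime (norm_poly r x) g"
proof (rule coprimeI)
  fix c assume c: "c dvd norm_poly r x" "c dvd g"
  show "is_unit c"
  proof (rule ccontr)
    assume "\<not> is_unit c"
    moreover have "c \<noteq> 0" using c assms by auto
    ultimately have "degree (lift_ac c) > 0" by (simp add: is_unit_iff_degree)
    then obtain y where y: "poly (lift_ac c) y = 0" using alg_closed_imp_poly_has_root by blast
    have "lift_ac c dvd lift_ac (norm_poly r x)" "lift_ac c dvd lift_ac g" using c by simp_all
    then have "poly (lift_ac (norm_poly r x)) y = 0" "poly (lift_ac g) y = 0" using y by (metis dvd_trans poly_eq_0_iff_dvd)+
    then obtain i where "y = x ^ (CARD('a) ^ i)"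
      unfolding lift_ac_norm_poly[OF assms(2)] by (auto simp: lin_norm_def poly_prod)
    with \<open>poly (lift_ac g) y = 0\<close> assms(1) show False by (simp add: poly_frob)
  qed
qed

section \<open>Character sums over linear polynomials\<close>

text \<open>Dirichlet characters modulo \<open>g\<close> that may also be ramified at infinity, to order \<open>k\<close>.\<close>

definition ray_char :: "'a :: field poly \<Rightarrow> nat \<Rightarrow> ('a poly \<Rightarrow> complex) \<Rightarrow> bool"
  where "ray_char g k h \<longleftrightarrow>
    (\<forall>f. lead_coeff f = 1 \<longrightarrow> coprime f g \<longrightarrow> cmod (h f) = 1) \<and>
    (\<forall>f. lead_coeff f = 1 \<longrightarrow> \<not> coprime f g \<longrightarrow> h f = 0) \<and>
    (\<forall>f f'. lead_coeff f = 1 \<longrightarrow> lead_coeff f' = 1 \<longrightarrow> h (f * f') = h f * h f') \<and>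
    (\<forall>f f'. lead_coeff f = 1 \<longrightarrow> lead_coeff f' = 1 \<longrightarrow> ray_equiv g k f f' \<longrightarrow> h f = h f')"

lemma dcharD:
  assumes "ray_char g k h"
  shows "lead_coeff f = 1 \<Longrightarrow> coprime f g \<Longrightarrow> cmod (h f) = 1"
    and "lead_coeff f = 1 \<Longrightarrow> \<not> coprime f g \<Longrightarrow> h f = 0"
    and "lead_coeff f = 1 \<Longrightarrow> lead_coeff f' = 1 \<Longrightarrow> h (f * f') = h f * h f'"
    and "lead_coeff f = 1 \<Longrightarrow> lead_coeff f' = 1 \<Longrightarrow> ray_equiv g k f f' \<Longrightarrow> h f = h f'"
    and "lead_coeff f = 1 \<Longrightarrow> cmod (h f) \<le> 1"
proof -
  show 1: "lead_coeff f = 1 \<Longrightarrow> coprime f g \<Longrightarrow> cmod (h f) = 1" 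
    and 2: "lead_coeff f = 1 \<Longrightarrow> \<not> coprime f g \<Longrightarrow> h f = 0"
    and "lead_coeff f = 1 \<Longrightarrow> lead_coeff f' = 1 \<Longrightarrow> h (f * f') = h f * h f'"
    and "lead_coeff f = 1 \<Longrightarrow> lead_coeff f' = 1 \<Longrightarrow> ray_equiv g k f f' \<Longrightarrow> h f = h f'"
    using assms unfolding ray_char_def by blast+
  show "lead_coeff f = 1 \<Longrightarrow> cmod (h f) \<le> 1"
    using 1 2 by (cases "coprime f g") auto
qed

lemma ray_char_1: "ray_char g k h \<Longrightarrow> h 1 = 1"
  using dcharD(3)[of g k h 1 1] dcharD(1)[of g k h 1] by auto

lemma ex_regular_point:
  fixes g :: "'a :: finite_field poly"
  assumes "g \<noteq> 0"
  shows "\<exists>b s. s > 0 \<and> b ^ (CARD('a) ^ s) = b \<and> poly (lift_ac g) b \<noteq> 0"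
proof -
  define s where "s = Suc (degree g)"
  have "card {x. poly (lift_ac g) x = 0} \<le> degree g" using card_poly_roots_bound[of "lift_ac g"] assms by simp
  also have "\<dots> < CARD('a) ^ s"
    using power_gt_expt[of "CARD('a)" s] card_ge_2[where 'a = 'a] by (simp add: s_def)
  also have "\<dots> = card {x :: 'a alg_closure. x ^ (CARD('a) ^ s) = x}"
    by (rule card_frob_ac(2) [symmetric]) (simp add: s_def)
  finally have "\<not> {x :: 'a alg_closure. x ^ (CARD('a) ^ s) = x} \<subseteq> {x. poly (lift_ac g) x = 0}"
    using card_mono[OF poly_roots_finite[of "lift_ac g"]] assms by (auto simp: not_le [symmetric])
  then obtain x where "x ^ (CARD('a) ^ s) = x" "poly (lift_ac g) x \<noteq> 0" by blast
  then show ?thesis by (intro exI[of _ x] exI[of _ s]) (simp add: s_def)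
qed

text \<open>The matrix w(x) is that of \<open>lin_norm m (b + x)\<close>. The translation by b and
  the exponent m are chosen so that w(0) is the identity; \<open>character_sum\<close> is then
  applied with q^m in place of q, and m times its modulus N becomes the s of the conclusion.\<close>

lemma ray_char_sum:
  fixes g :: "'a :: finite_field poly"
  assumes g: "g \<noteq> 0" and h: "ray_char g k h"
  shows "\<exists>lam\<in>{0, 1}. \<exists>(C :: real) s. s > (0 :: nat) \<and> (\<forall>t>0. 
    cmod ((\<Sum>x | x ^ (CARD('a) ^ (2 * s * t)) = x. h (norm_poly (2 * s * t) x)) - lam * of_nat (CARD('a) ^ (2 * s * t)))
      \<le> C * CARD('a) ^ (s * t))"
proof -
  define q where "q = CARD('a)"
  define G where "G = lift_ac g"
  define d where "d = degree G + k"
  have G: "G \<noteq> 0" using g by (simp add: G_def)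
  obtain b s where b: "s > 0" "b ^ (q ^ s) = b" "poly G b \<noteq> 0"
    using ex_regular_point[OF g] by (auto simp: q_def G_def)
  have "coprime (norm_poly s b) g" using b by (intro coprime_norm_poly) (auto simp: q_def G_def)
  moreover have "lead_coeff (norm_poly s b) = 1" using b by (intro norm_poly_monic) (auto simp: q_def)
  ultimately obtain n0 where n0: "n0 > 0" "ray_equiv g k (norm_poly s b ^ n0) 1" using ex_power_ray_equiv_1[OF g] by blast
  \<comment> \<open>A multiple of s keeps b fixed by the q^m-th power map; the factor
    \<open>n0\<close> makes the class of its norm polynomial trivial.\<close>
  define m where "m = s * n0"
  have m: "m > 0" using b n0 by (simp add: m_def)
  have mod_mat: "b ^ (q ^ m) = b" using b frob_power_mult unfolding q_def m_def by blast
  have bmr: "b ^ (q ^ (m * r)) = b" for r using mod_mat frob_power_mult unfolding q_def by blast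
  have Mb: "ray_matrix G k (lin_norm m b) = id_mat d"
  proof -
    have "lin_norm m b = lift_ac (norm_poly s b ^ n0)"
      unfolding m_def using b by (simp add: lin_norm_mult q_def lift_ac_power lift_ac_norm_poly)
    then have "ray_matrix G k (lin_norm m b) = ray_matrix G k (lift_ac 1)"
      unfolding G_def using n0(2) by (auto intro!: ray_matrix_ray_equiv simp del: map_poly_1')
    then show ?thesis by (simp add: ray_matrix_1 d_def)
  qed
  \<comment> \<open>This is \<open>lin_norm m (b + x)\<close> with the point x as inner
    variable.\<close>
  define NN where "NN = (\<Prod>i<m. [:- ([:b, 1:] ^ (q ^ i)), 1:] :: 'a alg_closure poly poly)"
  define w where "w = (\<lambda>i j. \<Sum>l\<le>m. smult (Lam G k m l i j) (coeff NN l))"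
  have spec_NN: "spec x NN = lin_norm m (b + x)" for x
    unfolding NN_def lin_norm_def ring_hom_fun_prod[OF ring_hom_fun_spec]
    by (intro prod.cong refl) (simp add: map_poly_pCons poly_power q_def)
  have w_eval: "poly (w i j) x = ray_matrix G k (lin_norm m (b + x)) i j" for i j x
  proof -
    have "poly (w i j) x = (\<Sum>l\<le>m. coeff (spec x NN) l * Lam G k m l i j)"
      by (simp add: w_def poly_sum coeff_map_poly mult.commute)
    also have "\<dots> = ray_matrix G k (lin_norm m (b + x)) i j"
      unfolding spec_NN by (rule ray_matrix_linear [symmetric]) (rule lin_norm_monic)
    finally show ?thesis .
  qed
  define fr where "fr = (\<lambda>z :: 'a alg_closure. z ^ (q ^ m))"
  have fr: "ring_hom_fun fr" unfolding fr_def q_def by (rule ring_hom_fun_frob_ac)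
  have fr_NN: "map_poly (map_poly fr) NN = NN"
  proof -
    have "map_poly fr [:b, 1:] = [:b, 1:]" using mod_mat by (simp add: map_poly_pCons fr_def q_def)
    then have "map_poly fr (- ([:b, 1:] ^ (q ^ i))) = - ([:b, 1:] ^ (q ^ i))" for i
      by (simp only: ring_hom_fun_minus[OF ring_hom_fun_map_poly[OF fr]] ring_hom_fun_power[OF ring_hom_fun_map_poly[OF fr]])
    then show ?thesis
      unfolding NN_def ring_hom_fun_prod[OF ring_hom_fun_map_poly[OF ring_hom_fun_map_poly[OF fr]]]
      by (intro prod.cong refl) (simp add: map_poly_pCons ring_hom_fun_1[OF ring_hom_fun_map_poly[OF fr]] ring_hom_fun_1[OF fr])
  qed
  have w_coeff: "coeff (w i j) n ^ (q ^ m) = coeff (w i j) n" for i j n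
  proof -
    have 1: "fr (coeff (coeff NN l) n) = coeff (coeff NN l) n" for l
      using arg_cong[OF fr_NN, of "\<lambda>P. coeff (coeff P l) n"] ring_hom_fun_0[OF fr] ring_hom_fun_0[OF ring_hom_fun_map_poly[OF fr]]
      by (simp add: coeff_map_poly)
    have 2: "fr (Lam G k m l i j) = Lam G k m l i j" for l
      unfolding fr_def G_def q_def by (rule Lam_frob[OF g])
    have "coeff (w i j) n = (\<Sum>l\<le>m. Lam G k m l i j * coeff (coeff NN l) n)"
      by (simp add: w_def coeff_sum)
    then have "fr (coeff (w i j) n) = coeff (w i j) n"
      by (simp add: ring_hom_fun_sum[OF fr] ring_hom_fun_mult[OF fr] 1 2)
    then show ?thesis by (simp add: fr_def)
  qed
  have w_0: "coeff (w i j) 0 = id_mat d i j" for i j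
    using w_eval[of i j 0] by (simp add: poly_0_coeff_0 Mb)
  have w_square_mats: "w \<in> square_mats d"
  proof -
    have "Lam G k m l i j = 0" if "\<not> (i < d \<and> j < d)" for l i j
      using that by (auto simp: Lam_def d_def Let_def)
    then show ?thesis by (auto simp: square_mats_def w_def)
  qed
  interpret frob_matrix "q ^ m" "ff_degree TYPE('a) * m" d w
  proof
    show "prime CHAR('a alg_closure)" by (rule char_ac)
    show "q ^ m = CHAR('a alg_closure) ^ (ff_degree TYPE('a) * m)"
      using char_ac(2)[where 'a = 'a] by (simp add: q_def power_mult)
    show "ff_degree TYPE('a) * m > 0" using char_ac(3)[where 'a = 'a] m by simp
    fix z :: "'a alg_closure"
    obtain n where n: "n > 0" "z ^ (q ^ n) = z" using ac_frob_periodic[of z] by (auto simp: q_def)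
    have "z ^ ((q ^ m) ^ n) = z"
      using frob_power_mult[of z n m] n by (simp add: q_def power_mult [symmetric] mult.commute)
    then show "\<exists>n>0. z ^ ((q ^ m) ^ n) = z" using n by blast
  qed (use w_square_mats w_coeff w_0 in auto)
  have qmr: "(q ^ m) ^ r = q ^ (m * r)" for r by (simp add: power_mult)
  have cls_eq: "map_mat (\<lambda>p. poly p x) (W r) = ray_matrix G k (lin_norm (m * r) (b + x))" for r x
  proof (induction r)
    case 0
    show ?case unfolding W.simps map_mat_id_mat[OF ring_hom_fun_poly] by (simp add: lin_norm_def ray_matrix_1 d_def)
  next
    case (Suc r)
    have hw: "map_mat (\<lambda>p. poly p x) w = ray_matrix G k (lin_norm m (b + x))"
      by (simp add: map_mat_def w_eval)
    have "map_mat (\<lambda>p. poly p x) (W (Suc r)) = 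
        mat_mult d (ray_matrix G k (lin_norm (m * r) (b + x))) (twist (q ^ (m * r)) (ray_matrix G k (lin_norm m (b + x))))"
      by (simp add: map_mat_mat_mult[OF ring_hom_fun_poly] map_mat_twist[OF ring_hom_fun_poly] Suc hw qmr)
    also have "twist (q ^ (m * r)) (ray_matrix G k (lin_norm m (b + x))) = ray_matrix G k (lin_norm m ((b + x) ^ (q ^ (m * r))))"
      unfolding G_def q_def by (simp add: ray_matrix_frob[OF g] lin_norm_frob)
    also have "mat_mult d (ray_matrix G k (lin_norm (m * r) (b + x))) \<dots> = ray_matrix G k (lin_norm (m * r + m) (b + x))"
      unfolding d_def by (simp add: ray_matrix_mult[OF G] lin_norm_add q_def)
    finally show ?case by (simp add: add.commute)
  qed
  define Gs where "Gs = (\<lambda>f. ray_matrix G k (lift_ac f)) ` {f :: 'a poly. lead_coeff f = 1 \<and> coprime f g}"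
  have finGs: "finite Gs"
  proof -
    define P where "P = {f :: 'a poly. lead_coeff f = 1 \<and> coprime f g}"
    define key where "key = (\<lambda>p. ray_matrix G k (lift_ac (SOME f. f \<in> P \<and> ray_class g k f = p)))"
    have "ray_matrix G k (lift_ac f) = key (ray_class g k f)" if "f \<in> P" for f
    proof -
      define f' where "f' = (SOME f'. f' \<in> P \<and> ray_class g k f' = ray_class g k f)"
      have "f' \<in> P \<and> ray_class g k f' = ray_class g k f"
        unfolding f'_def by (rule someI[of _ f]) (use that in auto)
      then have "ray_equiv g k f f'" by (simp add: ray_equiv_iff_ray_class)
      then have "ray_equiv G k (lift_ac f) (lift_ac f')" by (simp add: G_def)
      from ray_matrix_ray_equiv[OF this] show ?thesis by (simp add: key_def f'_def)
    qed
    then have "Gs \<subseteq> key ` range (ray_class g k)" by (auto simp: Gs_def P_def)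
    then show ?thesis using finite_ray_class[OF g] finite_subset by blast
  qed
  have Gs_square_mats: "Gs \<subseteq> square_mats d" using ray_matrix_square_mats by (auto simp: Gs_def d_def)
  have Gs_one: "id_mat d \<in> Gs" unfolding Gs_def by (rule image_eqI[of _ _ 1]) (auto simp: ray_matrix_1 d_def)
  have Gs_mult: "mat_mult d x y \<in> Gs" if "x \<in> Gs" "y \<in> Gs" for x y
  proof -
    from that obtain f f' where f: "x = ray_matrix G k (lift_ac f)" "y = ray_matrix G k (lift_ac f')" "lead_coeff f = 1" "lead_coeff f' = 1"
      "coprime f g" "coprime f' g" by (auto simp: Gs_def)
    have "mat_mult d x y = ray_matrix G k (lift_ac (f * f'))" unfolding f d_def by (simp add: ray_matrix_mult[OF G] lift_ac_mult)
    moreover have "coprime (f * f') g" using f coprime_mult_right[of g f f'] by (simp add: coprime_commute)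
    ultimately show ?thesis using f unfolding Gs_def by (intro image_eqI[of _ _ "f * f'"]) (auto simp: lead_coeff_mult)
  qed
  have Gs_inv: "\<exists>c'\<in>Gs. mat_mult d c' c = id_mat d" if "c \<in> Gs" for c
  proof -
    from that obtain f where f: "c = ray_matrix G k (lift_ac f)" "lead_coeff f = 1" "coprime f g" by (auto simp: Gs_def)
    obtain n where n: "n > 0" "ray_equiv g k (f ^ n) 1" using ex_power_ray_equiv_1[OF g f(2,3)] by blast
    define f' where "f' = f ^ (n - 1)"
    have "f' * f = f ^ n" using n(1) by (cases n) (auto simp: f'_def mult.commute)
    then have "ray_equiv G k (lift_ac f' * lift_ac f) (lift_ac 1)" using n(2) by (simp add: G_def lift_ac_mult [symmetric] del: map_poly_1')
    from ray_matrix_ray_equiv[OF this] have "mat_mult d (ray_matrix G k (lift_ac f')) c = id_mat d"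
      unfolding f d_def by (simp add: ray_matrix_mult[OF G] ray_matrix_1)
    moreover have "ray_matrix G k (lift_ac f') \<in> Gs"
      unfolding Gs_def f'_def using f coprime_power_right[of g f] 
      by (intro imageI) (auto simp: lead_coeff_power coprime_commute)
    ultimately show ?thesis by blast
  qed
  have pts_fixed: "(b + x) ^ (q ^ (m * r)) = b + x" if "x ^ ((q ^ m) ^ r) = x" for r x
    using that bmr[of r] frob_ac_add[of b x "m * r"] unfolding qmr unfolding q_def by simp
  \<comment> \<open>If e were a nonconstant common divisor of f and g, multiplication by f would
    kill the nonzero residue s = g / e, but its matrix is invertible at a point where
    \<open>\<Delta>\<close> does not vanish.\<close>
  have coprime_pts: "coprime (norm_poly (m * r) (b + x)) g" if x: "x \<in> pts r" for r x
  proof (rule ccontr)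
    define f where "f = norm_poly (m * r) (b + x)"
    have fixed: "(b + x) ^ (q ^ (m * r)) = b + x" using x pts_fixed by (auto simp: pts_def)
    then have lift_ac_f: "lift_ac f = lin_norm (m * r) (b + x)" unfolding f_def q_def by (rule lift_ac_norm_poly)
    assume "\<not> coprime (norm_poly (m * r) (b + x)) g"
    then obtain e where e: "e dvd f" "e dvd g" "\<not> is_unit e" by (auto simp: f_def coprime_def)
    from e(2) obtain s where s: "g = e * s" by (elim dvdE)
    have "g dvd f * s" using e(1) s by (metis mult_dvd_mono dvd_refl)
    have "\<not> g dvd s"
    proof
      assume "g dvd s"
      then have "degree g \<le> degree s" using g s by (intro dvd_imp_degree_le) auto
      moreover have "degree g = degree e + degree s" using g s by (auto simp: degree_mult_eq)
      ultimately have "degree e = 0" by simp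
      moreover have "e \<noteq> 0" using s g by auto
      ultimately show False using e(3) by (simp add: is_unit_iff_degree)
    qed
    have bm0: "mod_mat G (lift_ac (f * s)) i j = 0" for i j
    proof -
      have "G dvd lift_ac (f * s) * XX ^ j" unfolding G_def using \<open>g dvd f * s\<close> by (intro dvd_mult2) simp
      then show ?thesis by (simp add: mod_mat_def)
    qed
    define dl where "dl = poly (Dl r) x"
    have "dl \<noteq> 0" using x by (auto simp: dl_def Dl_def pts_def poly_prod)
    have "mat_mult d (map_mat (\<lambda>p. poly p x) (AW r)) (ray_matrix G k (lift_ac f)) = scale_mat dl (id_mat d)"
      using arg_cong[OF AW_W[of r], of "map_mat (\<lambda>p. poly p x)"]
      by (simp add: map_mat_mat_mult[OF ring_hom_fun_poly] map_mat_scale_mat[OF ring_hom_fun_poly] map_mat_id_mat[OF ring_hom_fun_poly] cls_eq lift_ac_f dl_def)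
    then have "mat_mult d (map_mat (\<lambda>p. poly p x) (AW r)) (mat_mult d (ray_matrix G k (lift_ac f)) (ray_matrix G k (lift_ac s))) = scale_mat dl (ray_matrix G k (lift_ac s))"
      by (simp add: mat_mult_assoc [symmetric] mat_mult_scale_mat_left mat_mult_id_mat_left ray_matrix_square_mats d_def)
    also have "mat_mult d (ray_matrix G k (lift_ac f)) (ray_matrix G k (lift_ac s)) = ray_matrix G k (lift_ac (f * s))"
      unfolding d_def by (simp add: ray_matrix_mult[OF G] lift_ac_mult)
    finally have eq: "scale_mat dl (ray_matrix G k (lift_ac s)) = mat_mult d (map_mat (\<lambda>p. poly p x) (AW r)) (ray_matrix G k (lift_ac (f * s)))" ..
    have "mod_mat G (lift_ac s) i 0 = 0" if i: "i < degree G" for i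
    proof -
      have "scale_mat dl (ray_matrix G k (lift_ac s)) i 0 = (\<Sum>l<d. map_mat (\<lambda>p. poly p x) (AW r) i l * ray_matrix G k (lift_ac (f * s)) l 0)"
        unfolding eq using i by (auto simp: mat_mult_def d_def)
      also have "\<dots> = 0" using i bm0 by (intro sum.neutral) (auto simp: ray_matrix_def Let_def)
      finally show ?thesis using i \<open>dl \<noteq> 0\<close> by (auto simp: scale_mat_def ray_matrix_def Let_def)
    qed
    then have "lift_ac s mod G = 0"
      using coeff_mod_ge[OF G, of _ "lift_ac s"] by (intro poly_eqI) (auto simp: mod_mat_def not_less [symmetric])
    then have "g dvd s" unfolding G_def by (simp add: dvd_eq_mod_eq_0 [symmetric])
    with \<open>\<not> g dvd s\<close> show False ..
  qed
  define \<chi> where "\<chi> = (\<lambda>c. h (SOME f. lead_coeff f = 1 \<and> coprime f g \<and> ray_matrix G k (lift_ac f) = c))"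
  have \<chi>_eq: "\<chi> (ray_matrix G k (lift_ac f)) = h f" if f: "lead_coeff f = 1" "coprime f g" for f
  proof -
    define f' where "f' = (SOME f'. lead_coeff f' = 1 \<and> coprime f' g \<and> ray_matrix G k (lift_ac f') = ray_matrix G k (lift_ac f))"
    have f': "lead_coeff f' = 1 \<and> coprime f' g \<and> ray_matrix G k (lift_ac f') = ray_matrix G k (lift_ac f)"
      unfolding f'_def by (rule someI[of _ f]) (use f in auto)
    then have "ray_equiv G k (lift_ac f') (lift_ac f)" using G by (intro ray_equiv_ray_matrix) auto
    then have "ray_equiv g k f' f" by (simp add: G_def)
    with f f' have "h f' = h f" by (intro dcharD(4)[OF h]) auto
    moreover have "\<chi> (ray_matrix G k (lift_ac f)) = h f'" unfolding \<chi>_def f'_def ..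
    ultimately show ?thesis by simp
  qed
  have cls_norm_poly: "map_mat (\<lambda>p. poly p x) (W r) = ray_matrix G k (lift_ac (norm_poly (m * r) (b + x)))"
    "lead_coeff (norm_poly (m * r) (b + x)) = 1" if "x \<in> pts r" for r x
  proof -
    have fixed: "(b + x) ^ (q ^ (m * r)) = b + x" using that pts_fixed by (auto simp: pts_def)
    show "map_mat (\<lambda>p. poly p x) (W r) = ray_matrix G k (lift_ac (norm_poly (m * r) (b + x)))"
      unfolding cls_eq using lift_ac_norm_poly[of "b + x" "m * r"] fixed by (simp add: q_def)
    show "lead_coeff (norm_poly (m * r) (b + x)) = 1" using norm_poly_monic fixed unfolding q_def by blast
  qed
  have "\<exists>lam\<in>{0, 1}. \<exists>(C :: real) N. N > (0 :: nat) \<and> (\<forall>\<mu>>0. N dvd \<mu> \<longrightarrow> 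
    cmod ((\<Sum>x\<in>pts (2 * \<mu>). \<chi> (map_mat (\<lambda>p. poly p x) (W (2 * \<mu>)))) - lam * of_nat ((q ^ m) ^ (2 * \<mu>))) \<le> C * (q ^ m) ^ \<mu>)"
  proof (rule character_sum[OF finGs Gs_square_mats Gs_one Gs_mult Gs_inv])
    show "map_mat (\<lambda>p. poly p x) (W r) \<in> Gs" if "x \<in> pts r" for r x
      unfolding Gs_def using cls_norm_poly[OF that] coprime_pts[OF that] by auto
    show "\<chi> (mat_mult d x y) = \<chi> x * \<chi> y" if "x \<in> Gs" "y \<in> Gs" for x y
    proof -
      from that obtain f f' where f: "x = ray_matrix G k (lift_ac f)" "y = ray_matrix G k (lift_ac f')" "lead_coeff f = 1" "lead_coeff f' = 1"
        "coprime f g" "coprime f' g" by (auto simp: Gs_def)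
      have "mat_mult d x y = ray_matrix G k (lift_ac (f * f'))" unfolding f d_def by (simp add: ray_matrix_mult[OF G] lift_ac_mult)
      moreover have "coprime (f * f') g" using f coprime_mult_right[of g f f'] by (simp add: coprime_commute)
      ultimately show ?thesis using f dcharD(3)[OF h] by (simp add: \<chi>_eq lead_coeff_mult)
    qed
    show "cmod (\<chi> x) = 1" if "x \<in> Gs" for x
      using that dcharD(1)[OF h] by (auto simp: Gs_def \<chi>_eq)
  qed
  then obtain lam and C :: real and N :: nat where lam: "lam \<in> {0, 1 :: complex}" "N > 0" 
    "\<And>\<mu>. \<mu> > 0 \<Longrightarrow> N dvd \<mu> \<Longrightarrow>
    cmod ((\<Sum>x\<in>pts (2 * \<mu>). \<chi> (map_mat (\<lambda>p. poly p x) (W (2 * \<mu>)))) - lam * of_nat ((q ^ m) ^ (2 * \<mu>))) \<le> C * (q ^ m) ^ \<mu>"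
    by blast
  define C' where "C' = C + degree \<Delta>"
  have "cmod ((\<Sum>x | x ^ (q ^ (2 * (m * N) * t)) = x. h (norm_poly (2 * (m * N) * t) x)) - lam * of_nat (q ^ (2 * (m * N) * t)))
      \<le> C' * q ^ (m * N * t)" if t: "t > 0" for t
  proof -
    define \<mu> where "\<mu> = N * t"
    have \<mu>: "\<mu> > 0" "N dvd \<mu>" using t lam(2) by (auto simp: \<mu>_def)
    define R where "R = m * (2 * \<mu>)"
    have R: "2 * (m * N) * t = R" "(q ^ m) ^ (2 * \<mu>) = q ^ R" "(q ^ m) ^ \<mu> = q ^ (m * N * t)"
      by (simp_all add: R_def \<mu>_def power_mult [symmetric] mult_ac)
    define F where "F = {x :: 'a alg_closure. x ^ (q ^ R) = x}"
    have "R > 0" using m \<mu> by (simp add: R_def)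
    have finF: "finite F" unfolding F_def q_def by (rule card_frob_ac) (rule \<open>R > 0\<close>)
    have bR: "b ^ (q ^ R) = b" unfolding R_def by (rule bmr)
    \<comment> \<open>As b lies in the field with q^R elements, translation by b permutes that field
      and undoes the shift of the origin.\<close>
    have s1: "(\<Sum>x\<in>F. h (norm_poly R x)) = (\<Sum>x\<in>F. h (norm_poly R (b + x)))"
    proof (rule sum.reindex_bij_witness[of _ "\<lambda>x. b + x" "\<lambda>x. x - b"])
      fix x assume "x \<in> F"
      then show "x - b \<in> F" "b + x \<in> F"
        using bR frob_ac_diff[of x b R] frob_ac_add[of b x R] by (simp_all add: F_def q_def)
    qed auto
    define Z where "Z = {x\<in>F. poly \<Delta> x = 0}"
    have F_eq: "F = pts (2 * \<mu>) \<union> Z"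
      by (auto simp: F_def Z_def pts_def R(2))
    have s2: "(\<Sum>x\<in>F. h (norm_poly R (b + x))) = (\<Sum>x\<in>pts (2 * \<mu>). h (norm_poly R (b + x))) + (\<Sum>x\<in>Z. h (norm_poly R (b + x)))"
      unfolding F_eq using finF \<mu> by (intro sum.union_disjoint finite_pts) (auto simp: pts_def Z_def)
    have s3: "(\<Sum>x\<in>pts (2 * \<mu>). h (norm_poly R (b + x))) = (\<Sum>x\<in>pts (2 * \<mu>). \<chi> (map_mat (\<lambda>p. poly p x) (W (2 * \<mu>))))"
    proof (intro sum.cong refl)
      fix x assume x: "x \<in> pts (2 * \<mu>)"
      show "h (norm_poly R (b + x)) = \<chi> (map_mat (\<lambda>p. poly p x) (W (2 * \<mu>)))"
        unfolding cls_norm_poly(1)[OF x] R_def using cls_norm_poly(2)[OF x] coprime_pts[OF x] by (intro \<chi>_eq [symmetric])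
    qed
    have eq: "(\<Sum>x\<in>F. h (norm_poly R x)) - lam * of_nat (q ^ R) = 
       ((\<Sum>x\<in>pts (2 * \<mu>). \<chi> (map_mat (\<lambda>p. poly p x) (W (2 * \<mu>)))) - lam * of_nat (q ^ R)) +
       (\<Sum>x\<in>Z. h (norm_poly R (b + x)))"
      unfolding s1 s2 s3 by simp
    have small: "cmod (\<Sum>x\<in>Z. h (norm_poly R (b + x))) \<le> degree \<Delta>"
    proof -
      have "cmod (h (norm_poly R (b + x))) \<le> 1" if "x \<in> F" for x
      proof -
        have "(b + x) ^ (q ^ R) = b + x" using that bR frob_ac_add[of b x R] by (simp add: F_def q_def)
        then show ?thesis unfolding q_def by (intro dcharD(5)[OF h] norm_poly_monic)
      qed
      then have "cmod (\<Sum>x\<in>Z. h (norm_poly R (b + x))) \<le> (\<Sum>x\<in>Z. 1)"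
        by (intro sum_norm_le) (auto simp: Z_def)
      also have "\<dots> = card Z" by simp
      also have "card Z \<le> card {x. poly \<Delta> x = 0}"
        using \<Delta>_nz by (intro card_mono poly_roots_finite) (auto simp: Z_def)
      also have "\<dots> \<le> degree \<Delta>" by (rule card_poly_roots_bound[OF \<Delta>_nz])
      finally show ?thesis by simp
    qed
    have "cmod ((\<Sum>x\<in>F. h (norm_poly R x)) - lam * of_nat (q ^ R)) \<le> C * (q ^ m) ^ \<mu> + degree \<Delta>"
      unfolding eq using lam(3)[OF \<mu>] small 
      by (intro order_trans[OF norm_triangle_ineq] add_mono) (simp_all add: R(2))
    also have "\<dots> \<le> C' * q ^ (m * N * t)"
    proof -
      have "1 \<le> real (q ^ (m * N * t))" using card_ge_2[where 'a = 'a] by (simp add: q_def)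
      then have "real (degree \<Delta>) * 1 \<le> degree \<Delta> * real (q ^ (m * N * t))" by (intro mult_left_mono) auto
      then show ?thesis using R(3) by (simp add: C'_def algebra_simps)
    qed
    finally show ?thesis unfolding F_def R(1) .
  qed
  moreover have "m * N > 0" using m lam by simp
  ultimately show ?thesis using lam(1) unfolding q_def by blast
qed

section \<open>The logarithmic derivative of an \<open>L\<close>-function\<close>

lemma size_proots_alg_closed:
  fixes p :: "'k :: alg_closed_field poly"
  assumes "p \<noteq> 0"
  shows "size (proots p) = degree p"
proof -
  obtain A where A: "size A = degree p" "p = smult (lead_coeff p) (\<Prod>x\<in>#A. [:-x, 1:])"
    using alg_closed_imp_factorization[OF assms] by blast
  have "proots p = proots (\<Prod>x\<in>#A. [:-x, 1:])"
    by (subst A(2)) (use assms in simp)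
  also have "\<dots> = A"
  proof (induction A)
    case (add x A)
    have "(\<Prod>x\<in>#A. [:-x, 1:]) \<noteq> 0" by (auto simp: prod_mset_zero_iff)
    then show ?case using add by (simp add: proots_mult del: mult_pCons_left)
  qed auto
  finally show ?thesis using A by simp
qed

lemma sum_order_eq_degree:
  fixes p :: "'k :: alg_closed_field poly"
  assumes "p \<noteq> 0"
  shows "(\<Sum>x | poly p x = 0. Polynomial.order x p) = degree p"
proof -
  have "size (proots p) = (\<Sum>x | poly p x = 0. count (proots p) x)"
    using assms by (simp add: size_multiset_overloaded_eq)
  then show ?thesis using assms by (simp add: size_proots_alg_closed)
qed

lemma coprime_linear: "x \<noteq> y \<Longrightarrow> coprime [:-x, 1:] [:-y, 1 :: 'k :: field:]"
proof (rule coprimeI)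
  fix c assume "x \<noteq> y" "c dvd [:-x, 1:]" "c dvd [:-y, 1:]"
  then have "c dvd [:-x, 1:] - [:-y, 1:]" by (intro dvd_diff)
  also have "[:-x, 1:] - [:-y, 1:] = [:y - x:]" by simp
  also have "\<dots> dvd 1" using \<open>x \<noteq> y\<close> by (simp add: is_unit_const_poly_iff dvd_field_iff)
  finally show "is_unit c" .
qed

lemma prod_linear_powers_dvd:
  fixes p :: "'k :: field poly"
  assumes "finite Y" "\<And>y. y \<in> Y \<Longrightarrow> [:-y, 1:] ^ k dvd p"
  shows "(\<Prod>y\<in>Y. [:-y, 1:] ^ k) dvd p"
  using assms
proof (induction Y rule: finite_induct)
  case (insert y Y)
  have "coprime [:-y, 1:] (\<Prod>y\<in>Y. [:-y, 1:] ^ k)"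
    using insert.hyps
  proof (induction Y rule: finite_induct)
    case (insert z Y)
    then show ?case by (auto intro!: coprime_mult_right coprime_power_right coprime_linear)
  qed auto
  then have cop: "coprime ([:-y, 1:] ^ k) (\<Prod>y\<in>Y. [:-y, 1:] ^ k)"
    using coprime_power_right[of "\<Prod>y\<in>Y. [:-y, 1:] ^ k" "[:-y, 1:]" k] by (simp add: coprime_commute)
  from insert obtain s where s: "p = (\<Prod>y\<in>Y. [:-y, 1:] ^ k) * s" by (auto elim: dvdE)
  have "[:-y, 1:] ^ k dvd (\<Prod>y\<in>Y. [:-y, 1:] ^ k) * s" using insert.prems s by simp
  then have "[:-y, 1:] ^ k dvd s" by (rule coprime_dvd_cancel_left[OF cop])
  then show ?case using insert.hyps unfolding s
    by (simp add: mult.commute)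
qed auto

definition period :: "'a :: finite_field alg_closure \<Rightarrow> nat"
  where "period x = (LEAST e. e > 0 \<and> x ^ (CARD('a) ^ e) = x)"

lemma period: "period x > 0" "x ^ (CARD('a) ^ period x) = x" for x :: "'a :: finite_field alg_closure"
  using LeastI_ex[of "\<lambda>e. e > 0 \<and> x ^ (CARD('a) ^ e) = x"] ac_frob_periodic[of x] by (auto simp: period_def)

lemma period_least: "e > 0 \<Longrightarrow> x ^ (CARD('a) ^ e) = x \<Longrightarrow> period x \<le> e" for x :: "'a :: finite_field alg_closure"
  unfolding period_def by (rule Least_le) auto

lemma period_dvd_iff: "x ^ (CARD('a) ^ r) = x \<longleftrightarrow> period x dvd r" for x :: "'a :: finite_field alg_closure"
proof
  assume "period x dvd r"
  then show "x ^ (CARD('a) ^ r) = x" using frob_power_mult[OF period(2)[of x]] by (auto elim!: dvdE)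
next
  assume r: "x ^ (CARD('a) ^ r) = x"
  define e where "e = period x"
  have "x ^ (CARD('a) ^ (e * (r div e))) = x" unfolding e_def by (rule frob_power_mult[OF period(2)])
  then have "x ^ (CARD('a) ^ r) = x ^ (CARD('a) ^ (r mod e))"
    by (metis mult_div_mod_eq power_add power_mult)
  with r have "x ^ (CARD('a) ^ (r mod e)) = x" by simp
  moreover have "r mod e < e" using period(1)[of x] by (simp add: e_def)
  ultimately have "r mod e = 0" using period_least[of "r mod e" x] by (auto simp: e_def)
  then show "period x dvd r" by (auto simp: e_def)
qed

lemma norm_poly_mult:
  fixes x :: "'a :: finite_field alg_closure"
  assumes "x ^ (CARD('a) ^ r) = x"
  shows "norm_poly (r * n) x = norm_poly r x ^ n"
proof -
  have "lift_ac (norm_poly (r * n) x) = lift_ac (norm_poly r x ^ n)"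
    using assms by (simp add: lift_ac_norm_poly frob_power_mult lin_norm_mult lift_ac_power)
  then show ?thesis by simp
qed

text \<open>As f has coefficients in F_q, all conjugates of x are zeros of f to the same order;
  those with exponent i below the period are distinct, so their linear factors are coprime.\<close>

lemma norm_poly_power_dvd_iff:
  fixes x :: "'a :: finite_field alg_closure"
  assumes "f \<noteq> 0"
  shows "norm_poly (period x * k) x dvd f \<longleftrightarrow> k \<le> Polynomial.order x (lift_ac f)"
proof -
  define e where "e = period x"
  have e: "e > 0" "x ^ (CARD('a) ^ e) = x" using period by (auto simp: e_def)
  have lift_ac: "lift_ac (norm_poly (e * k) x) = lin_norm e x ^ k" using e by (simp add: norm_poly_mult lift_ac_power lift_ac_norm_poly)
  show ?thesis
  proof
    assume "norm_poly (period x * k) x dvd f"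
    then have "lin_norm e x ^ k dvd lift_ac f" unfolding lift_ac[symmetric] by (simp add: e_def)
    moreover have "[:-x, 1:] dvd lin_norm e x"
      unfolding lin_norm_def using e by (intro dvd_trans[OF _ dvd_prodI[of _ 0]]) auto
    then have "[:-x, 1:] ^ k dvd lin_norm e x ^ k" by (rule dvd_power_same)
    ultimately have "[:-x, 1:] ^ k dvd lift_ac f" by (rule dvd_trans[rotated])
    then show "k \<le> Polynomial.order x (lift_ac f)" using assms by (simp add: order_divides)
  next
    assume "k \<le> Polynomial.order x (lift_ac f)"
    then have "[:-x, 1:] ^ k dvd lift_ac f" by (simp add: order_divides)
    then obtain s where s: "lift_ac f = [:-x, 1:] ^ k * s" by (elim dvdE)
    have div: "[:- (x ^ (CARD('a) ^ i)), 1:] ^ k dvd lift_ac f" for i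
    proof -
      define \<phi> where "\<phi> = map_poly (\<lambda>z :: 'a alg_closure. z ^ (CARD('a) ^ i))"
      have \<phi>: "ring_hom_fun \<phi>" unfolding \<phi>_def by (rule ring_hom_fun_map_poly[OF ring_hom_fun_frob_ac])
      have "to_ac c ^ (CARD('a) ^ i) = to_ac c" for c :: 'a
        using finite_field_power_card_power_eq_same[of "CARD('a) ^ i" i c] by (simp flip: to_ac_power)
      then have "\<phi> (lift_ac f) = lift_ac f" unfolding \<phi>_def by (intro poly_eqI) (simp add: coeff_map_poly power_0_left)
      then have "lift_ac f = \<phi> ([:-x, 1:] ^ k * s)" by (simp flip: s)
      also have "\<dots> = [:- (x ^ (CARD('a) ^ i)), 1:] ^ k * \<phi> s"
        unfolding ring_hom_fun_mult[OF \<phi>] ring_hom_fun_power[OF \<phi>] by (simp add: \<phi>_def map_poly_pCons power_0_left frob_ac_minus)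
      finally show ?thesis by simp
    qed
    define Y where "Y = (\<lambda>i. x ^ (CARD('a) ^ i)) ` {..<e}"
    have inj: "inj_on (\<lambda>i. x ^ (CARD('a) ^ i)) {..<e}"
    proof (rule linorder_inj_onI)
      fix i j assume ij: "i < j" "i \<in> {..<e}" "j \<in> {..<e}"
      show "x ^ (CARD('a) ^ i) \<noteq> x ^ (CARD('a) ^ j)"
      proof
        assume eq: "x ^ (CARD('a) ^ i) = x ^ (CARD('a) ^ j)"
        have "x ^ (CARD('a) ^ j) = (x ^ (CARD('a) ^ (j - i))) ^ (CARD('a) ^ i)"
          using ij(1) by (simp add: power_mult [symmetric] power_add [symmetric])
        with eq have "x ^ (CARD('a) ^ (j - i)) = x" by (metis frob_ac_inj)
        then have "e \<le> j - i" unfolding e_def using ij by (intro period_least) auto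
        then show False using ij by auto
      qed
    qed auto
    have "lin_norm e x ^ k = (\<Prod>y\<in>Y. [:-y, 1:] ^ k)"
      unfolding Y_def lin_norm_def prod_power_distrib by (subst prod.reindex[OF inj]) simp
    also have "\<dots> dvd lift_ac f" using div by (intro prod_linear_powers_dvd) (auto simp: Y_def)
    finally show "norm_poly (period x * k) x dvd f" unfolding lift_ac[symmetric] by (simp add: e_def)
  qed
qed

text \<open>A pair (r, x) corresponds to a zero x of f and a number k from 1 up to its multiplicity,
  with r equal to k times the period of x; counted with multiplicity there are n zeros.\<close>

lemma card_norm_divisors:
  fixes f :: "'a :: finite_field poly"
  assumes f: "lead_coeff f = 1" "degree f = n"
  shows "card {(r, x). r \<in> {1..n} \<and> x ^ (CARD('a) ^ r) = x \<and> norm_poly r x dvd f} = n"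
proof -
  have f0: "f \<noteq> 0" using f by auto
  define T where "T = (SIGMA x:{x. poly (lift_ac f) x = 0}. {1..Polynomial.order x (lift_ac f)})"
  have "bij_betw (\<lambda>(x, k). (period x * k, x)) T {(r, x). r \<in> {1..n} \<and> x ^ (CARD('a) ^ r) = x \<and> norm_poly r x dvd f}"
  proof (intro bij_betw_imageI)
    show "inj_on (\<lambda>(x, k). (period x * k, x)) T"
      using period(1)[where 'a = 'a] by (auto simp: inj_on_def) (metis less_irrefl)
    show "(\<lambda>(x, k). (period x * k, x)) ` T = {(r, x). r \<in> {1..n} \<and> x ^ (CARD('a) ^ r) = x \<and> norm_poly r x dvd f}"
    proof (intro equalityI subsetI)
      fix y assume "y \<in> (\<lambda>(x, k). (period x * k, x)) ` T"
      then obtain z where z: "z \<in> T" "y = (case z of (x, k) \<Rightarrow> (period x * k, x))" by blast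
      obtain x k where "z = (x, k)" by (cases z)
      with z have y: "y = (period x * k, x)" "k \<ge> 1" "k \<le> Polynomial.order x (lift_ac f)" by (auto simp: T_def)
      have fixed: "x ^ (CARD('a) ^ (period x * k)) = x" by (simp add: period_dvd_iff)
      have dvd: "norm_poly (period x * k) x dvd f" using norm_poly_power_dvd_iff[OF f0] y by blast
      have "period x * k \<le> n" using dvd_imp_degree_le[OF dvd f0] norm_poly_monic(2)[OF fixed] f by simp
      then show "y \<in> {(r, x). r \<in> {1..n} \<and> x ^ (CARD('a) ^ r) = x \<and> norm_poly r x dvd f}"
        using y fixed dvd period(1)[of x] by (auto simp: Suc_le_eq)
    next
      fix y assume "y \<in> {(r, x). r \<in> {1..n} \<and> x ^ (CARD('a) ^ r) = x \<and> norm_poly r x dvd f}"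
      then obtain r x where y: "y = (r, x)" "r \<ge> 1" "x ^ (CARD('a) ^ r) = x" "norm_poly r x dvd f" by auto
      then obtain k where k: "r = period x * k" unfolding period_dvd_iff by (elim dvdE)
      have ord: "k \<le> Polynomial.order x (lift_ac f)" using y(4) norm_poly_power_dvd_iff[OF f0] unfolding k by blast
      moreover have "k \<ge> 1" using y(2) k by (cases k) auto
      ultimately have "poly (lift_ac f) x = 0" using order_root[of "lift_ac f" x] by auto
      with ord \<open>k \<ge> 1\<close> have "(x, k) \<in> T" by (auto simp: T_def)
      then show "y \<in> (\<lambda>(x, k). (period x * k, x)) ` T" using y k by force
    qed
  qed
  then have "card {(r, x). r \<in> {1..n} \<and> x ^ (CARD('a) ^ r) = x \<and> norm_poly r x dvd f} = card T"
    by (rule bij_betw_same_card [symmetric])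
  also have "card T = (\<Sum>x | poly (lift_ac f) x = 0. Polynomial.order x (lift_ac f))"
    unfolding T_def using f0 by (subst card_SigmaI) (auto simp: poly_roots_finite)
  also have "\<dots> = n" using f0 f by (simp add: sum_order_eq_degree)
  finally show ?thesis .
qed

definition L_coeff :: "('a :: finite_field poly \<Rightarrow> complex) \<Rightarrow> nat \<Rightarrow> complex"
  where "L_coeff h n = (\<Sum>f\<in>monic_polys n. h f)"

text \<open>
  A monic irreducible \<open>P\<close> of degree \<open>e\<close> dividing \<open>r\<close> contributes \<open>e\<close> times the value at \<open>P ^ (r div e)\<close>,
  once for each of its roots; hence this is the \<open>r\<close>-th coefficient of \<open>u L'(u) / L(u)\<close>.
\<close>

definition L_power_sum :: "('a :: finite_field poly \<Rightarrow> complex) \<Rightarrow> nat \<Rightarrow> complex"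
  where "L_power_sum h r = (\<Sum>x | x ^ (CARD('a) ^ r) = x. h (norm_poly r x))"

lemma monic_polys_iff: "f \<in> monic_polys n \<longleftrightarrow> lead_coeff f = 1 \<and> degree f = n"
  by (simp add: monic_polys_def)

lemma sum_monic_multiples:
  fixes u :: "'a :: finite_field poly"
  assumes "lead_coeff u = 1" "degree u \<le> n"
  shows "(\<Sum>f\<in>monic_polys (n - degree u). g (u * f)) = (\<Sum>f | f \<in> monic_polys n \<and> u dvd f. g f)"
proof (rule sum.reindex_bij_witness[of _ "\<lambda>f. f div u" "\<lambda>f. u * f"])
  have u0: "u \<noteq> 0" using assms by auto
  show "u * f div u = f" for f using u0 by simp
  show "u * f \<in> {f. f \<in> monic_polys n \<and> u dvd f}" if "f \<in> monic_polys (n - degree u)" for f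
  proof -
    have "f \<noteq> 0" using that by (auto simp: monic_polys_iff)
    then have "degree (u * f) = n" using that assms u0 by (auto simp: monic_polys_iff degree_mult_eq)
    moreover have "lead_coeff (u * f) = 1" unfolding lead_coeff_mult using that assms by (metis monic_polys_iff mult_1)
    ultimately show ?thesis by (simp add: monic_polys_iff)
  qed
  show "f div u \<in> monic_polys (n - degree u)" if "f \<in> {f. f \<in> monic_polys n \<and> u dvd f}" for f
  proof -
    from that obtain s where s: "f = u * s" by (auto elim: dvdE)
    have "s \<noteq> 0" using that s by (auto simp: monic_polys_iff)
    have "lead_coeff s = 1" using that s assms by (auto simp: monic_polys_iff lead_coeff_mult)
    moreover have "degree f = degree u + degree s" using s u0 \<open>s \<noteq> 0\<close> by (simp add: degree_mult_eq)
    ultimately show ?thesis using that s u0 by (auto simp: monic_polys_iff)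
  qed
  show "u * (f div u) = f" if "f \<in> {f. f \<in> monic_polys n \<and> u dvd f}" for f
    using that by auto
qed auto

text \<open>By \<open>card_norm_divisors\<close> the factor n in n h(f) counts the norm polynomials
  dividing f; splitting f into such a divisor and a monic cofactor gives the convolution.\<close>

lemma log_derivative:
  fixes h :: "'a :: finite_field poly \<Rightarrow> complex"
  assumes mult: "\<And>f f'. lead_coeff f = 1 \<Longrightarrow> lead_coeff f' = 1 \<Longrightarrow> h (f * f') = h f * h f'"
  shows "of_nat n * L_coeff h n = (\<Sum>r\<in>{1..n}. L_power_sum h r * L_coeff h (n - r))"
proof -
  define Z where "Z = (SIGMA r:{1..n}. {x :: 'a alg_closure. x ^ (CARD('a) ^ r) = x})"
  have finZ: "finite Z" unfolding Z_def using card_frob_ac(1)[where 'a = 'a] by (intro finite_SigmaI) auto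
  have "L_power_sum h r * L_coeff h (n - r) = (\<Sum>x | x ^ (CARD('a) ^ r) = x. \<Sum>f | f \<in> monic_polys n \<and> norm_poly r x dvd f. h f)"
    if r: "r \<in> {1..n}" for r
  proof -
    have "h (norm_poly r x) * L_coeff h (n - r) = (\<Sum>f | f \<in> monic_polys n \<and> norm_poly r x dvd f. h f)"
      if x: "x ^ (CARD('a) ^ r) = x" for x
    proof -
      have "h (norm_poly r x) * L_coeff h (n - r) = (\<Sum>f\<in>monic_polys (n - degree (norm_poly r x)). h (norm_poly r x * f))"
        unfolding L_coeff_def sum_distrib_left using norm_poly_monic[OF x] by (intro sum.cong) (auto simp: mult monic_polys_iff)
      also have "\<dots> = (\<Sum>f | f \<in> monic_polys n \<and> norm_poly r x dvd f. h f)"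
        using norm_poly_monic[OF x] r by (intro sum_monic_multiples) auto
      finally show ?thesis .
    qed
    then show ?thesis by (simp add: L_power_sum_def sum_distrib_right)
  qed
  then have "(\<Sum>r\<in>{1..n}. L_power_sum h r * L_coeff h (n - r)) = 
      (\<Sum>r\<in>{1..n}. \<Sum>x | x ^ (CARD('a) ^ r) = x. \<Sum>f | f \<in> monic_polys n \<and> norm_poly r x dvd f. h f)"
    by simp
  also have "\<dots> = (\<Sum>z\<in>Z. \<Sum>f | f \<in> monic_polys n \<and> norm_poly (fst z) (snd z) dvd f. h f)"
    unfolding Z_def using card_frob_ac(1)[where 'a = 'a] by (subst sum.Sigma) (auto simp: split_beta)
  also have "\<dots> = (\<Sum>z\<in>Z. \<Sum>f\<in>monic_polys n. if norm_poly (fst z) (snd z) dvd f then h f else 0)"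
    by (intro sum.cong refl sum.inter_filter finite_monic_polys)
  also have "\<dots> = (\<Sum>f\<in>monic_polys n. \<Sum>z\<in>Z. if norm_poly (fst z) (snd z) dvd f then h f else 0)"
    by (rule sum.swap)
  also have "\<dots> = (\<Sum>f\<in>monic_polys n. of_nat n * h f)"
  proof (intro sum.cong refl)
    fix f :: "'a poly" assume f: "f \<in> monic_polys n"
    have "(\<Sum>z\<in>Z. if norm_poly (fst z) (snd z) dvd f then h f else 0) = (\<Sum>z | z \<in> Z \<and> norm_poly (fst z) (snd z) dvd f. h f)"
      by (rule sum.inter_filter [symmetric, OF finZ])
    also have "{z. z \<in> Z \<and> norm_poly (fst z) (snd z) dvd f} = {(r, x). r \<in> {1..n} \<and> x ^ (CARD('a) ^ r) = x \<and> norm_poly r x dvd f}"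
      by (auto simp: Z_def)
    also have "(\<Sum>z\<in>\<dots>. h f) = of_nat n * h f"
      unfolding sum_constant by (subst card_norm_divisors) (use f in \<open>auto simp: monic_polys_iff\<close>)
    finally show "(\<Sum>z\<in>Z. if norm_poly (fst z) (snd z) dvd f then h f else 0) = of_nat n * h f" .
  qed
  finally show ?thesis by (simp add: L_coeff_def sum_distrib_left)
qed

section \<open>The Moebius function\<close>

lemma finite_monic_divisors: "f \<noteq> 0 \<Longrightarrow> finite {d :: 'a :: {finite, field} poly. lead_coeff d = 1 \<and> d dvd f}"
  by (rule finite_subset[OF _ finite_polys[of "degree f"]]) (auto intro: dvd_imp_degree_le)

lemma unit_monic_iff: "lead_coeff d = 1 \<Longrightarrow> is_unit d \<longleftrightarrow> d = (1 :: 'a :: field poly)"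
proof
  assume d: "lead_coeff d = 1" "is_unit d"
  then obtain c where "d = [:c:]" by (auto simp: is_unit_poly_iff)
  with d(1) show "d = 1" by (simp add: one_pCons)
qed auto

lemma monic_dvd_antisym:
  fixes a b :: "'a :: field poly"
  assumes "a dvd b" "b dvd a" "lead_coeff a = 1" "lead_coeff b = 1"
  shows "a = b"
proof -
  obtain c where c: "b = a * c" using assms by (auto elim: dvdE)
  have "degree a = degree b" using assms by (intro antisym dvd_imp_degree_le) auto
  moreover have "degree b = degree a + degree c" using assms c by (subst c, subst degree_mult_eq) auto
  ultimately have "degree c = 0" by simp
  then obtain z where z: "c = [:z:]" by (elim degree_eq_zeroE)
  have "lead_coeff b = lead_coeff a * lead_coeff c" unfolding c by (rule lead_coeff_mult)
  then have "z = 1" using assms z by simp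
  then show ?thesis using c z by simp
qed

lemma ex_monic_irreducible_divisor:
  fixes f :: "'a :: field poly"
  assumes "degree f > 0"
  shows "\<exists>P. lead_coeff P = 1 \<and> irreducible P \<and> P dvd f"
proof -
  define f1 where "f1 = smult (inverse (lead_coeff f)) f"
  have f1: "lead_coeff f1 = 1" "f1 dvd f" "degree f1 > 0"
    using assms by (auto simp: f1_def smult_dvd_iff)
  then have "\<exists>n. \<exists>P. lead_coeff P = 1 \<and> P dvd f \<and> degree P > 0 \<and> degree P = n" by blast
  from LeastI_ex[OF this] obtain P where P: "lead_coeff P = 1" "P dvd f" "degree P > 0"
    "degree P = (LEAST n. \<exists>P. lead_coeff P = 1 \<and> P dvd f \<and> degree P > 0 \<and> degree P = n)" by blast
  have min: "degree P \<le> degree R" if "lead_coeff R = 1" "R dvd f" "degree R > 0" for R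
    unfolding P(4) by (rule Least_le) (use that in auto)
  have "irreducible P"
  proof (rule comm_semiring_1_class.irreducibleI)
    show P0: "P \<noteq> 0" using P by auto
    show "\<not> is_unit P" using P(3) is_unit_iff_degree[OF P0] by simp
    fix a b assume ab: "P = a * b"
    have nz: "a \<noteq> 0" "b \<noteq> 0" using ab P by auto
    show "is_unit a \<or> is_unit b"
    proof (rule ccontr)
      assume "\<not> (is_unit a \<or> is_unit b)"
      then have d: "degree a > 0" "degree b > 0" using nz by (auto simp: is_unit_iff_degree)
      define R where "R = smult (inverse (lead_coeff a)) a"
      have "R dvd a" using nz by (simp add: R_def smult_dvd_iff)
      then have "R dvd f" using ab P(2) by (meson dvd_mult2 dvd_trans dvd_triv_left)
      moreover have "lead_coeff R = 1" "degree R = degree a" using nz by (auto simp: R_def)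
      ultimately have "degree P \<le> degree a" using min[of R] d by auto
      moreover have "degree P = degree a + degree b" using ab nz by (simp add: degree_mult_eq)
      ultimately show False using d by simp
    qed
  qed
  with P show ?thesis by blast
qed

lemma moebius_1 [simp]: "poly_moebius (1 :: 'a :: finite_field poly) = 1"
proof -
  have empty: "{g :: 'a poly. irreducible g \<and> lead_coeff g = 1 \<and> g dvd 1} = {}"
    by (auto simp: comm_semiring_1_class.irreducible_def)
  show ?thesis unfolding poly_moebius_def empty by simp
qed

lemma moebius_mult_irreducible:
  fixes P d :: "'a :: finite_field poly"
  assumes P: "irreducible P" "lead_coeff P = 1" and d: "lead_coeff d = 1" "\<not> P dvd d"
  shows "poly_moebius (P * d) = - poly_moebius d"
proof -
  have prime: "prime_elem P" using P by (intro field_poly_irreducible_imp_prime)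
  have nz: "P \<noteq> 0" "d \<noteq> 0" using P d by auto
  have sq: "squarefree (P * d) \<longleftrightarrow> squarefree d"
  proof
    assume "squarefree (P * d)" then show "squarefree d" by (auto simp: squarefree_def)
  next
    assume sd: "squarefree d"
    show "squarefree (P * d)"
    proof (rule squarefreeI)
      fix y assume y: "y ^ 2 dvd P * d"
      show "is_unit y"
      proof (cases "P dvd y")
        case True
        then have "P * P dvd P * d" using y by (metis dvd_trans mult_dvd_mono power2_eq_square)
        then have "P dvd d" using nz by simp
        with d show ?thesis by simp
      next
        case False
        from y obtain r where r: "P * d = y ^ 2 * r" by (elim dvdE)
        then have "P dvd y ^ 2 * r" by (metis dvd_triv_left)
        then have "P dvd r" using False prime by (auto simp: prime_elem_dvd_mult_iff prime_elem_dvd_power_iff)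
        then obtain s where "r = P * s" by (elim dvdE)
        with r nz have "d = y ^ 2 * s" by (simp add: mult.left_commute)
        then show ?thesis using sd by (auto simp: squarefree_def)
      qed
    qed
  qed
  have "{g. irreducible g \<and> lead_coeff g = 1 \<and> g dvd P * d} = insert P {g. irreducible g \<and> lead_coeff g = 1 \<and> g dvd d}"
  proof (intro equalityI subsetI)
    fix g assume "g \<in> {g. irreducible g \<and> lead_coeff g = 1 \<and> g dvd P * d}"
    then have g: "irreducible g" "lead_coeff g = 1" "g dvd P * d" by auto
    have "prime_elem g" using g by (intro field_poly_irreducible_imp_prime)
    then have "g dvd P \<or> g dvd d" using g by (simp add: prime_elem_dvd_mult_iff)
  moreover have "g = P" if gP: "g dvd P"
    proof -
      obtain c where c: "P = g * c" using gP unfolding dvd_def by blast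
      then have "is_unit g \<or> is_unit c" using P(1) unfolding comm_semiring_1_class.irreducible_def by blast
      then have "is_unit c" using g(1) unfolding comm_semiring_1_class.irreducible_def by blast
      then have "P dvd g" unfolding c by (simp add: mult_unit_dvd_iff)
      with gP show ?thesis using g P by (intro monic_dvd_antisym)
    qed
    ultimately show "g \<in> insert P {g. irreducible g \<and> lead_coeff g = 1 \<and> g dvd d}" using g by auto
  qed (use P in auto)
  moreover have "finite {g. irreducible g \<and> lead_coeff g = 1 \<and> g dvd d}"
    by (rule finite_subset[OF _ finite_monic_divisors[OF nz(2)]]) auto
  ultimately show ?thesis using d(2) sq by (simp add: poly_moebius_def)
qed

text \<open>Fix an irreducible P dividing f. Divisors divisible by P^2 contribute nothing, and the
  others pair off as d and P d with opposite signs.\<close>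

lemma sum_moebius_divisors:
  fixes f :: "'a :: finite_field poly"
  assumes f: "lead_coeff f = 1"
  shows "(\<Sum>d | lead_coeff d = 1 \<and> d dvd f. poly_moebius d) = (if f = 1 then 1 else 0)"
proof (cases "f = 1")
  case True
  have "{d :: 'a poly. lead_coeff d = 1 \<and> d dvd 1} = {1}"
    by (intro equalityI subsetI) (use unit_monic_iff in blast, simp)
  with True show ?thesis by simp
next
  case False
  have "f \<noteq> 0" using f by auto
  then have "degree f > 0" using False f unit_monic_iff[OF f] is_unit_iff_degree[of f] by blast
  then obtain P where P: "lead_coeff P = 1" "irreducible P" "P dvd f"
    using ex_monic_irreducible_divisor by blast
  have prime: "prime_elem P" using P by (intro field_poly_irreducible_imp_prime)
  have nz: "f \<noteq> 0" "P \<noteq> 0" using f P by auto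
  define Dv where "Dv = {d. lead_coeff d = 1 \<and> d dvd f}"
  have fin: "finite Dv" unfolding Dv_def by (rule finite_monic_divisors[OF nz(1)])
  define A where "A = {d\<in>Dv. \<not> P dvd d}"
  have "(\<Sum>d\<in>Dv. poly_moebius d) = (\<Sum>d\<in>A. poly_moebius d) + (\<Sum>d\<in>Dv - A. poly_moebius d)"
    using sum.subset_diff[of A Dv poly_moebius] fin by (simp add: A_def)
  also have "(\<Sum>d\<in>Dv - A. poly_moebius d) = (\<Sum>d\<in>(*) P ` A. poly_moebius d)"
  proof (rule sum.mono_neutral_right)
    show "(*) P ` A \<subseteq> Dv - A"
    proof
      fix x assume "x \<in> (*) P ` A"
      then obtain d where d: "x = P * d" "d \<in> A" by blast
      then obtain r where r: "f = d * r" by (auto simp: A_def Dv_def)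
      have "P dvd d * r" using P r by simp
      then have "P dvd r" using d prime by (auto simp: A_def prime_elem_dvd_mult_iff)
      then have "P * d dvd f" unfolding r by (simp add: mult.commute)
      moreover have "lead_coeff (P * d) = 1" unfolding lead_coeff_mult using P d by (simp add: A_def Dv_def)
      ultimately show "x \<in> Dv - A" using d by (simp add: A_def Dv_def)
    qed
    show "\<forall>d\<in>Dv - A - (*) P ` A. poly_moebius d = 0"
    proof
      fix d assume d: "d \<in> Dv - A - (*) P ` A"
      then have "P dvd d" by (auto simp: A_def)
      then obtain e where e: "d = P * e" by (elim dvdE)
      have "lead_coeff d = 1" "d dvd f" using d by (auto simp: Dv_def)
      then have "lead_coeff e = 1" "e dvd f" using e P by (auto simp: lead_coeff_mult dvd_mult_right)
      with d e have "P dvd e" by (auto simp: A_def Dv_def)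
      then have "P ^ 2 dvd d" using e by (simp add: power2_eq_square)
      moreover have "degree P > 0" using P nz by (auto simp: comm_semiring_1_class.irreducible_def is_unit_iff_degree)
      ultimately show "poly_moebius d = 0" by (rule poly_moebius_not_squarefree[rotated])
    qed
  qed (use fin in auto)
  also have "\<dots> = (\<Sum>d\<in>A. poly_moebius (P * d))"
    using nz by (subst sum.reindex) (auto simp: inj_on_def)
  also have "\<dots> = (\<Sum>d\<in>A. - poly_moebius d)"
    using P by (intro sum.cong moebius_mult_irreducible) (auto simp: A_def Dv_def)
  finally show ?thesis using False by (simp add: Dv_def sum_negf)
qed

section \<open>Zeros of \<open>L\<close>-functions and the inverse of an \<open>L\<close>-function\<close>

definition moebius_coeff :: "('a :: finite_field poly \<Rightarrow> complex) \<Rightarrow> nat \<Rightarrow> complex"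
  where "moebius_coeff h n = (\<Sum>f\<in>monic_polys n. of_int (poly_moebius f) * h f)"

lemma moebius_coeff_L_coeff:
  fixes h :: "'a :: finite_field poly \<Rightarrow> complex"
  assumes mult: "\<And>f f'. lead_coeff f = 1 \<Longrightarrow> lead_coeff f' = 1 \<Longrightarrow> h (f * f') = h f * h f'" and h1: "h 1 = 1"
  shows "Abs_fps (moebius_coeff h) * Abs_fps (L_coeff h) = 1"
proof (rule fps_ext)
  fix n
  define E where "E = (SIGMA f:monic_polys n :: 'a poly set. {d. lead_coeff d = 1 \<and> d dvd f})"
  have "fps_nth (Abs_fps (moebius_coeff h) * Abs_fps (L_coeff h)) n = (\<Sum>i=0..n. moebius_coeff h i * L_coeff h (n - i))"
    by (simp add: fps_mult_nth)
  also have "\<dots> = (\<Sum>i=0..n. \<Sum>d\<in>monic_polys i. \<Sum>f | f \<in> monic_polys n \<and> d dvd f. of_int (poly_moebius d) * h f)"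
  proof (intro sum.cong refl)
    fix i assume i: "i \<in> {0..n}"
    have "of_int (poly_moebius d) * h d * L_coeff h (n - i) = 
        (\<Sum>f | f \<in> monic_polys n \<and> d dvd f. of_int (poly_moebius d) * h f)" if d: "d \<in> monic_polys i" for d
    proof -
      have "of_int (poly_moebius d) * h d * L_coeff h (n - i) = 
          (\<Sum>f\<in>monic_polys (n - degree d). of_int (poly_moebius d) * h (d * f))"
        unfolding L_coeff_def sum_distrib_left using d by (intro sum.cong) (auto simp: mult monic_polys_iff mult_ac)
      also have "\<dots> = (\<Sum>f | f \<in> monic_polys n \<and> d dvd f. of_int (poly_moebius d) * h f)"
        using d i by (intro sum_monic_multiples) (auto simp: monic_polys_iff)
      finally show ?thesis .
    qed
    then show "moebius_coeff h i * L_coeff h (n - i) = (\<Sum>d\<in>monic_polys i. \<Sum>f | f \<in> monic_polys n \<and> d dvd f. of_int (poly_moebius d) * h f)"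
      by (simp add: moebius_coeff_def sum_distrib_right)
  qed
  also have "\<dots> = (\<Sum>d\<in>(\<Union>i\<in>{0..n}. monic_polys i). \<Sum>f | f \<in> monic_polys n \<and> d dvd f. of_int (poly_moebius d) * h f)"
    by (rule sum.UNION_disjoint [symmetric]) (auto simp: finite_monic_polys monic_polys_iff)
  also have "\<dots> = (\<Sum>d\<in>(\<Union>i\<in>{0..n}. monic_polys i). \<Sum>f\<in>monic_polys n. if d dvd f then of_int (poly_moebius d) * h f else 0)"
    by (intro sum.cong refl sum.inter_filter finite_monic_polys)
  also have "\<dots> = (\<Sum>f\<in>monic_polys n. \<Sum>d\<in>(\<Union>i\<in>{0..n}. monic_polys i). if d dvd f then of_int (poly_moebius d) * h f else 0)"
    by (rule sum.swap)
  also have "\<dots> = (\<Sum>f\<in>monic_polys n. h f * of_int (if f = 1 then 1 else 0))"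
  proof (intro sum.cong refl)
    fix f :: "'a poly" assume f: "f \<in> monic_polys n"
    have "(\<Sum>d\<in>(\<Union>i\<in>{0..n}. monic_polys i). if d dvd f then of_int (poly_moebius d) * h f else 0) = 
        (\<Sum>d | d \<in> (\<Union>i\<in>{0..n}. monic_polys i) \<and> d dvd f. of_int (poly_moebius d) * h f)"
      by (rule sum.inter_filter [symmetric]) (auto simp: finite_monic_polys)
    also have "{d. d \<in> (\<Union>i\<in>{0..n}. monic_polys i) \<and> d dvd f} = {d. lead_coeff d = 1 \<and> d dvd f}"
    proof -
      have "degree d \<le> n" if "d dvd f" for d using that f by (auto simp: monic_polys_iff dest!: dvd_imp_degree_le)
      then show ?thesis by (auto simp: monic_polys_iff)
    qed
    also have "(\<Sum>d\<in>\<dots>. of_int (poly_moebius d) * h f) = h f * of_int (\<Sum>d | lead_coeff d = 1 \<and> d dvd f. poly_moebius d)"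
      by (simp add: sum_distrib_left mult.commute)
    also have "\<dots> = h f * of_int (if f = 1 then 1 else 0)"
      using f by (subst sum_moebius_divisors) (auto simp: monic_polys_iff)
    finally show "(\<Sum>d\<in>(\<Union>i\<in>{0..n}. monic_polys i). if d dvd f then of_int (poly_moebius d) * h f else 0) = \<dots>" .
  qed
  also have "\<dots> = (\<Sum>f\<in>monic_polys n. if f = (1 :: 'a poly) then 1 else 0)"
    by (rule sum.cong) (simp_all add: h1)
  also have "\<dots> = fps_nth 1 n" by (simp add: finite_monic_polys monic_polys_iff)
  finally show "fps_nth (Abs_fps (moebius_coeff h) * Abs_fps (L_coeff h)) n = fps_nth 1 n" .
qed

abbreviation lin_factor :: "complex \<Rightarrow> complex fps" where "lin_factor a \<equiv> 1 - fps_const a * fps_X"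

text \<open>The series a X / (1 - a X), which is minus X times the logarithmic derivative of
  \<open>lin_factor a\<close>; the constant term 0 matches power sums that start at r = 1.\<close>

definition geom_series :: "complex \<Rightarrow> complex fps"
  where "geom_series a = Abs_fps (\<lambda>r. if r = 0 then 0 else a ^ r)"

lemma lin_factor_nth: "fps_nth (lin_factor a * F) n = fps_nth F n - (if n = 0 then 0 else a * fps_nth F (n - 1))"
  by (simp add: left_diff_distrib mult.assoc fps_X_mult_nth)

lemma lin_factor_geom_series: "lin_factor a * geom_series a = fps_const a * fps_X"
proof (rule fps_ext)
  fix n
  show "fps_nth (lin_factor a * geom_series a) n = fps_nth (fps_const a * fps_X) n"
    unfolding lin_factor_nth by (cases n rule: nat.exhaust; cases "n = 1") (auto simp: geom_series_def fps_X_def split: nat.splits)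
qed

lemma fps_X_deriv_lin_factor: "fps_X * fps_deriv (lin_factor a) = - (lin_factor a * geom_series a)"
  unfolding lin_factor_geom_series by (simp add: mult.commute)

lemma fps_X_deriv_prod_lin_factor:
  "fps_X * fps_deriv (\<Prod>a\<leftarrow>as. lin_factor a) = - (\<Prod>a\<leftarrow>as. lin_factor a) * (\<Sum>a\<leftarrow>as. geom_series a)"
proof (induction as)
  case (Cons a as)
  have ring: "- (u * v) * w + u * (- w * z) = - (u * w) * (v + z)" for u v w z :: "complex fps"
    by (simp add: algebra_simps)
  have "fps_X * fps_deriv (\<Prod>a\<leftarrow>a # as. lin_factor a) = 
      (fps_X * fps_deriv (lin_factor a)) * (\<Prod>a\<leftarrow>as. lin_factor a) + lin_factor a * (fps_X * fps_deriv (\<Prod>a\<leftarrow>as. lin_factor a))"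
    unfolding list.map prod_list.Cons fps_deriv_mult by (simp only: ring_distribs ac_simps)
  also have "\<dots> = - (\<Prod>a\<leftarrow>a # as. lin_factor a) * (\<Sum>a\<leftarrow>a # as. geom_series a)"
    unfolding fps_X_deriv_lin_factor Cons.IH list.map prod_list.Cons sum_list.Cons by (rule ring)
  finally show ?case .
qed simp

text \<open>The inverse zeros of p are the zeros of its reflection, which is monic because p has
  constant term 1.\<close>

lemma complex_poly_lin_factor_factorization:
  fixes p :: "complex poly"
  assumes "coeff p 0 = 1"
  shows "\<exists>as. length as = degree p \<and> fps_of_poly p = (\<Prod>a\<leftarrow>as. lin_factor a)"
proof -
  define r where "r = reflect_poly p"
  have p0: "p \<noteq> 0" using assms by auto
  have lc: "lead_coeff r = 1" "degree r = degree p" using assms by (simp_all add: r_def coeff_reflect_poly)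
  obtain as where as: "mset as = proots r" using ex_mset by blast
  have "smult (lead_coeff r) (\<Prod>x\<in>#proots r. [:-x, 1:]) = r" by (rule complex_poly_decompose_multiset)
  then have "r = (\<Prod>a\<leftarrow>as. [:-a, 1:])"
    unfolding lc(1) by (simp add: as [symmetric] prod_mset_prod_list flip: mset_map)
  then have "reflect_poly r = (\<Prod>a\<leftarrow>as. reflect_poly [:-a, 1:])"
    by (simp add: reflect_poly_prod_list o_def)
  also have "reflect_poly r = p" unfolding r_def using assms by (intro reflect_poly_reflect_poly) simp
  also have "(\<lambda>a. reflect_poly [:-a, 1:]) = (\<lambda>a :: complex. [:1, -a:])"
    by (auto simp: fun_eq_iff poly_eq_iff coeff_reflect_poly coeff_pCons split: nat.splits)
  finally have p: "p = (\<Prod>a\<leftarrow>as. [:1, -a:])" .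
  have "length as = size (proots r)" by (simp flip: as)
  also have "\<dots> = degree p" using lc by (simp add: size_proots_complex)
  finally have len: "length as = degree p" .
  have "fps_of_poly (\<Prod>a\<leftarrow>as. [:1, -a:]) = (\<Prod>a\<leftarrow>as. lin_factor a)"
  proof (induction as)
    case (Cons a as)
    have "fps_of_poly [:1, -a:] = lin_factor a" by (simp add: fps_of_poly_pCons)
    then show ?case using Cons by (simp only: list.map prod_list.Cons fps_of_poly_mult)
  qed simp
  then have "fps_of_poly p = (\<Prod>a\<leftarrow>as. lin_factor a)" by (simp only: p)
  with len show ?thesis by blast
qed

text \<open>Both sides of the factorisation are compared through X times the logarithmic derivative,
  which for L is the series of the \<open>L_power_sum\<close>. The extra factor is trivial, with b =
  0, when L itself is a polynomial; with b = q it removes the pole for the trivial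
  character.\<close>

lemma power_sums_eq:
  fixes h :: "'a :: finite_field poly \<Rightarrow> complex"
  assumes mult: "\<And>f f'. lead_coeff f = 1 \<Longrightarrow> lead_coeff f' = 1 \<Longrightarrow> h (f * f') = h f * h f'" and h1: "h 1 = 1"
    and as: "lin_factor b * Abs_fps (L_coeff h) = (\<Prod>a\<leftarrow>as. lin_factor a)" and r: "r > 0"
  shows "L_power_sum h r - b ^ r = - (\<Sum>a\<leftarrow>as. a ^ r)"
proof -
  define L where "L = Abs_fps (L_coeff h)"
  define Sf where "Sf = Abs_fps (\<lambda>r. if r = 0 then 0 else L_power_sum h r)"
  have XL: "fps_X * fps_deriv L = L * Sf"
  proof (rule fps_ext)
    fix n
    have "fps_nth (L * Sf) n = fps_nth (Sf * L) n" by (simp add: mult.commute)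
    also have "\<dots> = (\<Sum>i=0..n. (if i = 0 then 0 else L_power_sum h i) * L_coeff h (n - i))"
      by (simp add: fps_mult_nth L_def Sf_def)
    also have "\<dots> = (\<Sum>i\<in>{1..n}. L_power_sum h i * L_coeff h (n - i))"
      by (intro sum.mono_neutral_cong_right) auto
    also have "\<dots> = of_nat n * L_coeff h n" using log_derivative[of h n] mult by simp
    also have "\<dots> = fps_nth (fps_X * fps_deriv L) n" by (cases n) (auto simp: L_def fps_X_mult_nth)
    finally show "fps_nth (fps_X * fps_deriv L) n = fps_nth (L * Sf) n" ..
  qed
  have ring: "- (u * v) * w + u * (w * z) = u * w * (z - v)" for u v w z :: "complex fps"
    by (simp add: algebra_simps)
  define P where "P = (\<Prod>a\<leftarrow>as. lin_factor a)"
  have P: "P = lin_factor b * L" using as by (simp add: P_def L_def)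
  have "- P * (\<Sum>a\<leftarrow>as. geom_series a) = fps_X * fps_deriv P"
    unfolding P_def by (rule fps_X_deriv_prod_lin_factor [symmetric])
  also have "\<dots> = (fps_X * fps_deriv (lin_factor b)) * L + lin_factor b * (fps_X * fps_deriv L)"
    unfolding P fps_deriv_mult by (simp only: ring_distribs ac_simps)
  also have "\<dots> = P * (Sf - geom_series b)"
    unfolding fps_X_deriv_lin_factor XL P by (rule ring)
  finally have "P * (- (\<Sum>a\<leftarrow>as. geom_series a)) = P * (Sf - geom_series b)" by simp
  moreover have "P \<noteq> 0"
  proof -
    have "fps_nth P 0 = 1" unfolding P_def by (induction as) (auto simp: fps_mult_nth_0)
    then show ?thesis by auto
  qed
  ultimately have "- (\<Sum>a\<leftarrow>as. geom_series a) = Sf - geom_series b" by (simp only: mult_cancel_left) simp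
  from arg_cong[OF this, of "\<lambda>F. fps_nth F r"] have "- fps_nth (\<Sum>a\<leftarrow>as. geom_series a) r = L_power_sum h r - b ^ r"
    using r by (simp add: Sf_def geom_series_def)
  moreover have "fps_nth (\<Sum>a\<leftarrow>as. geom_series a) r = (\<Sum>a\<leftarrow>as. a ^ r)"
    using r by (induction as) (auto simp: geom_series_def)
  ultimately show ?thesis by simp
qed

text \<open>The coefficient is a complete homogeneous symmetric polynomial in at most E + 1
  variables, with n + E choose n monomials. The induction splits off one factor at a time and sums
  the binomials by \<open>sum_choose_lower\<close>.\<close>

lemma inverse_prod_lin_factor_bound:
  fixes Z :: "complex fps"
  assumes "Z * (\<Prod>a\<leftarrow>as. lin_factor a) = 1" "length as \<le> Suc E" "\<And>a. a \<in> set as \<Longrightarrow> cmod a \<le> \<rho>" "\<rho> \<ge> 0"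
  shows "cmod (fps_nth Z n) \<le> real (n + E choose n) * \<rho> ^ n"
  using assms(1-3)
proof (induction E arbitrary: Z as n)
  have one: "cmod (fps_nth (1 :: complex fps) n) \<le> real (n + E choose n) * \<rho> ^ n" for n E
    using \<open>\<rho> \<ge> 0\<close> by auto
  have step: "cmod (fps_nth Z n) \<le> (\<Sum>j\<le>n. \<rho> ^ (n - j) * cmod (fps_nth (lin_factor a * Z) j))" if "cmod a \<le> \<rho>" for a Z n
  proof (induction n)
    case (Suc n)
    have "fps_nth Z (Suc n) = fps_nth (lin_factor a * Z) (Suc n) + a * fps_nth Z n" unfolding lin_factor_nth by simp
    then have "cmod (fps_nth Z (Suc n)) \<le> cmod (fps_nth (lin_factor a * Z) (Suc n)) + cmod a * cmod (fps_nth Z n)"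
      by (metis norm_mult norm_triangle_ineq)
    also have "cmod a * cmod (fps_nth Z n) \<le> \<rho> * (\<Sum>j\<le>n. \<rho> ^ (n - j) * cmod (fps_nth (lin_factor a * Z) j))"
      using that Suc \<open>\<rho> \<ge> 0\<close> by (intro mult_mono) auto
    also have "\<dots> = (\<Sum>j\<le>n. \<rho> ^ (Suc n - j) * cmod (fps_nth (lin_factor a * Z) j))"
      unfolding sum_distrib_left by (intro sum.cong) (auto simp: Suc_diff_le mult_ac)
    finally show ?case by simp
  qed (simp add: lin_factor_nth)
  {
    case 0
    show ?case
    proof (cases as)
      case Nil
      then show ?thesis using 0 one[of n 0] by simp
    next
      case (Cons a as')
      then have Z: "lin_factor a * Z = 1" "cmod a \<le> \<rho>" using 0 by (auto simp: mult.commute)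
      have "cmod (fps_nth Z n) \<le> (\<Sum>j\<le>n. \<rho> ^ (n - j) * cmod (fps_nth 1 j))"
        using step[OF Z(2), of Z n] unfolding Z(1) .
      also have "\<dots> = (\<Sum>j\<le>n. if j = 0 then \<rho> ^ n else 0)" by (intro sum.cong) auto
      finally show ?thesis by simp
    qed
  next
    case (Suc E)
    show ?case
    proof (cases as)
      case Nil
      then show ?thesis using Suc.prems one[of n "Suc E"] by simp
    next
      case (Cons a as')
      have "(lin_factor a * Z) * (\<Prod>a\<leftarrow>as'. lin_factor a) = 1" using Suc.prems Cons by (simp add: mult_ac)
      then have IH: "cmod (fps_nth (lin_factor a * Z) j) \<le> real (j + E choose j) * \<rho> ^ j" for j
        using Suc.prems Cons by (intro Suc.IH[of _ as']) auto
      have "cmod a \<le> \<rho>" using Suc.prems Cons by auto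
      from step[OF this, of Z n] have "cmod (fps_nth Z n) \<le> (\<Sum>j\<le>n. \<rho> ^ (n - j) * cmod (fps_nth (lin_factor a * Z) j))" .
      also have "\<dots> \<le> (\<Sum>j\<le>n. \<rho> ^ (n - j) * (real (j + E choose j) * \<rho> ^ j))"
        using \<open>\<rho> \<ge> 0\<close> by (intro sum_mono mult_left_mono IH) auto
      also have "\<dots> = (\<Sum>j\<le>n. real (j + E choose j)) * \<rho> ^ n"
        unfolding sum_distrib_right by (intro sum.cong) (auto simp: power_add [symmetric] mult_ac)
      also have "(\<Sum>j\<le>n. real (j + E choose j)) = real (\<Sum>j\<le>n. E + j choose j)" by (simp add: add.commute)
      also have "(\<Sum>j\<le>n. E + j choose j) = (n + Suc E) choose n"
        using sum_choose_lower[of E n] by (simp add: add.commute)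
      finally show ?thesis .
    qed
  }
qed

section \<open>Residue classes of monic polynomials\<close>

lemma monic_polys_0: "monic_polys 0 = {1 :: 'a :: finite_field poly}"
proof -
  have "f = 1" if "f \<in> monic_polys 0" for f :: "'a poly"
    using that by (auto simp: monic_polys_iff one_pCons elim!: degree_eq_zeroE)
  then show ?thesis by (auto simp: monic_polys_iff)
qed

lemma card_monic_polys: "card (monic_polys n :: 'a :: finite_field poly set) = CARD('a) ^ n"
proof (induction n)
  case 0
  show ?case by (simp add: monic_polys_0)
next
  case (Suc n)
  have "monic_polys (Suc n) = (\<lambda>(a, f). pCons a f) ` (UNIV \<times> (monic_polys n :: 'a poly set))"
  proof (intro equalityI subsetI)
    fix f :: "'a poly" assume f: "f \<in> monic_polys (Suc n)"
    obtain a f' where "f = pCons a f'" by (cases f)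
    with f show "f \<in> (\<lambda>(a, f). pCons a f) ` (UNIV \<times> monic_polys n)"
      by (intro image_eqI[of _ _ "(a, f')"]) (auto simp: monic_polys_iff split: if_splits)
  qed (auto simp: monic_polys_iff split: if_splits)
  moreover have "inj_on (\<lambda>(a, f). pCons a f) (UNIV \<times> (monic_polys n :: 'a poly set))"
    by (auto simp: inj_on_def)
  ultimately show ?case using Suc by (simp add: card_image card_cartesian_product)
qed

lemma XX_power_eq_monom: "XX ^ k = monom 1 k"
  by (simp add: monom_altdef)

lemma ray_equiv_monic_iff:
  assumes "f \<in> monic_polys n" "f' \<in> monic_polys n"
  shows "ray_equiv g k f f' \<longleftrightarrow> g dvd f - f' \<and> (\<forall>i<k. i \<le> n \<longrightarrow> coeff f (n - i) = coeff f' (n - i))"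
proof -
  have "coeff (reflect_poly f - reflect_poly f') i = (if i \<le> n then coeff f (n - i) - coeff f' (n - i) else 0)" for i
    using assms by (simp add: coeff_reflect_poly monic_polys_iff)
  then have "XX ^ k dvd reflect_poly f - reflect_poly f' \<longleftrightarrow> (\<forall>i<k. i \<le> n \<longrightarrow> coeff f (n - i) = coeff f' (n - i))"
    unfolding XX_power_eq_monom monom_1_dvd_iff' by auto
  then show ?thesis by (simp add: ray_equiv_def)
qed

text \<open>The first k coefficients are put into u, and the residue modulo g is then corrected by
  r, whose degree, below n + 1 - k, is too small to touch them.\<close>

lemma ex_ray_equiv_monic_degree:
  fixes f :: "'a :: finite_field poly"
  assumes g: "g \<noteq> 0" and n: "degree g + k \<le> Suc n" and k: "k > 0" and f: "lead_coeff f = 1"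
  shows "\<exists>f'\<in>monic_polys n. ray_equiv g k f' f"
proof -
  define c where "c = (\<lambda>j. if n - j < k then coeff (reflect_poly f) (n - j) else 0)"
  define u where "u = Poly (map c [0..<Suc n])"
  define r where "r = (f - u) mod g"
  have u: "coeff u j = (if j \<le> n then c j else 0)" for j
    unfolding u_def coeff_Poly_eq by (auto simp: nth_default_def simp del: upt_Suc)
  have r: "coeff r j = 0" if "Suc n \<le> j + k" for j
  proof (cases "r = 0")
    case False
    then have "degree r < degree g" using degree_mod_less[OF g, of "f - u"] by (auto simp: r_def)
    then show ?thesis using that n by (intro coeff_eq_0) simp
  qed simp
  have f': "coeff (u + r) n = 1" using u r[of n] k f by (simp add: c_def)
  have "degree (u + r) \<le> n" using u r k by (intro degree_le) auto
  then have monic: "u + r \<in> monic_polys n" using f' le_degree[of "u + r" n] by (auto simp: monic_polys_iff)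
  have "g dvd (u + r) - f" 
    using dvd_minus_mod[of g "f - u"] by (metis r_def dvd_diff_commute diff_diff_eq)
  moreover have "coeff (reflect_poly (u + r) - reflect_poly f) i = 0" if i: "i < k" for i
  proof -
    have "i \<le> n" using i n by simp
    moreover from this have "coeff (u + r) (n - i) = coeff (reflect_poly f) i"
      using i u r[of "n - i"] by (simp add: c_def)
    ultimately show ?thesis using monic by (auto simp: coeff_reflect_poly monic_polys_iff)
  qed
  ultimately have "ray_equiv g k (u + r) f" unfolding ray_equiv_def XX_power_eq_monom monom_1_dvd_iff' by blast
  with monic show ?thesis by blast
qed

definition ray_classes :: "'a :: field poly \<Rightarrow> nat \<Rightarrow> ('a poly \<times> 'a poly) set"
  where "ray_classes g k = ray_class g k ` {f. lead_coeff f = 1}"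

definition class_rep :: "'a :: field poly \<Rightarrow> nat \<Rightarrow> 'a poly \<times> 'a poly \<Rightarrow> 'a poly"
  where "class_rep g k c = (SOME f. lead_coeff f = 1 \<and> ray_class g k f = c)"

lemma finite_ray_classes: "g \<noteq> 0 \<Longrightarrow> finite (ray_classes g k :: ('a :: {finite, field} poly \<times> _) set)"
  unfolding ray_classes_def by (rule finite_subset[OF _ finite_ray_class]) auto

lemma class_rep: "c \<in> ray_classes g k \<Longrightarrow> lead_coeff (class_rep g k c) = 1" "c \<in> ray_classes g k \<Longrightarrow> ray_class g k (class_rep g k c) = c"
  using someI_ex[of "\<lambda>f. lead_coeff f = 1 \<and> ray_class g k f = c"] by (auto simp: ray_classes_def class_rep_def)

lemma ray_class_in_ray_classes: "lead_coeff f = 1 \<Longrightarrow> ray_class g k f \<in> ray_classes g k"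
  by (auto simp: ray_classes_def)

lemma ray_equiv_class_rep: "lead_coeff f = 1 \<Longrightarrow> ray_equiv g k (class_rep g k (ray_class g k f)) f"
  unfolding ray_equiv_iff_ray_class by (rule class_rep(2)[OF ray_class_in_ray_classes])

lemma ray_equiv_translate:
  assumes f: "f \<in> monic_polys n" "f1 \<in> monic_polys n" "f2 \<in> monic_polys n" and ray_equiv: "ray_equiv g k f f1" and k: "k > 0"
  shows "f - f1 + f2 \<in> monic_polys n" "ray_equiv g k (f - f1 + f2) f2"
proof -
  have "coeff (f - f1 + f2) n = 1" using f by (auto simp: monic_polys_iff)
  moreover have "degree (f - f1 + f2) \<le> n"
    using f by (intro degree_add_le degree_diff_le) (auto simp: monic_polys_iff)
  ultimately show *: "f - f1 + f2 \<in> monic_polys n"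
    using le_degree[of "f - f1 + f2" n] by (auto simp: monic_polys_iff)
  show "ray_equiv g k (f - f1 + f2) f2"
    using ray_equiv unfolding ray_equiv_monic_iff[OF * f(3)] ray_equiv_monic_iff[OF f(1,2)] by simp
qed

text \<open>Adding f2 - f1, for fixed members of two classes, maps one fibre into the other, so all
  fibres in degree n have the same size.\<close>

lemma card_class_fibre:
  fixes g :: "'a :: finite_field poly"
  assumes g: "g \<noteq> 0" and n: "degree g + k \<le> Suc n" and k: "k > 0" and c: "c \<in> ray_classes g k" 
  shows "card {f \<in> monic_polys n. ray_class g k f = c} * card (ray_classes g k) = CARD('a) ^ n"
proof -
  let ?F = "\<lambda>c. {f \<in> monic_polys n. ray_class g k f = c}"
  have le: "card (?F a) \<le> card (?F b)" if ab: "a \<in> ray_classes g k" "b \<in> ray_classes g k" for a b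
  proof (cases "?F a = {}")
    case True then show ?thesis by (metis card.empty zero_le)
  next
    case False
    then obtain f1 where f1: "f1 \<in> monic_polys n" "ray_class g k f1 = a" by auto
    obtain f2 where "f2 \<in> monic_polys n" "ray_equiv g k f2 (class_rep g k b)" 
      using ex_ray_equiv_monic_degree[OF g n k class_rep(1)[OF ab(2)]] by blast
    then have f2: "f2 \<in> monic_polys n" "ray_class g k f2 = b" using class_rep(2)[OF ab(2)] by (auto simp: ray_equiv_iff_ray_class)
    show ?thesis
    proof (rule card_inj_on_le[of "\<lambda>f. f - f1 + f2"])
      show "(\<lambda>f. f - f1 + f2) ` ?F a \<subseteq> ?F b"
      proof (intro image_subsetI)
        fix f assume "f \<in> ?F a"
        then have f: "f \<in> monic_polys n" "ray_equiv g k f f1" using f1 by (auto simp: ray_equiv_iff_ray_class)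
        show "f - f1 + f2 \<in> ?F b"
          using ray_equiv_translate[OF f(1) f1(1) f2(1) f(2) k] f2(2) by (auto simp: ray_equiv_iff_ray_class)
      qed
    qed (auto simp: finite_monic_polys inj_on_def)
  qed
  have "CARD('a) ^ n = card (\<Union>a\<in>ray_classes g k. ?F a)"
    unfolding card_monic_polys [symmetric]
    by (intro arg_cong[of _ _ card]) (auto simp: ray_classes_def monic_polys_iff)
  also have "\<dots> = (\<Sum>a\<in>ray_classes g k. card (?F a))"
    using finite_ray_classes[OF g] by (intro card_UN_disjoint) (auto simp: finite_monic_polys)
  also have "\<dots> = (\<Sum>a\<in>ray_classes g k. card (?F c))"
    by (intro sum.cong refl antisym le c)
  finally show ?thesis by simp
qed

lemma card_ray_classes_pos: "g \<noteq> 0 \<Longrightarrow> card (ray_classes g k :: ('a :: {finite, field} poly \<times> _) set) > 0"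
  using finite_ray_classes ray_class_in_ray_classes[of 1 g k] by (auto simp: card_gt_0_iff)

text \<open>In degree \<open>degree g + k - 1\<close> all classes are attained equally often, so
  their number divides the number of monic polynomials of this degree; the -1 reflects that the
  leading coefficient is always 1.\<close>

lemma card_ray_classes_le:
  fixes g :: "'a :: finite_field poly"
  assumes g: "g \<noteq> 0" and k: "k > 0" 
  shows "card (ray_classes g k) \<le> CARD('a) ^ (degree g + k - 1)"
proof -
  have "ray_class g k 1 \<in> ray_classes g k" by (rule ray_class_in_ray_classes) simp
  from card_class_fibre[OF g _ k this, of "degree g + k - 1"]
  have eq: "CARD('a) ^ (degree g + k - 1) = card {f \<in> monic_polys (degree g + k - 1). ray_class g k f = ray_class g k 1} * card (ray_classes g k)"
    using k by simp
  have "card (ray_classes g k) dvd CARD('a) ^ (degree g + k - 1)" unfolding eq by (rule dvd_triv_right)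
  then show ?thesis by (rule dvd_imp_le) simp
qed

lemma sum_monic_classes:
  fixes g :: "'a :: finite_field poly" and \<Phi> :: "_ \<Rightarrow> complex"
  assumes g: "g \<noteq> 0" and n: "degree g + k \<le> Suc n" and k: "k > 0"
  shows "(\<Sum>f\<in>monic_polys n. \<Phi> (ray_class g k f)) = of_nat (CARD('a) ^ n) / of_nat (card (ray_classes g k)) * (\<Sum>c\<in>ray_classes g k. \<Phi> c)"
proof -
  have "(\<Sum>f\<in>monic_polys n. \<Phi> (ray_class g k f)) = (\<Sum>c\<in>ray_classes g k. \<Sum>f | f \<in> monic_polys n \<and> ray_class g k f = c. \<Phi> (ray_class g k f))"
    by (rule sum.group [symmetric, OF finite_monic_polys finite_ray_classes[OF g]]) (auto simp: ray_classes_def monic_polys_iff)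
  also have "\<dots> = (\<Sum>c\<in>ray_classes g k. of_nat (CARD('a) ^ n) / of_nat (card (ray_classes g k)) * \<Phi> c)"
  proof (intro sum.cong refl)
    fix c assume c: "c \<in> ray_classes g k"
    have "of_nat (CARD('a) ^ n) = of_nat (card {f \<in> monic_polys n. ray_class g k f = c}) * (of_nat (card (ray_classes g k)) :: complex)"
      unfolding card_class_fibre[OF g n k c, symmetric] of_nat_mult ..
    then have "of_nat (card {f \<in> monic_polys n. ray_class g k f = c}) = (of_nat (CARD('a) ^ n) / of_nat (card (ray_classes g k)) :: complex)"
      using card_ray_classes_pos[OF g, of k] by simp
    then show "(\<Sum>f | f \<in> monic_polys n \<and> ray_class g k f = c. \<Phi> (ray_class g k f)) = 
        of_nat (CARD('a) ^ n) / of_nat (card (ray_classes g k)) * \<Phi> c" by simp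
  qed
  finally show ?thesis by (simp add: sum_distrib_left)
qed

lemma ray_equiv_cancel:
  fixes f0 :: "'a :: finite_field poly"
  assumes "g \<noteq> 0" "lead_coeff f0 = 1" "coprime f0 g" "ray_equiv g k (f0 * f) (f0 * f')"
  shows "ray_equiv g k f f'"
proof -
  obtain N where N: "N > 0" "ray_equiv g k (f0 ^ N) 1" using ex_power_ray_equiv_1[OF assms(1-3)] by blast
  have *: "ray_equiv g k (f0 ^ N * f) f" for f using ray_equiv_mult[OF N(2) ray_equiv_refl, of f] by simp
  have "ray_equiv g k (f0 ^ (N - 1) * (f0 * f)) (f0 ^ (N - 1) * (f0 * f'))"
    by (rule ray_equiv_mult[OF ray_equiv_refl assms(4)])
  then have "ray_equiv g k (f0 ^ N * f) (f0 ^ N * f')" using N(1) power_minus_mult[of N f0] by (simp only: mult.assoc [symmetric])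
  then show ?thesis using * by (meson ray_equiv_sym ray_equiv_trans)
qed

lemma ray_char_class: "ray_char g k h \<Longrightarrow> lead_coeff f = 1 \<Longrightarrow> h f = h (class_rep g k (ray_class g k f))"
  by (rule dcharD(4)) (auto intro: ray_equiv_sym[OF ray_equiv_class_rep] class_rep ray_class_in_ray_classes)

lemma L_coeff_ray_char:
  fixes g :: "'a :: finite_field poly"
  assumes g: "g \<noteq> 0" and n: "degree g + k \<le> Suc n" and k: "k > 0" and h: "ray_char g k h"
  shows "L_coeff h n = of_nat (CARD('a) ^ n) / of_nat (card (ray_classes g k)) * (\<Sum>c\<in>ray_classes g k. h (class_rep g k c))"
proof -
  have "L_coeff h n = (\<Sum>f\<in>monic_polys n. h (class_rep g k (ray_class g k f)))"
    unfolding L_coeff_def by (intro sum.cong refl ray_char_class[OF h]) (auto simp: monic_polys_iff)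
  then show ?thesis using sum_monic_classes[OF g n k, of "\<lambda>c. h (class_rep g k c)"] by simp
qed

text \<open>From degree \<open>degree g + k - 1\<close> on, monic polynomials are equidistributed
  over the classes, and multiplication by \<open>f0\<close> permutes the classes while scaling the
  sum by \<open>h f0\<close>. So L is a polynomial.\<close>

lemma L_coeff_ray_char_nontrivial:
  fixes g :: "'a :: finite_field poly"
  assumes g: "g \<noteq> 0" and n: "degree g + k \<le> Suc n" and k: "k > 0" and h: "ray_char g k h"
    and f0: "lead_coeff f0 = 1" "coprime f0 g" "h f0 \<noteq> 1"
  shows "L_coeff h n = 0"
proof -
  define \<pi> where "\<pi> = (\<lambda>c. ray_class g k (f0 * class_rep g k c))"
  have monic: "lead_coeff (f0 * class_rep g k c) = 1" if "c \<in> ray_classes g k" for c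
    unfolding lead_coeff_mult using f0 class_rep(1)[OF that] by simp
  have sub: "\<pi> ` ray_classes g k \<subseteq> ray_classes g k" unfolding \<pi>_def using monic by (intro image_subsetI ray_class_in_ray_classes)
  have inj: "inj_on \<pi> (ray_classes g k)"
  proof (rule inj_onI)
    fix c c' assume c: "c \<in> ray_classes g k" "c' \<in> ray_classes g k" "\<pi> c = \<pi> c'"
    have "ray_equiv g k (f0 * class_rep g k c) (f0 * class_rep g k c')" using c(3) unfolding \<pi>_def ray_equiv_iff_ray_class .
    then have "ray_equiv g k (class_rep g k c) (class_rep g k c')" by (rule ray_equiv_cancel[OF g f0(1,2)])
    then show "c = c'" unfolding ray_equiv_iff_ray_class class_rep(2)[OF c(1)] class_rep(2)[OF c(2)] .
  qed
  have im: "\<pi> ` ray_classes g k = ray_classes g k" by (rule endo_inj_surj[OF finite_ray_classes[OF g] sub inj])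
  have "(\<Sum>c\<in>ray_classes g k. h (class_rep g k c)) = (\<Sum>c\<in>\<pi> ` ray_classes g k. h (class_rep g k c))" by (simp only: im)
  also have "\<dots> = (\<Sum>c\<in>ray_classes g k. h (class_rep g k (\<pi> c)))" by (simp add: sum.reindex[OF inj])
  also have "\<dots> = (\<Sum>c\<in>ray_classes g k. h f0 * h (class_rep g k c))"
  proof (intro sum.cong refl)
    fix c assume c: "c \<in> ray_classes g k"
    have "h (class_rep g k (\<pi> c)) = h (f0 * class_rep g k c)"
      unfolding \<pi>_def by (rule ray_char_class[OF h monic[OF c], symmetric])
    then show "h (class_rep g k (\<pi> c)) = h f0 * h (class_rep g k c)" using dcharD(3)[OF h f0(1) class_rep(1)[OF c]] by simp
  qed
  also have "\<dots> = h f0 * (\<Sum>c\<in>ray_classes g k. h (class_rep g k c))" by (rule sum_distrib_left [symmetric])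
  finally have "(\<Sum>c\<in>ray_classes g k. h (class_rep g k c)) = 0" using f0(3) by (metis mult_cancel_right1)
  then show ?thesis using L_coeff_ray_char[OF g n k h] by simp
qed

section \<open>The Riemann hypothesis and the resulting bound for Moebius sums\<close>

lemma fps_lin_factor_factorization:
  fixes F :: "complex fps"
  assumes "fps_nth F 0 = 1" "\<And>n. n > D \<Longrightarrow> fps_nth F n = 0"
  shows "\<exists>as. length as \<le> D \<and> F = (\<Prod>a\<leftarrow>as. lin_factor a)"
proof -
  define p where "p = Poly (map (fps_nth F) [0..<Suc D])"
  have p: "coeff p n = fps_nth F n" for n
    unfolding p_def coeff_Poly_eq using assms(2)[of n] by (auto simp: nth_default_def simp del: upt_Suc)
  then have "fps_of_poly p = F" by (simp add: fps_eq_iff)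
  moreover have "degree p \<le> D" using p assms(2) by (intro degree_le) auto
  moreover obtain as where "length as = degree p" "fps_of_poly p = (\<Prod>a\<leftarrow>as. lin_factor a)"
    using complex_poly_lin_factor_factorization[of p] p assms(1) by auto
  ultimately show ?thesis by metis
qed

text \<open>The power sums of the inverse zeros are, up to sign, the sums of
  \<open>ray_char_sum\<close>; a bound C q^(s t) for those with exponent 2 s t forces |a|^(2s) to be
  at most q^s, whatever C is.\<close>

lemma norm_inverse_root_le:
  fixes g :: "'a :: finite_field poly"
  assumes g: "g \<noteq> 0" and h: "ray_char g k h" and L: "Abs_fps (L_coeff h) = (\<Prod>a\<leftarrow>as. lin_factor a)" and a: "a \<in> set as"
  shows "cmod a \<le> sqrt CARD('a)"
proof -
  obtain lam s and C :: real where s: "lam \<in> {0, 1}" "s > 0"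
    and bd: "\<forall>t>0. cmod ((\<Sum>x | x ^ (CARD('a) ^ (2 * s * t)) = x. h (norm_poly (2 * s * t) x)) - lam * of_nat (CARD('a) ^ (2 * s * t)))
      \<le> C * CARD('a) ^ (s * t)"
    using ray_char_sum[OF g h] by (elim bexE exE conjE) (rule that)
  \<comment> \<open>A main term lam q^(2st) is itself a t-th power. It is carried along as one more
    value, at index \<open>length as\<close>, and the estimate is read off at the other
    indices.\<close>
  define \<gamma> where "\<gamma> = (\<lambda>i. if i < length as then (as ! i) ^ (2 * s) else lam * of_nat (CARD('a) ^ (2 * s)))"
  have bound: "cmod (\<Sum>i\<in>{..length as}. \<gamma> i ^ t) \<le> C * (real CARD('a) ^ s) ^ t" if t: "t > 0" for t
  proof -
    have "(\<Sum>i\<in>{..length as}. \<gamma> i ^ t) = (\<Sum>i<length as. (as ! i) ^ (2 * s * t)) + lam * of_nat (CARD('a) ^ (2 * s * t))"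
      using s t by (auto simp: \<gamma>_def lessThan_Suc_atMost [symmetric] power_mult power_mult_distrib)
    also have "(\<Sum>i<length as. (as ! i) ^ (2 * s * t)) = (\<Sum>a\<leftarrow>as. a ^ (2 * s * t))"
      by (simp add: sum_list_sum_nth atLeast0LessThan)
    also have "\<dots> = - L_power_sum h (2 * s * t)"
    proof -
      have "lin_factor 0 * Abs_fps (L_coeff h) = (\<Prod>a\<leftarrow>as. lin_factor a)" using L by simp
      moreover have st: "2 * s * t > 0" using s t by simp
      ultimately have "L_power_sum h (2 * s * t) - 0 ^ (2 * s * t) = - (\<Sum>a\<leftarrow>as. a ^ (2 * s * t))"
        by (intro power_sums_eq dcharD(3)[OF h] ray_char_1[OF h])
      moreover have "(0 :: complex) ^ (2 * s * t) = 0" using st by (simp only: power_0_left) simp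
      ultimately show ?thesis by (simp only: diff_0_right minus_minus)
    qed
    finally have "(\<Sum>i\<in>{..length as}. \<gamma> i ^ t) = - (L_power_sum h (2 * s * t) - lam * of_nat (CARD('a) ^ (2 * s * t)))" by simp
    then have "cmod (\<Sum>i\<in>{..length as}. \<gamma> i ^ t) = cmod (L_power_sum h (2 * s * t) - lam * of_nat (CARD('a) ^ (2 * s * t)))"
      by (simp only: norm_minus_cancel)
    also have "\<dots> \<le> C * CARD('a) ^ (s * t)" unfolding L_power_sum_def using bd t by blast
    finally show ?thesis by (simp add: power_mult)
  qed
  obtain i where i: "i < length as" "a = as ! i" using a by (auto simp: in_set_conv_nth)
  have "cmod (\<gamma> i) \<le> real CARD('a) ^ s"
    by (rule norm_le_of_power_sums_bounded[OF _ _ bound]) (use i in auto)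
  then have "((cmod a)\<^sup>2) ^ s \<le> real CARD('a) ^ s" using i by (simp add: \<gamma>_def norm_power power_mult)
  then have "(cmod a)\<^sup>2 \<le> real CARD('a)" using s(2) by (subst (asm) power_mono_iff) auto
  then show ?thesis by (rule real_le_rsqrt)
qed

lemma moebius_coeff_nontrivial_bound:
  fixes g :: "'a :: finite_field poly"
  assumes g: "g \<noteq> 0" and k: "k > 0" and h: "ray_char g k h" and E: "degree g + k \<le> Suc (Suc E)"
    and f0: "lead_coeff f0 = 1" "coprime f0 g" "h f0 \<noteq> 1"
  shows "cmod (moebius_coeff h n) \<le> real (n + E choose n) * sqrt CARD('a) ^ n"
proof -
  have "L_coeff h 0 = 1" using ray_char_1[OF h] by (simp add: L_coeff_def monic_polys_0)
  then obtain as where as: "length as \<le> Suc E" "Abs_fps (L_coeff h) = (\<Prod>a\<leftarrow>as. lin_factor a)"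
    using fps_lin_factor_factorization[of "Abs_fps (L_coeff h)" "Suc E"] L_coeff_ray_char_nontrivial[OF g _ k h f0] E by auto
  have "cmod (fps_nth (Abs_fps (moebius_coeff h)) n) \<le> real (n + E choose n) * sqrt CARD('a) ^ n"
  proof (rule inverse_prod_lin_factor_bound[OF _ as(1)])
    show "Abs_fps (moebius_coeff h) * (\<Prod>a\<leftarrow>as. lin_factor a) = 1"
      unfolding as(2) [symmetric] by (rule moebius_coeff_L_coeff[OF dcharD(3)[OF h] ray_char_1[OF h]])
  qed (use norm_inverse_root_le[OF g h as(2)] in auto)
  then show ?thesis by simp
qed

lemma trivial_L_power_sum_bound:
  fixes g :: "'a :: finite_field poly"
  assumes g: "g \<noteq> 0" and h: "ray_char g k h" and triv: "\<And>f. lead_coeff f = 1 \<Longrightarrow> coprime f g \<Longrightarrow> h f = 1" and r: "r > 0"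
  shows "cmod (L_power_sum h r - of_nat (CARD('a) ^ r)) \<le> 2 * real (degree g)"
proof -
  define F where "F = {x :: 'a alg_closure. x ^ (CARD('a) ^ r) = x}"
  define Y where "Y = {x \<in> F. poly (lift_ac g) x = 0}"
  have fin: "finite F" "card F = CARD('a) ^ r" unfolding F_def using card_frob_ac[OF r, where 'a = 'a] by auto
  have Y: "Y \<subseteq> F" "finite Y" using fin(1) by (auto simp: Y_def)
  have "L_power_sum h r - of_nat (CARD('a) ^ r) = (\<Sum>x\<in>F. h (norm_poly r x) - 1)"
    by (simp add: L_power_sum_def sum_subtractf fin flip: F_def)
  also have "\<dots> = (\<Sum>x\<in>Y. h (norm_poly r x) - 1)"
  proof (rule sum.mono_neutral_right[OF fin(1) Y(1)])
    show "\<forall>x\<in>F - Y. h (norm_poly r x) - 1 = 0"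
      using coprime_norm_poly[of g _ r] norm_poly_monic(1)[of _ r] triv by (auto simp: F_def Y_def)
  qed
  also have "cmod \<dots> \<le> of_nat (card Y) * 2"
  proof (rule sum_norm_bound)
    fix x assume "x \<in> Y"
    then have "cmod (h (norm_poly r x)) \<le> 1" by (intro dcharD(5)[OF h] norm_poly_monic) (auto simp: Y_def F_def)
    then show "cmod (h (norm_poly r x) - 1) \<le> 2" using norm_triangle_ineq4[of "h (norm_poly r x)" 1] by simp
  qed
  also have "card Y \<le> degree g"
  proof -
    have "card Y \<le> card {x. poly (lift_ac g) x = 0}"
      using g by (intro card_mono poly_roots_finite) (auto simp: Y_def)
    also have "\<dots> \<le> degree g" using card_poly_roots_bound[of "lift_ac g"] g by simp
    finally show ?thesis .
  qed
  finally show ?thesis by simp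
qed

text \<open>Here (1 - q X) L is a polynomial. Its inverse zeros have bounded power sums, since only
  points over zeros of g deviate, hence absolute value at most 1; and 1/L is 1 - q X times the
  inverse of that polynomial.\<close>

lemma moebius_coeff_trivial_bound:
  fixes g :: "'a :: finite_field poly"
  assumes g: "g \<noteq> 0" and k: "k > 0" and h: "ray_char g k h" and E: "degree g + k \<le> Suc (Suc E)"
    and triv: "\<And>f. lead_coeff f = 1 \<Longrightarrow> coprime f g \<Longrightarrow> h f = 1" and n: "n > 0"
  shows "cmod (moebius_coeff h n) \<le> (1 + real CARD('a)) * real (n + E choose n)"
proof -
  define q where "q = (of_nat CARD('a) :: complex)"
  have L0: "L_coeff h 0 = 1" using ray_char_1[OF h] by (simp add: L_coeff_def monic_polys_0)
  have "fps_nth (lin_factor q * Abs_fps (L_coeff h)) n = 0" if n: "n > Suc E" for n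
  proof -
    obtain j where j: "n = Suc j" using n by (cases n) auto
    show ?thesis unfolding lin_factor_nth using n E j L_coeff_ray_char[OF g _ k h, of n] L_coeff_ray_char[OF g _ k h, of j]
      by (simp add: q_def)
  qed
  then obtain as where as: "length as \<le> Suc E" "lin_factor q * Abs_fps (L_coeff h) = (\<Prod>a\<leftarrow>as. lin_factor a)"
    using fps_lin_factor_factorization[of "lin_factor q * Abs_fps (L_coeff h)" "Suc E"] L0 by (auto simp: lin_factor_nth)
  have root: "cmod a \<le> 1" if a: "a \<in> set as" for a
  proof -
    obtain i where i: "i < length as" "a = as ! i" using a by (auto simp: in_set_conv_nth)
    have bound: "cmod (\<Sum>i<length as. (as ! i) ^ r) \<le> 2 * real (degree g) * 1 ^ r" if r: "r > 0" for r
    proof -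
      have "L_power_sum h r - q ^ r = - (\<Sum>a\<leftarrow>as. a ^ r)"
        by (rule power_sums_eq[OF dcharD(3)[OF h] ray_char_1[OF h] as(2) r])
      also have "(\<Sum>a\<leftarrow>as. a ^ r) = (\<Sum>i<length as. (as ! i) ^ r)" by (simp add: sum_list_sum_nth atLeast0LessThan)
      finally have "(\<Sum>i<length as. (as ! i) ^ r) = - (L_power_sum h r - q ^ r)" by (simp only: minus_minus)
      then have "cmod (\<Sum>i<length as. (as ! i) ^ r) = cmod (L_power_sum h r - q ^ r)" by (simp only: norm_minus_cancel)
      then show "cmod (\<Sum>i<length as. (as ! i) ^ r) \<le> 2 * real (degree g) * 1 ^ r"
        using trivial_L_power_sum_bound[OF g h triv r] by (simp add: q_def)
    qed
    show ?thesis unfolding i(2)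
      by (rule norm_le_of_power_sums_bounded[of "{..<length as}" 1 "\<lambda>i. as ! i", OF _ _ bound]) (use i(1) in auto)
  qed
  define Z where "Z = inverse (\<Prod>a\<leftarrow>as. lin_factor a)"
  have nz: "fps_nth (\<Prod>a\<leftarrow>as. lin_factor a) 0 \<noteq> 0" by (induction as) (auto simp: fps_mult_nth_0)
  have Z: "Z * (\<Prod>a\<leftarrow>as. lin_factor a) = 1" unfolding Z_def by (rule inverse_mult_eq_1[OF nz])
  have Zb: "cmod (fps_nth Z j) \<le> real (j + E choose j)" for j
    using inverse_prod_lin_factor_bound[OF Z as(1) root, of j] by simp
  have "Abs_fps (moebius_coeff h) * Abs_fps (L_coeff h) = 1" by (rule moebius_coeff_L_coeff[OF dcharD(3)[OF h] ray_char_1[OF h]])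
  then have "lin_factor q * Z = Abs_fps (moebius_coeff h) * Abs_fps (L_coeff h) * (lin_factor q * Z)" by simp
  also have "\<dots> = Abs_fps (moebius_coeff h) * (Z * (lin_factor q * Abs_fps (L_coeff h)))" by (simp only: mult_ac)
  also have "\<dots> = Abs_fps (moebius_coeff h)" unfolding as(2) Z by simp
  finally have "moebius_coeff h n = fps_nth (lin_factor q * Z) n" by simp
  also have "\<dots> = fps_nth Z n - q * fps_nth Z (n - 1)" unfolding lin_factor_nth using n by simp
  also have "cmod \<dots> \<le> cmod (fps_nth Z n) + real CARD('a) * cmod (fps_nth Z (n - 1))"
    using norm_triangle_ineq4[of "fps_nth Z n" "q * fps_nth Z (n - 1)"] by (simp add: q_def norm_mult)
  also have "\<dots> \<le> real (n + E choose n) + real CARD('a) * real (n + E choose n)"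
  proof (intro add_mono mult_left_mono Zb)
    have "(n - 1 + E choose (n - 1)) \<le> (n + E choose n)" using n by (cases n) auto
    then show "cmod (fps_nth Z (n - 1)) \<le> real (n + E choose n)" using Zb[of "n - 1"] by linarith
  qed auto
  finally show ?thesis by (simp add: algebra_simps)
qed

lemma moebius_coeff_bound:
  fixes g :: "'a :: finite_field poly"
  assumes g: "g \<noteq> 0" and k: "k > 0" and h: "ray_char g k h" and E: "degree g + k \<le> Suc (Suc E)" and n: "n \<ge> 2"
  shows "cmod (moebius_coeff h n) \<le> 3 / 2 * real (n + E choose n) * sqrt CARD('a) ^ n"
proof (cases "\<forall>f. lead_coeff f = 1 \<longrightarrow> coprime f g \<longrightarrow> h f = 1")
  case True
  have q: "real CARD('a) \<ge> 2" using card_ge_2[where 'a = 'a] by simp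
  have "real CARD('a) = sqrt CARD('a) ^ 2" by simp
  also have "\<dots> \<le> sqrt CARD('a) ^ n" using q n by (intro power_increasing) auto
  \<comment> \<open>For q >= 2 one has 1 + q <= 3/2 q, and q is at most the n-th power of its square
    root as n >= 2; this is the origin of the factor 3/2.\<close>
  finally have "1 + real CARD('a) \<le> 3 / 2 * sqrt CARD('a) ^ n" using q by linarith
  then have "(1 + real CARD('a)) * real (n + E choose n) \<le> 3 / 2 * sqrt CARD('a) ^ n * real (n + E choose n)"
    by (rule mult_right_mono) simp
  moreover have "cmod (moebius_coeff h n) \<le> (1 + real CARD('a)) * real (n + E choose n)"
    using True n by (intro moebius_coeff_trivial_bound[OF g k h E]) auto
  ultimately have "cmod (moebius_coeff h n) \<le> 3 / 2 * sqrt CARD('a) ^ n * real (n + E choose n)" by linarith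
  then show ?thesis by (simp only: mult_ac)
next
  case False
  then obtain f0 where "lead_coeff f0 = 1" "coprime f0 g" "h f0 \<noteq> 1" by blast
  from moebius_coeff_nontrivial_bound[OF g k h E this, of n]
  have "cmod (moebius_coeff h n) \<le> real (n + E choose n) * sqrt CARD('a) ^ n" .
  also have "\<dots> \<le> 3 / 2 * (real (n + E choose n) * sqrt CARD('a) ^ n)" by simp
  finally show ?thesis by (simp add: mult_ac)
qed

section \<open>Characters of a finite commutative group\<close>

definition is_char :: "('b, 'c) monoid_scheme \<Rightarrow> 'b set \<Rightarrow> ('b \<Rightarrow> complex) \<Rightarrow> bool"
  where "is_char G H \<chi> \<longleftrightarrow> (\<forall>x\<in>H. \<forall>y\<in>H. \<chi> (x \<otimes>\<^bsub>G\<^esub> y) = \<chi> x * \<chi> y) \<and> (\<forall>x\<in>H. cmod (\<chi> x) = 1)"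

lemma is_charD:
  assumes "is_char G H \<chi>"
  shows "x \<in> H \<Longrightarrow> y \<in> H \<Longrightarrow> \<chi> (x \<otimes>\<^bsub>G\<^esub> y) = \<chi> x * \<chi> y" "x \<in> H \<Longrightarrow> cmod (\<chi> x) = 1"
  using assms by (auto simp: is_char_def)

lemma unit_complex_root:
  assumes "cmod z = 1"
  obtains w where "w ^ n = z \<or> n = 0" "cmod w = 1"
proof -
  have "z = cis (Arg z)" using assms by (subst cis_Arg) (auto simp: sgn_div_norm)
  then have "n > 0 \<Longrightarrow> cis (Arg z / real n) ^ n = z" by (simp add: DeMoivre)
  then show thesis using that[of "cis (Arg z / real n)"] by auto
qed

lemma sum_power2_le: "(\<Sum>x\<in>A. f x)\<^sup>2 \<le> real (card A) * (\<Sum>x\<in>A. (f x)\<^sup>2)"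
proof (cases "card A = 0")
  case False
  define S where "S = (\<Sum>x\<in>A. f x)"
  define n where "n = real (card A)"
  have n: "n > 0" using False by (simp add: n_def)
  have "0 \<le> (\<Sum>x\<in>A. (f x - S / n)\<^sup>2)" by (rule sum_nonneg) simp
  also have "\<dots> = (\<Sum>x\<in>A. (f x)\<^sup>2 - 2 * (S / n) * f x + (S / n)\<^sup>2)"
    by (intro sum.cong refl) (simp add: power2_diff)
  also have "\<dots> = (\<Sum>x\<in>A. (f x)\<^sup>2) - 2 * (S / n) * S + n * (S / n)\<^sup>2"
    by (simp add: sum.distrib sum_subtractf S_def n_def sum_distrib_left)
  also have "\<dots> = (\<Sum>x\<in>A. (f x)\<^sup>2) - S\<^sup>2 / n" using n by (simp add: power2_eq_square field_simps)
  finally show ?thesis using n by (simp add: S_def n_def field_simps)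
qed (auto simp: card_eq_0_iff)

locale finite_comm_group = comm_group G for G (structure) +
  assumes finite_carrier: "finite (carrier G)"
begin

lemma order_pos: "Coset.order G > 0"
  using finite_carrier one_closed by (auto simp: Coset.order_def card_gt_0_iff)

lemma inv_eq_pow: "x \<in> carrier G \<Longrightarrow> inv x = x [^] (Coset.order G - 1)"
  by (rule inv_unique'[symmetric]) (use order_pos pow_order_eq_1[of x] nat_pow_Suc[of x "Coset.order G - 1"] nat_pow_Suc2[of x "Coset.order G - 1"] in auto)

text \<open>In a finite group this describes the subgroups, an inverse being a power.\<close>

definition submon :: "'a set \<Rightarrow> bool"
  where "submon H \<longleftrightarrow> H \<subseteq> carrier G \<and> \<one> \<in> H \<and> (\<forall>x\<in>H. \<forall>y\<in>H. x \<otimes> y \<in> H)"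

lemma submonD:
  assumes "submon H"
  shows "\<one> \<in> H" "x \<in> H \<Longrightarrow> x \<in> carrier G" "x \<in> H \<Longrightarrow> y \<in> H \<Longrightarrow> x \<otimes> y \<in> H"
    "x \<in> H \<Longrightarrow> x [^] (n :: nat) \<in> H" "x \<in> H \<Longrightarrow> inv x \<in> H"
proof -
  show 1: "\<one> \<in> H" "x \<in> H \<Longrightarrow> x \<in> carrier G" "x \<in> H \<Longrightarrow> y \<in> H \<Longrightarrow> x \<otimes> y \<in> H"
    using assms by (auto simp: submon_def)
  have 2: "x \<in> H \<Longrightarrow> x [^] (n :: nat) \<in> H" for n using assms by (induction n) (auto simp: submon_def)
  then show "x \<in> H \<Longrightarrow> x [^] n \<in> H" .
  show "x \<in> H \<Longrightarrow> inv x \<in> H" using 1 2 by (simp add: inv_eq_pow)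
qed

lemma is_char_one: "submon H \<Longrightarrow> is_char G H \<chi> \<Longrightarrow> \<chi> \<one> = 1"
  using submonD[of H] is_charD(1)[of G H \<chi> \<one> \<one>] is_charD(2)[of G H \<chi> \<one>] by auto

lemma is_char_pow: "submon H \<Longrightarrow> is_char G H \<chi> \<Longrightarrow> x \<in> H \<Longrightarrow> \<chi> (x [^] (n :: nat)) = \<chi> x ^ n"
  by (induction n) (auto simp: is_char_one is_charD(1) submonD mult.commute)

text \<open>On the products h x^j the value has to be \<chi>(h) w^j. The least n with x^n in
  \<open>H\<close> divides every j with x^j in \<open>H\<close>, so w^n = \<chi>(x^n) makes this
  well defined.\<close>

lemma extend_char_step:
  assumes H: "submon H" and \<chi>: "is_char G H \<chi>" and x: "x \<in> carrier G" 
    and n: "n > 0" "x [^] n \<in> H" "\<And>k. 0 < k \<Longrightarrow> k < n \<Longrightarrow> x [^] k \<notin> H"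
    and w: "w ^ n = \<chi> (x [^] n)" "cmod w = 1"
  shows "\<exists>H' \<chi>'. submon H' \<and> is_char G H' \<chi>' \<and> H \<subseteq> H' \<and> x \<in> H' \<and> (\<forall>h\<in>H. \<chi>' h = \<chi> h) \<and> \<chi>' x = w"
proof -
  have pow: "n dvd j \<and> \<chi> (x [^] j) = w ^ j" if j: "x [^] j \<in> H" for j :: nat
  proof -
    define a where "a = x [^] (n * (j div n))"
    have a: "a \<in> H" unfolding a_def using submonD(4)[OF H n(2)] x by (simp add: nat_pow_pow)
    have "x [^] j = a \<otimes> x [^] (j mod n)" unfolding a_def using x by (simp add: nat_pow_mult)
    then have "x [^] (j mod n) = inv a \<otimes> x [^] j"
      using x submonD(2)[OF H a] by (simp add: m_assoc [symmetric])
    also have "\<dots> \<in> H" using submonD[OF H] a j by blast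
    finally have "j mod n = 0" using n(1) n(3)[of "j mod n"] by fastforce
    then obtain e where e: "j = n * e" by (auto simp: mod_eq_0_iff_dvd elim: dvdE)
    have "\<chi> (x [^] j) = \<chi> ((x [^] n) [^] e)" using x by (simp add: e nat_pow_pow)
    also have "\<dots> = w ^ j" using is_char_pow[OF H \<chi> n(2)] w(1) by (simp add: e power_mult)
    finally show ?thesis using e by simp
  qed
  have wd: "\<chi> h * w ^ j = \<chi> h' * w ^ j'"
    if h: "h \<in> H" "h' \<in> H" and le: "j \<le> j'" and eq: "h \<otimes> x [^] j = h' \<otimes> x [^] j'" for h h' and j j' :: nat
  proof -
    have c: "h \<in> carrier G" "h' \<in> carrier G" using h submonD(2)[OF H] by auto
    have "h \<otimes> x [^] j = (h' \<otimes> x [^] (j' - j)) \<otimes> x [^] j"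
      unfolding eq using c x le by (simp add: m_assoc nat_pow_mult)
    then have h_eq: "h = h' \<otimes> x [^] (j' - j)" using c x by simp
    then have "x [^] (j' - j) = inv h' \<otimes> h" using c x by (simp add: m_assoc [symmetric])
    also have "\<dots> \<in> H" using submonD[OF H] h by blast
    finally have p: "x [^] (j' - j) \<in> H" .
    have "\<chi> h = \<chi> h' * w ^ (j' - j)" unfolding h_eq using is_charD(1)[OF \<chi> h(2) p] pow[OF p] by simp
    then show ?thesis using le by (simp add: power_add [symmetric])
  qed
  then have wd: "\<chi> h * w ^ j = \<chi> h' * w ^ j'"
    if "h \<in> H" "h' \<in> H" "h \<otimes> x [^] j = h' \<otimes> x [^] j'" for h h' and j j' :: nat
    using that by (metis nat_le_linear)
  define H' where "H' = (\<lambda>(h, j :: nat). h \<otimes> x [^] j) ` (H \<times> UNIV)"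
  define \<chi>' where "\<chi>' = (\<lambda>y. SOME z. \<exists>h\<in>H. \<exists>j :: nat. y = h \<otimes> x [^] j \<and> z = \<chi> h * w ^ j)"
  have \<chi>': "\<chi>' (h \<otimes> x [^] j) = \<chi> h * w ^ j" if "h \<in> H" for h and j :: nat
  proof -
    have "\<exists>z. \<exists>h'\<in>H. \<exists>j' :: nat. h \<otimes> x [^] j = h' \<otimes> x [^] j' \<and> z = \<chi> h' * w ^ j'" using that by blast
    from someI_ex[OF this] have "\<exists>h'\<in>H. \<exists>j' :: nat. h \<otimes> x [^] j = h' \<otimes> x [^] j' \<and> \<chi>' (h \<otimes> x [^] j) = \<chi> h' * w ^ j'"
      unfolding \<chi>'_def .
    then show ?thesis using wd[OF that] by metis
  qed
  have mult: "(h \<otimes> x [^] j) \<otimes> (h' \<otimes> x [^] j') = (h \<otimes> h') \<otimes> x [^] (j + j')"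
    if "h \<in> H" "h' \<in> H" for h h' and j j' :: nat
    using submonD(2)[OF H that(1)] submonD(2)[OF H that(2)] x by (simp add: nat_pow_mult [symmetric] m_ac)
  have H'I: "h \<otimes> x [^] j \<in> H'" if "h \<in> H" for h and j :: nat using that by (auto simp: H'_def)
  have H0: "h \<otimes> x [^] (0 :: nat) = h" if "h \<in> H" for h using submonD(2)[OF H that] by simp
  have x1: "x = \<one> \<otimes> x [^] (1 :: nat)" using x by simp
  show ?thesis
  proof (intro exI[of _ H'] exI[of _ \<chi>'] conjI ballI)
    show "submon H'" unfolding submon_def
    proof (intro conjI ballI)
      show "H' \<subseteq> carrier G" using x submonD[OF H] by (auto simp: H'_def)
      show "\<one> \<in> H'" using H'I[OF submonD(1)[OF H], of 0] H0[OF submonD(1)[OF H]] by simp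
      fix y z assume "y \<in> H'" "z \<in> H'"
      then obtain h j h' j' where "y = h \<otimes> x [^] (j :: nat)" "z = h' \<otimes> x [^] (j' :: nat)" "h \<in> H" "h' \<in> H" by (auto simp: H'_def)
      then show "y \<otimes> z \<in> H'" using mult submonD(3)[OF H] by (auto intro: H'I)
    qed
    show "is_char G H' \<chi>'" unfolding is_char_def
    proof (intro conjI ballI)
      fix y z assume "y \<in> H'" "z \<in> H'"
      then obtain h j h' j' where *: "y = h \<otimes> x [^] (j :: nat)" "z = h' \<otimes> x [^] (j' :: nat)" "h \<in> H" "h' \<in> H" by (auto simp: H'_def)
      show "\<chi>' (y \<otimes> z) = \<chi>' y * \<chi>' z"
        unfolding * mult[OF *(3,4)] using * submonD(3)[OF H *(3,4)]
        by (simp add: \<chi>' is_charD(1)[OF \<chi>] power_add)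
    next
      fix y assume "y \<in> H'"
      then obtain h j where "y = h \<otimes> x [^] (j :: nat)" "h \<in> H" by (auto simp: H'_def)
      then show "cmod (\<chi>' y) = 1" using w(2) by (simp add: \<chi>' norm_mult norm_power is_charD(2)[OF \<chi>])
    qed
    show "H \<subseteq> H'" using H'I[of _ 0] H0 by fastforce
    show "x \<in> H'" using H'I[OF submonD(1)[OF H], of 1] x1 by simp
    show "\<chi>' h = \<chi> h" if "h \<in> H" for h using \<chi>'[OF that, of 0] H0[OF that] by simp
    show "\<chi>' x = w" using \<chi>'[OF submonD(1)[OF H], of 1] x1 is_char_one[OF H \<chi>] by simp
  qed
qed

lemma least_pow:
  assumes "submon H" "x \<in> carrier G"
  obtains n :: nat where "n > 0" "x [^] n \<in> H" "\<And>k :: nat. 0 < k \<Longrightarrow> k < n \<Longrightarrow> x [^] k \<notin> H"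
proof -
  have ex: "\<exists>n :: nat. n > 0 \<and> x [^] n \<in> H"
    using order_pos pow_order_eq_1[OF assms(2)] submonD(1)[OF assms(1)] by (intro exI[of _ "Coset.order G"]) auto
  show thesis
  proof (rule that[of "LEAST n :: nat. n > 0 \<and> x [^] n \<in> H"])
    show "(LEAST n :: nat. n > 0 \<and> x [^] n \<in> H) > 0" "x [^] (LEAST n :: nat. n > 0 \<and> x [^] n \<in> H) \<in> H"
      using LeastI_ex[OF ex] by auto
    show "x [^] k \<notin> H" if "0 < k" "k < (LEAST n :: nat. n > 0 \<and> x [^] n \<in> H)" for k :: nat
      using not_less_Least[OF that(2)] that(1) by auto
  qed
qed

lemma extend_char:
  assumes "submon H" "is_char G H \<chi>"
  shows "\<exists>\<chi>'. is_char G (carrier G) \<chi>' \<and> (\<forall>h\<in>H. \<chi>' h = \<chi> h)"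
  using assms
proof (induction "card (carrier G - H)" arbitrary: H \<chi> rule: less_induct)
  case less
  show ?case
  proof (cases "H = carrier G")
    case True
    with less.prems show ?thesis by blast
  next
    case False
    then obtain x where x: "x \<in> carrier G" "x \<notin> H" using submonD(2)[OF less.prems(1)] by blast
    obtain n :: nat where n: "n > 0" "x [^] n \<in> H" "\<And>k :: nat. 0 < k \<Longrightarrow> k < n \<Longrightarrow> x [^] k \<notin> H"
      using least_pow[OF less.prems(1) x(1)] by blast
    obtain w where w: "w ^ n = \<chi> (x [^] n)" "cmod w = 1"
      using unit_complex_root[OF is_charD(2)[OF less.prems(2) n(2)], of n] n(1) by blast
    obtain H' \<chi>' where H': "submon H'" "is_char G H' \<chi>'" "H \<subseteq> H'" "x \<in> H'" "\<forall>h\<in>H. \<chi>' h = \<chi> h"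
      using extend_char_step[OF less.prems x(1) n w] by blast
    have "card (carrier G - H') < card (carrier G - H)"
      using finite_carrier H' x by (intro psubset_card_mono) auto
    from less.hyps[OF this H'(1,2)] H'(3,5) show ?thesis by (metis subsetD)
  qed
qed

text \<open>Starting from the trivial subgroup, the value at x may be any n-th root of unity, n > 1
  being the order of x; a primitive one is taken and extended to the group.\<close>

lemma separating_char:
  assumes x: "x \<in> carrier G" "x \<noteq> \<one>"
  shows "\<exists>\<chi>. is_char G (carrier G) \<chi> \<and> \<chi> x \<noteq> 1"
proof -
  have H: "submon {\<one>}" and \<chi>: "is_char G {\<one>} (\<lambda>_. 1)" by (auto simp: submon_def is_char_def)
  obtain n :: nat where n: "n > 0" "x [^] n \<in> {\<one>}" "\<And>k :: nat. 0 < k \<Longrightarrow> k < n \<Longrightarrow> x [^] k \<notin> {\<one>}"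
    using least_pow[OF H x(1)] by blast
  have "n \<noteq> 1" using n(2) x by auto
  with n(1) have n2: "n \<ge> 2" by simp
  define w where "w = cis (2 * pi / n)"
  have w: "w ^ n = 1" "cmod w = 1" using n2 by (auto simp: w_def DeMoivre)
  have "w \<noteq> 1"
  proof
    assume "w = 1"
    then have eq: "cis (2 * pi * real 1 / n) = cis (2 * pi * real 0 / n)" by (simp add: w_def)
    have "inj_on (\<lambda>k. cis (2 * pi * real k / n)) {..<n}"
      using bij_betw_roots_unity[of n] n2 by (simp add: bij_betw_def)
    from inj_onD[OF this eq] have "1 = (0 :: nat)" using n2 by simp
    then show False by simp
  qed
  obtain H' \<chi>' where H': "submon H'" "is_char G H' \<chi>'" "x \<in> H'" "\<chi>' x = w"
    using extend_char_step[OF H \<chi> x(1) n, of w] w by blast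
  from extend_char[OF H'(1,2)] H'(3,4) \<open>w \<noteq> 1\<close> show ?thesis by metis
qed

definition dual :: "('a \<Rightarrow> complex) set"
  where "dual = {\<chi> \<in> extensional (carrier G). is_char G (carrier G) \<chi>}"

lemma submon_carrier: "submon (carrier G)"
  by (auto simp: submon_def)

lemma finite_dual: "finite dual"
proof (rule finite_subset)
  show "dual \<subseteq> carrier G \<rightarrow>\<^sub>E {z. z ^ Coset.order G = 1}"
  proof
    fix \<chi> assume "\<chi> \<in> dual"
    then have \<chi>: "\<chi> \<in> extensional (carrier G)" "is_char G (carrier G) \<chi>" by (auto simp: dual_def)
    have "\<chi> x ^ Coset.order G = 1" if "x \<in> carrier G" for x
      using is_char_pow[OF submon_carrier \<chi>(2) that, of "Coset.order G"] pow_order_eq_1[OF that] is_char_one[OF submon_carrier \<chi>(2)] by simp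
    then show "\<chi> \<in> carrier G \<rightarrow>\<^sub>E {z. z ^ Coset.order G = 1}" using \<chi>(1) by (simp add: PiE_iff)
  qed
  show "finite (carrier G \<rightarrow>\<^sub>E {z :: complex. z ^ Coset.order G = 1})"
    using order_pos by (intro finite_PiE finite_carrier) (auto intro!: finite_nth_roots)
qed

lemma dualD:
  assumes "\<chi> \<in> dual"
  shows "is_char G (carrier G) \<chi>" "x \<in> carrier G \<Longrightarrow> y \<in> carrier G \<Longrightarrow> \<chi> (x \<otimes> y) = \<chi> x * \<chi> y"
    "x \<in> carrier G \<Longrightarrow> cmod (\<chi> x) = 1" "\<chi> \<one> = 1" "x \<in> carrier G \<Longrightarrow> \<chi> (inv x) = cnj (\<chi> x)"
proof -
  show *: "is_char G (carrier G) \<chi>" using assms by (simp add: dual_def)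
  show m: "x \<in> carrier G \<Longrightarrow> y \<in> carrier G \<Longrightarrow> \<chi> (x \<otimes> y) = \<chi> x * \<chi> y" for x y by (rule is_charD(1)[OF *])
  show c: "x \<in> carrier G \<Longrightarrow> cmod (\<chi> x) = 1" for x by (rule is_charD(2)[OF *])
  show o: "\<chi> \<one> = 1" by (rule is_char_one[OF submon_carrier *])
  show "\<chi> (inv x) = cnj (\<chi> x)" if x: "x \<in> carrier G"
  proof -
    have "\<chi> x * \<chi> (inv x) = 1" using m[OF x, of "inv x"] x o by simp
    moreover have "\<chi> x * cnj (\<chi> x) = 1" using c[OF x] complex_norm_square[of "\<chi> x"] by simp
    ultimately show ?thesis using c[OF x] by (metis mult_left_cancel norm_zero zero_neq_one)
  qed
qed

lemma sum_dual:
  assumes x: "x \<in> carrier G" 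
  shows "(\<Sum>\<chi>\<in>dual. \<chi> x) = (if x = \<one> then of_nat (card dual) else 0)"
proof (cases "x = \<one>")
  case True
  have "(\<Sum>\<chi>\<in>dual. \<chi> x) = (\<Sum>\<chi>\<in>dual. 1)" unfolding True by (intro sum.cong refl dualD(4))
  then show ?thesis using True by simp
next
  case False
  then obtain \<chi>1 where \<chi>1: "is_char G (carrier G) \<chi>1" "\<chi>1 x \<noteq> 1" using separating_char[OF x] by blast
  define m where "m = (\<lambda>\<chi>. restrict (\<lambda>y. \<chi>1 y * \<chi> y) (carrier G))"
  have sub: "m ` dual \<subseteq> dual"
    using is_charD[OF \<chi>1(1)] by (auto simp: m_def dual_def is_char_def norm_mult)
  have inj: "inj_on m dual"
  proof (rule inj_onI)
    fix \<chi> \<chi>' assume *: "\<chi> \<in> dual" "\<chi>' \<in> dual" "m \<chi> = m \<chi>'"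
    have "\<chi> y = \<chi>' y" if y: "y \<in> carrier G" for y
    proof -
      have "\<chi>1 y * \<chi> y = \<chi>1 y * \<chi>' y" using fun_cong[OF *(3), of y] y by (simp add: m_def)
      moreover have "\<chi>1 y \<noteq> 0" using is_charD(2)[OF \<chi>1(1) y] by auto
      ultimately show ?thesis by simp
    qed
    then show "\<chi> = \<chi>'" using * by (intro extensionalityI[of _ "carrier G"]) (auto simp: dual_def)
  qed
  have "(\<Sum>\<chi>\<in>dual. \<chi> x) = (\<Sum>\<chi>\<in>m ` dual. \<chi> x)" using endo_inj_surj[OF finite_dual sub inj] by simp
  also have "\<dots> = (\<Sum>\<chi>\<in>dual. m \<chi> x)" by (simp add: sum.reindex[OF inj])
  also have "\<dots> = \<chi>1 x * (\<Sum>\<chi>\<in>dual. \<chi> x)" using x by (simp add: m_def sum_distrib_left)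
  finally have "(\<Sum>\<chi>\<in>dual. \<chi> x) = 0" using \<chi>1(2) by (metis mult_cancel_right1)
  then show ?thesis using False by simp
qed

lemma card_dual_pos: "card dual > 0"
proof -
  have "restrict (\<lambda>_. 1) (carrier G) \<in> dual" by (auto simp: dual_def is_char_def)
  then show ?thesis using finite_dual by (auto simp: card_gt_0_iff)
qed

text \<open>By Cauchy-Schwarz the square of the l1-norm is at most \<open>card dual\<close> times
  the sum of squares, which by Parseval is the sum of |\<phi>|^2 divided by
  \<open>card dual\<close>. The coefficients are normalised by \<open>card dual\<close>, the value
  of \<open>sum_dual\<close> at the identity.\<close>

lemma character_expansion:
  fixes \<phi> :: "'a \<Rightarrow> complex"
  assumes \<phi>: "\<And>x. x \<in> carrier G \<Longrightarrow> cmod (\<phi> x) \<le> 1"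
  shows "\<exists>a. (\<forall>x\<in>carrier G. \<phi> x = (\<Sum>\<chi>\<in>dual. a \<chi> * \<chi> x)) \<and> (\<Sum>\<chi>\<in>dual. cmod (a \<chi>)) \<le> sqrt (real (Coset.order G))"
proof -
  define N where "N = (of_nat (card dual) :: complex)"
  have N: "N \<noteq> 0" using card_dual_pos by (simp add: N_def)
  define a where "a = (\<lambda>\<chi>. (\<Sum>y\<in>carrier G. \<phi> y * cnj (\<chi> y)) / N)"
  have expand: "\<phi> x = (\<Sum>\<chi>\<in>dual. a \<chi> * \<chi> x)" if x: "x \<in> carrier G" for x
  proof -
    have "(\<Sum>\<chi>\<in>dual. a \<chi> * \<chi> x) = (\<Sum>\<chi>\<in>dual. \<Sum>y\<in>carrier G. \<phi> y / N * \<chi> (x \<otimes> inv y))"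
      unfolding a_def sum_divide_distrib sum_distrib_right
      using x by (intro sum.cong refl) (simp add: dualD mult_ac)
    also have "\<dots> = (\<Sum>y\<in>carrier G. \<phi> y / N * (\<Sum>\<chi>\<in>dual. \<chi> (x \<otimes> inv y)))"
      by (subst sum.swap) (simp add: sum_distrib_left)
    also have "\<dots> = (\<Sum>y\<in>carrier G. if y = x then \<phi> y else 0)"
    proof (intro sum.cong refl)
      fix y assume y: "y \<in> carrier G"
      have "x \<otimes> inv y = \<one> \<longleftrightarrow> y = x" using x y by (metis inv_closed inv_inv inv_unique' r_inv inv_equality)
      then show "\<phi> y / N * (\<Sum>\<chi>\<in>dual. \<chi> (x \<otimes> inv y)) = (if y = x then \<phi> y else 0)"
        using x y N by (simp add: sum_dual N_def)
    qed
    also have "\<dots> = \<phi> x" using x finite_carrier by simp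
    finally show ?thesis ..
  qed
  have "of_real (\<Sum>\<chi>\<in>dual. (cmod (a \<chi>))\<^sup>2) = (\<Sum>\<chi>\<in>dual. a \<chi> * cnj (a \<chi>))"
    by (simp add: complex_norm_square del: of_real_power)
  also have "\<dots> = (\<Sum>\<chi>\<in>dual. \<Sum>y\<in>carrier G. cnj (\<phi> y) / N * (a \<chi> * \<chi> y))"
  proof (intro sum.cong refl)
    fix \<chi> assume "\<chi> \<in> dual"
    have "cnj (a \<chi>) = (\<Sum>y\<in>carrier G. cnj (\<phi> y) / N * \<chi> y)" by (simp add: a_def N_def sum_divide_distrib)
    then show "a \<chi> * cnj (a \<chi>) = (\<Sum>y\<in>carrier G. cnj (\<phi> y) / N * (a \<chi> * \<chi> y))"
      by (simp add: sum_distrib_left mult_ac)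
  qed
  also have "\<dots> = (\<Sum>y\<in>carrier G. cnj (\<phi> y) / N * (\<Sum>\<chi>\<in>dual. a \<chi> * \<chi> y))"
    by (subst sum.swap) (simp add: sum_distrib_left)
  also have "\<dots> = (\<Sum>y\<in>carrier G. cnj (\<phi> y) / N * \<phi> y)"
    using expand by simp
  also have "\<dots> = of_real ((\<Sum>y\<in>carrier G. (cmod (\<phi> y))\<^sup>2) / real (card dual))"
    by (simp add: N_def complex_norm_square sum_divide_distrib mult_ac del: of_real_power)
  finally have pars: "(\<Sum>\<chi>\<in>dual. (cmod (a \<chi>))\<^sup>2) = (\<Sum>y\<in>carrier G. (cmod (\<phi> y))\<^sup>2) / real (card dual)"
    by (simp only: of_real_eq_iff)
  have "(\<Sum>\<chi>\<in>dual. cmod (a \<chi>))\<^sup>2 \<le> real (card dual) * (\<Sum>\<chi>\<in>dual. (cmod (a \<chi>))\<^sup>2)"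
    by (rule sum_power2_le)
  also have "\<dots> = (\<Sum>y\<in>carrier G. (cmod (\<phi> y))\<^sup>2)" using card_dual_pos by (simp add: pars)
  also have "\<dots> \<le> (\<Sum>y\<in>carrier G. 1)" using \<phi> by (intro sum_mono power_le_one) auto
  also have "\<dots> = real (Coset.order G)" by (simp add: Coset.order_def)
  finally have "(\<Sum>\<chi>\<in>dual. cmod (a \<chi>)) \<le> sqrt (real (Coset.order G))" by (intro real_le_rsqrt) simp
  with expand show ?thesis by blast
qed

end

section \<open>Sums over residue classes\<close>

lemma coprime_dvd_diff: 
  fixes f f' g :: "'a :: field poly"
  assumes "coprime f g" "g dvd f - f'"
  shows "coprime f' g"
proof (rule coprimeI)
  fix c assume c: "c dvd f'" "c dvd g"
  have "c dvd (f - f') + f'" using c assms(2) by (intro dvd_add) (auto intro: dvd_trans)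
  then have "c dvd f" by simp
  with c assms(1) show "is_unit c" by (auto dest: coprime_common_divisor)
qed

lemma coprime_mult_iff_poly:
  "coprime (f * f') g \<longleftrightarrow> coprime f g \<and> coprime f' g" for f f' g :: "'a :: field poly"
proof
  assume "coprime (f * f') g"
  then show "coprime f g \<and> coprime f' g" by (meson coprime_divisors dvd_refl dvd_triv_left dvd_triv_right)
next
  assume "coprime f g \<and> coprime f' g"
  then show "coprime (f * f') g" using coprime_mult_right[of g f f'] by (simp add: coprime_commute)
qed

definition ray_class_group :: "'a :: field poly \<Rightarrow> nat \<Rightarrow> ('a poly \<times> 'a poly) monoid"
  where "ray_class_group g k = \<lparr>carrier = ray_class g k ` {f. lead_coeff f = 1 \<and> coprime f g},
    mult = (\<lambda>c c'. ray_class g k (class_rep g k c * class_rep g k c')), one = ray_class g k 1\<rparr>"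

lemma carrier_ray_class_group: "c \<in> carrier (ray_class_group g k) \<longleftrightarrow> (\<exists>f. lead_coeff f = 1 \<and> coprime f g \<and> c = ray_class g k f)"
  by (auto simp: ray_class_group_def)

lemma mult_ray_class_group:
  assumes "lead_coeff f = 1" "lead_coeff f' = 1"
  shows "ray_class g k f \<otimes>\<^bsub>ray_class_group g k\<^esub> ray_class g k f' = ray_class g k (f * f')"
  using ray_equiv_mult[OF ray_equiv_class_rep[OF assms(1), of g k] ray_equiv_class_rep[OF assms(2), of g k]] by (simp add: ray_class_group_def ray_equiv_iff_ray_class)

lemma one_ray_class_group: "\<one>\<^bsub>ray_class_group g k\<^esub> = ray_class g k 1"
  by (simp add: ray_class_group_def)

lemma lead_coeff_mult_1: "lead_coeff f = 1 \<Longrightarrow> lead_coeff f' = 1 \<Longrightarrow> lead_coeff (f * f') = (1 :: 'a :: idom)"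
  by (simp only: lead_coeff_mult mult_1)

lemma finite_comm_group_ray_class_group:
  fixes g :: "'a :: finite_field poly"
  assumes g: "g \<noteq> 0"
  shows "finite_comm_group (ray_class_group g k)"
proof -
  have "comm_group (ray_class_group g k)"
  proof (rule comm_groupI)
    fix x y z assume "x \<in> carrier (ray_class_group g k)" "y \<in> carrier (ray_class_group g k)" "z \<in> carrier (ray_class_group g k)"
    then obtain a b c where *: "lead_coeff a = 1" "coprime a g" "x = ray_class g k a" "lead_coeff b = 1" "coprime b g" "y = ray_class g k b"
      "lead_coeff c = 1" "coprime c g" "z = ray_class g k c" unfolding carrier_ray_class_group by blast
    note lc = lead_coeff_mult_1[OF *(1,4)] lead_coeff_mult_1[OF *(4,7)]
    show "x \<otimes>\<^bsub>ray_class_group g k\<^esub> y \<in> carrier (ray_class_group g k)"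
      unfolding *(3,6) mult_ray_class_group[OF *(1,4)] carrier_ray_class_group using lc *(2,5) by (metis coprime_mult_iff_poly)
    show "x \<otimes>\<^bsub>ray_class_group g k\<^esub> y \<otimes>\<^bsub>ray_class_group g k\<^esub> z = x \<otimes>\<^bsub>ray_class_group g k\<^esub> (y \<otimes>\<^bsub>ray_class_group g k\<^esub> z)"
      unfolding *(3,6,9) mult_ray_class_group[OF *(1,4)] mult_ray_class_group[OF *(4,7)] mult_ray_class_group[OF lc(1) *(7)] mult_ray_class_group[OF *(1) lc(2)]
      by (simp only: mult.assoc)
  next
    fix x y assume "x \<in> carrier (ray_class_group g k)" "y \<in> carrier (ray_class_group g k)"
    then obtain a b where *: "lead_coeff a = 1" "x = ray_class g k a" "lead_coeff b = 1" "y = ray_class g k b"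
      unfolding carrier_ray_class_group by blast
    show "x \<otimes>\<^bsub>ray_class_group g k\<^esub> y = y \<otimes>\<^bsub>ray_class_group g k\<^esub> x"
      unfolding * mult_ray_class_group[OF *(1,3)] mult_ray_class_group[OF *(3,1)] by (simp only: mult.commute)
  next
    show "\<one>\<^bsub>ray_class_group g k\<^esub> \<in> carrier (ray_class_group g k)" unfolding carrier_ray_class_group one_ray_class_group by (intro exI[of _ 1]) auto
    fix x assume "x \<in> carrier (ray_class_group g k)"
    then obtain a where a: "lead_coeff a = 1" "coprime a g" "x = ray_class g k a" unfolding carrier_ray_class_group by blast
    have 1: "lead_coeff (1 :: 'a poly) = 1" by simp
    show "\<one>\<^bsub>ray_class_group g k\<^esub> \<otimes>\<^bsub>ray_class_group g k\<^esub> x = x" unfolding a one_ray_class_group mult_ray_class_group[OF 1 a(1)] by simp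
    obtain N where N: "N > 0" "ray_equiv g k (a ^ N) 1" using ex_power_ray_equiv_1[OF g a(1,2)] by blast
    have lc: "lead_coeff (a ^ (N - 1)) = 1" using a(1) by (simp add: lead_coeff_power)
    have "coprime (a ^ (N - 1)) g" using coprime_power_right[of g a] a(2) by (simp add: coprime_commute)
    then have "ray_class g k (a ^ (N - 1)) \<in> carrier (ray_class_group g k)" unfolding carrier_ray_class_group using lc by blast
    moreover have "ray_class g k (a ^ (N - 1)) \<otimes>\<^bsub>ray_class_group g k\<^esub> x = \<one>\<^bsub>ray_class_group g k\<^esub>"
      unfolding a(3) mult_ray_class_group[OF lc a(1)] one_ray_class_group power_minus_mult[OF N(1)] using N(2) by (simp only: ray_equiv_iff_ray_class)
    ultimately show "\<exists>y\<in>carrier (ray_class_group g k). y \<otimes>\<^bsub>ray_class_group g k\<^esub> x = \<one>\<^bsub>ray_class_group g k\<^esub>" by blast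
  qed
  moreover have "finite (carrier (ray_class_group g k))"
    by (rule finite_subset[OF _ finite_ray_class[OF g, of k]]) (auto simp: ray_class_group_def)
  ultimately show ?thesis by (simp add: finite_comm_group_def finite_comm_group_axioms_def)
qed

lemma ray_char_of_char:
  assumes \<chi>: "is_char (ray_class_group g' k) (carrier (ray_class_group g' k)) \<chi>" and dvd: "g' dvd g"
  shows "ray_char g k (\<lambda>f. if coprime f g then \<chi> (ray_class g' k f) else 0)"
  unfolding ray_char_def
proof (intro conjI allI impI)
  have cop: "coprime f g'" if "coprime f g" for f using that dvd by (meson coprime_divisors dvd_refl)
  have mem: "ray_class g' k f \<in> carrier (ray_class_group g' k)" if "coprime f g" "lead_coeff f = 1" for f
    using that cop unfolding carrier_ray_class_group by blast
  {
    fix f f' :: "'a poly" assume lc: "lead_coeff f = 1" "lead_coeff f' = 1"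
    show "(if coprime (f * f') g then \<chi> (ray_class g' k (f * f')) else 0) = 
      (if coprime f g then \<chi> (ray_class g' k f) else 0) * (if coprime f' g then \<chi> (ray_class g' k f') else 0)"
    proof (cases "coprime f g \<and> coprime f' g")
      case True
      then have "\<chi> (ray_class g' k f \<otimes>\<^bsub>ray_class_group g' k\<^esub> ray_class g' k f') = \<chi> (ray_class g' k f) * \<chi> (ray_class g' k f')"
        using lc mem by (intro is_charD(1)[OF \<chi>]) auto
      then show ?thesis using True by (simp add: mult_ray_class_group[OF lc] coprime_mult_iff_poly)
    qed (auto simp: coprime_mult_iff_poly)
  next
    fix f f' :: "'a poly" assume ray_equiv: "ray_equiv g k f f'"
    then have "coprime f g \<longleftrightarrow> coprime f' g"
      using coprime_dvd_diff[of f g f'] coprime_dvd_diff[of f' g f] by (auto simp: ray_equiv_def dvd_diff_commute)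
    moreover have "ray_equiv g' k f f'" using ray_equiv dvd by (auto simp: ray_equiv_def intro: dvd_trans)
    ultimately show "(if coprime f g then \<chi> (ray_class g' k f) else 0) = (if coprime f' g then \<chi> (ray_class g' k f') else 0)"
      by (simp add: ray_equiv_iff_ray_class)
  next
    fix f :: "'a poly" assume "lead_coeff f = 1" "coprime f g"
    with is_charD(2)[OF \<chi> mem] show "cmod (if coprime f g then \<chi> (ray_class g' k f) else 0) = 1" by simp
  }
qed simp

lemma order_ray_class_group_le:
  fixes g :: "'a :: finite_field poly"
  assumes "g \<noteq> 0" "k > 0"
  shows "Coset.order (ray_class_group g k) \<le> CARD('a) ^ (degree g + k - 1)"
proof -
  have "card (carrier (ray_class_group g k)) \<le> card (ray_classes g k)"
    using finite_ray_classes[OF assms(1)] by (intro card_mono) (auto simp: ray_class_group_def ray_classes_def)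
  with card_ray_classes_le[OF assms] show ?thesis by (simp add: Coset.order_def)
qed

text \<open>The expansion takes place in the group modulo g', while coprimality to the larger g is
  absorbed into the characters. So the l1-norm costs only the square root of the smaller group, on
  which the later summation over divisors of g relies.\<close>

lemma moebius_class_sum_bound:
  fixes g :: "'a :: finite_field poly" and \<psi> :: "'a poly \<Rightarrow> complex"
  assumes g: "g \<noteq> 0" and g': "g' dvd g" and k: "k > 0" and E: "degree g + k \<le> Suc (Suc E)" and n: "n \<ge> 2"
    and bd: "\<And>f. f \<in> monic_polys n \<Longrightarrow> cmod (\<psi> f) \<le> 1"
    and inv: "\<And>f f'. f \<in> monic_polys n \<Longrightarrow> f' \<in> monic_polys n \<Longrightarrow> ray_equiv g' k f f' \<Longrightarrow> \<psi> f = \<psi> f'"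
  shows "cmod (\<Sum>f | f \<in> monic_polys n \<and> coprime f g. of_int (poly_moebius f) * \<psi> f)
    \<le> sqrt (real (CARD('a) ^ (degree g' + k - 1))) * (3 / 2 * real (n + E choose n) * sqrt CARD('a) ^ n)"
proof -
  have nz: "g' \<noteq> 0" using g g' by auto
  interpret G: finite_comm_group "ray_class_group g' k" by (rule finite_comm_group_ray_class_group[OF nz])
  define P where "P = (\<lambda>c f. f \<in> monic_polys n \<and> ray_class g' k f = c)"
  define \<phi> where "\<phi> = (\<lambda>c. if \<exists>f. P c f then \<psi> (SOME f. P c f) else 0)"
  have \<phi>: "\<phi> (ray_class g' k f) = \<psi> f" if f: "f \<in> monic_polys n" for f
  proof -
    have ex: "P (ray_class g' k f) f" using f by (simp add: P_def)
    from someI[of "P (ray_class g' k f)", OF ex] have "\<psi> (SOME f'. P (ray_class g' k f) f') = \<psi> f"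
      unfolding P_def using f by (intro inv) (auto simp: ray_equiv_iff_ray_class)
    then show ?thesis using ex by (auto simp: \<phi>_def)
  qed
  have "cmod (\<phi> c) \<le> 1" for c
    using bd someI_ex[of "P c"] by (auto simp: \<phi>_def P_def)
  from G.character_expansion[of \<phi>, OF this] obtain a 
    where a: "\<And>c. c \<in> carrier (ray_class_group g' k) \<Longrightarrow> \<phi> c = (\<Sum>\<chi>\<in>G.dual. a \<chi> * \<chi> c)"
      "(\<Sum>\<chi>\<in>G.dual. cmod (a \<chi>)) \<le> sqrt (real (Coset.order (ray_class_group g' k)))" by blast
  define h where "h = (\<lambda>\<chi> f. if coprime f g then \<chi> (ray_class g' k f) else (0 :: complex))"
  define B where "B = 3 / 2 * real (n + E choose n) * sqrt CARD('a) ^ n"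
  have B: "B \<ge> 0" by (simp add: B_def)
  have "(\<Sum>f | f \<in> monic_polys n \<and> coprime f g. of_int (poly_moebius f) * \<psi> f) = 
      (\<Sum>f | f \<in> monic_polys n \<and> coprime f g. \<Sum>\<chi>\<in>G.dual. a \<chi> * (of_int (poly_moebius f) * h \<chi> f))"
  proof (intro sum.cong refl)
    fix f assume f: "f \<in> {f. f \<in> monic_polys n \<and> coprime f g}"
    then have "coprime f g'" using g' coprime_divisors[of f f g' g] by simp
    with f have "ray_class g' k f \<in> carrier (ray_class_group g' k)" unfolding carrier_ray_class_group monic_polys_iff by blast
    from a(1)[OF this] have "\<psi> f = (\<Sum>\<chi>\<in>G.dual. a \<chi> * h \<chi> f)" using f by (simp add: \<phi> h_def)
    then show "of_int (poly_moebius f) * \<psi> f = (\<Sum>\<chi>\<in>G.dual. a \<chi> * (of_int (poly_moebius f) * h \<chi> f))"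
      by (simp add: sum_distrib_left mult_ac)
  qed
  also have "\<dots> = (\<Sum>\<chi>\<in>G.dual. a \<chi> * (\<Sum>f | f \<in> monic_polys n \<and> coprime f g. of_int (poly_moebius f) * h \<chi> f))"
    by (subst sum.swap) (simp add: sum_distrib_left)
  also have "\<dots> = (\<Sum>\<chi>\<in>G.dual. a \<chi> * moebius_coeff (h \<chi>) n)"
  proof -
    have "(\<Sum>f | f \<in> monic_polys n \<and> coprime f g. of_int (poly_moebius f) * h \<chi> f) = moebius_coeff (h \<chi>) n" for \<chi>
      unfolding moebius_coeff_def by (rule sum.mono_neutral_left) (auto simp: finite_monic_polys h_def)
    then show ?thesis by simp
  qed
  finally have "cmod (\<Sum>f | f \<in> monic_polys n \<and> coprime f g. of_int (poly_moebius f) * \<psi> f) \<le> (\<Sum>\<chi>\<in>G.dual. cmod (a \<chi> * moebius_coeff (h \<chi>) n))"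
    by (simp only: norm_sum)
  also have "\<dots> \<le> (\<Sum>\<chi>\<in>G.dual. cmod (a \<chi>) * B)"
  proof (intro sum_mono)
    fix \<chi> assume "\<chi> \<in> G.dual"
    then have "ray_char g k (h \<chi>)" unfolding h_def by (intro ray_char_of_char[OF _ g'] G.dualD(1))
    from moebius_coeff_bound[OF g k this E n] show "cmod (a \<chi> * moebius_coeff (h \<chi>) n) \<le> cmod (a \<chi>) * B"
      unfolding norm_mult B_def by (intro mult_left_mono) auto
  qed
  also have "\<dots> = (\<Sum>\<chi>\<in>G.dual. cmod (a \<chi>)) * B" by (simp only: sum_distrib_right)
  also have "\<dots> \<le> sqrt (real (CARD('a) ^ (degree g' + k - 1))) * B"
  proof (rule mult_right_mono[OF _ B])
    have "sqrt (real (Coset.order (ray_class_group g' k))) \<le> sqrt (real (CARD('a) ^ (degree g' + k - 1)))"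
      using order_ray_class_group_le[OF nz k] by (simp only: real_sqrt_le_iff of_nat_le_iff)
    with a(2) show "(\<Sum>\<chi>\<in>G.dual. cmod (a \<chi>)) \<le> sqrt (real (CARD('a) ^ (degree g' + k - 1)))" by linarith
  qed
  finally show ?thesis unfolding B_def .
qed

section \<open>Exponential sums\<close>

lemma moebius_mult_coprime:
  fixes d f :: "'a :: finite_field poly"
  assumes "lead_coeff d = 1" "lead_coeff f = 1" "coprime f d"
  shows "poly_moebius (d * f) = poly_moebius d * poly_moebius f"
  using assms
proof (induction "degree d" arbitrary: d rule: less_induct)
  case less
  show ?case
  proof (cases "degree d = 0")
    case True
    then have "d \<in> monic_polys 0" using less.prems(1) by (simp add: monic_polys_iff)
    then have "d = 1" by (simp add: monic_polys_0)
    then show ?thesis by simp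
  next
    case False
    then obtain P where P: "lead_coeff P = 1" "irreducible P" "P dvd d"
      using ex_monic_irreducible_divisor[of d] by auto
    have prime: "prime_elem P" using P by (intro field_poly_irreducible_imp_prime)
    have nu: "\<not> is_unit P" "P \<noteq> 0" using P(2) by (auto simp: comm_semiring_1_class.irreducible_def)
    then have dP: "degree P > 0" by (simp add: is_unit_iff_degree)
    obtain d1 where d1: "d = P * d1" using P(3) by (elim dvdE)
    have lc: "lead_coeff d1 = 1" using less.prems(1) P(1) unfolding d1 lead_coeff_mult by simp
    show ?thesis
    proof (cases "P dvd d1")
      case True
      then have "P ^ 2 dvd d" unfolding d1 power2_eq_square by (rule mult_dvd_mono[OF dvd_refl])
      then show ?thesis using dP by (simp add: poly_moebius_not_squarefree dvd_mult2)
    next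
      case False
      have "\<not> P dvd f" using less.prems(3) P(3) nu by (auto dest: coprime_common_divisor)
      with False have ndvd: "\<not> P dvd d1 * f" using prime by (simp add: prime_elem_dvd_mult_iff)
      have "degree d = degree P + degree d1" unfolding d1 using nu lc by (subst degree_mult_eq) auto
      moreover have "coprime f d1" using less.prems(3) coprime_divisors[of f f d1 d] d1 by simp
      ultimately have "poly_moebius (d1 * f) = poly_moebius d1 * poly_moebius f"
        using less.prems(2) lc dP by (intro less.hyps) auto
      moreover have "poly_moebius (P * (d1 * f)) = - poly_moebius (d1 * f)"
        using lead_coeff_mult_1[OF lc less.prems(2)] ndvd P by (intro moebius_mult_irreducible)
      moreover have "poly_moebius (P * d1) = - poly_moebius d1" 
        using lc False P by (intro moebius_mult_irreducible)
      ultimately show ?thesis by (simp add: d1 mult.assoc)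
    qed
  qed
qed

lemma abs_poly_moebius_le: "\<bar>poly_moebius f\<bar> \<le> 1"
  by (simp add: poly_moebius_def power_abs)

text \<open>Take for d a common divisor of largest degree. An irreducible P dividing both f / d and
  g would not divide d, as f is squarefree, so d P would be a larger common divisor.\<close>

lemma squarefree_coprime_part:
  fixes f g :: "'a :: finite_field poly"
  assumes f: "lead_coeff f = 1" "squarefree f" and g: "g \<noteq> 0"
  shows "\<exists>d f'. lead_coeff d = 1 \<and> d dvd g \<and> lead_coeff f' = 1 \<and> coprime f' g \<and> f = d * f'"
proof -
  define Q where "Q = (\<lambda>d. lead_coeff d = 1 \<and> d dvd f \<and> d dvd g)"
  have "Q 1" by (simp add: Q_def)
  moreover have "\<forall>d. Q d \<longrightarrow> degree d < Suc (degree g)" using g by (auto simp: Q_def less_Suc_eq_le intro: dvd_imp_degree_le)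
  ultimately have "\<exists>d. Q d \<and> (\<forall>d'. Q d' \<longrightarrow> degree d' \<le> degree d)"
    by (rule ex_has_greatest_nat[where f = degree])
  then obtain d where d: "Q d" "\<And>d'. Q d' \<Longrightarrow> degree d' \<le> degree d" by blast
  then have d': "lead_coeff d = 1" "d dvd f" "d dvd g" by (auto simp: Q_def)
  then obtain f' where f': "f = d * f'" by (elim dvdE)
  have lc: "lead_coeff f' = 1" using f(1) d'(1) unfolding f' lead_coeff_mult by simp
  have "coprime f' g"
  proof (rule coprimeI, rule ccontr)
    fix c assume c: "c dvd f'" "c dvd g" "\<not> is_unit c"
    have "c \<noteq> 0" using c(2) g by auto
    with c(3) have "degree c > 0" by (simp add: is_unit_iff_degree)
    then obtain P where P: "lead_coeff P = 1" "irreducible P" "P dvd c"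
      using ex_monic_irreducible_divisor by blast
    have prime: "prime_elem P" using P by (intro field_poly_irreducible_imp_prime)
    have nu: "\<not> is_unit P" "P \<noteq> 0" using P(2) by (auto simp: comm_semiring_1_class.irreducible_def)
    have Pd: "P dvd f'" "P dvd g" using P(3) c by (auto intro: dvd_trans)
    have "\<not> P dvd d"
    proof
      assume "P dvd d"
      then have "P * P dvd f" unfolding f' using Pd(1) by (rule mult_dvd_mono)
      then show False using f(2) nu by (auto simp: squarefree_def power2_eq_square)
    qed
    moreover obtain s where s: "g = d * s" using d'(3) by (elim dvdE)
    ultimately have "P dvd s" using Pd(2) prime by (simp add: prime_elem_dvd_mult_iff)
    then have "d * P dvd g" unfolding s by (intro mult_dvd_mono) auto
    moreover have "d * P dvd f" unfolding f' using Pd(1) by (intro mult_dvd_mono) auto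
    ultimately have "Q (d * P)" using lead_coeff_mult_1[OF d'(1) P(1)] by (auto simp: Q_def)
    from d(2)[OF this] have "degree (d * P) \<le> degree d" .
    moreover have "degree (d * P) = degree d + degree P" using d'(1) nu by (intro degree_mult_eq) auto
    moreover have "degree P > 0" using nu by (simp add: is_unit_iff_degree)
    ultimately show False by simp
  qed
  with d' lc f' show ?thesis by blast
qed

text \<open>Only squarefree f contribute, and these are uniquely d f' with d dividing g and f'
  coprime to g; on such products the Moebius function is multiplicative.\<close>

lemma sum_moebius_split:
  fixes g :: "'a :: finite_field poly" and \<phi> :: "'a poly \<Rightarrow> complex"
  assumes g: "lead_coeff g = 1" and n: "degree g \<le> n"
  shows "(\<Sum>f\<in>monic_polys n. of_int (poly_moebius f) * \<phi> f) = 
    (\<Sum>d | lead_coeff d = 1 \<and> d dvd g. of_int (poly_moebius d) *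
      (\<Sum>f | f \<in> monic_polys (n - degree d) \<and> coprime f g. of_int (poly_moebius f) * \<phi> (d * f)))"
proof -
  have g0: "g \<noteq> 0" using g by auto
  define D where "D = {d. lead_coeff d = 1 \<and> d dvd g}"
  define T where "T = (SIGMA d:D. {f \<in> monic_polys (n - degree d). coprime f g})"
  have finD: "finite D" unfolding D_def by (rule finite_monic_divisors[OF g0])
  have T: "d * f \<in> monic_polys n" if "(d, f) \<in> T" for d f
  proof -
    have *: "lead_coeff d = 1" "d dvd g" "lead_coeff f = 1" "degree f = n - degree d"
      using that by (auto simp: T_def D_def monic_polys_iff)
    have "degree (d * f) = degree d + degree f" using *(1,3) by (intro degree_mult_eq) auto
    moreover have "degree d \<le> degree g" using *(2) g0 by (rule dvd_imp_degree_le)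
    ultimately show ?thesis using lead_coeff_mult_1[OF *(1,3)] * n by (auto simp: monic_polys_iff)
  qed
  have inj: "inj_on (\<lambda>(d, f). d * f) T"
  proof (rule inj_onI, clarify)
    fix d f d' f' assume *: "(d, f) \<in> T" "(d', f') \<in> T" "d * f = d' * f'"
    have m: "lead_coeff d = 1" "d dvd g" "coprime f g" "lead_coeff d' = 1" "d' dvd g" "coprime f' g"
      using * by (auto simp: T_def D_def)
    have "coprime d f'" "coprime d' f" 
      using m coprime_divisors[of d g f' f'] coprime_divisors[of d' g f f] by (simp_all add: coprime_commute)
    then have "d dvd d'" "d' dvd d"
      using coprime_dvd_cancel_left[of d f' d'] coprime_dvd_cancel_left[of d' f d] *(3)
      by (metis dvd_triv_left mult.commute)+
    then have "d = d'" using m by (intro monic_dvd_antisym)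
    moreover have "d \<noteq> 0" using m by auto
    ultimately show "d = d' \<and> f = f'" using *(3) by simp
  qed
  have "(\<Sum>f\<in>monic_polys n. of_int (poly_moebius f) * \<phi> f) = (\<Sum>f\<in>(\<lambda>(d, f). d * f) ` T. of_int (poly_moebius f) * \<phi> f)"
  proof (rule sum.mono_neutral_right[OF finite_monic_polys])
    show "(\<lambda>(d, f). d * f) ` T \<subseteq> monic_polys n" using T by auto
    show "\<forall>f\<in>monic_polys n - (\<lambda>(d, f). d * f) ` T. of_int (poly_moebius f) * \<phi> f = 0"
    proof
      fix f assume f: "f \<in> monic_polys n - (\<lambda>(d, f). d * f) ` T"
      have "\<not> squarefree f"
      proof
        assume "squarefree f"
        then obtain d f' where *: "lead_coeff d = 1" "d dvd g" "lead_coeff f' = 1" "coprime f' g" "f = d * f'"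
          using squarefree_coprime_part[of f g] f g0 by (auto simp: monic_polys_iff)
        have "degree f = degree d + degree f'" unfolding *(5) using *(1,3) by (intro degree_mult_eq) auto
        then have "(d, f') \<in> T" using * f by (auto simp: T_def D_def monic_polys_iff)
        then have "f \<in> (\<lambda>(d, f). d * f) ` T" using *(5) by force
        then show False using f by simp
      qed
      then show "of_int (poly_moebius f) * \<phi> f = 0" by (simp add: poly_moebius_def)
    qed
  qed
  also have "\<dots> = (\<Sum>(d, f)\<in>T. of_int (poly_moebius (d * f)) * \<phi> (d * f))"
    by (subst sum.reindex[OF inj]) (simp add: o_def split_beta)
  also have "\<dots> = (\<Sum>d\<in>D. \<Sum>f | f \<in> monic_polys (n - degree d) \<and> coprime f g. of_int (poly_moebius (d * f)) * \<phi> (d * f))"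
    unfolding T_def by (rule sum.Sigma [symmetric]) (auto simp: finD finite_monic_polys)
  also have "\<dots> = (\<Sum>d\<in>D. of_int (poly_moebius d) * (\<Sum>f | f \<in> monic_polys (n - degree d) \<and> coprime f g. of_int (poly_moebius f) * \<phi> (d * f)))"
    unfolding sum_distrib_left
  proof (intro sum.cong refl)
    fix d f assume d: "d \<in> D" and f: "f \<in> {f \<in> monic_polys (n - degree d). coprime f g}"
    have "coprime f d" using d f coprime_divisors[of f f d g] by (simp add: D_def)
    then have "poly_moebius (d * f) = poly_moebius d * poly_moebius f"
      using d f by (intro moebius_mult_coprime) (auto simp: D_def monic_polys_iff)
    then show "of_int (poly_moebius (d * f)) * \<phi> (d * f) = of_int (poly_moebius d) * (of_int (poly_moebius f) * \<phi> (d * f))"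
      by (simp add: mult.assoc)
  qed
  finally show ?thesis by (simp add: D_def)
qed

text \<open>For d of degree e, \<phi>(d f) depends on f only through its class modulo g / d, and f
  has degree n - e. Each of these saves q^(e/2), which together balances the at most q^e divisors d.
  The binomials are summed over e by \<open>sum_choose_lower\<close>, which raises E to E +
  1.\<close>

lemma moebius_sum_bound:
  fixes g :: "'a :: finite_field poly" and \<phi> :: "'a poly \<Rightarrow> complex"
  assumes g: "lead_coeff g = 1" and k: "k > 0" and E: "degree g + k = Suc (Suc E)" and n: "n \<ge> degree g + 2"
    and bd: "\<And>f. f \<in> monic_polys n \<Longrightarrow> cmod (\<phi> f) \<le> 1"
    and inv: "\<And>f f'. f \<in> monic_polys n \<Longrightarrow> f' \<in> monic_polys n \<Longrightarrow> ray_equiv g k f f' \<Longrightarrow> \<phi> f = \<phi> f'"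
  shows "cmod (\<Sum>f\<in>monic_polys n. of_int (poly_moebius f) * \<phi> f)
    \<le> 3 / 2 * real (n + Suc E choose n) * sqrt CARD('a) ^ (n + Suc E)"
proof -
  have g0: "g \<noteq> 0" using g by auto
  define s where "s = sqrt CARD('a)"
  have s: "s > 0" "s\<^sup>2 = CARD('a)" by (auto simp: s_def)
  define D where "D = {d. lead_coeff d = 1 \<and> d dvd g}"
  have finD: "finite D" unfolding D_def by (rule finite_monic_divisors[OF g0])
  define W where "W = (\<lambda>e. 3 / 2 * real (n - e + E choose (n - e)) * s ^ (n + Suc E) / s ^ (2 * e))"
  have inner: "cmod (\<Sum>f | f \<in> monic_polys (n - degree d) \<and> coprime f g. of_int (poly_moebius f) * \<phi> (d * f)) \<le> W (degree d)"
    if d: "d \<in> D" for d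
  proof -
    obtain g' where g': "g = d * g'" using d by (auto simp: D_def)
    have nz: "d \<noteq> 0" "g' \<noteq> 0" using g' g0 by auto
    have deg: "degree g = degree d + degree g'" unfolding g' using nz by (intro degree_mult_eq)
    have memb: "d * f \<in> monic_polys n" if f: "f \<in> monic_polys (n - degree d)" for f
    proof -
      have *: "lead_coeff d = 1" "lead_coeff f = 1" "degree f = n - degree d"
        using d f by (auto simp: D_def monic_polys_iff)
      have "degree (d * f) = degree d + degree f" using *(1,2) by (intro degree_mult_eq) auto
      then show ?thesis using lead_coeff_mult_1[OF *(1,2)] *(3) n deg by (auto simp: monic_polys_iff)
    qed
    have inv': "\<phi> (d * f) = \<phi> (d * f')" if f: "f \<in> monic_polys (n - degree d)" "f' \<in> monic_polys (n - degree d)" "ray_equiv g' k f f'" for f f'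
    proof (rule inv[OF memb[OF f(1)] memb[OF f(2)]])
      have "ray_equiv g' k (d * f) (d * f')" using f(3) by (rule ray_equiv_mult[OF ray_equiv_refl])
      moreover have "g dvd d * f - d * f'" unfolding g' right_diff_distrib [symmetric]
        using f(3) by (intro mult_dvd_mono dvd_refl) (simp add: ray_equiv_def)
      ultimately show "ray_equiv g k (d * f) (d * f')" by (simp add: ray_equiv_def)
    qed
    have "cmod (\<Sum>f | f \<in> monic_polys (n - degree d) \<and> coprime f g. of_int (poly_moebius f) * \<phi> (d * f))
      \<le> sqrt (real (CARD('a) ^ (degree g' + k - 1))) * (3 / 2 * real (n - degree d + E choose (n - degree d)) * sqrt CARD('a) ^ (n - degree d))"
      using n deg E g' by (intro moebius_class_sum_bound[OF g0 _ k] inv' bd memb) auto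
    also have "\<dots> = W (degree d)"
    proof -
      have "sqrt (real (CARD('a) ^ (degree g' + k - 1))) = s ^ (degree g' + k - 1)" by (simp add: s_def real_sqrt_power)
      moreover have "s ^ (n + Suc E) = s ^ (degree g' + k - 1) * s ^ (n - degree d) * s ^ (2 * degree d)"
        unfolding power_add [symmetric] using deg E n k by (intro arg_cong[of _ _ "\<lambda>i. s ^ i"]) simp
      ultimately show ?thesis using s(1) by (simp add: W_def flip: s_def)
    qed
    finally show ?thesis .
  qed
  have "cmod (\<Sum>f\<in>monic_polys n. of_int (poly_moebius f) * \<phi> f) \<le> (\<Sum>d\<in>D. W (degree d))"
    unfolding sum_moebius_split[OF g add_leD1[OF n]] D_def [symmetric]
  proof (rule order_trans[OF norm_sum sum_mono])
    fix d assume d: "d \<in> D"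
    have "cmod (of_int (poly_moebius d)) \<le> 1" using abs_poly_moebius_le[of d] by simp
    from mult_mono[OF this inner[OF d]]
    show "cmod (of_int (poly_moebius d) * (\<Sum>f | f \<in> monic_polys (n - degree d) \<and> coprime f g. of_int (poly_moebius f) * \<phi> (d * f)))
      \<le> W (degree d)" by (simp add: norm_mult)
  qed
  also have "\<dots> = (\<Sum>e\<le>n. \<Sum>d | d \<in> D \<and> degree d = e. W (degree d))"
    using finD n by (intro sum.group [symmetric]) (auto simp: D_def dest!: dvd_imp_degree_le[OF _ g0])
  also have "\<dots> \<le> (\<Sum>e\<le>n. 3 / 2 * real (n - e + E choose (n - e)) * s ^ (n + Suc E))"
  proof (rule sum_mono)
    fix e
    have "card {d \<in> D. degree d = e} \<le> card (monic_polys e :: 'a poly set)"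
      by (intro card_mono finite_monic_polys) (auto simp: D_def monic_polys_iff)
    then have "real (card {d \<in> D. degree d = e}) \<le> real (CARD('a) ^ e)" by (simp only: card_monic_polys of_nat_le_iff)
    also have "\<dots> = s ^ (2 * e)" by (simp add: power_mult s(2))
    finally have c: "real (card {d \<in> D. degree d = e}) \<le> s ^ (2 * e)" .
    have "(\<Sum>d | d \<in> D \<and> degree d = e. W (degree d)) = real (card {d \<in> D. degree d = e}) * W e" by simp
    also have "\<dots> \<le> s ^ (2 * e) * W e" using s(1) by (intro mult_right_mono c) (simp add: W_def)
    also have "\<dots> = 3 / 2 * real (n - e + E choose (n - e)) * s ^ (n + Suc E)" using s(1) by (simp add: W_def)
    finally show "(\<Sum>d | d \<in> D \<and> degree d = e. W (degree d)) \<le> 3 / 2 * real (n - e + E choose (n - e)) * s ^ (n + Suc E)" .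
  qed
  also have "\<dots> = (\<Sum>e\<le>n. 3 / 2 * real (e + E choose e) * s ^ (n + Suc E))"
    by (rule sum.reindex_bij_witness[of _ "\<lambda>e. n - e" "\<lambda>e. n - e"]) auto
  also have "\<dots> = 3 / 2 * real (\<Sum>e\<le>n. (E + e) choose e) * s ^ (n + Suc E)"
    by (simp add: sum_distrib_left sum_distrib_right add.commute)
  also have "(\<Sum>e\<le>n. (E + e) choose e) = (n + Suc E choose n)" 
    unfolding sum_choose_lower by (simp add: add.commute)
  finally show ?thesis by (simp add: s_def)
qed

text \<open>One term of the binomial expansion of (2/3 + 1/3)^(n + m) is at most 1. The weights 2 :
  1 are adapted to m near n / 2, where this term is among the largest.\<close>

lemma choose_le_3_power: "real (n + m choose n) \<le> 3 ^ m * (3 / 2) ^ n"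
proof -
  have "real (n + m choose n) * (2 / 3) ^ n * (1 / 3) ^ (n + m - n) \<le> (\<Sum>k\<le>n + m. real (n + m choose k) * (2 / 3) ^ k * (1 / 3) ^ (n + m - k))"
    by (rule member_le_sum) auto
  also have "\<dots> = (2 / 3 + 1 / 3 :: real) ^ (n + m)" by (rule binomial_ring [symmetric])
  finally have "real (n + m choose n) * (2 / 3) ^ n * (1 / 3) ^ m \<le> 1" by simp
  then show ?thesis by (simp add: power_divide field_simps)
qed

section \<open>The residue pairing and the final estimate\<close>

lemma norm_ff_psi: "cmod (ff_psi x) = 1"
  unfolding ff_psi_def norm_exp_eq_Re by simp

lemma fls_nth_of_poly_inv: "fls_nth (fls_of_poly_inv f) j = (if j > 0 then 0 else coeff f (nat (- j)))"
  using fls_of_poly_inv_nth[of f "- j"] by simp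

lemma fls_of_poly_inv_diff: "fls_of_poly_inv (f - f') = fls_of_poly_inv f - fls_of_poly_inv f'"
  by (rule fls_eqI) (simp add: fls_nth_of_poly_inv)

lemma fls_of_poly_inv_sum: "fls_of_poly_inv (\<Sum>i\<in>I. f i) = (\<Sum>i\<in>I. fls_of_poly_inv (f i))"
  by (rule fls_eqI) (simp add: fls_nth_of_poly_inv coeff_sum fls_nth_sum)

lemma fls_of_poly_inv_smult: "fls_of_poly_inv (smult c f) = fls_const c * fls_of_poly_inv f"
  by (rule fls_eqI) (simp add: fls_nth_of_poly_inv)

text \<open>The residue pairing: the coefficient of t^(-1) in f \<theta>, found at index 1 because
  the series variable is 1/t.\<close>

definition resid :: "'a :: finite_field fls \<Rightarrow> 'a poly \<Rightarrow> 'a"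
  where "resid \<theta> f = fls_nth (fls_of_poly_inv f * \<theta>) 1"

lemma e_q_resid: "e_q (fls_of_poly_inv f * \<theta>) = ff_psi (resid \<theta> f)"
  by (simp add: e_q_def resid_def)

lemma resid_diff: "resid \<theta> (f - f') = resid \<theta> f - resid \<theta> f'"
  by (simp add: resid_def fls_of_poly_inv_diff left_diff_distrib)

lemma resid_sum: "resid \<theta> (\<Sum>i\<in>I. f i) = (\<Sum>i\<in>I. resid \<theta> (f i))"
  by (simp add: resid_def fls_of_poly_inv_sum sum_distrib_right fls_nth_sum)

lemma resid_smult: "resid \<theta> (smult c f) = c * resid \<theta> f"
  by (simp add: resid_def fls_of_poly_inv_smult mult.assoc)

text \<open>This is Dirichlet's approximation theorem: \<open>g\<close> is the denominator of a rational function close to \<open>\<theta>\<close>.\<close>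

lemma ex_denominator:
  fixes \<theta> :: "'a :: finite_field fls"
  shows "\<exists>g. lead_coeff g = 1 \<and> degree g \<le> N \<and> (\<forall>w. degree w < N \<longrightarrow> resid \<theta> (g * w) = 0)"
proof -
  obtain c where c: "\<exists>v\<in>{..N}. c v \<noteq> 0" "\<forall>e\<in>{..<N}. (\<Sum>v\<in>{..N}. c v * resid \<theta> (monom 1 (v + e))) = 0"
    using homogeneous_solution[of "{..<N}" "{..N}" "\<lambda>e v. resid \<theta> (monom 1 (v + e))"] by auto
  define g where "g = (\<Sum>v\<le>N. monom (c v) v)"
  have coeff_g: "coeff g i = (if i \<le> N then c i else 0)" for i by (simp add: g_def coeff_sum)
  have g: "g \<noteq> 0" "degree g \<le> N" using c(1) coeff_g by (auto simp: poly_eq_iff intro!: degree_le)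
  have base: "resid \<theta> (g * monom 1 e) = 0" if "e < N" for e
  proof -
    have "g * monom 1 e = (\<Sum>v\<le>N. smult (c v) (monom 1 (v + e)))"
      by (simp add: g_def sum_distrib_right mult_monom smult_monom)
    then show ?thesis using c(2) that by (simp add: resid_sum resid_smult)
  qed
  have all: "resid \<theta> (g * w) = 0" if w: "degree w < N" for w
  proof -
    have "g * w = g * (\<Sum>i\<le>degree w. monom (coeff w i) i)" by (simp add: poly_as_sum_of_monoms)
    also have "\<dots> = (\<Sum>i\<le>degree w. smult (coeff w i) (g * monom 1 i))"
      unfolding sum_distrib_left by (intro sum.cong refl) (simp add: smult_monom flip: mult_smult_right)
    finally show ?thesis using base w by (simp add: resid_sum resid_smult)
  qed
  define g1 where "g1 = smult (inverse (lead_coeff g)) g"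
  have "lead_coeff g1 = 1" "degree g1 \<le> N" using g by (auto simp: g1_def)
  moreover have "resid \<theta> (g1 * w) = 0" if "degree w < N" for w
    using all[OF that] by (simp add: g1_def resid_smult)
  ultimately show ?thesis by blast
qed

text \<open>Whatever the degree of g, the choice of k gives degree g + k = m + 1 with m = n - n div
  2. So \<open>moebius_sum_bound\<close> yields q to the exponent (n + m) / 2, at most (3 n + 1) /
  4, and the binomial coefficient n + m choose n.\<close>

lemma moebius_exp_sum_bound:
  fixes \<theta> :: "'a :: finite_field fls"
  assumes n: "n \<ge> 3"
  shows "cmod (\<Sum>f\<in>monic_polys n. of_int (poly_moebius f) * e_q (fls_of_poly_inv f * \<theta>))
    \<le> 4 * real CARD('a) powr ((3 * real n + 1) / 4) * (3 * sqrt 3 / 2) ^ n"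
proof -
  define N where "N = n div 2"
  define m where "m = n - N"
  \<comment> \<open>The bound m >= 2 is where n >= 3 enters: after removing a divisor of g, a
    cofactor of degree at least n - degree g >= 2 remains, as the estimate for Moebius coefficients
    requires.\<close>
  have N: "N \<ge> 1" "N \<le> m" "m \<ge> 2" "2 * m \<le> n + 1" "n = m + N" using n by (auto simp: N_def m_def)
  obtain g where g: "lead_coeff g = 1" "degree g \<le> N" "\<And>w. degree w < N \<Longrightarrow> resid \<theta> (g * w) = 0"
    using ex_denominator[of N \<theta>] by blast
  have g0: "g \<noteq> 0" using g(1) by auto
  \<comment> \<open>If f and f' agree in their first k coefficients and f - f' = g w with w nonzero,
    then degree w <= n - k - degree g = N - 1, just small enough for the defining property of
    g.\<close>
  define k where "k = Suc (m - degree g)"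
  define E where "E = m - 1"
  have E: "degree g + k = Suc (Suc E)" "m = Suc E" using N g(2) by (auto simp: k_def E_def)
  have inv: "ff_psi (resid \<theta> f) = ff_psi (resid \<theta> f')"
    if f: "f \<in> monic_polys n" "f' \<in> monic_polys n" "ray_equiv g k f f'" for f f'
  proof -
    have *: "g dvd f - f'" "\<forall>i<k. i \<le> n \<longrightarrow> coeff f (n - i) = coeff f' (n - i)"
      using f(3) unfolding ray_equiv_monic_iff[OF f(1,2)] by auto
    then obtain w where w: "f - f' = g * w" by (elim dvdE)
    have "resid \<theta> (g * w) = 0"
    proof (cases "w = 0")
      case True then show ?thesis by (simp add: resid_def fls_of_poly_inv_def)
    next
      case False
      then have deg: "degree (f - f') = degree g + degree w" unfolding w using g0 by (intro degree_mult_eq)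
      have "coeff (f - f') j = 0" if j: "j + k > n" for j
      proof (cases "j \<le> n")
        case True then show ?thesis using *(2)[rule_format, of "n - j"] j by simp
      next
        case False then show ?thesis using f by (auto simp: monic_polys_iff coeff_eq_0)
      qed
      moreover have "coeff (f - f') (degree (f - f')) \<noteq> 0" using False g0 w by auto
      ultimately have "degree (f - f') + k \<le> n" using not_le_imp_less by blast
      then show ?thesis using deg N g(2) by (intro g(3)) (simp add: k_def)
    qed
    then show ?thesis using resid_diff[of \<theta> f f'] w by simp
  qed
  have "cmod (\<Sum>f\<in>monic_polys n. of_int (poly_moebius f) * ff_psi (resid \<theta> f))
      \<le> 3 / 2 * real (n + Suc E choose n) * sqrt CARD('a) ^ (n + Suc E)"
    using N g(2) by (intro moebius_sum_bound[OF g(1) _ E(1)] inv) (auto simp: norm_ff_psi k_def)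
  also have "\<dots> \<le> 3 / 2 * (sqrt 3 * (3 * sqrt 3 / 2) ^ n) * real CARD('a) powr ((3 * real n + 1) / 4)"
  proof (intro mult_mono mult_left_mono)
    have "real (n + Suc E choose n) \<le> 3 ^ m * (3 / 2) ^ n" unfolding E(2) [symmetric] by (rule choose_le_3_power)
    also have "(3 :: real) ^ m = sqrt 3 ^ (2 * m)" by (simp add: power_mult)
    also have "sqrt 3 ^ (2 * m) * (3 / 2) ^ n \<le> sqrt 3 ^ (n + 1) * (3 / 2 :: real) ^ n"
      using N(4) by (intro mult_right_mono power_increasing) auto
    also have "\<dots> = sqrt 3 * (3 * sqrt 3 / 2) ^ n" by (simp add: power_mult_distrib power_divide)
    finally show "real (n + Suc E choose n) \<le> sqrt 3 * (3 * sqrt 3 / 2) ^ n" .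
    have q: "real CARD('a) \<ge> 1" using card_ge_2[where 'a = 'a] by simp
    have "sqrt CARD('a) ^ (n + Suc E) = (real CARD('a) powr (1 / 2)) powr real (n + Suc E)"
      using q powr_realpow[of "sqrt CARD('a)" "n + Suc E"] by (simp add: powr_half_sqrt)
    also have "\<dots> = real CARD('a) powr (real (n + m) / 2)" by (simp add: powr_powr E(2))
    also have "\<dots> \<le> real CARD('a) powr ((3 * real n + 1) / 4)"
    proof (rule powr_mono[OF _ q])
      have "2 * real m \<le> real n + 1" using N(4) by linarith
      then show "real (n + m) / 2 \<le> (3 * real n + 1) / 4" by simp
    qed
    finally show "sqrt CARD('a) ^ (n + Suc E) \<le> real CARD('a) powr ((3 * real n + 1) / 4)" .
  qed auto
  also have "\<dots> = (3 / 2 * sqrt 3) * (real CARD('a) powr ((3 * real n + 1) / 4) * (3 * sqrt 3 / 2) ^ n)" by simp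
  \<comment> \<open>Here sqrt 3 comes from rounding m up, 2 m <= n + 1, and 3/2 from the trivial
    character.\<close>
  also have "\<dots> \<le> 4 * (real CARD('a) powr ((3 * real n + 1) / 4) * (3 * sqrt 3 / 2) ^ n)"
  proof (rule mult_right_mono)
    have "sqrt 3 \<le> 2" by (rule real_le_lsqrt) auto
    then show "3 / 2 * sqrt 3 \<le> 4" by simp
  qed auto
  finally show ?thesis by (simp only: e_q_resid mult.assoc)
qed

theorem theorem1:
  fixes n :: nat
  assumes "n \<ge> 3"
  shows "Max ((\<lambda>\<theta> :: 'a :: finite_field fls.
            cmod (\<Sum>f\<in>monic_polys n. of_int (poly_moebius f) * e_q (fls_of_poly_inv f * \<theta>)))
           ` unit_interval_fls)
         \<le> 4 * real CARD('a) powr ((3 * real n + 1) / 4) * (3 * sqrt 3 / 2) ^ n"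
proof (rule Max.boundedI[OF finite_moebius_exp_sum])
  show "(\<lambda>\<theta> :: 'a fls. cmod (\<Sum>f\<in>monic_polys n. of_int (poly_moebius f) * e_q (fls_of_poly_inv f * \<theta>)))
      ` unit_interval_fls \<noteq> {}"
    using zero_in_unit_interval_fls by blast
qed (auto intro: moebius_exp_sum_bound[OF assms])

end
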